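(* Let $R$ be a commutative unital ring and let $I\triangleleft R$ be an ideal generated by a finite or infinite regular sequence $u_1,u_2,\ldots$. For $s\geq 2$, the complex of graded $R/I$-modules $$\mathrm{Tor}^R_*(R/I,R/I)\xrightarrow{\partial^{(1)}_*}\mathrm{Tor}^R_*(R/I,I/I^2)\to\cdots\to\mathrm{Tor}^R_*(R/I,I^{s-2}/I^{s-1})\xrightarrow{\partial^{(s-1)}_*}\mathrm{Tor}^R_*(R/I,I^{s-1}/I^s)$$ is exact (at each intermediate term). Hence the spectral sequence converging to $\mathrm{Tor}^R_*(R/I,R/I^s)$ described in the context collapses at $E^2$ to give $$\mathrm{Tor}^R_n(R/I,R/I^s)=\begin{cases}R/I&\text{if }n=0,\\ \operatorname{coker}\bigl(\partial^{(s-1)}_*:\mathrm{Tor}^R_{n+1}(R/I,I^{s-2}/I^{s-1})\to\mathrm{Tor}^R_n(R/I,I^{s-1}/I^s)\bigr)&\text{if }n\neq 0.\end{cases}$$ With its natural $R/I$-algebra structure, $\mathrm{Tor}^R_*(R/I,R/I^s)$ has trivial products, i.e. the product of any two elements of positive degree is zero.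
   Context: All tensor products are over $R$ unless indicated. A regular sequence $u_1,u_2,\ldots$ (finite or infinite) is one in which each $u_k$ is a non-zero-divisor on $R/(u_1,\ldots,u_{k-1})$ and $R/I\neq 0$, where $I=(u_1,u_2,\ldots)$. Complexes are graded homologically, with differentials lowering degree by one. $I^0/I$ means $R/I$. Koszul complex: $\mathbf{K}_*=\Lambda_R(e_i: i\geq 1)$ is the exterior algebra with one generator $e_i$ in degree $1$ for each $u_i$, with the derivation differential $d$ determined by $d e_i=u_i$. For $k\geq 0$, $\mathrm{U}^{(k)}$ is the free $R$-module (in degree $0$) on basis elements $\tilde u_{\mathbf{i}}=\tilde u_{(i_1,\ldots,i_k)}$ indexed by the distinct (formal, commutative) monomials $u_{i_1}\cdots u_{i_k}$ of degree $k$ in the generators; so $\tilde u_{(i_1,\ldots,i_k)}$ is independent of the order of the indices, and $\mathrm{U}^{(0)}=R$. Put $\mathbf{Q}^{(k)}_*=\mathbf{K}_*\otimes \mathrm{U}^{(k)}$, write $x\tilde u_{\mathbf{i}}$ for $x\otimes\tilde u_{\mathbf{i}}$, and let $d_{\mathbf{Q}}^{(k)}(x\tilde u_{\mathbf{i}})=(dx)\tilde u_{\mathbf{i}}$. With the augmentation sending $\tilde u_{\mathbf{i}}$ to the class of $u_{i_1}\cdots u_{i_k}$, $\mathbf{Q}^{(k)}_*$ is a free resolution of $I^k/I^{k+1}$ over $R$, so that $\mathrm{Tor}^R_*(R/I,I^k/I^{k+1})=\mathrm{H}_*(R/I\otimes\mathbf{Q}^{(k)}_*,1\otimes d_{\mathbf{Q}}^{(k)})$.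 For $k\geq 0$, $\partial^{(k+1)}:\mathbf{Q}^{(k)}_*\to\mathbf{Q}^{(k+1)}_{*-1}$ is the $R$-linear map $$\partial^{(k+1)}(e_{j_1}\cdots e_{j_p}\tilde u_{(i_1,\ldots,i_k)})=\sum_{r=1}^p(-1)^{r-1}e_{j_1}\cdots \widehat{e_{j_r}}\cdots e_{j_p}\,\tilde u_{(i_1,\ldots,i_k,j_r)}.$$ It satisfies $d_{\mathbf{Q}}^{(k+1)}\partial^{(k+1)}+\partial^{(k+1)}d_{\mathbf{Q}}^{(k)}=0$ and $\partial^{(k+2)}\partial^{(k+1)}=0$, and $1\otimes\partial^{(k+1)}$ induces homomorphisms $\partial^{(k+1)}_*:\mathrm{Tor}^R_n(R/I,I^k/I^{k+1})\to\mathrm{Tor}^R_{n-1}(R/I,I^{k+1}/I^{k+2})$, lowering degree by one. For $s\geq 1$, $\mathbf{K}(R;I^s)_*=\mathbf{Q}^{(0)}_*\oplus\cdots\oplus\mathbf{Q}^{(s-1)}_*$, with differential $d^{(s)}(x_0,\ldots,x_{s-1})=(x_0',\ldots,x_{s-1}')$, where $x_0'=d_{\mathbf{Q}}^{(0)}x_0$ and $x_k'=\partial^{(k)}x_{k-1}+d_{\mathbf{Q}}^{(k)}x_k$ for $1\leq k\leq s-1$; it is a free resolution of $R/I^s$ over $R$. Spectral sequence: let $\bar{\mathrm{P}}_{*,*}$ be the double complex of $R/I$-modules with $\bar{\mathrm{P}}_{-p,q}=R/I\otimes\mathbf{Q}^{(p)}_{q-p}$ for $0\leq p\leq s-1$ (and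 zero otherwise), horizontal differential $d^{\mathrm{h}}=1\otimes\partial^{(p+1)}:\bar{\mathrm{P}}_{-p,q}\to\bar{\mathrm{P}}_{-p-1,q}$ (zero for $p=s-1$) and vertical differential $d^{\mathrm{v}}=1\otimes d_{\mathbf{Q}}^{(p)}:\bar{\mathrm{P}}_{-p,q}\to\bar{\mathrm{P}}_{-p,q-1}$. Its total complex is $(R/I\otimes\mathbf{K}(R;I^s)_*,1\otimes d^{(s)})$, with homology $\mathrm{Tor}^R_*(R/I,R/I^s)$. Filtering by columns gives the spectral sequence $$E^2_{-p,q}=\mathrm{H}_{-p}(\mathrm{H}_q(\bar{\mathrm{P}}_{*,*},d^{\mathrm{v}}),d^{\mathrm{h}})\Longrightarrow\mathrm{Tor}^R_{q-p}(R/I,R/I^s).$$ *)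

theory Defs
  imports "HOL-Algebra.Module" "HOL-Algebra.QuotRing" "HOL-Algebra.Ideal_Product"
     "HOL-Library.Multiset" "HOL-Library.Extended_Nat"
begin

text \<open>
  Modules are the module records of HOL-Algebra. Such a record extends a ring record, but the
  fields mult and one play no role for a module; they are left undefined below.
\<close>

section \<open>Modules\<close>

definition lin_maps ::
    "('a, 'r) ring_scheme \<Rightarrow> ('a, 'm) module \<Rightarrow> ('a, 'n) module \<Rightarrow> ('m \<Rightarrow> 'n) set" where
  "lin_maps R M N = {h. h \<in> carrier M \<rightarrow> carrier N
     \<and> (\<forall>x\<in>carrier M. \<forall>y\<in>carrier M. h (x \<oplus>\<^bsub>M\<^esub> y) = h x \<oplus>\<^bsub>N\<^esub> h y)
     \<and> (\<forall>r\<in>carrier R. \<forall>x\<in>carrier M. h (r \<odot>\<^bsub>M\<^esub> x) = r \<odot>\<^bsub>N\<^esub> h x)}"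

definition mod_isomorphic ::
    "('a, 'r) ring_scheme \<Rightarrow> ('a, 'm) module \<Rightarrow> ('a, 'n) module \<Rightarrow> bool" where
  "mod_isomorphic R M N \<longleftrightarrow> (\<exists>h \<in> lin_maps R M N. bij_betw h (carrier M) (carrier N))"

definition reg_mod :: "('a, 'r) ring_scheme \<Rightarrow> ('a, 'a) module" where
  "reg_mod R = \<lparr>carrier = carrier R, monoid.mult = undefined, monoid.one = undefined,
     ring.zero = \<zero>\<^bsub>R\<^esub>, ring.add = add R, smult = monoid.mult R\<rparr>"

text \<open>The elements of the quotient module M/N are the cosets of N in M.\<close>

definition quot_mod :: "('a, 'm) module \<Rightarrow> 'm set \<Rightarrow> ('a, 'm set) module" where
  "quot_mod M N = \<lparr>carrier = a_rcosets\<^bsub>M\<^esub> N, monoid.mult = undefined, monoid.one = undefined,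
     ring.zero = N, ring.add = set_add M, smult = (\<lambda>r U. \<Union>x\<in>U. N +>\<^bsub>M\<^esub> (r \<odot>\<^bsub>M\<^esub> x))\<rparr>"

definition submodule_gen ::
    "('a, 'r) ring_scheme \<Rightarrow> ('a, 'm) module \<Rightarrow> 'm set \<Rightarrow> 'm set" where
  "submodule_gen R M S = \<Inter>{H. submodule H R M \<and> S \<subseteq> H}"

text \<open>The free R-module on the set B: finitely supported functions from B to R, extended by zero.\<close>

definition free_mod :: "('a, 'r) ring_scheme \<Rightarrow> 'b set \<Rightarrow> ('a, 'b \<Rightarrow> 'a) module" where
  "free_mod R B = \<lparr>
     carrier = {f. (\<forall>b\<in>B. f b \<in> carrier R) \<and> (\<forall>b. b \<notin> B \<longrightarrow> f b = \<zero>\<^bsub>R\<^esub>) \<and> finite {b. f b \<noteq> \<zero>\<^bsub>R\<^esub>}},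
     monoid.mult = undefined, monoid.one = undefined,
     ring.zero = (\<lambda>b. \<zero>\<^bsub>R\<^esub>), ring.add = (\<lambda>f g b. f b \<oplus>\<^bsub>R\<^esub> g b), smult = (\<lambda>r f b. r \<otimes>\<^bsub>R\<^esub> f b)\<rparr>"

definition basis_vec :: "('a, 'r) ring_scheme \<Rightarrow> 'b \<Rightarrow> 'b \<Rightarrow> 'a" where
  "basis_vec R b = (\<lambda>c. if c = b then \<one>\<^bsub>R\<^esub> else \<zero>\<^bsub>R\<^esub>)"

text \<open>The R-linear map from a free module to M with prescribed values v on the basis.\<close>

definition lin_ext ::
    "('a, 'r) ring_scheme \<Rightarrow> ('a, 'm) module \<Rightarrow> ('b \<Rightarrow> 'm) \<Rightarrow> ('b \<Rightarrow> 'a) \<Rightarrow> 'm" where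
  "lin_ext R M v f = finsum M (\<lambda>b. f b \<odot>\<^bsub>M\<^esub> v b) {b. f b \<noteq> \<zero>\<^bsub>R\<^esub>}"

definition is_free_mod :: "('a, 'r) ring_scheme \<Rightarrow> ('a, 'm) module \<Rightarrow> bool" where
  "is_free_mod R M \<longleftrightarrow> Module.module R M \<and>
     (\<exists>B \<subseteq> carrier M. bij_betw (lin_ext R M (\<lambda>b. b)) (carrier (free_mod R B)) (carrier M))"


section \<open>Extension of scalars\<close>

text \<open>
  For a ring homomorphism \<open>\<phi>\<close> from R to A, the A-module \<open>A \<otimes> M\<close> (tensor product over R) is presented
  by generators \<open>1 \<otimes> x\<close> for x in M (the basis vectors of the free A-module on M), subject to
  \<open>1 \<otimes> (x + y) = 1 \<otimes> x + 1 \<otimes> y\<close> and \<open>1 \<otimes> r x = \<phi>(r) (1 \<otimes> x)\<close>.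
  The elementary tensor \<open>a \<otimes> x\<close> is \<open>a (1 \<otimes> x)\<close>.
\<close>

definition tensor_rel ::
    "('a, 'r) ring_scheme \<Rightarrow> ('c, 'd) ring_scheme \<Rightarrow> ('a \<Rightarrow> 'c) \<Rightarrow> ('a, 'm) module \<Rightarrow> ('m \<Rightarrow> 'c) set"
  where
  "tensor_rel R A \<phi> M = (let F = free_mod A (carrier M); e = basis_vec A in
     submodule_gen A F
       ({e (x \<oplus>\<^bsub>M\<^esub> y) \<ominus>\<^bsub>F\<^esub> (e x \<oplus>\<^bsub>F\<^esub> e y) | x y. x \<in> carrier M \<and> y \<in> carrier M}
        \<union> {e (r \<odot>\<^bsub>M\<^esub> x) \<ominus>\<^bsub>F\<^esub> \<phi> r \<odot>\<^bsub>F\<^esub> e x | r x. r \<in> carrier R \<and> x \<in> carrier M}))"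

definition tensor_mod ::
    "('a, 'r) ring_scheme \<Rightarrow> ('c, 'd) ring_scheme \<Rightarrow> ('a \<Rightarrow> 'c) \<Rightarrow> ('a, 'm) module
      \<Rightarrow> ('c, ('m \<Rightarrow> 'c) set) module" where
  "tensor_mod R A \<phi> M = quot_mod (free_mod A (carrier M)) (tensor_rel R A \<phi> M)"

text \<open>The map \<open>1 \<otimes> h\<close> from \<open>A \<otimes> M\<close> to \<open>A \<otimes> N\<close>. The codomain N has to be supplied.\<close>

definition tensor_map ::
    "('a, 'r) ring_scheme \<Rightarrow> ('c, 'd) ring_scheme \<Rightarrow> ('a \<Rightarrow> 'c) \<Rightarrow> ('a, 'n) module
      \<Rightarrow> ('m \<Rightarrow> 'n) \<Rightarrow> ('m \<Rightarrow> 'c) set \<Rightarrow> ('n \<Rightarrow> 'c) set" where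
  "tensor_map R A \<phi> N h U = (let F = free_mod A (carrier N) in
     \<Union>f\<in>U. tensor_rel R A \<phi> N +>\<^bsub>F\<^esub> lin_ext A F (\<lambda>x. basis_vec A (h x)) f)"

text \<open>
  The pairing \<open>(a \<otimes> x, b \<otimes> y) \<mapsto> ab \<otimes> \<beta>(x, y)\<close> with values in \<open>A \<otimes> N\<close> induced by an R-bilinear
  map \<open>\<beta>\<close> with values in N.
\<close>

definition tensor_pairing ::
    "('a, 'r) ring_scheme \<Rightarrow> ('c, 'd) ring_scheme \<Rightarrow> ('a \<Rightarrow> 'c) \<Rightarrow> ('a, 'n) module
      \<Rightarrow> ('l \<Rightarrow> 'm \<Rightarrow> 'n) \<Rightarrow> ('l \<Rightarrow> 'c) set \<Rightarrow> ('m \<Rightarrow> 'c) set \<Rightarrow> ('n \<Rightarrow> 'c) set" where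
  "tensor_pairing R A \<phi> N \<beta> U V = (let F = free_mod A (carrier N) in
     \<Union>f\<in>U. \<Union>g\<in>V. tensor_rel R A \<phi> N +>\<^bsub>F\<^esub>
       finsum F (\<lambda>(x, y). (f x \<otimes>\<^bsub>A\<^esub> g y) \<odot>\<^bsub>F\<^esub> basis_vec A (\<beta> x y))
         ({x. f x \<noteq> \<zero>\<^bsub>A\<^esub>} \<times> {y. g y \<noteq> \<zero>\<^bsub>A\<^esub>}))"


section \<open>Chain complexes, homology and Tor\<close>

text \<open>The differential \<open>bdry C n\<close> goes from degree n to degree n - 1.\<close>

record ('a, 'm) chain_cx =
  chains :: "int \<Rightarrow> ('a, 'm) module"
  bdry :: "int \<Rightarrow> 'm \<Rightarrow> 'm"

definition cycles :: "('a, 'm) chain_cx \<Rightarrow> int \<Rightarrow> 'm set" where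
  "cycles C n = {x \<in> carrier (chains C n). bdry C n x = \<zero>\<^bsub>chains C (n - 1)\<^esub>}"

definition boundaries :: "('a, 'm) chain_cx \<Rightarrow> int \<Rightarrow> 'm set" where
  "boundaries C n = bdry C (n + 1) ` carrier (chains C (n + 1))"

definition homology :: "('a, 'm) chain_cx \<Rightarrow> int \<Rightarrow> ('a, 'm set) module" where
  "homology C n = quot_mod (chains C n\<lparr>carrier := cycles C n\<rparr>) (boundaries C n)"

text \<open>The map on homology, with values in degree n of D, induced by a map h on cycles.\<close>

definition homology_map ::
    "('a, 'n) chain_cx \<Rightarrow> int \<Rightarrow> ('m \<Rightarrow> 'n) \<Rightarrow> 'm set \<Rightarrow> 'n set" where
  "homology_map D n h U = (\<Union>x\<in>U. boundaries D n +>\<^bsub>chains D n\<^esub> h x)"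

definition chain_complex :: "('a, 'r) ring_scheme \<Rightarrow> ('a, 'm) chain_cx \<Rightarrow> bool" where
  "chain_complex R C \<longleftrightarrow> (\<forall>n. Module.module R (chains C n)
     \<and> bdry C n \<in> lin_maps R (chains C n) (chains C (n - 1))
     \<and> (\<forall>x\<in>carrier (chains C n). bdry C (n - 1) (bdry C n x) = \<zero>\<^bsub>chains C (n - 2)\<^esub>))"

definition free_resolution ::
    "('a, 'r) ring_scheme \<Rightarrow> ('a, 'm) chain_cx \<Rightarrow> ('a, 'n) module \<Rightarrow> ('m \<Rightarrow> 'n) \<Rightarrow> bool" where
  "free_resolution R P N \<epsilon> \<longleftrightarrow>
     chain_complex R P
     \<and> (\<forall>n. is_free_mod R (chains P n))
     \<and> (\<forall>n<0. carrier (chains P n) = {\<zero>\<^bsub>chains P n\<^esub>})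
     \<and> (\<forall>n>0. cycles P n = boundaries P n)
     \<and> \<epsilon> \<in> lin_maps R (chains P 0) N
     \<and> \<epsilon> ` carrier (chains P 0) = carrier N
     \<and> {x \<in> carrier (chains P 0). \<epsilon> x = \<zero>\<^bsub>N\<^esub>} = boundaries P 0"

definition tensor_cx ::
    "('a, 'r) ring_scheme \<Rightarrow> ('c, 'd) ring_scheme \<Rightarrow> ('a \<Rightarrow> 'c) \<Rightarrow> ('a, 'm) chain_cx
      \<Rightarrow> ('c, ('m \<Rightarrow> 'c) set) chain_cx" where
  "tensor_cx R A \<phi> C =
     \<lparr>chains = (\<lambda>n. tensor_mod R A \<phi> (chains C n)),
      bdry = (\<lambda>n. tensor_map R A \<phi> (chains C (n - 1)) (bdry C n))\<rparr>"

text \<open>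
  The A-module \<open>Tor\<^sub>n(A, N)\<close> over R, computed from a free resolution P of N.
\<close>

definition Tor ::
    "('a, 'r) ring_scheme \<Rightarrow> ('c, 'd) ring_scheme \<Rightarrow> ('a \<Rightarrow> 'c) \<Rightarrow> ('a, 'm) chain_cx \<Rightarrow> int
      \<Rightarrow> ('c, ('m \<Rightarrow> 'c) set set) module" where
  "Tor R A \<phi> P n = homology (tensor_cx R A \<phi> P) n"

text \<open>
  Let P be a free resolution, with augmentation \<open>\<epsilon>\<close>, of an R-algebra S. A family \<open>\<mu>\<close> as below is the
  same as a chain map from \<open>P \<otimes> P\<close> to P lifting the multiplication of S. It induces the natural
  product on \<open>Tor\<^sub>*(A, S)\<close>, which does not depend on the choice of \<open>\<mu>\<close>.
\<close>

definition mult_lift ::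
    "('a, 'r) ring_scheme \<Rightarrow> ('a, 'm) chain_cx \<Rightarrow> ('n, 's) ring_scheme \<Rightarrow> ('m \<Rightarrow> 'n)
      \<Rightarrow> (int \<Rightarrow> int \<Rightarrow> 'm \<Rightarrow> 'm \<Rightarrow> 'm) \<Rightarrow> bool" where
  "mult_lift R P S \<epsilon> \<mu> \<longleftrightarrow>
     (\<forall>p q. \<forall>x\<in>carrier (chains P p).
        \<mu> p q x \<in> lin_maps R (chains P q) (chains P (p + q)))
     \<and> (\<forall>p q. \<forall>y\<in>carrier (chains P q).
        (\<lambda>x. \<mu> p q x y) \<in> lin_maps R (chains P p) (chains P (p + q)))
     \<and> (\<forall>p q. \<forall>x\<in>carrier (chains P p). \<forall>y\<in>carrier (chains P q).
        bdry P (p + q) (\<mu> p q x y) =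
          (let M = chains P (p + q - 1); z = \<mu> p (q - 1) x (bdry P q y) in
           \<mu> (p - 1) q (bdry P p x) y \<oplus>\<^bsub>M\<^esub> (if even p then z else \<ominus>\<^bsub>M\<^esub> z)))
     \<and> (\<forall>x\<in>carrier (chains P 0). \<forall>y\<in>carrier (chains P 0). \<epsilon> (\<mu> 0 0 x y) = \<epsilon> x \<otimes>\<^bsub>S\<^esub> \<epsilon> y)"

definition Tor_prod ::
    "('a, 'r) ring_scheme \<Rightarrow> ('c, 'd) ring_scheme \<Rightarrow> ('a \<Rightarrow> 'c) \<Rightarrow> ('a, 'm) chain_cx
      \<Rightarrow> (int \<Rightarrow> int \<Rightarrow> 'm \<Rightarrow> 'm \<Rightarrow> 'm) \<Rightarrow> int \<Rightarrow> int
      \<Rightarrow> ('m \<Rightarrow> 'c) set set \<Rightarrow> ('m \<Rightarrow> 'c) set set \<Rightarrow> ('m \<Rightarrow> 'c) set set" where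
  "Tor_prod R A \<phi> P \<mu> p q U V = (let T = tensor_cx R A \<phi> P in
     \<Union>x\<in>U. \<Union>y\<in>V. boundaries T (p + q) +>\<^bsub>chains T (p + q)\<^esub>
       tensor_pairing R A \<phi> (chains P (p + q)) (\<mu> p q) x y)"


section \<open>Double complexes and the spectral sequence of a filtered complex\<close>

text \<open>
  \<open>hdiff D p q\<close> goes from (p, q) to (p - 1, q), and \<open>vdiff D p q\<close> from (p, q) to (p, q - 1). The
  two differentials are supposed to anticommute, so that the total differential is their sum.
\<close>

record ('a, 'm) double_cx =
  obj :: "int \<Rightarrow> int \<Rightarrow> ('a, 'm) module"
  hdiff :: "int \<Rightarrow> int \<Rightarrow> 'm \<Rightarrow> 'm"
  vdiff :: "int \<Rightarrow> int \<Rightarrow> 'm \<Rightarrow> 'm"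

text \<open>An element x of total degree n has its component \<open>x p\<close> in position (p, n - p).\<close>

definition total_cx :: "('a, 'm) double_cx \<Rightarrow> ('a, int \<Rightarrow> 'm) chain_cx" where
  "total_cx D =
     \<lparr>chains = (\<lambda>n. \<lparr>
        carrier = {x. (\<forall>p. x p \<in> carrier (obj D p (n - p)))
                      \<and> finite {p. x p \<noteq> \<zero>\<^bsub>obj D p (n - p)\<^esub>}},
        monoid.mult = undefined, monoid.one = undefined,
        ring.zero = (\<lambda>p. \<zero>\<^bsub>obj D p (n - p)\<^esub>),
        ring.add = (\<lambda>x y p. x p \<oplus>\<^bsub>obj D p (n - p)\<^esub> y p),
        smult = (\<lambda>r x p. r \<odot>\<^bsub>obj D p (n - p)\<^esub> x p)\<rparr>),
      bdry = (\<lambda>n x p. hdiff D (p + 1) (n - p - 1) (x (p + 1))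
                       \<oplus>\<^bsub>obj D p (n - 1 - p)\<^esub> vdiff D p (n - p) (x p))\<rparr>"

definition column_filtration :: "('a, 'm) double_cx \<Rightarrow> int \<Rightarrow> int \<Rightarrow> (int \<Rightarrow> 'm) set" where
  "column_filtration D p n =
     {x \<in> carrier (chains (total_cx D) n). \<forall>j>p. x j = \<zero>\<^bsub>obj D j (n - j)\<^esub>}"

text \<open>
  For an increasing filtration, with \<open>F p n\<close> the p-th step in degree n, the page \<open>E\<^sup>r\<close> (r \<open>\<ge>\<close> 1) is
  \<open>Z r p / (Z (r - 1) (p - 1) + d (Z (r - 1) (p + r - 1)))\<close>, where
  \<open>Z r p = {x \<in> F p. d x \<in> F (p - r)}\<close>, and \<open>d\<^sup>r\<close> is induced by d.
\<close>

definition ss_cycles ::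
    "('a, 'm) chain_cx \<Rightarrow> (int \<Rightarrow> int \<Rightarrow> 'm set) \<Rightarrow> nat \<Rightarrow> int \<Rightarrow> int \<Rightarrow> 'm set" where
  "ss_cycles C F r p n = {x \<in> F p n. bdry C n x \<in> F (p - int r) (n - 1)}"

definition ss_boundaries ::
    "('a, 'm) chain_cx \<Rightarrow> (int \<Rightarrow> int \<Rightarrow> 'm set) \<Rightarrow> nat \<Rightarrow> int \<Rightarrow> int \<Rightarrow> 'm set" where
  "ss_boundaries C F r p n =
     ss_cycles C F (r - 1) (p - 1) n
       <+>\<^bsub>chains C n\<^esub> bdry C (n + 1) ` ss_cycles C F (r - 1) (p + int r - 1) (n + 1)"

definition ss_page ::
    "('a, 'm) chain_cx \<Rightarrow> (int \<Rightarrow> int \<Rightarrow> 'm set) \<Rightarrow> nat \<Rightarrow> int \<Rightarrow> int \<Rightarrow> ('a, 'm set) module" where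
  "ss_page C F r p q =
     quot_mod (chains C (p + q)\<lparr>carrier := ss_cycles C F r p (p + q)\<rparr>)
       (ss_boundaries C F r p (p + q))"

definition ss_diff ::
    "('a, 'm) chain_cx \<Rightarrow> (int \<Rightarrow> int \<Rightarrow> 'm set) \<Rightarrow> nat \<Rightarrow> int \<Rightarrow> int \<Rightarrow> 'm set \<Rightarrow> 'm set" where
  "ss_diff C F r p q U =
     (\<Union>x\<in>U. ss_boundaries C F r (p - int r) (p + q - 1)
              +>\<^bsub>chains C (p + q - 1)\<^esub> bdry C (p + q) x)"

definition ss_collapses_at ::
    "('a, 'm) chain_cx \<Rightarrow> (int \<Rightarrow> int \<Rightarrow> 'm set) \<Rightarrow> nat \<Rightarrow> bool" where
  "ss_collapses_at C F k \<longleftrightarrow> (\<forall>r\<ge>k. \<forall>p q. \<forall>U\<in>carrier (ss_page C F r p q).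
     ss_diff C F r p q U = \<zero>\<^bsub>ss_page C F r (p - int r) (q + int r - 1)\<^esub>)"


section \<open>Regular sequences\<close>

text \<open>A sequence of length N, possibly infinite, is indexed from 1.\<close>

definition seq_index :: "enat \<Rightarrow> nat set" where
  "seq_index N = {i. 1 \<le> i \<and> enat i \<le> N}"

definition regular_sequence :: "('a, 'r) ring_scheme \<Rightarrow> enat \<Rightarrow> (nat \<Rightarrow> 'a) \<Rightarrow> bool" where
  "regular_sequence R N u \<longleftrightarrow>
     u \<in> seq_index N \<rightarrow> carrier R
     \<and> (\<forall>k\<in>seq_index N. let J = genideal R (u ` {1..<k}) in
          \<forall>x\<in>carrier (R Quot J). (J +>\<^bsub>R\<^esub> u k) \<otimes>\<^bsub>R Quot J\<^esub> x = \<zero>\<^bsub>R Quot J\<^esub> \<longrightarrow> x = \<zero>\<^bsub>R Quot J\<^esub>)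
     \<and> carrier (R Quot genideal R (u ` seq_index N)) \<noteq> {\<zero>\<^bsub>R Quot genideal R (u ` seq_index N)\<^esub>}"

definition ideal_pow :: "('a, 'r) ring_scheme \<Rightarrow> 'a set \<Rightarrow> nat \<Rightarrow> 'a set" where
  "ideal_pow R I k = I [^]\<^bsub>ideals_set R\<^esub> k"

definition ideal_pow_quot :: "('a, 'r) ring_scheme \<Rightarrow> 'a set \<Rightarrow> nat \<Rightarrow> ('a, 'a set) module" where
  "ideal_pow_quot R I k =
     quot_mod (reg_mod R\<lparr>carrier := ideal_pow R I k\<rparr>) (ideal_pow R I (Suc k))"


section \<open>The complexes Q and the maps between them\<close>

text \<open>
  \<open>\<Lambda>(e\<^sub>i)\<close> is free on the monomials \<open>e\<^sub>J = e\<^bsub>j1\<^esub> \<dots> e\<^bsub>jp\<^esub>\<close> with \<open>J = {j1 < \<dots> < jp}\<close>, and the monomials of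
  degree k in the \<open>u\<^sub>i\<close> correspond to the multisets m of size k. The pair (J, m) stands for the
  basis element \<open>e\<^sub>J \<otimes> u\<^sub>m\<close> of Q.
\<close>

definition Q_basis :: "enat \<Rightarrow> nat \<Rightarrow> int \<Rightarrow> (nat set \<times> nat multiset) set" where
  "Q_basis N k n = {(J, m). finite J \<and> J \<subseteq> seq_index N \<and> int (card J) = n
     \<and> set_mset m \<subseteq> seq_index N \<and> size m = k}"

abbreviation Q_mod ::
    "('a, 'r) ring_scheme \<Rightarrow> enat \<Rightarrow> nat \<Rightarrow> int \<Rightarrow> ('a, nat set \<times> nat multiset \<Rightarrow> 'a) module" where
  "Q_mod R N k n \<equiv> free_mod R (Q_basis N k n)"

text \<open>\<open>(-1)\<^bsup>r-1\<^esup>\<close>, where j is the r-th smallest element of J.\<close>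

definition koszul_sign :: "('a, 'r) ring_scheme \<Rightarrow> nat set \<Rightarrow> nat \<Rightarrow> 'a" where
  "koszul_sign R J j = (\<ominus>\<^bsub>R\<^esub> \<one>\<^bsub>R\<^esub>) [^]\<^bsub>R\<^esub> card {i \<in> J. i < j}"

definition Q_cx ::
    "('a, 'r) ring_scheme \<Rightarrow> enat \<Rightarrow> (nat \<Rightarrow> 'a) \<Rightarrow> nat
      \<Rightarrow> ('a, nat set \<times> nat multiset \<Rightarrow> 'a) chain_cx" where
  "Q_cx R N u k =
     \<lparr>chains = Q_mod R N k,
      bdry = (\<lambda>n. lin_ext R (Q_mod R N k (n - 1))
        (\<lambda>(J, m). finsum (Q_mod R N k (n - 1))
           (\<lambda>j. (koszul_sign R J j \<otimes>\<^bsub>R\<^esub> u j) \<odot>\<^bsub>Q_mod R N k (n - 1)\<^esub> basis_vec R (J - {j}, m)) J))\<rparr>"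

text \<open>The augmentation in degree 0, where J is empty.\<close>

definition Q_aug ::
    "('a, 'r) ring_scheme \<Rightarrow> enat \<Rightarrow> (nat \<Rightarrow> 'a) \<Rightarrow> nat
      \<Rightarrow> (nat set \<times> nat multiset \<Rightarrow> 'a) \<Rightarrow> 'a set" where
  "Q_aug R N u k = (let I = genideal R (u ` seq_index N) in
     lin_ext R (ideal_pow_quot R I k)
       (\<lambda>(J, m). ideal_pow R I (Suc k)
          +>\<^bsub>R\<^esub> finprod R (\<lambda>i. u i [^]\<^bsub>R\<^esub> count m i) (set_mset m)))"

text \<open>\<open>\<partial>\<^bsup>(k+1)\<^esup>\<close> from degree n of \<open>Q\<^bsup>(k)\<^esup>\<close> to degree n - 1 of \<open>Q\<^bsup>(k+1)\<^esup>\<close>.\<close>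

definition Q_del ::
    "('a, 'r) ring_scheme \<Rightarrow> enat \<Rightarrow> nat \<Rightarrow> int
      \<Rightarrow> (nat set \<times> nat multiset \<Rightarrow> 'a) \<Rightarrow> nat set \<times> nat multiset \<Rightarrow> 'a" where
  "Q_del R N k n = lin_ext R (Q_mod R N (Suc k) (n - 1))
     (\<lambda>(J, m). finsum (Q_mod R N (Suc k) (n - 1))
        (\<lambda>j. koszul_sign R J j \<odot>\<^bsub>Q_mod R N (Suc k) (n - 1)\<^esub> basis_vec R (J - {j}, add_mset j m)) J)"

text \<open>\<open>Tor\<^sub>n(R/I, I\<^sup>k/I\<^bsup>k+1\<^esup>)\<close>, computed from \<open>Q\<^bsup>(k)\<^esup>\<close>, and the map induced by \<open>\<partial>\<^bsup>(k+1)\<^esup>\<close>.\<close>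

definition Tor_Q ::
    "('a, 'r) ring_scheme \<Rightarrow> enat \<Rightarrow> (nat \<Rightarrow> 'a) \<Rightarrow> nat \<Rightarrow> int
      \<Rightarrow> ('a set, (((nat set \<times> nat multiset \<Rightarrow> 'a) \<Rightarrow> 'a set) set) set) module" where
  "Tor_Q R N u k n = (let I = genideal R (u ` seq_index N) in
     Tor R (R Quot I) (a_r_coset R I) (Q_cx R N u k) n)"

definition Tor_del ::
    "('a, 'r) ring_scheme \<Rightarrow> enat \<Rightarrow> (nat \<Rightarrow> 'a) \<Rightarrow> nat \<Rightarrow> int
      \<Rightarrow> ((nat set \<times> nat multiset \<Rightarrow> 'a) \<Rightarrow> 'a set) set set
      \<Rightarrow> ((nat set \<times> nat multiset \<Rightarrow> 'a) \<Rightarrow> 'a set) set set" where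
  "Tor_del R N u k n =
     (let I = genideal R (u ` seq_index N); A = R Quot I; \<phi> = a_r_coset R I in
      homology_map (tensor_cx R A \<phi> (Q_cx R N u (Suc k))) (n - 1)
        (tensor_map R A \<phi> (Q_mod R N (Suc k) (n - 1)) (Q_del R N k n)))"

text \<open>
  The double complex with \<open>R/I \<otimes> Q\<^bsup>(k)\<^esup>\<close> in degree q - k at position (-k, q) for 0 \<open>\<le>\<close> k < s. In the
  other columns it is the zero module, written as \<open>R/I \<otimes> 0\<close>.
\<close>

definition P_double ::
    "('a, 'r) ring_scheme \<Rightarrow> enat \<Rightarrow> (nat \<Rightarrow> 'a) \<Rightarrow> nat
      \<Rightarrow> ('a set, ((nat set \<times> nat multiset \<Rightarrow> 'a) \<Rightarrow> 'a set) set) double_cx" where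
  "P_double R N u s =
     (let I = genideal R (u ` seq_index N); A = R Quot I; \<phi> = a_r_coset R I;
          col = (\<lambda>p::int. - int s < p \<and> p \<le> 0);
          M = (\<lambda>p q. if col p then Q_mod R N (nat (- p)) (p + q) else free_mod R {})
      in \<lparr>obj = (\<lambda>p q. tensor_mod R A \<phi> (M p q)),
          hdiff = (\<lambda>p q. if col p \<and> col (p - 1)
             then tensor_map R A \<phi> (M (p - 1) q) (Q_del R N (nat (- p)) (p + q))
             else (\<lambda>_. \<zero>\<^bsub>tensor_mod R A \<phi> (M (p - 1) q)\<^esub>)),
          vdiff = (\<lambda>p q. if col p
             then tensor_map R A \<phi> (M p (q - 1)) (bdry (Q_cx R N u (nat (- p))) (p + q))
             else (\<lambda>_. \<zero>\<^bsub>tensor_mod R A \<phi> (M p (q - 1))\<^esub>))\<rparr>)"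

end

theory Submission
  imports Defs
begin

text \<open>
  Everything takes place over R, in free modules, and is then reduced modulo I.

  The coefficients of the Koszul differential lie in I. So over R/I it vanishes, Tor of R/I with
  \<open>I\<^sup>k/I\<^bsup>k+1\<^esup>\<close> is \<open>R/I \<otimes> Q\<^bsup>(k)\<^esup>\<close> (\<open>Zc_Q\<close>), and only the maps \<open>\<partial>\<close> remain. These have a contracting homotopy
  over any ring: on the basis element \<open>e\<^sub>J u\<^sub>m\<close> it moves the smallest index x that occurs in J or m from m to J,
  if it is not yet in J. The identity \<open>\<partial> h + h \<partial> = 1\<close> holds on all basis elements except the unit
  (\<open>hom_identity\<close>). This gives the exactness (\<open>Tor_exact\<close>).

  The spectral sequence collapses for a formal reason. The total differential over R/I consists of \<open>\<partial>\<close>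
  alone, and it moves each column to the next. If the boundary of an element drops by at least two steps of
  the filtration, then its leading component is a cycle and can be dropped without changing the
  boundary (\<open>collapse\<close>).

  That the \<open>Q\<^bsup>(k)\<^esup>\<close> are resolutions is the acyclicity of the Koszul complex (\<open>koszul_acyclic\<close>) together with
  quasi-regularity (\<open>Q_augmentation_kernel\<close>). The latter is deduced from the acyclicity of \<open>K(R; I\<^sup>s)\<close>, which
  follows by induction on s, one column being added at a time (\<open>K_acyclic\<close>).

  Tor may be computed from \<open>K(R; I\<^sup>s)\<close> in place of a given resolution P
  (\<open>resolution_comparison_presents\<close>). Over R/I, the homotopy pushes each cycle of nonzero degree into the
  last column (\<open>top_decomposition\<close>). There the boundaries are the image of \<open>\<partial>\<close>, whence the cokernel
  (\<open>coker_kernel\<close>); in degree zero the unit survives (\<open>Tor_degree_zero\<close>).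

  For the products, both factors may be taken from the last column. On it, the multiplication of P lifts
  the zero map, because the product of two elements of \<open>I\<^bsup>s-1\<^esup>\<close> lies in \<open>I\<^sup>s\<close> for \<open>s \<ge> 2\<close>. It is therefore
  null-homotopic, and a null-homotopy makes products of cycles into boundaries (\<open>top_product\<close>).
\<close>

section \<open>Linear maps and free modules\<close>

lemma lin_mapsI:
  assumes "\<And>x. x \<in> carrier M \<Longrightarrow> h x \<in> carrier N"
    and "\<And>x y. x \<in> carrier M \<Longrightarrow> y \<in> carrier M \<Longrightarrow> h (x \<oplus>\<^bsub>M\<^esub> y) = h x \<oplus>\<^bsub>N\<^esub> h y"
    and "\<And>r x. r \<in> carrier R \<Longrightarrow> x \<in> carrier M \<Longrightarrow> h (r \<odot>\<^bsub>M\<^esub> x) = r \<odot>\<^bsub>N\<^esub> h x"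
  shows "h \<in> lin_maps R M N"
  using assms by (auto simp: lin_maps_def)

lemma lin_closed: "h \<in> lin_maps R M N \<Longrightarrow> x \<in> carrier M \<Longrightarrow> h x \<in> carrier N"
  and lin_add: "h \<in> lin_maps R M N \<Longrightarrow> x \<in> carrier M \<Longrightarrow> y \<in> carrier M \<Longrightarrow> h (x \<oplus>\<^bsub>M\<^esub> y) = h x \<oplus>\<^bsub>N\<^esub> h y"
  and lin_smult: "h \<in> lin_maps R M N \<Longrightarrow> r \<in> carrier R \<Longrightarrow> x \<in> carrier M \<Longrightarrow> h (r \<odot>\<^bsub>M\<^esub> x) = r \<odot>\<^bsub>N\<^esub> h x"
  by (auto simp: lin_maps_def)

lemma lin_cong:
  assumes "h \<in> lin_maps R M N" "Module.module R M" "\<And>x. x \<in> carrier M \<Longrightarrow> g x = h x"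
  shows "g \<in> lin_maps R M N"
proof -
  interpret M: Module.module R M by fact
  show ?thesis using assms(1,3) by (auto simp: lin_maps_def)
qed

lemma lin_zero:
  assumes "h \<in> lin_maps R M N" "Module.module R M" "Module.module R N"
  shows "h \<zero>\<^bsub>M\<^esub> = \<zero>\<^bsub>N\<^esub>"
proof -
  interpret M: Module.module R M by fact
  interpret N: Module.module R N by fact
  show ?thesis
    using lin_smult[OF assms(1), of "\<zero>\<^bsub>R\<^esub>" "\<zero>\<^bsub>M\<^esub>"] lin_closed[OF assms(1), of "\<zero>\<^bsub>M\<^esub>"] by simp
qed

lemma lin_neg:
  assumes "h \<in> lin_maps R M N" "Module.module R M" "Module.module R N" "x \<in> carrier M"
  shows "h (\<ominus>\<^bsub>M\<^esub> x) = \<ominus>\<^bsub>N\<^esub> h x"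
proof -
  interpret M: Module.module R M by fact
  interpret N: Module.module R N by fact
  have "h (\<ominus>\<^bsub>M\<^esub> x) \<oplus>\<^bsub>N\<^esub> h x = \<zero>\<^bsub>N\<^esub>"
    using lin_add[OF assms(1), of "\<ominus>\<^bsub>M\<^esub> x" x] assms(4) lin_zero[OF assms(1-3)] by (simp add: M.M.l_neg)
  then show ?thesis using assms(4) lin_closed[OF assms(1)] by (metis M.M.add.inv_closed N.M.minus_equality)
qed

lemma lin_minus:
  assumes "h \<in> lin_maps R M N" "Module.module R M" "Module.module R N" "x \<in> carrier M" "y \<in> carrier M"
  shows "h (x \<ominus>\<^bsub>M\<^esub> y) = h x \<ominus>\<^bsub>N\<^esub> h y"
proof -
  interpret M: Module.module R M by fact
  show ?thesis using assms(4,5) lin_neg[OF assms(1-3)] lin_add[OF assms(1)] by (simp add: a_minus_def)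
qed

lemma lin_finsum:
  assumes "h \<in> lin_maps R M N" "Module.module R M" "Module.module R N" "f \<in> S \<rightarrow> carrier M"
  shows "h (finsum M f S) = finsum N (\<lambda>i. h (f i)) S"
proof -
  interpret M: Module.module R M by fact
  interpret N: Module.module R N by fact
  show ?thesis
  proof (cases "finite S")
    case True
    then show ?thesis using assms(4)
    proof (induction S rule: finite_induct)
      case empty
      then show ?case using lin_zero[OF assms(1-3)] by simp
    next
      case (insert x S)
      then have "f \<in> S \<rightarrow> carrier M" "f x \<in> carrier M" by auto
      moreover from this have "(\<lambda>i. h (f i)) \<in> S \<rightarrow> carrier N" using lin_closed[OF assms(1)] by auto
      ultimately show ?case using insert lin_add[OF assms(1)] lin_closed[OF assms(1)] by simp
    qed
  next
    case False
    then show ?thesis using lin_zero[OF assms(1-3)] by (simp add: M.finsum_infinite N.finsum_infinite)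
  qed
qed

lemma lin_compose:
  "h \<in> lin_maps R M N \<Longrightarrow> g \<in> lin_maps R N K \<Longrightarrow> (\<lambda>x. g (h x)) \<in> lin_maps R M K"
  by (auto simp: lin_maps_def Pi_iff)

lemma lin_id: "(\<lambda>x. x) \<in> lin_maps R M M"
  by (auto simp: lin_maps_def)

lemma lin_zero_map: "Module.module R N \<Longrightarrow> (\<lambda>x. \<zero>\<^bsub>N\<^esub>) \<in> lin_maps R M N"
proof -
  assume "Module.module R N"
  then interpret N: Module.module R N .
  show ?thesis by (auto simp: lin_maps_def)
qed

lemma lin_plus:
  assumes "f \<in> lin_maps R M N" "g \<in> lin_maps R M N" "Module.module R N"
  shows "(\<lambda>x. f x \<oplus>\<^bsub>N\<^esub> g x) \<in> lin_maps R M N"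
proof -
  interpret N: Module.module R N by fact
  show ?thesis using lin_closed[OF assms(1)] lin_closed[OF assms(2)]
    by (intro lin_mapsI) (simp_all add: lin_add[OF assms(1)] lin_add[OF assms(2)]
      lin_smult[OF assms(1)] lin_smult[OF assms(2)] N.smult_r_distr N.M.a_ac)
qed

lemma lin_smult_map:
  assumes "f \<in> lin_maps R M N" "Module.module R N" "r \<in> carrier R"
  shows "(\<lambda>x. r \<odot>\<^bsub>N\<^esub> f x) \<in> lin_maps R M N"
proof -
  interpret N: Module.module R N by fact
  have "r \<odot>\<^bsub>N\<^esub> (s \<odot>\<^bsub>N\<^esub> y) = s \<odot>\<^bsub>N\<^esub> (r \<odot>\<^bsub>N\<^esub> y)" if "s \<in> carrier R" "y \<in> carrier N" for s y
    using that assms(3) by (metis N.R.m_comm N.smult_assoc1)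
  then show ?thesis using lin_closed[OF assms(1)] assms(3)
    by (intro lin_mapsI) (simp_all add: lin_add[OF assms(1)] lin_smult[OF assms(1)] N.smult_r_distr)
qed

lemma lin_neg_map:
  assumes "f \<in> lin_maps R M N" "Module.module R N"
  shows "(\<lambda>x. \<ominus>\<^bsub>N\<^esub> f x) \<in> lin_maps R M N"
proof -
  interpret N: Module.module R N by fact
  show ?thesis using lin_closed[OF assms(1)]
    by (intro lin_mapsI) (simp_all add: lin_add[OF assms(1)] lin_smult[OF assms(1)] N.M.minus_add N.smult_r_minus N.M.a_comm)
qed

lemma lin_minus_map:
  assumes "f \<in> lin_maps R M N" "g \<in> lin_maps R M N" "Module.module R N"
  shows "(\<lambda>x. f x \<ominus>\<^bsub>N\<^esub> g x) \<in> lin_maps R M N"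
  unfolding a_minus_def by (intro lin_plus lin_neg_map assms)

lemma free_mod_simps [simp]:
  "\<zero>\<^bsub>free_mod R B\<^esub> = (\<lambda>b. \<zero>\<^bsub>R\<^esub>)"
  "f \<oplus>\<^bsub>free_mod R B\<^esub> g = (\<lambda>b. f b \<oplus>\<^bsub>R\<^esub> g b)"
  "r \<odot>\<^bsub>free_mod R B\<^esub> f = (\<lambda>b. r \<otimes>\<^bsub>R\<^esub> f b)"
  by (simp_all add: free_mod_def)

lemma free_mod_carrier:
  "f \<in> carrier (free_mod R B) \<longleftrightarrow>
     (\<forall>b\<in>B. f b \<in> carrier R) \<and> (\<forall>b. b \<notin> B \<longrightarrow> f b = \<zero>\<^bsub>R\<^esub>) \<and> finite {b. f b \<noteq> \<zero>\<^bsub>R\<^esub>}"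
  by (simp add: free_mod_def)

context cring
begin

lemma free_mod_value: "f \<in> carrier (free_mod R B) \<Longrightarrow> f b \<in> carrier R"
  by (cases "b \<in> B") (auto simp: free_mod_carrier)

lemma free_mod_support: "f \<in> carrier (free_mod R B) \<Longrightarrow> finite {b. f b \<noteq> \<zero>}"
  by (simp add: free_mod_carrier)

lemma free_mod_support_subset: "f \<in> carrier (free_mod R B) \<Longrightarrow> {b. f b \<noteq> \<zero>} \<subseteq> B"
  by (auto simp: free_mod_carrier)

lemma free_mod_mono: "f \<in> carrier (free_mod R B) \<Longrightarrow> B \<subseteq> B' \<Longrightarrow> f \<in> carrier (free_mod R B')"
  by (auto simp: free_mod_carrier)

lemma free_mod_module: "Module.module R (free_mod R B)"
proof (rule moduleI)
  show "cring R" ..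
  have sub: "finite {b. f b \<oplus> g b \<noteq> \<zero>}" if "f \<in> carrier (free_mod R B)" "g \<in> carrier (free_mod R B)" for f g
  proof (rule finite_subset)
    show "{b. f b \<oplus> g b \<noteq> \<zero>} \<subseteq> {b. f b \<noteq> \<zero>} \<union> {b. g b \<noteq> \<zero>}" by auto
    show "finite ({b. f b \<noteq> \<zero>} \<union> {b. g b \<noteq> \<zero>})" using that by (simp add: free_mod_carrier)
  qed
  have sm: "(\<lambda>b. r \<otimes> f b) \<in> carrier (free_mod R B)" if "f \<in> carrier (free_mod R B)" "r \<in> carrier R" for f r
  proof -
    have "{b. r \<otimes> f b \<noteq> \<zero>} \<subseteq> {b. f b \<noteq> \<zero>}" using that by auto
    then show ?thesis using that by (auto simp: free_mod_carrier intro: finite_subset)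
  qed
  then show "r \<odot>\<^bsub>free_mod R B\<^esub> x \<in> carrier (free_mod R B)" if "r \<in> carrier R" "x \<in> carrier (free_mod R B)" for r x
    using that by simp
  show "abelian_group (free_mod R B)"
  proof (rule abelian_groupI)
    fix x assume x: "x \<in> carrier (free_mod R B)"
    show "\<exists>y\<in>carrier (free_mod R B). y \<oplus>\<^bsub>free_mod R B\<^esub> x = \<zero>\<^bsub>free_mod R B\<^esub>"
    proof
      show "(\<lambda>b. \<ominus> \<one> \<otimes> x b) \<in> carrier (free_mod R B)" using sm[OF x] by simp
      show "(\<lambda>b. \<ominus> \<one> \<otimes> x b) \<oplus>\<^bsub>free_mod R B\<^esub> x = \<zero>\<^bsub>free_mod R B\<^esub>"
        using free_mod_value[OF x] by (simp add: l_minus l_neg)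
    qed
  next
    fix x y z assume "x \<in> carrier (free_mod R B)" "y \<in> carrier (free_mod R B)" "z \<in> carrier (free_mod R B)"
    then show "x \<oplus>\<^bsub>free_mod R B\<^esub> y \<oplus>\<^bsub>free_mod R B\<^esub> z = x \<oplus>\<^bsub>free_mod R B\<^esub> (y \<oplus>\<^bsub>free_mod R B\<^esub> z)"
      by (simp add: free_mod_value a_assoc)
  next
    fix x y assume xy: "x \<in> carrier (free_mod R B)" "y \<in> carrier (free_mod R B)"
    then show "x \<oplus>\<^bsub>free_mod R B\<^esub> y = y \<oplus>\<^bsub>free_mod R B\<^esub> x"
      by (simp add: free_mod_value a_comm)
    show "x \<oplus>\<^bsub>free_mod R B\<^esub> y \<in> carrier (free_mod R B)"
      using xy sub[OF xy] by (simp add: free_mod_carrier)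
  next
    fix x assume "x \<in> carrier (free_mod R B)"
    then show "\<zero>\<^bsub>free_mod R B\<^esub> \<oplus>\<^bsub>free_mod R B\<^esub> x = x" by (simp add: free_mod_value)
  qed (simp add: free_mod_carrier)
qed (simp_all add: free_mod_value l_distr r_distr m_assoc)

lemma basis_vec_closed: "b \<in> B \<Longrightarrow> basis_vec R b \<in> carrier (free_mod R B)"
proof -
  have "{c. basis_vec R b c \<noteq> \<zero>} \<subseteq> {b}" by (auto simp: basis_vec_def)
  then show "b \<in> B \<Longrightarrow> ?thesis" by (auto simp: free_mod_carrier basis_vec_def intro: finite_subset)
qed

lemma free_mod_neg:
  assumes "f \<in> carrier (free_mod R B)"
  shows "\<ominus>\<^bsub>free_mod R B\<^esub> f = (\<lambda>b. \<ominus> f b)"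
proof -
  interpret F: Module.module R "free_mod R B" by (rule free_mod_module)
  have "\<ominus>\<^bsub>free_mod R B\<^esub> f = (\<ominus> \<one>) \<odot>\<^bsub>free_mod R B\<^esub> f"
    using assms F.smult_l_minus[of \<one> f] by (simp del: free_mod_simps)
  then show ?thesis using assms by (simp add: free_mod_value l_minus)
qed

lemma free_mod_minus:
  assumes "f \<in> carrier (free_mod R B)" "g \<in> carrier (free_mod R B)"
  shows "f \<ominus>\<^bsub>free_mod R B\<^esub> g = (\<lambda>b. f b \<ominus> g b)"
  using assms by (simp add: a_minus_def free_mod_neg)

lemma finsum_free_mod:
  assumes "finite S" "g \<in> S \<rightarrow> carrier (free_mod R B)"
  shows "finsum (free_mod R B) g S = (\<lambda>b. finsum R (\<lambda>i. g i b) S)"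
  using assms
proof (induction S rule: finite_induct)
  case empty
  interpret F: Module.module R "free_mod R B" by (rule free_mod_module)
  show ?case by simp
next
  case (insert x S)
  interpret F: Module.module R "free_mod R B" by (rule free_mod_module)
  have g: "g x \<in> carrier (free_mod R B)" "g \<in> S \<rightarrow> carrier (free_mod R B)" using insert.prems by auto
  have gb: "(\<lambda>i. g i b) \<in> S \<rightarrow> carrier R" "g x b \<in> carrier R" for b
    using g(2) free_mod_value[of "g _" B b] free_mod_value[OF g(1)] by (auto simp: Pi_iff)
  have "finsum (free_mod R B) g (insert x S) = g x \<oplus>\<^bsub>free_mod R B\<^esub> finsum (free_mod R B) g S"
    by (rule F.M.finsum_insert[OF insert.hyps g(2,1)])
  also have "\<dots> = (\<lambda>b. g x b \<oplus> finsum R (\<lambda>i. g i b) S)"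
    by (simp only: insert.IH[OF g(2)] free_mod_simps)
  also have "\<dots> = (\<lambda>b. finsum R (\<lambda>i. g i b) (insert x S))"
    using finsum_insert[OF insert.hyps gb] by simp
  finally show ?case .
qed

lemma finsum_delta:
  assumes "finite S" "f \<in> S \<rightarrow> carrier R"
  shows "finsum R (\<lambda>b. f b \<otimes> basis_vec R b c) S = (if c \<in> S then f c else \<zero>)"
proof (cases "c \<in> S")
  case True
  have "finsum R (\<lambda>b. f b \<otimes> basis_vec R b c) S = finsum R (\<lambda>b. if c = b then f b else \<zero>) S"
    using assms by (intro finsum_cong') (auto simp: basis_vec_def Pi_iff)
  also have "\<dots> = f c" using finsum_singleton[OF True assms] by simp
  finally show ?thesis using True by simp
next
  case False
  have "finsum R (\<lambda>b. f b \<otimes> basis_vec R b c) S = finsum R (\<lambda>b. \<zero>) S"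
    using False assms by (intro finsum_cong') (auto simp: basis_vec_def Pi_iff)
  then show ?thesis using False by simp
qed

lemma free_mod_expand:
  assumes "f \<in> carrier (free_mod R B)"
  shows "f = finsum (free_mod R B) (\<lambda>b. f b \<odot>\<^bsub>free_mod R B\<^esub> basis_vec R b) {b. f b \<noteq> \<zero>}"
proof -
  interpret F: Module.module R "free_mod R B" by (rule free_mod_module)
  have "(\<lambda>b. f b \<odot>\<^bsub>free_mod R B\<^esub> basis_vec R b) \<in> {b. f b \<noteq> \<zero>} \<rightarrow> carrier (free_mod R B)"
  proof
    fix b assume "b \<in> {b. f b \<noteq> \<zero>}"
    then have "b \<in> B" using free_mod_support_subset[OF assms] by auto
    then show "f b \<odot>\<^bsub>free_mod R B\<^esub> basis_vec R b \<in> carrier (free_mod R B)"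
      by (intro F.smult_closed free_mod_value[OF assms] basis_vec_closed)
  qed
  then show ?thesis
    using finsum_delta[OF free_mod_support[OF assms], of f] free_mod_value[OF assms]
    by (subst finsum_free_mod) (auto simp: free_mod_support[OF assms])
qed

end

text \<open>
  The support of a sum of two elements depends on cancellation. Additivity of the extension is
  therefore proved over a common finite index set, on which the extra coefficients are zero.
\<close>

lemma lin_ext_superset:
  assumes "Module.module R M" "f \<in> carrier (free_mod R B)" "v \<in> B \<rightarrow> carrier M"
    "finite S" "{b. f b \<noteq> \<zero>\<^bsub>R\<^esub>} \<subseteq> S" "S \<subseteq> B"
  shows "lin_ext R M v f = finsum M (\<lambda>b. f b \<odot>\<^bsub>M\<^esub> v b) S"
proof -
  interpret M: Module.module R M by fact
  show ?thesis unfolding lin_ext_def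
    using assms M.R.free_mod_value[OF assms(2)]
    by (intro M.add.finprod_mono_neutral_cong_left) (auto simp: Pi_iff subset_iff)
qed

lemma lin_ext_lin:
  assumes "Module.module R M" "v \<in> B \<rightarrow> carrier M"
  shows "lin_ext R M v \<in> lin_maps R (free_mod R B) M"
proof -
  interpret M: Module.module R M by fact
  interpret F: Module.module R "free_mod R B" by (rule M.R.free_mod_module)
  note fin = M.R.free_mod_support and sub = M.R.free_mod_support_subset and val = M.R.free_mod_value
  have vB: "v b \<in> carrier M" if "b \<in> B" for b using that assms(2) by auto
  show ?thesis
  proof (rule lin_mapsI)
    fix f assume f: "f \<in> carrier (free_mod R B)"
    show "lin_ext R M v f \<in> carrier M"
      unfolding lin_ext_def using sub[OF f] val[OF f] vB by (intro M.finsum_closed) auto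
  next
    fix f g assume f: "f \<in> carrier (free_mod R B)" and g: "g \<in> carrier (free_mod R B)"
    define S where "S = {b. f b \<noteq> \<zero>\<^bsub>R\<^esub>} \<union> {b. g b \<noteq> \<zero>\<^bsub>R\<^esub>}"
    have S: "finite S" "S \<subseteq> B" using fin[OF f] fin[OF g] sub[OF f] sub[OF g] by (auto simp: S_def)
    have s: "{b. f b \<noteq> \<zero>\<^bsub>R\<^esub>} \<subseteq> S" "{b. g b \<noteq> \<zero>\<^bsub>R\<^esub>} \<subseteq> S"
      "{b. (f \<oplus>\<^bsub>free_mod R B\<^esub> g) b \<noteq> \<zero>\<^bsub>R\<^esub>} \<subseteq> S"
      by (auto simp: S_def)
    have fg: "f \<oplus>\<^bsub>free_mod R B\<^esub> g \<in> carrier (free_mod R B)" using f g by (rule F.M.a_closed)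
    have P: "(\<lambda>b. f b \<odot>\<^bsub>M\<^esub> v b) \<in> S \<rightarrow> carrier M" "(\<lambda>b. g b \<odot>\<^bsub>M\<^esub> v b) \<in> S \<rightarrow> carrier M"
      using vB S val[OF f] val[OF g] by auto
    show "lin_ext R M v (f \<oplus>\<^bsub>free_mod R B\<^esub> g) = lin_ext R M v f \<oplus>\<^bsub>M\<^esub> lin_ext R M v g"
      unfolding lin_ext_superset[OF assms(1) f assms(2) S(1) s(1) S(2)]
        lin_ext_superset[OF assms(1) g assms(2) S(1) s(2) S(2)]
        lin_ext_superset[OF assms(1) fg assms(2) S(1) s(3) S(2)] M.finsum_addf[OF P, symmetric]
      using P S vB val[OF f] val[OF g]
      by (intro M.finsum_cong') (auto simp: M.smult_l_distr subset_iff)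
  next
    fix r f assume r: "r \<in> carrier R" and f: "f \<in> carrier (free_mod R B)"
    let ?S = "{b. f b \<noteq> \<zero>\<^bsub>R\<^esub>}"
    have rf: "r \<odot>\<^bsub>free_mod R B\<^esub> f \<in> carrier (free_mod R B)" using r f by (rule F.smult_closed)
    have s: "{b. (r \<odot>\<^bsub>free_mod R B\<^esub> f) b \<noteq> \<zero>\<^bsub>R\<^esub>} \<subseteq> ?S" using r by auto
    have P: "(\<lambda>b. f b \<odot>\<^bsub>M\<^esub> v b) \<in> ?S \<rightarrow> carrier M" using vB val[OF f] sub[OF f] by auto
    show "lin_ext R M v (r \<odot>\<^bsub>free_mod R B\<^esub> f) = r \<odot>\<^bsub>M\<^esub> lin_ext R M v f"
      unfolding lin_ext_superset[OF assms(1) rf assms(2) fin[OF f] s sub[OF f]]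
        lin_ext_superset[OF assms(1) f assms(2) fin[OF f] subset_refl sub[OF f]]
        M.finsum_smult_ldistr[OF fin[OF f] r P]
      using r vB val[OF f] sub[OF f] by (intro M.finsum_cong') (auto simp: M.smult_assoc1 subset_iff)
  qed
qed

lemma lin_ext_basis:
  assumes "Module.module R M" "v b \<in> carrier M"
  shows "lin_ext R M v (basis_vec R b) = v b"
proof -
  interpret M: Module.module R M by fact
  have "lin_ext R M v (basis_vec R b) = finsum M (\<lambda>c. basis_vec R b c \<odot>\<^bsub>M\<^esub> v c) {b}"
    using assms by (intro lin_ext_superset[where B = "{b}"] M.R.basis_vec_closed) (auto simp: basis_vec_def)
  then show ?thesis using assms by (simp add: basis_vec_def)
qed

lemma lin_on_free:
  assumes "h \<in> lin_maps R (free_mod R B) M" "Module.module R M" "f \<in> carrier (free_mod R B)"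
  shows "h f = lin_ext R M (\<lambda>b. h (basis_vec R b)) f"
proof -
  interpret M: Module.module R M by fact
  interpret F: Module.module R "free_mod R B" by (rule M.R.free_mod_module)
  let ?S = "{b. f b \<noteq> \<zero>\<^bsub>R\<^esub>}"
  have S: "?S \<subseteq> B" "finite ?S" using M.R.free_mod_support_subset M.R.free_mod_support assms(3) by auto
  have c: "basis_vec R b \<in> carrier (free_mod R B)" "f b \<in> carrier R" if "b \<in> ?S" for b
  proof -
    have "b \<in> B" using that S by auto
    then show "basis_vec R b \<in> carrier (free_mod R B)" by (rule M.R.basis_vec_closed)
    show "f b \<in> carrier R" by (rule M.R.free_mod_value[OF assms(3)])
  qed
  have "h f = finsum M (\<lambda>b. h (f b \<odot>\<^bsub>free_mod R B\<^esub> basis_vec R b)) ?S"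
    by (subst M.R.free_mod_expand[OF assms(3)], rule lin_finsum[OF assms(1) F.module_axioms assms(2)])
      (use c in \<open>auto simp del: free_mod_simps intro!: F.smult_closed\<close>)
  also have "\<dots> = finsum M (\<lambda>b. f b \<odot>\<^bsub>M\<^esub> h (basis_vec R b)) ?S"
    using c lin_closed[OF assms(1)] by (intro M.finsum_cong') (auto simp: lin_smult[OF assms(1)] simp del: free_mod_simps)
  finally show ?thesis by (simp add: lin_ext_def)
qed

lemma lin_ext_cong:
  assumes "Module.module R M" "f \<in> carrier (free_mod R B)" "\<And>b. b \<in> B \<Longrightarrow> v b = w b" "\<And>b. b \<in> B \<Longrightarrow> w b \<in> carrier M"
  shows "lin_ext R M v f = lin_ext R M w f"
proof -
  interpret M: Module.module R M by fact
  show ?thesis unfolding lin_ext_def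
    using assms M.R.free_mod_support_subset[OF assms(2)] M.R.free_mod_value[OF assms(2)]
    by (intro M.finsum_cong') (auto simp: subset_iff)
qed

lemma lin_eq_on_free:
  assumes "h \<in> lin_maps R (free_mod R B) M" "g \<in> lin_maps R (free_mod R B) M" "Module.module R M"
    "\<And>b. b \<in> B \<Longrightarrow> h (basis_vec R b) = g (basis_vec R b)" "f \<in> carrier (free_mod R B)"
  shows "h f = g f"
proof -
  interpret M: Module.module R M by fact
  show ?thesis
    unfolding lin_on_free[OF assms(1,3,5)] lin_on_free[OF assms(2,3,5)]
    by (rule lin_ext_cong[OF assms(3,5)]) (simp_all add: assms(4) lin_closed[OF assms(2)] M.R.basis_vec_closed)
qed

lemma lin_ext_compose:
  assumes "Module.module R M" "Module.module R N" "h \<in> lin_maps R M N" "v \<in> B \<rightarrow> carrier M"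
    "f \<in> carrier (free_mod R B)"
  shows "h (lin_ext R M v f) = lin_ext R N (\<lambda>b. h (v b)) f"
proof -
  interpret M: Module.module R M by fact
  have v: "v b \<in> carrier M" "h (v b) \<in> carrier N" if "b \<in> B" for b
    using that assms(4) lin_closed[OF assms(3)] by auto
  show ?thesis
  proof (rule lin_eq_on_free[OF _ _ assms(2) _ assms(5)])
    show "(\<lambda>f. h (lin_ext R M v f)) \<in> lin_maps R (free_mod R B) N"
      by (rule lin_compose[OF lin_ext_lin[OF assms(1,4)] assms(3)])
    show "lin_ext R N (\<lambda>b. h (v b)) \<in> lin_maps R (free_mod R B) N"
      using v by (intro lin_ext_lin assms(2)) auto
    show "h (lin_ext R M v (basis_vec R b)) = lin_ext R N (\<lambda>b. h (v b)) (basis_vec R b)" if "b \<in> B" for b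
      using v[OF that] by (simp add: lin_ext_basis assms)
  qed
qed

lemma finsum_in_submodule:
  assumes "submodule H R M" "Module.module R M" "g \<in> S \<rightarrow> H"
  shows "finsum M g S \<in> H"
proof -
  interpret M: Module.module R M by fact
  note H = M.submoduleE[OF assms(1)]
  have z: "\<zero>\<^bsub>M\<^esub> \<in> H" using H by (metis M.M.l_neg equals0I in_mono)
  show ?thesis
  proof (cases "finite S")
    case True
    then show ?thesis using assms(3)
    proof (induction S rule: finite_induct)
      case (insert x S)
      then have "g x \<in> H" "g \<in> S \<rightarrow> H" by auto
      moreover from this H(1) have "g x \<in> carrier M" "g \<in> S \<rightarrow> carrier M" by auto
      ultimately show ?case using insert H(5) by simp
    qed (use z in simp)
  qed (use z in \<open>simp add: M.finsum_infinite\<close>)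
qed

lemma lin_image_in_submodule:
  assumes "h \<in> lin_maps R (free_mod R B) M" "Module.module R M" "submodule H R M"
    "\<And>b. b \<in> B \<Longrightarrow> h (basis_vec R b) \<in> H" "f \<in> carrier (free_mod R B)"
  shows "h f \<in> H"
proof -
  interpret M: Module.module R M by fact
  show ?thesis
    unfolding lin_on_free[OF assms(1,2,5)] lin_ext_def
    using assms M.R.free_mod_support_subset[OF assms(5)] M.R.free_mod_value[OF assms(5)] M.submoduleE(4)[OF assms(3)]
    by (intro finsum_in_submodule[OF assms(3,2)]) auto
qed

text \<open>
  The basis consists of the basis vectors, which are distinct for distinct indices because 1 differs from 0.
\<close>

lemma free_mod_is_free:
  assumes "cring R" "\<one>\<^bsub>R\<^esub> \<noteq> \<zero>\<^bsub>R\<^esub>"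
  shows "is_free_mod R (free_mod R B)"
proof -
  interpret R: cring R by fact
  let ?F = "free_mod R B" and ?E = "basis_vec R ` B"
  interpret F: Module.module R ?F by (rule R.free_mod_module)
  have inj: "inj_on (basis_vec R) B"
    using assms(2) by (auto simp: inj_on_def basis_vec_def fun_eq_iff split: if_splits)
  have E: "?E \<subseteq> carrier ?F" by (auto simp: R.basis_vec_closed simp del: free_mod_simps)
  then have L: "lin_ext R ?F (\<lambda>x. x) \<in> lin_maps R (free_mod R ?E) ?F"
    by (intro lin_ext_lin F.module_axioms) auto
  have val: "lin_ext R ?F (\<lambda>x. x) f b = f (basis_vec R b)" if f: "f \<in> carrier (free_mod R ?E)" and b: "b \<in> B" for f b
  proof -
    let ?S = "{x. f x \<noteq> \<zero>\<^bsub>R\<^esub>}"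
    have S: "?S \<subseteq> ?E" "finite ?S" using R.free_mod_support_subset[OF f] R.free_mod_support[OF f] by auto
    have "lin_ext R ?F (\<lambda>x. x) f b = finsum R (\<lambda>x. f x \<otimes>\<^bsub>R\<^esub> x b) ?S"
      unfolding lin_ext_def
      by (subst R.finsum_free_mod) (use S E in \<open>auto simp del: free_mod_simps intro!: F.smult_closed R.free_mod_value[OF f]\<close>, simp)
    also have "\<dots> = finsum R (\<lambda>x. if basis_vec R b = x then f x else \<zero>\<^bsub>R\<^esub>) ?S"
    proof (rule R.finsum_cong')
      fix x assume "x \<in> ?S"
      then obtain c where c: "x = basis_vec R c" "c \<in> B" using S by auto
      show "f x \<otimes>\<^bsub>R\<^esub> x b = (if basis_vec R b = x then f x else \<zero>\<^bsub>R\<^esub>)"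
      proof (cases "b = c")
        case True
        then show ?thesis using c R.free_mod_value[OF f] by (simp add: basis_vec_def)
      next
        case False
        then have "basis_vec R b \<noteq> x" using inj b c by (auto simp: inj_on_def)
        then show ?thesis using c False R.free_mod_value[OF f] by (simp add: basis_vec_def)
      qed
    qed (use R.free_mod_value[OF f] in auto)
    also have "\<dots> = f (basis_vec R b)"
    proof (cases "basis_vec R b \<in> ?S")
      case True
      then show ?thesis using R.finsum_singleton[OF True S(2), of f] R.free_mod_value[OF f] by auto
    next
      case False
      then have "finsum R (\<lambda>x. if basis_vec R b = x then f x else \<zero>\<^bsub>R\<^esub>) ?S = finsum R (\<lambda>x. \<zero>\<^bsub>R\<^esub>) ?S"
        by (intro R.finsum_cong') auto
      then show ?thesis using False by simp
    qed
    finally show ?thesis .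
  qed
  have "bij_betw (lin_ext R ?F (\<lambda>x. x)) (carrier (free_mod R ?E)) (carrier ?F)"
    unfolding bij_betw_def
  proof
    show "inj_on (lin_ext R ?F (\<lambda>x. x)) (carrier (free_mod R ?E))"
    proof (rule inj_onI)
      fix f g assume f: "f \<in> carrier (free_mod R ?E)" and g: "g \<in> carrier (free_mod R ?E)"
        and eq: "lin_ext R ?F (\<lambda>x. x) f = lin_ext R ?F (\<lambda>x. x) g"
      show "f = g"
      proof
        fix x show "f x = g x"
          using val[OF f] val[OF g] eq f g by (cases "x \<in> ?E") (auto simp: free_mod_carrier)
      qed
    qed
    show "lin_ext R ?F (\<lambda>x. x) ` carrier (free_mod R ?E) = carrier ?F"
    proof (intro equalityI subsetI)
      fix x assume "x \<in> lin_ext R ?F (\<lambda>x. x) ` carrier (free_mod R ?E)"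
      then show "x \<in> carrier ?F" using lin_closed[OF L] by auto
    next
      fix g assume g: "g \<in> carrier ?F"
      define f where "f x = (if x \<in> ?E then g (the_inv_into B (basis_vec R) x) else \<zero>\<^bsub>R\<^esub>)" for x
      have fb: "f (basis_vec R b) = g b" if "b \<in> B" for b
        using that inj by (simp add: f_def the_inv_into_f_f)
      have "{x. f x \<noteq> \<zero>\<^bsub>R\<^esub>} \<subseteq> basis_vec R ` {b. g b \<noteq> \<zero>\<^bsub>R\<^esub>}"
        using fb by (auto simp: f_def split: if_splits)
      then have "finite {x. f x \<noteq> \<zero>\<^bsub>R\<^esub>}"
        using R.free_mod_support[OF g] finite_surj by blast
      then have f: "f \<in> carrier (free_mod R ?E)"
        using fb R.free_mod_value[OF g] by (auto simp: free_mod_carrier f_def[of "_"])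
      have "lin_ext R ?F (\<lambda>x. x) f = g"
      proof
        fix b show "lin_ext R ?F (\<lambda>x. x) f b = g b"
        proof (cases "b \<in> B")
          case True
          then show ?thesis using val[OF f True] fb by simp
        next
          case False
          then show ?thesis using lin_closed[OF L f] g by (simp add: free_mod_carrier)
        qed
      qed
      then show "g \<in> lin_ext R ?F (\<lambda>x. x) ` carrier (free_mod R ?E)" using f by auto
    qed
  qed
  then show ?thesis using E F.module_axioms unfolding is_free_mod_def by blast
qed

lemma is_free_mod_coordinates:
  assumes "is_free_mod R M"
  obtains B c where "B \<subseteq> carrier M" "c \<in> lin_maps R M (free_mod R B)"
    "\<forall>x\<in>carrier M. lin_ext R M (\<lambda>b. b) (c x) = x"
proof -
  interpret M: Module.module R M using assms by (simp add: is_free_mod_def)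
  obtain B where B: "B \<subseteq> carrier M" and bij: "bij_betw (lin_ext R M (\<lambda>b. b)) (carrier (free_mod R B)) (carrier M)"
    using assms by (auto simp: is_free_mod_def)
  let ?F = "free_mod R B" and ?l = "lin_ext R M (\<lambda>b. b)"
  interpret F: Module.module R ?F by (rule M.R.free_mod_module)
  have l: "?l \<in> lin_maps R ?F M" using B by (intro lin_ext_lin M.module_axioms) auto
  define c where "c = the_inv_into (carrier ?F) ?l"
  have c1: "c x \<in> carrier ?F" "?l (c x) = x" if "x \<in> carrier M" for x
    using that bij unfolding c_def bij_betw_def
    by (auto intro: the_inv_into_into[OF _ _ subset_refl] simp: f_the_inv_into_f)
  have c2: "c (?l f) = f" if "f \<in> carrier ?F" for f
    using that bij unfolding c_def bij_betw_def by (auto simp: the_inv_into_f_f)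
  have "c \<in> lin_maps R M ?F"
  proof (rule lin_mapsI)
    fix x y assume "x \<in> carrier M" "y \<in> carrier M"
    then show "c (x \<oplus>\<^bsub>M\<^esub> y) = c x \<oplus>\<^bsub>?F\<^esub> c y"
      using c1 c2[of "c x \<oplus>\<^bsub>?F\<^esub> c y"] lin_add[OF l, of "c x" "c y"] by (simp del: free_mod_simps)
  next
    fix r x assume "r \<in> carrier R" "x \<in> carrier M"
    then show "c (r \<odot>\<^bsub>M\<^esub> x) = r \<odot>\<^bsub>?F\<^esub> c x"
      using c1 c2[of "r \<odot>\<^bsub>?F\<^esub> c x"] lin_smult[OF l, of r "c x"] by (simp del: free_mod_simps)
  qed (rule c1)
  then show ?thesis using that B c1 by blast
qed

lemma free_projective:
  assumes "is_free_mod R M" "Module.module R N" "Module.module R K"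
    and f: "f \<in> lin_maps R N K" and g: "g \<in> lin_maps R M K"
    and im: "\<And>x. x \<in> carrier M \<Longrightarrow> g x \<in> f ` carrier N"
  shows "\<exists>h\<in>lin_maps R M N. \<forall>x\<in>carrier M. f (h x) = g x"
proof -
  interpret M: Module.module R M using assms(1) by (simp add: is_free_mod_def)
  obtain B c where B: "B \<subseteq> carrier M" and c: "c \<in> lin_maps R M (free_mod R B)"
    and lc: "\<forall>x\<in>carrier M. lin_ext R M (\<lambda>b. b) (c x) = x"
    by (rule is_free_mod_coordinates[OF assms(1)])
  have "\<forall>b\<in>B. \<exists>w. w \<in> carrier N \<and> f w = g b"
  proof
    fix b assume "b \<in> B"
    then have "g b \<in> f ` carrier N" using B by (intro im) auto
    then show "\<exists>w. w \<in> carrier N \<and> f w = g b" by auto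
  qed
  then obtain w where w: "\<And>b. b \<in> B \<Longrightarrow> w b \<in> carrier N \<and> f (w b) = g b" by (rule bchoice[THEN exE]) blast
  have wl: "lin_ext R N w \<in> lin_maps R (free_mod R B) N" using w by (intro lin_ext_lin assms(2)) auto
  have "f (lin_ext R N w (c x)) = g x" if x: "x \<in> carrier M" for x
  proof -
    have cx: "c x \<in> carrier (free_mod R B)" by (rule lin_closed[OF c x])
    have "f (lin_ext R N w (c x)) = lin_ext R K (\<lambda>b. f (w b)) (c x)"
      by (rule lin_ext_compose[OF assms(2,3) f _ cx]) (use w in auto)
    also have "\<dots> = lin_ext R K g (c x)"
    proof (rule lin_ext_cong[OF assms(3) cx])
      fix b assume "b \<in> B"
      then show "f (w b) = g b" "g b \<in> carrier K" using w B lin_closed[OF g, of b] by auto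
    qed
    also have "\<dots> = g (lin_ext R M (\<lambda>b. b) (c x))"
      by (rule lin_ext_compose[OF M.module_axioms assms(3) g _ cx, symmetric]) (use B in auto)
    finally show ?thesis unfolding lc[rule_format, OF x] .
  qed
  then show ?thesis by (intro bexI[OF _ lin_compose[OF c wl]]) simp
qed

definition bilin ::
    "('a, 'r) ring_scheme \<Rightarrow> ('a, 'l) module \<Rightarrow> ('a, 'm) module \<Rightarrow> ('a, 'n) module \<Rightarrow> ('l \<Rightarrow> 'm \<Rightarrow> 'n) \<Rightarrow> bool" where
  "bilin R L M N h \<longleftrightarrow> (\<forall>x\<in>carrier L. h x \<in> lin_maps R M N) \<and> (\<forall>y\<in>carrier M. (\<lambda>x. h x y) \<in> lin_maps R L N)"

lemma bilin_left: "bilin R L M N h \<Longrightarrow> y \<in> carrier M \<Longrightarrow> (\<lambda>x. h x y) \<in> lin_maps R L N"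
  and bilin_right: "bilin R L M N h \<Longrightarrow> x \<in> carrier L \<Longrightarrow> h x \<in> lin_maps R M N"
  by (simp_all add: bilin_def)

lemma bilin_closed: "bilin R L M N h \<Longrightarrow> x \<in> carrier L \<Longrightarrow> y \<in> carrier M \<Longrightarrow> h x y \<in> carrier N"
  using lin_closed bilin_right by metis

text \<open>
  A bilinear map out of free modules is chosen one basis vector of the left factor at a time: each
  of them needs a linear map out of the right factor, which exists because that factor is projective.
\<close>

lemma bilin_projective:
  assumes "is_free_mod R L" "is_free_mod R M" "Module.module R N" "Module.module R K"
    and f: "f \<in> lin_maps R N K" and g: "bilin R L M K g"
    and im: "\<And>x y. x \<in> carrier L \<Longrightarrow> y \<in> carrier M \<Longrightarrow> g x y \<in> f ` carrier N"
  shows "\<exists>h. bilin R L M N h \<and> (\<forall>x\<in>carrier L. \<forall>y\<in>carrier M. f (h x y) = g x y)"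
proof -
  interpret L: Module.module R L using assms(1) by (simp add: is_free_mod_def)
  interpret M: Module.module R M using assms(2) by (simp add: is_free_mod_def)
  interpret N: Module.module R N by fact
  obtain B c where B: "B \<subseteq> carrier L" and c: "c \<in> lin_maps R L (free_mod R B)"
    and lc: "\<forall>x\<in>carrier L. lin_ext R L (\<lambda>b. b) (c x) = x"
    by (rule is_free_mod_coordinates[OF assms(1)])
  have "\<forall>b\<in>B. \<exists>H. H \<in> lin_maps R M N \<and> (\<forall>y\<in>carrier M. f (H y) = g b y)"
  proof
    fix b assume "b \<in> B"
    then have b: "b \<in> carrier L" using B by auto
    show "\<exists>H. H \<in> lin_maps R M N \<and> (\<forall>y\<in>carrier M. f (H y) = g b y)"
      using free_projective[OF assms(2,3,4) f bilin_right[OF g b] im[OF b]] by auto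
  qed
  then obtain H where H: "\<And>b. b \<in> B \<Longrightarrow> H b \<in> lin_maps R M N \<and> (\<forall>y\<in>carrier M. f (H b y) = g b y)"
    by (rule bchoice[THEN exE]) blast
  have Hl: "H b \<in> lin_maps R M N" if "b \<in> B" for b using H[OF that] by simp
  have Hc: "H b y \<in> carrier N" if "b \<in> B" "y \<in> carrier M" for b y
    using H[OF that(1)] that(2) by (auto intro: lin_closed)
  define h where "h x y = lin_ext R N (\<lambda>b. H b y) (c x)" for x y
  have cx: "c x \<in> carrier (free_mod R B)" if "x \<in> carrier L" for x by (rule lin_closed[OF c that])
  have left: "(\<lambda>x. h x y) \<in> lin_maps R L N" if "y \<in> carrier M" for y
    unfolding h_def using that Hc by (intro lin_compose[OF c] lin_ext_lin N.module_axioms) auto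
  have right: "h x \<in> lin_maps R M N" if x: "x \<in> carrier L" for x
  proof -
    let ?S = "{b. c x b \<noteq> \<zero>\<^bsub>R\<^esub>}"
    have S: "finite ?S" "?S \<subseteq> B" using L.R.free_mod_support[OF cx[OF x]] L.R.free_mod_support_subset[OF cx[OF x]] by auto
    have v: "c x b \<in> carrier R" for b by (rule L.R.free_mod_value[OF cx[OF x]])
    have t: "(\<lambda>b. c x b \<odot>\<^bsub>N\<^esub> H b y) \<in> ?S \<rightarrow> carrier N" if "y \<in> carrier M" for y using that S v Hc by auto
    show ?thesis
    proof (rule lin_mapsI)
      fix y z assume y: "y \<in> carrier M" and z: "z \<in> carrier M"
      show "h x (y \<oplus>\<^bsub>M\<^esub> z) = h x y \<oplus>\<^bsub>N\<^esub> h x z"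
        unfolding h_def lin_ext_def N.finsum_addf[OF t[OF y] t[OF z], symmetric]
        using S v Hc y z by (intro N.finsum_cong') (auto simp: lin_add[OF Hl] N.smult_r_distr subset_iff)
    next
      fix r y assume r: "r \<in> carrier R" and y: "y \<in> carrier M"
      have "c x b \<odot>\<^bsub>N\<^esub> (r \<odot>\<^bsub>N\<^esub> z) = r \<odot>\<^bsub>N\<^esub> (c x b \<odot>\<^bsub>N\<^esub> z)" if "z \<in> carrier N" for b z
        using that r v by (metis L.R.m_comm N.smult_assoc1)
      then show "h x (r \<odot>\<^bsub>M\<^esub> y) = r \<odot>\<^bsub>N\<^esub> h x y"
        unfolding h_def lin_ext_def N.finsum_smult_ldistr[OF S(1) r t[OF y]]
        using S v Hc r y by (intro N.finsum_cong') (auto simp: lin_smult[OF Hl] subset_iff)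
    qed (rule lin_closed[OF left x])
  qed
  have "f (h x y) = g x y" if x: "x \<in> carrier L" and y: "y \<in> carrier M" for x y
  proof -
    have gy: "(\<lambda>x. g x y) \<in> lin_maps R L K" by (rule bilin_left[OF g y])
    have "f (h x y) = lin_ext R K (\<lambda>b. f (H b y)) (c x)"
      unfolding h_def by (rule lin_ext_compose[OF assms(3,4) f _ cx[OF x]]) (use Hc y in auto)
    also have "\<dots> = lin_ext R K (\<lambda>b. g b y) (c x)"
    proof (rule lin_ext_cong[OF assms(4) cx[OF x]])
      fix b assume "b \<in> B"
      then show "f (H b y) = g b y" "g b y \<in> carrier K" using H y B lin_closed[OF gy, of b] by auto
    qed
    also have "\<dots> = g (lin_ext R L (\<lambda>b. b) (c x)) y"
      by (rule lin_ext_compose[OF L.module_axioms assms(4) gy _ cx[OF x], symmetric]) (use B in auto)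
    finally show ?thesis unfolding lc[rule_format, OF x] .
  qed
  then show ?thesis using left right by (intro exI[of _ h]) (simp add: bilin_def)
qed

section \<open>Comparison of resolutions\<close>

definition free_nonneg :: "('a, 'r) ring_scheme \<Rightarrow> ('a, 'm) chain_cx \<Rightarrow> bool" where
  "free_nonneg R X \<longleftrightarrow> chain_complex R X \<and> (\<forall>n. is_free_mod R (chains X n))
     \<and> (\<forall>n<0. carrier (chains X n) = {\<zero>\<^bsub>chains X n\<^esub>})"

lemma free_resolution_nonneg: "free_resolution R P N \<epsilon> \<Longrightarrow> free_nonneg R P"
  by (simp add: free_resolution_def free_nonneg_def)

lemma cx_module: "chain_complex R C \<Longrightarrow> Module.module R (chains C n)"
  and cx_lin: "chain_complex R C \<Longrightarrow> bdry C n \<in> lin_maps R (chains C n) (chains C (n - 1))"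
  and cx_dd: "chain_complex R C \<Longrightarrow> x \<in> carrier (chains C n) \<Longrightarrow> bdry C (n - 1) (bdry C n x) = \<zero>\<^bsub>chains C (n - 2)\<^esub>"
  by (simp_all add: chain_complex_def)

lemma cx_closed: "chain_complex R C \<Longrightarrow> x \<in> carrier (chains C n) \<Longrightarrow> bdry C n x \<in> carrier (chains C (n - 1))"
  by (rule lin_closed[OF cx_lin])

definition signed :: "('a, 'm) module \<Rightarrow> int \<Rightarrow> 'm \<Rightarrow> 'm" where
  "signed M p z = (if even p then z else \<ominus>\<^bsub>M\<^esub> z)"

lemma signed_closed:
  assumes "Module.module R M" "z \<in> carrier M"
  shows "signed M p z \<in> carrier M"
proof -
  interpret M: Module.module R M by fact
  show ?thesis using assms by (simp add: signed_def)
qed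

lemma signed_zero:
  assumes "Module.module R M"
  shows "signed M p \<zero>\<^bsub>M\<^esub> = \<zero>\<^bsub>M\<^esub>"
proof -
  interpret M: Module.module R M by fact
  show ?thesis by (simp add: signed_def)
qed

lemma signed_lin_map:
  assumes "Module.module R M" "h \<in> lin_maps R L M"
  shows "(\<lambda>x. signed M p (h x)) \<in> lin_maps R L M"
  using assms lin_neg_map[OF assms(2,1)] by (cases "even p") (simp_all add: signed_def)

lemma lin_signed:
  assumes "h \<in> lin_maps R M N" "Module.module R M" "Module.module R N" "x \<in> carrier M"
  shows "h (signed M p x) = signed N p (h x)"
  using assms by (simp add: signed_def lin_neg)

lemma signed_add:
  assumes "Module.module R M" "x \<in> carrier M" "y \<in> carrier M"
  shows "signed M p (x \<oplus>\<^bsub>M\<^esub> y) = signed M p x \<oplus>\<^bsub>M\<^esub> signed M p y"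
proof -
  interpret M: Module.module R M by fact
  show ?thesis using assms by (simp add: signed_def M.M.minus_add)
qed

lemma signed_pred:
  assumes "Module.module R M" "x \<in> carrier M"
  shows "signed M (p - 1) x = \<ominus>\<^bsub>M\<^esub> signed M p x"
proof -
  interpret M: Module.module R M by fact
  show ?thesis using assms by (simp add: signed_def)
qed

lemma bilin_plus:
  assumes "bilin R L M N f" "bilin R L M N g" "Module.module R N"
  shows "bilin R L M N (\<lambda>x y. f x y \<oplus>\<^bsub>N\<^esub> g x y)"
  using assms unfolding bilin_def by (auto intro!: lin_plus)

lemma bilin_signed:
  assumes "bilin R L M N f" "Module.module R N"
  shows "bilin R L M N (\<lambda>x y. signed N p (f x y))"
  using assms unfolding bilin_def by (auto intro!: signed_lin_map)

lemma bilin_zero: "Module.module R N \<Longrightarrow> bilin R L M N (\<lambda>x y. \<zero>\<^bsub>N\<^esub>)"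
  unfolding bilin_def by (auto intro!: lin_zero_map)

lemma bilin_compose:
  assumes "bilin R L M N h" "f \<in> lin_maps R L' L" "g \<in> lin_maps R M' M"
  shows "bilin R L' M' N (\<lambda>x y. h (f x) (g y))"
  unfolding bilin_def
proof (intro conjI ballI)
  fix x assume "x \<in> carrier L'"
  then show "(\<lambda>y. h (f x) (g y)) \<in> lin_maps R M' N"
    by (rule lin_compose[OF assms(3) bilin_right[OF assms(1) lin_closed[OF assms(2)]]])
next
  fix y assume "y \<in> carrier M'"
  then show "(\<lambda>x. h (f x) (g y)) \<in> lin_maps R L' N"
    by (rule lin_compose[OF assms(2) bilin_left[OF assms(1) lin_closed[OF assms(3)]]])
qed

lemma bilin_zero_left:
  assumes "bilin R L M N h" "Module.module R L" "Module.module R N" "y \<in> carrier M"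
  shows "h \<zero>\<^bsub>L\<^esub> y = \<zero>\<^bsub>N\<^esub>"
  using lin_zero[OF bilin_left[OF assms(1,4)] assms(2,3)] .

lemma bilin_zero_right:
  assumes "bilin R L M N h" "Module.module R M" "Module.module R N" "x \<in> carrier L"
  shows "h x \<zero>\<^bsub>M\<^esub> = \<zero>\<^bsub>N\<^esub>"
  using lin_zero[OF bilin_right[OF assms(1,4)] assms(2,3)] .

text \<open>
  The value at \<open>d(x \<otimes> y) = dx \<otimes> y + (-1)\<^sup>p x \<otimes> dy\<close> of the map that h induces on tensor products. A
  family of bilinear maps thus stands for a map out of the complex \<open>X \<otimes> Y\<close>, which is never formed.
\<close>

definition leibniz ::
    "('a, 'l) chain_cx \<Rightarrow> ('a, 'm) chain_cx \<Rightarrow> ('a, 'n) module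
      \<Rightarrow> int \<Rightarrow> int \<Rightarrow> (int \<Rightarrow> int \<Rightarrow> 'l \<Rightarrow> 'm \<Rightarrow> 'n) \<Rightarrow> 'l \<Rightarrow> 'm \<Rightarrow> 'n" where
  "leibniz X Y M p q h x y =
     h (p - 1) q (bdry X p x) y \<oplus>\<^bsub>M\<^esub> signed M p (h p (q - 1) x (bdry Y q y))"

lemma leibniz_bilin:
  assumes "chain_complex R X" "chain_complex R Y" "Module.module R M"
    "bilin R (chains X (p - 1)) (chains Y q) M (h (p - 1) q)"
    "bilin R (chains X p) (chains Y (q - 1)) M (h p (q - 1))"
  shows "bilin R (chains X p) (chains Y q) M (leibniz X Y M p q h)"
proof -
  have "bilin R (chains X p) (chains Y q) M (\<lambda>x y. h (p - 1) q (bdry X p x) y)"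
    by (rule bilin_compose[OF assms(4) cx_lin[OF assms(1)] lin_id])
  moreover have "bilin R (chains X p) (chains Y q) M (\<lambda>x y. h p (q - 1) x (bdry Y q y))"
    by (rule bilin_compose[OF assms(5) lin_id cx_lin[OF assms(2)]])
  ultimately have "bilin R (chains X p) (chains Y q) M (\<lambda>x y. leibniz X Y M p q h x y)"
    unfolding leibniz_def using assms(3) by (intro bilin_plus bilin_signed)
  then show ?thesis by simp
qed

text \<open>
  One induction on the total degree serves both for chain maps out of \<open>X \<otimes> Y\<close> (shift e = 0 and G = 0)
  and for null-homotopies of a chain map (e = 1 and G the map up to sign). The right-hand side of the
  equation to be solved is a cycle by the hypothesis on G, hence a boundary by acyclicity, and
  projectivity turns this pointwise statement into a bilinear solution.
\<close>

lemma leibniz_extension: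
  fixes e :: int and X :: "('a, 'l) chain_cx" and Y :: "('a, 'm) chain_cx" and C :: "('a, 'n) chain_cx"
  assumes X: "free_nonneg R X" and Y: "free_nonneg R Y" and C: "chain_complex R C"
    and ac: "\<And>n. n > 0 \<Longrightarrow> cycles C n = boundaries C n"
    and G: "\<And>p q k. k = p + q + e - 1 \<Longrightarrow> bilin R (chains X p) (chains Y q) (chains C k) (G p q)"
    and dG: "\<And>p q k x y. \<lbrakk>k = p + q + e - 1; x \<in> carrier (chains X p); y \<in> carrier (chains Y q)\<rbrakk> \<Longrightarrow>
      bdry C k (G p q x y) \<oplus>\<^bsub>chains C (k - 1)\<^esub> leibniz X Y (chains C (k - 1)) p q G x y = \<zero>\<^bsub>chains C (k - 1)\<^esub>"
    and H0: "\<And>p q. p + q = - e \<Longrightarrow> bilin R (chains X p) (chains Y q) (chains C 0) (H0 p q)"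
    and start: "\<And>p q x y. \<lbrakk>p + q = 1 - e; x \<in> carrier (chains X p); y \<in> carrier (chains Y q)\<rbrakk> \<Longrightarrow>
      G p q x y \<oplus>\<^bsub>chains C 0\<^esub> leibniz X Y (chains C 0) p q H0 x y \<in> boundaries C 0"
  shows "\<exists>h. (\<forall>p q. bilin R (chains X p) (chains Y q) (chains C (p + q + e)) (h p q))
    \<and> (\<forall>p q. \<forall>x\<in>carrier (chains X p). \<forall>y\<in>carrier (chains Y q). p + q + e > 0 \<longrightarrow>
         bdry C (p + q + e) (h p q x y)
         = G p q x y \<oplus>\<^bsub>chains C (p + q + e - 1)\<^esub> leibniz X Y (chains C (p + q + e - 1)) p q h x y)
    \<and> (\<forall>p q. p + q + e = 0 \<longrightarrow> h p q = H0 p q)"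
proof -
  have Xc: "chain_complex R X" and Xf: "\<And>n. is_free_mod R (chains X n)" using X by (auto simp: free_nonneg_def)
  have Yc: "chain_complex R Y" and Yf: "\<And>n. is_free_mod R (chains Y n)" using Y by (auto simp: free_nonneg_def)
  note Cm = cx_module[OF C]
  define rhs where "rhs k p q h x y = G p q x y \<oplus>\<^bsub>chains C k\<^esub> leibniz X Y (chains C k) p q h x y" for k p q h x y
  \<comment> \<open>P: a solution in total degree n - e for which the next equation is solvable; Q: H' solves that equation\<close>
  define P where "P n H \<longleftrightarrow>
      (\<forall>p q. p + q + e = int n \<longrightarrow> bilin R (chains X p) (chains Y q) (chains C (int n)) (H p q))
      \<and> (\<forall>p q. \<forall>x\<in>carrier (chains X p). \<forall>y\<in>carrier (chains Y q). p + q + e = int n + 1 \<longrightarrow>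
           rhs (int n) p q H x y \<in> boundaries C (int n))
      \<and> (n = 0 \<longrightarrow> (\<forall>p q. p + q + e = 0 \<longrightarrow> H p q = H0 p q))" for n and H :: "int \<Rightarrow> int \<Rightarrow> 'l \<Rightarrow> 'm \<Rightarrow> 'n"
  define Q where "Q n H H' \<longleftrightarrow>
      (\<forall>p q. \<forall>x\<in>carrier (chains X p). \<forall>y\<in>carrier (chains Y q). p + q + e = int n + 1 \<longrightarrow>
         bdry C (int n + 1) (H' p q x y) = rhs (int n) p q H x y)"
    for n and H H' :: "int \<Rightarrow> int \<Rightarrow> 'l \<Rightarrow> 'm \<Rightarrow> 'n"
  have "\<exists>f. \<forall>n. P n (f n) \<and> Q n (f n) (f (Suc n))"
  proof (rule dependent_nat_choice)
    have "P 0 H0" unfolding P_def rhs_def using H0 start by (auto simp: algebra_simps)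
    then show "\<exists>H. P 0 H" by (rule exI[where x = H0])
  next
    fix H n assume PH: "P n H"
    have Hb: "bilin R (chains X p) (chains Y q) (chains C (int n)) (H p q)" if "p + q + e = int n" for p q
      using PH that unfolding P_def by simp
    have ex: "\<exists>h. p + q + e = int n + 1 \<longrightarrow> bilin R (chains X p) (chains Y q) (chains C (int n + 1)) h
        \<and> (\<forall>x\<in>carrier (chains X p). \<forall>y\<in>carrier (chains Y q). bdry C (int n + 1) (h x y) = rhs (int n) p q H x y)"
      for p q
    proof (cases "p + q + e = int n + 1")
      case pq: True
      have d: "bdry C (int n + 1) \<in> lin_maps R (chains C (int n + 1)) (chains C (int n))"
        using cx_lin[OF C, of "int n + 1"] by simp
      have b: "bilin R (chains X p) (chains Y q) (chains C (int n)) (rhs (int n) p q H)"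
        unfolding rhs_def[abs_def]
        by (intro bilin_plus leibniz_bilin Xc Yc Cm G Hb) (use pq in auto)
      have "rhs (int n) p q H x y \<in> bdry C (int n + 1) ` carrier (chains C (int n + 1))"
        if "x \<in> carrier (chains X p)" "y \<in> carrier (chains Y q)" for x y
        using PH that pq unfolding P_def boundaries_def by blast
      from bilin_projective[OF Xf Yf Cm Cm d b this] show ?thesis by blast
    qed simp
    obtain H' where H'b: "\<And>p q. p + q + e = int n + 1 \<Longrightarrow> bilin R (chains X p) (chains Y q) (chains C (int n + 1)) (H' p q)"
      and H'd: "\<And>p q x y. \<lbrakk>p + q + e = int n + 1; x \<in> carrier (chains X p); y \<in> carrier (chains Y q)\<rbrakk> \<Longrightarrow>
          bdry C (int n + 1) (H' p q x y) = rhs (int n) p q H x y"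
    proof -
      have "\<forall>pq. \<exists>h. fst pq + snd pq + e = int n + 1 \<longrightarrow> bilin R (chains X (fst pq)) (chains Y (snd pq)) (chains C (int n + 1)) h
        \<and> (\<forall>x\<in>carrier (chains X (fst pq)). \<forall>y\<in>carrier (chains Y (snd pq)).
             bdry C (int n + 1) (h x y) = rhs (int n) (fst pq) (snd pq) H x y)" using ex by blast
      from choice[OF this] obtain F where F: "\<And>p q. p + q + e = int n + 1 \<Longrightarrow> bilin R (chains X p) (chains Y q) (chains C (int n + 1)) (F (p, q))
        \<and> (\<forall>x\<in>carrier (chains X p). \<forall>y\<in>carrier (chains Y q). bdry C (int n + 1) (F (p, q) x y) = rhs (int n) p q H x y)"
        by (metis fst_conv snd_conv)
      show ?thesis by (rule that[of "\<lambda>p q. F (p, q)"]) (use F in auto)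
    qed
    have cyc: "rhs (int n + 1) p q H' x y \<in> boundaries C (int n + 1)"
      if pq: "p + q + e = int n + 1 + 1" and x: "x \<in> carrier (chains X p)" and y: "y \<in> carrier (chains Y q)" for p q x y
    proof -
      let ?M = "chains C (int n)" and ?M1 = "chains C (int n + 1)"
      interpret M: Module.module R ?M by (rule Cm)
      have pq1: "p - 1 + q + e = int n + 1" "p + (q - 1) + e = int n + 1" "p - 1 + (q - 1) + e = int n"
        "p - 2 + q + e = int n" "p + (q - 2) + e = int n" using pq by auto
      have d: "bdry C (int n + 1) \<in> lin_maps R ?M1 ?M"
        using cx_lin[OF C, of "int n + 1"] by simp
      have dx: "bdry X p x \<in> carrier (chains X (p - 1))" and dy: "bdry Y q y \<in> carrier (chains Y (q - 1))"
        using cx_closed[OF Xc x] cx_closed[OF Yc y] by auto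
      have ddx: "bdry X (p - 1) (bdry X p x) = \<zero>\<^bsub>chains X (p - 2)\<^esub>" and ddy: "bdry Y (q - 1) (bdry Y q y) = \<zero>\<^bsub>chains Y (q - 2)\<^esub>"
        using cx_dd[OF Xc x] cx_dd[OF Yc y] by auto
      define w where "w = H (p - 1) (q - 1) (bdry X p x) (bdry Y q y)"
      have w: "w \<in> carrier ?M" unfolding w_def by (rule bilin_closed[OF Hb dx dy]) (use pq1 in auto)
      have Gpq: "G p q x y \<in> carrier ?M1"
        by (rule bilin_closed[OF G x y]) (use pq in auto)
      have H1: "H' (p - 1) q (bdry X p x) y \<in> carrier ?M1"
        by (rule bilin_closed[OF H'b dx y]) (use pq1 in auto)
      have H2: "H' p (q - 1) x (bdry Y q y) \<in> carrier ?M1"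
        by (rule bilin_closed[OF H'b x dy]) (use pq1 in auto)
      have G1: "G (p - 1) q (bdry X p x) y \<in> carrier ?M"
        by (rule bilin_closed[OF G dx y]) (use pq1 in auto)
      have G2: "G p (q - 1) x (bdry Y q y) \<in> carrier ?M"
        by (rule bilin_closed[OF G x dy]) (use pq1 in auto)
      have z1: "H (p - 2) q \<zero>\<^bsub>chains X (p - 2)\<^esub> y = \<zero>\<^bsub>?M\<^esub>"
        by (rule bilin_zero_left[OF Hb[OF pq1(4)] cx_module[OF Xc] Cm y])
      have z2: "H p (q - 2) x \<zero>\<^bsub>chains Y (q - 2)\<^esub> = \<zero>\<^bsub>?M\<^esub>"
        by (rule bilin_zero_right[OF Hb[OF pq1(5)] cx_module[OF Yc] Cm x])
      have e1: "bdry C (int n + 1) (H' (p - 1) q (bdry X p x) y) = G (p - 1) q (bdry X p x) y \<oplus>\<^bsub>?M\<^esub> \<ominus>\<^bsub>?M\<^esub> signed ?M p w"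
        using H'd[OF pq1(1) dx y] z1 w signed_closed[OF Cm w]
        by (simp add: rhs_def leibniz_def ddx signed_pred[OF Cm] w_def[symmetric])
      have e2: "bdry C (int n + 1) (H' p (q - 1) x (bdry Y q y)) = G p (q - 1) x (bdry Y q y) \<oplus>\<^bsub>?M\<^esub> w"
        using H'd[OF pq1(2) x dy] z2 w
        by (simp add: rhs_def leibniz_def ddy signed_zero[OF Cm] w_def[symmetric])
      let ?a = "bdry C (int n + 1) (G p q x y)" and ?b = "G (p - 1) q (bdry X p x) y"
        and ?c = "signed ?M p (G p (q - 1) x (bdry Y q y))" and ?s = "signed ?M p w"
      have abc: "?a \<in> carrier ?M" "?c \<in> carrier ?M" "?s \<in> carrier ?M"
        using lin_closed[OF d Gpq] signed_closed[OF Cm G2] signed_closed[OF Cm w] by auto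
      have "bdry C (int n + 1) (rhs (int n + 1) p q H' x y)
          = ?a \<oplus>\<^bsub>?M\<^esub> ((?b \<oplus>\<^bsub>?M\<^esub> \<ominus>\<^bsub>?M\<^esub> ?s) \<oplus>\<^bsub>?M\<^esub> (?c \<oplus>\<^bsub>?M\<^esub> ?s))"
        unfolding rhs_def leibniz_def
        using Gpq H1 H2 signed_closed[OF Cm H2] M.M.a_closed cx_module[OF C, THEN Module.module.axioms(2), THEN abelian_group.axioms(1), THEN abelian_monoid.a_closed]
        by (simp add: lin_add[OF d] lin_signed[OF d Cm Cm] e1 e2 signed_add[OF Cm G2 w])
      also have "\<dots> = ?a \<oplus>\<^bsub>?M\<^esub> (?b \<oplus>\<^bsub>?M\<^esub> ?c)"
      proof -
        have "(?b \<oplus>\<^bsub>?M\<^esub> \<ominus>\<^bsub>?M\<^esub> ?s) \<oplus>\<^bsub>?M\<^esub> (?c \<oplus>\<^bsub>?M\<^esub> ?s) = (?b \<oplus>\<^bsub>?M\<^esub> ?c) \<oplus>\<^bsub>?M\<^esub> (\<ominus>\<^bsub>?M\<^esub> ?s \<oplus>\<^bsub>?M\<^esub> ?s)"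
          using abc G1 by (simp add: M.M.a_ac del: M.M.add.l_inv)
        then show ?thesis using abc G1 by (simp add: M.M.l_neg)
      qed
      also have "\<dots> = \<zero>\<^bsub>?M\<^esub>" using dG[OF _ x y, of "int n + 1"] pq by (simp add: leibniz_def)
      finally have "rhs (int n + 1) p q H' x y \<in> cycles C (int n + 1)"
      proof -
        assume z: "bdry C (int n + 1) (rhs (int n + 1) p q H' x y) = \<zero>\<^bsub>?M\<^esub>"
        have "bilin R (chains X p) (chains Y q) ?M1 (rhs (int n + 1) p q H')"
          unfolding rhs_def[abs_def] by (intro bilin_plus leibniz_bilin Xc Yc Cm G H'b) (use pq in auto)
        from bilin_closed[OF this x y] z show ?thesis by (simp add: cycles_def)
      qed
      then show ?thesis using ac by simp
    qed
    have "P (Suc n) H'" unfolding P_def using H'b cyc by (auto simp: algebra_simps)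
    moreover have "Q n H H'" unfolding Q_def using H'd by auto
    ultimately show "\<exists>H'. P (Suc n) H' \<and> Q n H H'" by blast
  qed
  then obtain f where fP: "\<And>n. P n (f n)" and fQ: "\<And>n. Q n (f n) (f (Suc n))" by blast
  define h where "h p q = (if p + q + e < 0 then (\<lambda>x y. \<zero>\<^bsub>chains C (p + q + e)\<^esub>) else f (nat (p + q + e)) p q)" for p q
  show ?thesis
  proof (intro exI[of _ h] conjI allI ballI impI)
    fix p q
    show "bilin R (chains X p) (chains Y q) (chains C (p + q + e)) (h p q)"
      using fP[of "nat (p + q + e)"] unfolding P_def h_def by (auto intro!: bilin_zero Cm)
  next
    fix p q x y assume x: "x \<in> carrier (chains X p)" and y: "y \<in> carrier (chains Y q)" and pq: "p + q + e > 0"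
    define n where "n = nat (p + q + e - 1)"
    have n: "p + q + e = int n + 1" using pq by (simp add: n_def)
    have "h (p - 1) q = f n (p - 1) q" "h p (q - 1) = f n p (q - 1)" "h p q = f (Suc n) p q"
    proof -
      have "nat (p - 1 + q + e) = n" "nat (p + (q - 1) + e) = n" "nat (p + q + e) = Suc n" using n by auto
      then show "h (p - 1) q = f n (p - 1) q" "h p (q - 1) = f n p (q - 1)" "h p q = f (Suc n) p q"
        using n by (auto simp: h_def)
    qed
    then show "bdry C (p + q + e) (h p q x y)
         = G p q x y \<oplus>\<^bsub>chains C (p + q + e - 1)\<^esub> leibniz X Y (chains C (p + q + e - 1)) p q h x y"
      using fQ[of n] x y n unfolding Q_def rhs_def leibniz_def by auto
  next
    fix p q assume "p + q + e = 0"
    then show "h p q = H0 p q" using fP[of 0] unfolding P_def h_def by auto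
  qed
qed

lemma free_resolutionD:
  assumes "free_resolution R P N \<epsilon>"
  shows "chain_complex R P" "\<And>n. n > 0 \<Longrightarrow> cycles P n = boundaries P n"
    "\<epsilon> \<in> lin_maps R (chains P 0) N" "\<epsilon> ` carrier (chains P 0) = carrier N"
    "{x \<in> carrier (chains P 0). \<epsilon> x = \<zero>\<^bsub>N\<^esub>} = boundaries P 0"
    "\<And>n. n < 0 \<Longrightarrow> carrier (chains P n) = {\<zero>\<^bsub>chains P n\<^esub>}"
  using assms by (auto simp: free_resolution_def)

theorem bilinear_lift:
  assumes X: "free_nonneg R X" and Y: "free_nonneg R Y"
    and C: "free_resolution R C N \<epsilon>" and N: "Module.module R N"
    and \<beta>: "bilin R (chains X 0) (chains Y 0) N \<beta>"
    and \<beta>l: "\<And>x y. x \<in> carrier (chains X 1) \<Longrightarrow> y \<in> carrier (chains Y 0) \<Longrightarrow> \<beta> (bdry X 1 x) y = \<zero>\<^bsub>N\<^esub>"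
    and \<beta>r: "\<And>x y. x \<in> carrier (chains X 0) \<Longrightarrow> y \<in> carrier (chains Y 1) \<Longrightarrow> \<beta> x (bdry Y 1 y) = \<zero>\<^bsub>N\<^esub>"
  shows "\<exists>\<mu>. (\<forall>p q. bilin R (chains X p) (chains Y q) (chains C (p + q)) (\<mu> p q))
    \<and> (\<forall>p q. \<forall>x\<in>carrier (chains X p). \<forall>y\<in>carrier (chains Y q).
         bdry C (p + q) (\<mu> p q x y) = leibniz X Y (chains C (p + q - 1)) p q \<mu> x y)
    \<and> (\<forall>x\<in>carrier (chains X 0). \<forall>y\<in>carrier (chains Y 0). \<epsilon> (\<mu> 0 0 x y) = \<beta> x y)"
proof -
  have Xc: "chain_complex R X" and Xf: "\<And>n. is_free_mod R (chains X n)" using X by (auto simp: free_nonneg_def)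
  have Yc: "chain_complex R Y" and Yf: "\<And>n. is_free_mod R (chains Y n)" using Y by (auto simp: free_nonneg_def)
  note Cc = free_resolutionD(1)[OF C] and ac = free_resolutionD(2)[OF C] and \<epsilon> = free_resolutionD(3)[OF C]
  note Cm = cx_module[OF Cc]
  interpret N: Module.module R N by fact
  \<comment> \<open>in total degree zero, the other pairs (p, q) have a factor of negative degree, which is zero\<close>
  define g where "g p x y = (if p = (0::int) then \<beta> x y else \<zero>\<^bsub>N\<^esub>)" for p x y
  have gb: "bilin R (chains X p) (chains Y q) N (g p)" if "p + q = 0" for p q
    using that \<beta> bilin_zero[OF N] unfolding g_def by (cases "p = 0") auto
  have ex: "\<exists>h. p + q = 0 \<longrightarrow> bilin R (chains X p) (chains Y q) (chains C 0) h
      \<and> (\<forall>x\<in>carrier (chains X p). \<forall>y\<in>carrier (chains Y q). \<epsilon> (h x y) = g p x y)" for p q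
  proof (cases "p + q = 0")
    case True
    have "g p x y \<in> \<epsilon> ` carrier (chains C 0)" if "x \<in> carrier (chains X p)" "y \<in> carrier (chains Y q)" for x y
      unfolding free_resolutionD(4)[OF C] by (rule bilin_closed[OF gb[OF True] that])
    from bilin_projective[OF Xf Yf Cm N \<epsilon> gb[OF True] this] show ?thesis by blast
  qed simp
  obtain H where Hb: "\<And>p q. p + q = 0 \<Longrightarrow> bilin R (chains X p) (chains Y q) (chains C 0) (H p q)"
    and Hg: "\<And>p q x y. \<lbrakk>p + q = 0; x \<in> carrier (chains X p); y \<in> carrier (chains Y q)\<rbrakk> \<Longrightarrow> \<epsilon> (H p q x y) = g p x y"
  proof -
    have "\<forall>pq. \<exists>h. fst pq + snd pq = 0 \<longrightarrow> bilin R (chains X (fst pq)) (chains Y (snd pq)) (chains C 0) h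
      \<and> (\<forall>x\<in>carrier (chains X (fst pq)). \<forall>y\<in>carrier (chains Y (snd pq)). \<epsilon> (h x y) = g (fst pq) x y)" using ex by blast
    from choice[OF this] obtain F where F: "\<And>p q. p + q = 0 \<Longrightarrow> bilin R (chains X p) (chains Y q) (chains C 0) (F (p, q))
      \<and> (\<forall>x\<in>carrier (chains X p). \<forall>y\<in>carrier (chains Y q). \<epsilon> (F (p, q) x y) = g p x y)"
      by (metis fst_conv snd_conv)
    show ?thesis by (rule that[of "\<lambda>p q. F (p, q)"]) (use F in auto)
  qed
  let ?G = "\<lambda>p q x y. \<zero>\<^bsub>chains C (p + q - 1)\<^esub>"
  have zero: "bdry C k \<zero>\<^bsub>chains C k\<^esub> = \<zero>\<^bsub>chains C (k - 1)\<^esub>" for k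
    by (rule lin_zero[OF cx_lin[OF Cc] Cm Cm])
  have addz: "\<zero>\<^bsub>chains C k\<^esub> \<oplus>\<^bsub>chains C k\<^esub> x = x" if "x \<in> carrier (chains C k)" for k x
  proof -
    interpret C: Module.module R "chains C k" by (rule Cm)
    show ?thesis using that by simp
  qed
  have zc: "\<zero>\<^bsub>chains C k\<^esub> \<in> carrier (chains C k)" for k
  proof -
    interpret C: Module.module R "chains C k" by (rule Cm)
    show ?thesis by simp
  qed
  have "\<exists>h. (\<forall>p q. bilin R (chains X p) (chains Y q) (chains C (p + q + 0)) (h p q))
    \<and> (\<forall>p q. \<forall>x\<in>carrier (chains X p). \<forall>y\<in>carrier (chains Y q). p + q + 0 > 0 \<longrightarrow>
         bdry C (p + q + 0) (h p q x y)
         = ?G p q x y \<oplus>\<^bsub>chains C (p + q + 0 - 1)\<^esub> leibniz X Y (chains C (p + q + 0 - 1)) p q h x y)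
    \<and> (\<forall>p q. p + q + 0 = 0 \<longrightarrow> h p q = H p q)"
  proof (rule leibniz_extension[OF X Y Cc ac])
    fix p q k x y assume k: "k = p + q + 0 - (1::int)"
    show "bilin R (chains X p) (chains Y q) (chains C k) (?G p q)" using k bilin_zero[OF Cm] by simp
    have "p - 1 + q - 1 = k - 1" "p + (q - 1) - 1 = k - 1" "p + q - 1 = k" "p + q - 2 = k - 1" using k by auto
    then show "bdry C k (?G p q x y) \<oplus>\<^bsub>chains C (k - 1)\<^esub> leibniz X Y (chains C (k - 1)) p q ?G x y = \<zero>\<^bsub>chains C (k - 1)\<^esub>"
      by (simp add: zero leibniz_def signed_zero[OF Cm] addz zc)
  next
    fix p q x y assume pq: "p + q = 1 - (0::int)" and x: "x \<in> carrier (chains X p)" and y: "y \<in> carrier (chains Y q)"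
    have pq': "p - 1 + q = 0" "p + (q - 1) = 0" using pq by auto
    have b: "bilin R (chains X p) (chains Y q) (chains C 0) (leibniz X Y (chains C 0) p q H)"
      by (intro leibniz_bilin Xc Yc Cm Hb pq')
    have dx: "bdry X p x \<in> carrier (chains X (p - 1))" and dy: "bdry Y q y \<in> carrier (chains Y (q - 1))"
      using cx_closed[OF Xc x] cx_closed[OF Yc y] by auto
    note h1 = bilin_closed[OF Hb[OF pq'(1)] dx y] and h2 = bilin_closed[OF Hb[OF pq'(2)] x dy]
    have g1: "g (p - 1) (bdry X p x) y = \<zero>\<^bsub>N\<^esub>" using \<beta>l x y pq by (auto simp: g_def)
    have g2: "g p x (bdry Y q y) = \<zero>\<^bsub>N\<^esub>" using \<beta>r x y pq by (auto simp: g_def)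
    have "\<epsilon> (leibniz X Y (chains C 0) p q H x y) = g (p - 1) (bdry X p x) y \<oplus>\<^bsub>N\<^esub> signed N p (g p x (bdry Y q y))"
      by (simp add: leibniz_def lin_add[OF \<epsilon> h1 signed_closed[OF Cm h2]] lin_signed[OF \<epsilon> Cm N h2]
          Hg[OF pq'(1) dx y] Hg[OF pq'(2) x dy])
    then have "\<epsilon> (leibniz X Y (chains C 0) p q H x y) = \<zero>\<^bsub>N\<^esub>" by (simp add: g1 g2 signed_zero[OF N])
    then show "?G p q x y \<oplus>\<^bsub>chains C 0\<^esub> leibniz X Y (chains C 0) p q H x y \<in> boundaries C 0"
      using bilin_closed[OF b x y] free_resolutionD(5)[OF C] pq by (auto simp: addz)
  qed (use Hb in auto)
  then obtain h where h1: "\<forall>p q. bilin R (chains X p) (chains Y q) (chains C (p + q + 0)) (h p q)"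
    and h2: "\<forall>p q. \<forall>x\<in>carrier (chains X p). \<forall>y\<in>carrier (chains Y q). p + q + 0 > 0 \<longrightarrow>
         bdry C (p + q + 0) (h p q x y)
         = ?G p q x y \<oplus>\<^bsub>chains C (p + q + 0 - 1)\<^esub> leibniz X Y (chains C (p + q + 0 - 1)) p q h x y"
    and h3: "\<forall>p q. p + q + 0 = 0 \<longrightarrow> h p q = H p q" by (elim exE conjE) (rule that)
  have hb: "bilin R (chains X p) (chains Y q) (chains C (p + q)) (h p q)" for p q using h1 by simp
  have hd: "bdry C (p + q) (h p q x y)
         = \<zero>\<^bsub>chains C (p + q - 1)\<^esub> \<oplus>\<^bsub>chains C (p + q - 1)\<^esub> leibniz X Y (chains C (p + q - 1)) p q h x y"
    if "x \<in> carrier (chains X p)" "y \<in> carrier (chains Y q)" "p + q > 0" for p q x y using h2 that by simp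
  have h0: "h p q = H p q" if "p + q = 0" for p q using h3 that by simp
  show ?thesis
  proof (intro exI[of _ h] conjI allI ballI)
    fix p q x y assume x: "x \<in> carrier (chains X p)" and y: "y \<in> carrier (chains Y q)"
    have b: "bilin R (chains X p) (chains Y q) (chains C (p + q - 1)) (leibniz X Y (chains C (p + q - 1)) p q h)"
      using hb[of "p - 1" q] hb[of p "q - 1"] by (intro leibniz_bilin Xc Yc Cm) (simp_all add: algebra_simps)
    note l = bilin_closed[OF b x y] and r = cx_closed[OF Cc bilin_closed[OF hb x y]]
    show "bdry C (p + q) (h p q x y) = leibniz X Y (chains C (p + q - 1)) p q h x y"
    proof (cases "p + q > 0")
      case True
      then show ?thesis using hd[OF x y] addz[OF l] by simp
    next
      case False
      then show ?thesis using free_resolutionD(6)[OF C, of "p + q - 1"] l r by auto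
    qed
  next
    fix x y assume "x \<in> carrier (chains X 0)" "y \<in> carrier (chains Y 0)"
    then show "\<epsilon> (h 0 0 x y) = \<beta> x y" using h0[of 0 0] Hg[of 0 0] by (simp add: g_def)
  qed (rule hb)
qed

theorem bilinear_nullhomotopy:
  assumes X: "free_nonneg R X" and Y: "free_nonneg R Y"
    and C: "free_resolution R C N \<epsilon>" and N: "Module.module R N"
    and F: "\<And>p q. bilin R (chains X p) (chains Y q) (chains C (p + q)) (F p q)"
    and dF: "\<And>p q x y. \<lbrakk>x \<in> carrier (chains X p); y \<in> carrier (chains Y q)\<rbrakk> \<Longrightarrow>
         bdry C (p + q) (F p q x y) = leibniz X Y (chains C (p + q - 1)) p q F x y"
    and F0: "\<And>x y. \<lbrakk>x \<in> carrier (chains X 0); y \<in> carrier (chains Y 0)\<rbrakk> \<Longrightarrow> \<epsilon> (F 0 0 x y) = \<zero>\<^bsub>N\<^esub>"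
  shows "\<exists>h. (\<forall>p q. bilin R (chains X p) (chains Y q) (chains C (p + q + 1)) (h p q))
    \<and> (\<forall>p q. \<forall>x\<in>carrier (chains X p). \<forall>y\<in>carrier (chains Y q). p + q \<ge> 0 \<longrightarrow>
         bdry C (p + q + 1) (h p q x y)
         = signed (chains C (p + q)) (p + q) (F p q x y) \<oplus>\<^bsub>chains C (p + q)\<^esub> leibniz X Y (chains C (p + q)) p q h x y)"
proof -
  have Xc: "chain_complex R X" and Xn: "\<And>n. n < 0 \<Longrightarrow> carrier (chains X n) = {\<zero>\<^bsub>chains X n\<^esub>}"
    using X by (auto simp: free_nonneg_def)
  have Yc: "chain_complex R Y" and Yn: "\<And>n. n < 0 \<Longrightarrow> carrier (chains Y n) = {\<zero>\<^bsub>chains Y n\<^esub>}"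
    using Y by (auto simp: free_nonneg_def)
  note Cc = free_resolutionD(1)[OF C] and ac = free_resolutionD(2)[OF C] and \<epsilon> = free_resolutionD(3)[OF C]
  note Cm = cx_module[OF Cc]
  let ?G = "\<lambda>p q x y. signed (chains C (p + q)) (p + q) (F p q x y)"
  let ?H = "\<lambda>(p::int) (q::int) x y. \<zero>\<^bsub>chains C 0\<^esub>"
  have "\<exists>h. (\<forall>p q. bilin R (chains X p) (chains Y q) (chains C (p + q + 1)) (h p q))
    \<and> (\<forall>p q. \<forall>x\<in>carrier (chains X p). \<forall>y\<in>carrier (chains Y q). p + q + 1 > 0 \<longrightarrow>
         bdry C (p + q + 1) (h p q x y)
         = ?G p q x y \<oplus>\<^bsub>chains C (p + q + 1 - 1)\<^esub> leibniz X Y (chains C (p + q + 1 - 1)) p q h x y)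
    \<and> (\<forall>p q. p + q + 1 = 0 \<longrightarrow> h p q = ?H p q)"
  proof (rule leibniz_extension[OF X Y Cc ac])
    fix p q k assume k: "k = p + q + 1 - (1::int)"
    show "bilin R (chains X p) (chains Y q) (chains C k) (?G p q)"
      using k bilin_signed[OF F[of p q] Cm] by simp
    fix x y assume x: "x \<in> carrier (chains X p)" and y: "y \<in> carrier (chains Y q)"
    interpret M: Module.module R "chains C (k - 1)" by (rule Cm)
    have i: "p - 1 + q = k - 1" "p + (q - 1) = k - 1" "p + q = k" "p + q - 1 = k - 1" using k by auto
    have dx: "bdry X p x \<in> carrier (chains X (p - 1))" and dy: "bdry Y q y \<in> carrier (chains Y (q - 1))"
      using cx_closed[OF Xc x] cx_closed[OF Yc y] by auto
    have a: "F (p - 1) q (bdry X p x) y \<in> carrier (chains C (k - 1))"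
      using bilin_closed[OF F dx y] i by simp
    have b: "F p (q - 1) x (bdry Y q y) \<in> carrier (chains C (k - 1))"
      using bilin_closed[OF F x dy] i by simp
    have Fk: "F p q x y \<in> carrier (chains C k)" using bilin_closed[OF F x y] i by simp
    have e: "bdry C k (F p q x y) = F (p - 1) q (bdry X p x) y \<oplus>\<^bsub>chains C (k - 1)\<^esub>
        signed (chains C (k - 1)) p (F p (q - 1) x (bdry Y q y))"
      using dF[OF x y] i by (simp add: leibniz_def)
    show "bdry C k (?G p q x y) \<oplus>\<^bsub>chains C (k - 1)\<^esub> leibniz X Y (chains C (k - 1)) p q ?G x y = \<zero>\<^bsub>chains C (k - 1)\<^esub>"
      unfolding leibniz_def i lin_signed[OF cx_lin[OF Cc] Cm Cm Fk] e
      using a b by (auto simp: signed_def M.M.minus_add M.M.a_ac M.M.r_neg M.M.r_neg1 M.M.r_neg2)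
  next
    fix p q x y assume pq: "p + q = 1 - (1::int)" and x: "x \<in> carrier (chains X p)" and y: "y \<in> carrier (chains Y q)"
    interpret M: Module.module R "chains C 0" by (rule Cm)
    have pq0: "p + q = 0" using pq by simp
    have Fc: "F p q x y \<in> carrier (chains C 0)" using bilin_closed[OF F x y] pq by simp
    have "\<epsilon> (F p q x y) = \<zero>\<^bsub>N\<^esub>"
    proof -
      consider "p = 0" "q = 0" | "p < 0" | "q < 0" using pq by linarith
      then show ?thesis
      proof cases
        case 1
        then show ?thesis using F0 x y by simp
      next
        case 2
        then have "F p q x y = \<zero>\<^bsub>chains C 0\<^esub>"
          using bilin_zero_left[OF F cx_module[OF Xc] Cm y, of p] Xn[OF 2] x pq0 by simp
        then show ?thesis using lin_zero[OF \<epsilon> Cm N] by simp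
      next
        case 3
        then have "F p q x y = \<zero>\<^bsub>chains C 0\<^esub>"
          using bilin_zero_right[OF F cx_module[OF Yc] Cm x, of q] Yn[OF 3] y pq0 by simp
        then show ?thesis using lin_zero[OF \<epsilon> Cm N] by simp
      qed
    qed
    then have "F p q x y \<in> boundaries C 0" using Fc free_resolutionD(5)[OF C] by auto
    then show "?G p q x y \<oplus>\<^bsub>chains C 0\<^esub> leibniz X Y (chains C 0) p q ?H x y \<in> boundaries C 0"
      using Fc pq0 by (simp add: leibniz_def signed_zero[OF Cm] signed_def[of _ 0])
  qed (auto intro: bilin_zero Cm)
  then show ?thesis
  proof (elim exE conjE)
    fix h assume "\<forall>p q. bilin R (chains X p) (chains Y q) (chains C (p + q + 1)) (h p q)"
      "\<forall>p q. \<forall>x\<in>carrier (chains X p). \<forall>y\<in>carrier (chains Y q). p + q + 1 > 0 \<longrightarrow>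
         bdry C (p + q + 1) (h p q x y)
         = ?G p q x y \<oplus>\<^bsub>chains C (p + q + 1 - 1)\<^esub> leibniz X Y (chains C (p + q + 1 - 1)) p q h x y"
    then show ?thesis by (intro exI[of _ h]) simp
  qed
qed

text \<open>The same induction for linear maps out of a single complex.\<close>

lemma linear_extension:
  fixes e :: int
  assumes X: "free_nonneg R X" and C: "chain_complex R C"
    and ac: "\<And>n. n > 0 \<Longrightarrow> cycles C n = boundaries C n"
    and G: "\<And>n k. k = n + e - 1 \<Longrightarrow> G n \<in> lin_maps R (chains X n) (chains C k)"
    and dG: "\<And>n k x. \<lbrakk>k = n + e - 1; x \<in> carrier (chains X n)\<rbrakk> \<Longrightarrow>
      bdry C k (G n x) \<oplus>\<^bsub>chains C (k - 1)\<^esub> G (n - 1) (bdry X n x) = \<zero>\<^bsub>chains C (k - 1)\<^esub>"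
    and H0: "H0 \<in> lin_maps R (chains X (- e)) (chains C 0)"
    and start: "\<And>x. x \<in> carrier (chains X (1 - e)) \<Longrightarrow>
      G (1 - e) x \<oplus>\<^bsub>chains C 0\<^esub> H0 (bdry X (1 - e) x) \<in> boundaries C 0"
  shows "\<exists>h. (\<forall>n. h n \<in> lin_maps R (chains X n) (chains C (n + e)))
    \<and> (\<forall>n. \<forall>x\<in>carrier (chains X n). n + e > 0 \<longrightarrow>
         bdry C (n + e) (h n x) = G n x \<oplus>\<^bsub>chains C (n + e - 1)\<^esub> h (n - 1) (bdry X n x))
    \<and> h (- e) = H0"
proof -
  have Xc: "chain_complex R X" and Xf: "\<And>n. is_free_mod R (chains X n)" using X by (auto simp: free_nonneg_def)
  note Cm = cx_module[OF C] and Xm = cx_module[OF Xc]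
  define P where "P m H \<longleftrightarrow> H \<in> lin_maps R (chains X (int m - e)) (chains C (int m))
      \<and> (\<forall>x\<in>carrier (chains X (int m + 1 - e)). G (int m + 1 - e) x \<oplus>\<^bsub>chains C (int m)\<^esub> H (bdry X (int m + 1 - e) x) \<in> boundaries C (int m))
      \<and> (m = 0 \<longrightarrow> H = H0)" for m H
  define Q where "Q m H H' \<longleftrightarrow> (\<forall>x\<in>carrier (chains X (int m + 1 - e)).
      bdry C (int m + 1) (H' x) = G (int m + 1 - e) x \<oplus>\<^bsub>chains C (int m)\<^esub> H (bdry X (int m + 1 - e) x))" for m H H'
  have "\<exists>f. \<forall>m. P m (f m) \<and> Q m (f m) (f (Suc m))"
  proof (rule dependent_nat_choice)
    have "P 0 H0" unfolding P_def using H0 start by simp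
    then show "\<exists>H. P 0 H" by (rule exI[where x = H0])
  next
    fix H m assume PH: "P m H"
    define n where "n = int m + 1 - e"
    have n: "int m = n + e - 1" "int m - e = n - 1" "int m + 1 = n + 1 + e - 1" by (auto simp: n_def)
    let ?M = "chains C (int m)" and ?M1 = "chains C (int m + 1)"
    interpret M: Module.module R ?M by (rule Cm)
    have Hl: "H \<in> lin_maps R (chains X (n - 1)) ?M"
      and Hb: "\<And>x. x \<in> carrier (chains X n) \<Longrightarrow> G n x \<oplus>\<^bsub>?M\<^esub> H (bdry X n x) \<in> boundaries C (int m)"
      using PH unfolding P_def n_def[symmetric] n(2) by auto
    have d: "bdry C (int m + 1) \<in> lin_maps R ?M1 ?M" using cx_lin[OF C, of "int m + 1"] by simp
    obtain H' where H'l: "H' \<in> lin_maps R (chains X n) ?M1"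
      and H'd: "\<And>x. x \<in> carrier (chains X n) \<Longrightarrow> bdry C (int m + 1) (H' x) = G n x \<oplus>\<^bsub>?M\<^esub> H (bdry X n x)"
      using free_projective[OF Xf Cm Cm d lin_plus[OF G[OF n(1)] lin_compose[OF cx_lin[OF Xc] Hl] Cm]] Hb
      unfolding boundaries_def by blast
    have "G (n + 1) x \<oplus>\<^bsub>?M1\<^esub> H' (bdry X (n + 1) x) \<in> boundaries C (int m + 1)" if x: "x \<in> carrier (chains X (n + 1))" for x
    proof -
      interpret M1: Module.module R ?M1 by (rule Cm)
      have dx: "bdry X (n + 1) x \<in> carrier (chains X n)" using cx_closed[OF Xc x] by simp
      have Gx: "G (n + 1) x \<in> carrier ?M1" by (rule lin_closed[OF G[OF n(3)] x])
      have "H (bdry X n (bdry X (n + 1) x)) = \<zero>\<^bsub>?M\<^esub>" using cx_dd[OF Xc x] lin_zero[OF Hl Xm Cm] by simp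
      then have "bdry C (int m + 1) (H' (bdry X (n + 1) x)) = G n (bdry X (n + 1) x)"
        using H'd[OF dx] lin_closed[OF G[OF n(1)] dx] by simp
      then have "bdry C (int m + 1) (G (n + 1) x \<oplus>\<^bsub>?M1\<^esub> H' (bdry X (n + 1) x)) = \<zero>\<^bsub>?M\<^esub>"
        using lin_add[OF d Gx lin_closed[OF H'l dx]] dG[OF n(3) x] by simp
      then have "G (n + 1) x \<oplus>\<^bsub>?M1\<^esub> H' (bdry X (n + 1) x) \<in> cycles C (int m + 1)"
        using M1.M.a_closed[OF Gx lin_closed[OF H'l dx]] by (simp add: cycles_def)
      then show ?thesis using ac[of "int m + 1"] by simp
    qed
    moreover have s: "int (Suc m) = int m + 1" "int m + 1 - e = n" "int m + 1 + 1 - e = n + 1" by (auto simp: n_def)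
    ultimately have "P (Suc m) H'" unfolding P_def s using H'l by blast
    moreover have "Q m H H'" unfolding Q_def n_def[symmetric] using H'd by simp
    ultimately show "\<exists>H'. P (Suc m) H' \<and> Q m H H'" by blast
  qed
  then obtain f where fP: "\<And>m. P m (f m)" and fQ: "\<And>m. Q m (f m) (f (Suc m))" by blast
  define h where "h n = (if n + e < 0 then (\<lambda>x. \<zero>\<^bsub>chains C (n + e)\<^esub>) else f (nat (n + e)))" for n
  show ?thesis
  proof (intro exI[of _ h] conjI allI ballI impI)
    fix n
    show "h n \<in> lin_maps R (chains X n) (chains C (n + e))"
      using fP[of "nat (n + e)"] unfolding P_def h_def by (auto intro: lin_zero_map Cm)
    fix x assume x: "x \<in> carrier (chains X n)" and n: "n + e > 0"
    define m where "m = nat (n + e - 1)"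
    have m: "n = int m + 1 - e" "n + e = int m + 1" "n + e - 1 = int m" "nat (n + e) = Suc m" "nat (n - 1 + e) = m"
      using n by (auto simp: m_def)
    have "h n = f (Suc m)" "h (n - 1) = f m" using n m(4,5) by (simp_all add: h_def)
    then show "bdry C (n + e) (h n x) = G n x \<oplus>\<^bsub>chains C (n + e - 1)\<^esub> h (n - 1) (bdry X n x)"
      using fQ[of m] x unfolding Q_def m(1)[symmetric] m(2,3) by simp
  next
    show "h (- e) = H0" using fP[of 0] unfolding P_def h_def by simp
  qed
qed

corollary chain_map_lift:
  assumes X: "free_nonneg R X" and C: "free_resolution R C N \<epsilon>" and N: "Module.module R N"
    and \<gamma>: "\<gamma> \<in> lin_maps R (chains X 0) N"
    and \<gamma>0: "\<And>x. x \<in> carrier (chains X 1) \<Longrightarrow> \<gamma> (bdry X 1 x) = \<zero>\<^bsub>N\<^esub>"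
  shows "\<exists>f. (\<forall>n. f n \<in> lin_maps R (chains X n) (chains C n))
    \<and> (\<forall>n. \<forall>x\<in>carrier (chains X n). bdry C n (f n x) = f (n - 1) (bdry X n x))
    \<and> (\<forall>x\<in>carrier (chains X 0). \<epsilon> (f 0 x) = \<gamma> x)"
proof -
  have Xc: "chain_complex R X" and Xf: "is_free_mod R (chains X 0)" using X by (auto simp: free_nonneg_def)
  note Cc = free_resolutionD(1)[OF C] and \<epsilon> = free_resolutionD(3)[OF C]
  note Cm = cx_module[OF Cc]
  have l: "\<zero>\<^bsub>chains C k\<^esub> \<oplus>\<^bsub>chains C k\<^esub> y = y" if "y \<in> carrier (chains C k)" for k y
    using abelian_monoid.l_zero[OF abelian_group.axioms(1)[OF Module.module.axioms(2)[OF Cm]] that] .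
  have z: "bdry C k \<zero>\<^bsub>chains C k\<^esub> = \<zero>\<^bsub>chains C (k - 1)\<^esub>" for k by (rule lin_zero[OF cx_lin[OF Cc] Cm Cm])
  have zc: "\<zero>\<^bsub>chains C k\<^esub> \<in> carrier (chains C k)" for k
    using abelian_monoid.zero_closed[OF abelian_group.axioms(1)[OF Module.module.axioms(2)[OF Cm]]] .
  have "\<gamma> x \<in> \<epsilon> ` carrier (chains C 0)" if "x \<in> carrier (chains X 0)" for x
    unfolding free_resolutionD(4)[OF C] by (rule lin_closed[OF \<gamma> that])
  from free_projective[OF Xf Cm N \<epsilon> \<gamma> this] obtain f0 where f0: "f0 \<in> lin_maps R (chains X 0) (chains C 0)"
    and \<epsilon>f0: "\<And>x. x \<in> carrier (chains X 0) \<Longrightarrow> \<epsilon> (f0 x) = \<gamma> x" by blast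
  have "\<exists>h. (\<forall>n. h n \<in> lin_maps R (chains X n) (chains C (n + 0)))
    \<and> (\<forall>n. \<forall>x\<in>carrier (chains X n). n + 0 > 0 \<longrightarrow>
         bdry C (n + 0) (h n x) = \<zero>\<^bsub>chains C (n + 0 - 1)\<^esub> \<oplus>\<^bsub>chains C (n + 0 - 1)\<^esub> h (n - 1) (bdry X n x))
    \<and> h (- 0) = f0"
  proof (rule linear_extension[OF X Cc free_resolutionD(2)[OF C]])
    fix x assume "x \<in> carrier (chains X (1 - 0))"
    then have x: "x \<in> carrier (chains X 1)" by simp
    have dx: "bdry X 1 x \<in> carrier (chains X 0)" using cx_closed[OF Xc x] by simp
    have "f0 (bdry X 1 x) \<in> boundaries C 0"
      using lin_closed[OF f0 dx] \<epsilon>f0[OF dx] \<gamma>0[OF x] unfolding free_resolutionD(5)[OF C, symmetric] by simp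
    then show "\<zero>\<^bsub>chains C (1 - 0 + 0 - 1)\<^esub> \<oplus>\<^bsub>chains C 0\<^esub> f0 (bdry X (1 - 0) x) \<in> boundaries C 0"
      using l[OF lin_closed[OF f0 dx]] by simp
  qed (auto simp: z l zc algebra_simps intro: lin_zero_map[OF Cm] f0)
  then obtain f where fl: "\<And>n. f n \<in> lin_maps R (chains X n) (chains C n)"
    and fd: "\<And>n x. \<lbrakk>x \<in> carrier (chains X n); n > 0\<rbrakk> \<Longrightarrow> bdry C n (f n x) = \<zero>\<^bsub>chains C (n - 1)\<^esub> \<oplus>\<^bsub>chains C (n - 1)\<^esub> f (n - 1) (bdry X n x)"
    and f00: "f 0 = f0" by auto
  have "bdry C n (f n x) = f (n - 1) (bdry X n x)" if x: "x \<in> carrier (chains X n)" for n x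
  proof (cases "n > 0")
    case True
    then show ?thesis using fd[OF x True] l[OF lin_closed[OF fl cx_closed[OF Xc x]]] by simp
  next
    case False
    then show ?thesis
      using free_resolutionD(6)[OF C, of "n - 1"] cx_closed[OF Cc lin_closed[OF fl x]] lin_closed[OF fl cx_closed[OF Xc x]] by auto
  qed
  then show ?thesis using fl \<epsilon>f0 by (intro exI[of _ f]) (simp add: f00)
qed

text \<open>
  The sign alternates with the degree, which lets the homotopy satisfy an equation without a minus.
\<close>

corollary chain_map_nullhomotopy:
  assumes X: "free_nonneg R X" and C: "free_resolution R C N \<epsilon>"
    and f: "\<And>n. f n \<in> lin_maps R (chains X n) (chains C n)"
    and df: "\<And>n x. x \<in> carrier (chains X n) \<Longrightarrow> bdry C n (f n x) = f (n - 1) (bdry X n x)"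
    and f0: "\<And>x. x \<in> carrier (chains X 0) \<Longrightarrow> \<epsilon> (f 0 x) = \<zero>\<^bsub>N\<^esub>"
  shows "\<exists>h. (\<forall>n. h n \<in> lin_maps R (chains X n) (chains C (n + 1)))
    \<and> (\<forall>n\<ge>0. \<forall>x\<in>carrier (chains X n). bdry C (n + 1) (h n x)
         = signed (chains C n) n (f n x) \<oplus>\<^bsub>chains C n\<^esub> h (n - 1) (bdry X n x))"
proof -
  have Xc: "chain_complex R X" using X by (auto simp: free_nonneg_def)
  note Cc = free_resolutionD(1)[OF C]
  note Cm = cx_module[OF Cc]
  let ?G = "\<lambda>n x. signed (chains C n) n (f n x)"
  have "\<exists>h. (\<forall>n. h n \<in> lin_maps R (chains X n) (chains C (n + 1)))
    \<and> (\<forall>n. \<forall>x\<in>carrier (chains X n). n + 1 > 0 \<longrightarrow>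
         bdry C (n + 1) (h n x) = ?G n x \<oplus>\<^bsub>chains C (n + 1 - 1)\<^esub> h (n - 1) (bdry X n x))
    \<and> h (- 1) = (\<lambda>x. \<zero>\<^bsub>chains C 0\<^esub>)"
  proof (rule linear_extension[OF X Cc free_resolutionD(2)[OF C]])
    show "?G n \<in> lin_maps R (chains X n) (chains C k)" if "k = n + 1 - 1" for n k
      using that signed_lin_map[OF Cm f[of n]] by simp
    show "bdry C k (?G n x) \<oplus>\<^bsub>chains C (k - 1)\<^esub> ?G (n - 1) (bdry X n x) = \<zero>\<^bsub>chains C (k - 1)\<^esub>"
      if k: "k = n + 1 - 1" and x: "x \<in> carrier (chains X n)" for n k x
    proof -
      interpret M: Module.module R "chains C (n - 1)" by (rule Cm)
      have c: "f (n - 1) (bdry X n x) \<in> carrier (chains C (n - 1))" by (rule lin_closed[OF f cx_closed[OF Xc x]])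
      have kn: "k = n" using k by simp
      show ?thesis unfolding kn lin_signed[OF cx_lin[OF Cc] Cm Cm lin_closed[OF f x]] df[OF x] signed_pred[OF Cm c]
        by (rule M.M.r_neg[OF signed_closed[OF Cm c]])
    qed
    fix x assume "x \<in> carrier (chains X (1 - 1))"
    then have x: "x \<in> carrier (chains X 0)" by simp
    interpret M: Module.module R "chains C 0" by (rule Cm)
    have "f 0 x \<in> boundaries C 0"
      using lin_closed[OF f x] f0[OF x] unfolding free_resolutionD(5)[OF C, symmetric] by simp
    then show "?G (1 - 1) x \<oplus>\<^bsub>chains C 0\<^esub> \<zero>\<^bsub>chains C 0\<^esub> \<in> boundaries C 0"
      using lin_closed[OF f x] by (simp add: signed_def)
  qed (auto intro: lin_zero_map[OF Cm])
  then obtain h where "\<forall>n. h n \<in> lin_maps R (chains X n) (chains C (n + 1))"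
    and "\<forall>n. \<forall>x\<in>carrier (chains X n). n + 1 > 0 \<longrightarrow>
         bdry C (n + 1) (h n x) = ?G n x \<oplus>\<^bsub>chains C (n + 1 - 1)\<^esub> h (n - 1) (bdry X n x)" by blast
  then show ?thesis by (intro exI[of _ h]) simp
qed

section \<open>Quotients and presentations\<close>

lemma submodule_abelian_subgroup:
  assumes "Module.module R M" "submodule H R M"
  shows "abelian_subgroup H M"
proof -
  interpret M: Module.module R M by fact
  show ?thesis
    using assms(2) by (intro abelian_subgroupI3 additive_subgroup.intro M.M.abelian_group_axioms) (simp add: submodule_def)
qed

lemma submodule_zero: "Module.module R M \<Longrightarrow> submodule H R M \<Longrightarrow> \<zero>\<^bsub>M\<^esub> \<in> H"
  using submodule_abelian_subgroup abelian_subgroup.axioms(1) additive_subgroup.zero_closed by blast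

lemma (in Module.module) submoduleI_smult:
  assumes "H \<subseteq> carrier M" "\<zero>\<^bsub>M\<^esub> \<in> H" "\<And>a b. a \<in> H \<Longrightarrow> b \<in> H \<Longrightarrow> a \<oplus>\<^bsub>M\<^esub> b \<in> H"
    "\<And>r a. r \<in> carrier R \<Longrightarrow> a \<in> H \<Longrightarrow> r \<odot>\<^bsub>M\<^esub> a \<in> H"
  shows "submodule H R M"
proof (rule submoduleI[OF assms(1,2) _ assms(3,4)])
  fix a assume a: "a \<in> H"
  then have "\<ominus>\<^bsub>M\<^esub> a = (\<ominus> \<one>) \<odot>\<^bsub>M\<^esub> a" using assms(1) smult_l_minus[of \<one> a] by auto
  then show "\<ominus>\<^bsub>M\<^esub> a \<in> H" using assms(4)[of "\<ominus> \<one>" a] a by simp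
qed

lemma submodule_minus:
  assumes "Module.module R M" "submodule H R M" "x \<in> H" "y \<in> H"
  shows "x \<ominus>\<^bsub>M\<^esub> y \<in> H"
  using Module.module.submoduleE(3,5)[OF assms(1,2)] assms(3,4) by (simp add: a_minus_def)

lemma submodule_transfer:
  assumes "Module.module R M" "submodule H R M" "x \<in> carrier M" "y \<in> H" "x \<ominus>\<^bsub>M\<^esub> y \<in> H"
  shows "x \<in> H"
proof -
  interpret M: Module.module R M by fact
  have "y \<in> carrier M" using M.submoduleE(1)[OF assms(2)] assms(4) by auto
  then have "x = (x \<ominus>\<^bsub>M\<^esub> y) \<oplus>\<^bsub>M\<^esub> y" using assms(3) by (simp add: a_minus_def M.M.a_assoc M.M.l_neg)
  then show ?thesis using M.submoduleE(5)[OF assms(2,5,4)] by simp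
qed

lemma a_r_coset_carrier_update [simp]: "a_r_coset (M\<lparr>carrier := Z\<rparr>) = a_r_coset M"
  by (simp add: fun_eq_iff a_r_coset_def r_coset_def)

lemma quot_mod_simps:
  "carrier (quot_mod M H) = (\<lambda>x. H +>\<^bsub>M\<^esub> x) ` carrier M" "\<zero>\<^bsub>quot_mod M H\<^esub> = H"
  "U \<oplus>\<^bsub>quot_mod M H\<^esub> V = U <+>\<^bsub>M\<^esub> V"
  "r \<odot>\<^bsub>quot_mod M H\<^esub> U = (\<Union>x\<in>U. H +>\<^bsub>M\<^esub> (r \<odot>\<^bsub>M\<^esub> x))"
  by (auto simp: quot_mod_def A_RCOSETS_def')

lemma coset_minus_iff:
  assumes "Module.module R M" "submodule H R M" "x \<in> carrier M" "y \<in> carrier M"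
  shows "H +>\<^bsub>M\<^esub> x = H +>\<^bsub>M\<^esub> y \<longleftrightarrow> x \<ominus>\<^bsub>M\<^esub> y \<in> H"
proof -
  interpret M: Module.module R M by fact
  interpret H: abelian_subgroup H M by (rule submodule_abelian_subgroup[OF assms(1,2)])
  show ?thesis
  proof
    assume "H +>\<^bsub>M\<^esub> x = H +>\<^bsub>M\<^esub> y"
    then have "x \<in> H +>\<^bsub>M\<^esub> y" using H.a_rcos_self[OF assms(3)] by simp
    then obtain k where "k \<in> H" "x = k \<oplus>\<^bsub>M\<^esub> y" by (auto simp: a_r_coset_def')
    then show "x \<ominus>\<^bsub>M\<^esub> y \<in> H" using assms(4) H.a_subset by (auto simp: a_minus_def M.M.a_assoc M.M.r_neg subset_iff)
  next
    assume h: "x \<ominus>\<^bsub>M\<^esub> y \<in> H"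
    have "x = (x \<ominus>\<^bsub>M\<^esub> y) \<oplus>\<^bsub>M\<^esub> y" using assms(3,4) by (simp add: a_minus_def M.M.a_assoc M.M.l_neg)
    then have "x \<in> H +>\<^bsub>M\<^esub> y" using h by (auto simp: a_r_coset_def')
    then show "H +>\<^bsub>M\<^esub> x = H +>\<^bsub>M\<^esub> y"
      using M.M.a_repr_independence[OF _ assms(4) H.a_subgroup] by metis
  qed
qed

lemma coset_zero_iff:
  assumes "Module.module R M" "submodule H R M" "x \<in> carrier M"
  shows "H +>\<^bsub>M\<^esub> x = H \<longleftrightarrow> x \<in> H"
proof -
  interpret M: Module.module R M by fact
  interpret H: abelian_subgroup H M by (rule submodule_abelian_subgroup[OF assms(1,2)])
  show ?thesis
    using M.M.a_coset_join1[OF _ assms(3) H.a_subgroup] M.M.a_coset_join2[OF assms(3) H.a_subgroup] by auto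
qed

lemma coset_smult:
  assumes "Module.module R M" "submodule H R M" "r \<in> carrier R" "x \<in> carrier M"
  shows "r \<odot>\<^bsub>quot_mod M H\<^esub> (H +>\<^bsub>M\<^esub> x) = H +>\<^bsub>M\<^esub> (r \<odot>\<^bsub>M\<^esub> x)"
proof -
  interpret M: Module.module R M by fact
  interpret H: abelian_subgroup H M by (rule submodule_abelian_subgroup[OF assms(1,2)])
  have "H +>\<^bsub>M\<^esub> (r \<odot>\<^bsub>M\<^esub> y) = H +>\<^bsub>M\<^esub> (r \<odot>\<^bsub>M\<^esub> x)" if "y \<in> H +>\<^bsub>M\<^esub> x" for y
  proof -
    obtain k where k: "k \<in> H" "y = k \<oplus>\<^bsub>M\<^esub> x" using \<open>y \<in> H +>\<^bsub>M\<^esub> x\<close> by (auto simp: a_r_coset_def')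
    have kM: "k \<in> carrier M" using k H.a_subset by auto
    have rk: "r \<odot>\<^bsub>M\<^esub> k \<in> H" by (rule M.submoduleE(4)[OF assms(2,3) k(1)])
    have "r \<odot>\<^bsub>M\<^esub> y \<ominus>\<^bsub>M\<^esub> r \<odot>\<^bsub>M\<^esub> x = r \<odot>\<^bsub>M\<^esub> k"
      using kM assms(3,4) k by (simp add: a_minus_def M.smult_r_distr M.M.a_assoc M.M.r_neg)
    then show ?thesis using coset_minus_iff[OF assms(1,2)] k kM assms(3,4) rk by simp
  qed
  moreover have "H +>\<^bsub>M\<^esub> x \<noteq> {}" using H.a_rcos_self[OF assms(4)] by auto
  ultimately show ?thesis by (simp add: quot_mod_simps)
qed

lemma coset_add:
  assumes "Module.module R M" "submodule H R M" "x \<in> carrier M" "y \<in> carrier M"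
  shows "(H +>\<^bsub>M\<^esub> x) \<oplus>\<^bsub>quot_mod M H\<^esub> (H +>\<^bsub>M\<^esub> y) = H +>\<^bsub>M\<^esub> (x \<oplus>\<^bsub>M\<^esub> y)"
  using abelian_subgroup.a_rcos_sum[OF submodule_abelian_subgroup[OF assms(1,2)] assms(3,4)]
  by (simp add: quot_mod_simps)

lemma quot_mod_lin:
  assumes "Module.module R M" "submodule H R M"
  shows "(\<lambda>x. H +>\<^bsub>M\<^esub> x) \<in> lin_maps R M (quot_mod M H)"
  by (rule lin_mapsI) (auto simp: coset_add[OF assms] coset_smult[OF assms] quot_mod_simps(1))

lemma quot_mod_module:
  assumes "Module.module R M" "submodule H R M"
  shows "Module.module R (quot_mod M H)"
proof -
  interpret M: Module.module R M by fact
  note a = coset_add[OF assms] and s = coset_smult[OF assms]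
  have z: "H +>\<^bsub>M\<^esub> \<zero>\<^bsub>M\<^esub> = \<zero>\<^bsub>quot_mod M H\<^esub>"
    using coset_zero_iff[OF assms] submodule_zero[OF assms] by (simp add: quot_mod_simps)
  have ex: "(\<And>x. x \<in> carrier M \<Longrightarrow> P (H +>\<^bsub>M\<^esub> x)) \<Longrightarrow> U \<in> carrier (quot_mod M H) \<Longrightarrow> P U" for P U
    by (auto simp: quot_mod_simps(1))
  show ?thesis
  proof (rule moduleI)
    show "abelian_group (quot_mod M H)"
    proof (rule abelian_groupI)
      fix U V assume "U \<in> carrier (quot_mod M H)" "V \<in> carrier (quot_mod M H)"
      then show "U \<oplus>\<^bsub>quot_mod M H\<^esub> V \<in> carrier (quot_mod M H)"
        by (elim ex[rotated]) (simp add: a, simp add: quot_mod_simps(1))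
    next
      show "\<zero>\<^bsub>quot_mod M H\<^esub> \<in> carrier (quot_mod M H)" unfolding z[symmetric] by (simp add: quot_mod_simps(1))
    next
      fix U V W assume "U \<in> carrier (quot_mod M H)" "V \<in> carrier (quot_mod M H)" "W \<in> carrier (quot_mod M H)"
      then show "U \<oplus>\<^bsub>quot_mod M H\<^esub> V \<oplus>\<^bsub>quot_mod M H\<^esub> W = U \<oplus>\<^bsub>quot_mod M H\<^esub> (V \<oplus>\<^bsub>quot_mod M H\<^esub> W)"
        by (elim ex[rotated]) (simp add: a M.M.a_assoc)
    next
      fix U V assume "U \<in> carrier (quot_mod M H)" "V \<in> carrier (quot_mod M H)"
      then show "U \<oplus>\<^bsub>quot_mod M H\<^esub> V = V \<oplus>\<^bsub>quot_mod M H\<^esub> U"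
        by (elim ex[rotated]) (simp add: a M.M.a_comm)
    next
      fix U assume "U \<in> carrier (quot_mod M H)"
      then show "\<zero>\<^bsub>quot_mod M H\<^esub> \<oplus>\<^bsub>quot_mod M H\<^esub> U = U"
        unfolding z[symmetric] by (elim ex[rotated]) (simp add: a)
    next
      fix U assume "U \<in> carrier (quot_mod M H)"
      then obtain x where x: "x \<in> carrier M" "U = H +>\<^bsub>M\<^esub> x" by (auto simp: quot_mod_simps(1))
      then show "\<exists>y\<in>carrier (quot_mod M H). y \<oplus>\<^bsub>quot_mod M H\<^esub> U = \<zero>\<^bsub>quot_mod M H\<^esub>"
        unfolding z[symmetric]
        by (intro bexI[of _ "H +>\<^bsub>M\<^esub> (\<ominus>\<^bsub>M\<^esub> x)"]) (simp_all add: a M.M.l_neg quot_mod_simps(1))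
    qed
  next
    show "cring R" by (rule M.R.cring_axioms)
  next
    fix r U assume "r \<in> carrier R" "U \<in> carrier (quot_mod M H)"
    then show "r \<odot>\<^bsub>quot_mod M H\<^esub> U \<in> carrier (quot_mod M H)"
      by (elim ex[rotated]) (simp add: s, simp add: quot_mod_simps(1))
  next
    fix r t U assume "r \<in> carrier R" "t \<in> carrier R" "U \<in> carrier (quot_mod M H)"
    then show "(r \<oplus>\<^bsub>R\<^esub> t) \<odot>\<^bsub>quot_mod M H\<^esub> U = r \<odot>\<^bsub>quot_mod M H\<^esub> U \<oplus>\<^bsub>quot_mod M H\<^esub> t \<odot>\<^bsub>quot_mod M H\<^esub> U"
      "(r \<otimes>\<^bsub>R\<^esub> t) \<odot>\<^bsub>quot_mod M H\<^esub> U = r \<odot>\<^bsub>quot_mod M H\<^esub> (t \<odot>\<^bsub>quot_mod M H\<^esub> U)"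
      by (auto elim!: ex[rotated] simp: s a M.smult_l_distr M.smult_assoc1)
  next
    fix r U V assume "r \<in> carrier R" "U \<in> carrier (quot_mod M H)" "V \<in> carrier (quot_mod M H)"
    then show "r \<odot>\<^bsub>quot_mod M H\<^esub> (U \<oplus>\<^bsub>quot_mod M H\<^esub> V) = r \<odot>\<^bsub>quot_mod M H\<^esub> U \<oplus>\<^bsub>quot_mod M H\<^esub> r \<odot>\<^bsub>quot_mod M H\<^esub> V"
      by (elim ex[rotated]) (simp add: s a M.smult_r_distr)
  next
    fix U assume "U \<in> carrier (quot_mod M H)"
    then show "\<one>\<^bsub>R\<^esub> \<odot>\<^bsub>quot_mod M H\<^esub> U = U" by (elim ex[rotated]) (simp add: s)
  qed
qed

lemma lin_kernel_submodule:
  assumes "h \<in> lin_maps R M N" "Module.module R M" "Module.module R N" "submodule H R N"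
  shows "submodule {x \<in> carrier M. h x \<in> H} R M"
proof -
  interpret M: Module.module R M by fact
  interpret N: Module.module R N by fact
  note H = N.submoduleE[OF assms(4)]
  show ?thesis
    by (rule M.submoduleI)
      (auto simp: lin_add[OF assms(1)] lin_smult[OF assms(1)] lin_neg[OF assms(1-3)] lin_zero[OF assms(1-3)]
        H submodule_zero[OF assms(3,4)])
qed

lemma zero_submodule:
  assumes "Module.module R M"
  shows "submodule {\<zero>\<^bsub>M\<^esub>} R M"
proof -
  interpret M: Module.module R M by fact
  show ?thesis by (rule M.submoduleI) auto
qed

lemma lin_image_submodule:
  assumes "h \<in> lin_maps R M N" "Module.module R M" "Module.module R N" "submodule H R M"
  shows "submodule (h ` H) R N"
proof -
  interpret M: Module.module R M by fact
  interpret N: Module.module R N by fact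
  note H = M.submoduleE[OF assms(4)]
  show ?thesis
  proof (rule N.submoduleI)
    show "h ` H \<subseteq> carrier N" using H(1) lin_closed[OF assms(1)] by auto
    show "\<zero>\<^bsub>N\<^esub> \<in> h ` H" using lin_zero[OF assms(1-3)] submodule_zero[OF assms(2,4)] by force
    fix a assume "a \<in> h ` H"
    then obtain x where x: "x \<in> H" "a = h x" by auto
    then show "\<ominus>\<^bsub>N\<^esub> a \<in> h ` H" using lin_neg[OF assms(1-3), of x] H by force
    show "r \<odot>\<^bsub>N\<^esub> a \<in> h ` H" if "r \<in> carrier R" for r
      using lin_smult[OF assms(1) that, of x] x H(1) H(4)[OF that x(1)] by force
    fix b assume "b \<in> h ` H"
    then obtain y where y: "y \<in> H" "b = h y" by auto
    have "h (x \<oplus>\<^bsub>M\<^esub> y) = a \<oplus>\<^bsub>N\<^esub> b" using lin_add[OF assms(1)] x y H(1) by blast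
    then show "a \<oplus>\<^bsub>N\<^esub> b \<in> h ` H" using H(5)[OF x(1) y(1)] by force
  qed
qed

lemma submodule_gen_submodule:
  assumes "Module.module R M" "S \<subseteq> carrier M"
  shows "submodule (submodule_gen R M S) R M"
proof -
  interpret M: Module.module R M by fact
  have c: "carrier M \<in> {H. submodule H R M \<and> S \<subseteq> H}" using assms M.carrier_is_submodule by simp
  note E = M.submoduleE
  show ?thesis unfolding submodule_gen_def
  proof (rule M.submoduleI)
    show "\<Inter>{H. submodule H R M \<and> S \<subseteq> H} \<subseteq> carrier M" using c by auto
  qed (auto intro: submodule_zero[OF assms(1)] E(3-5))
qed

lemma submodule_gen_least: "submodule H R M \<Longrightarrow> S \<subseteq> H \<Longrightarrow> submodule_gen R M S \<subseteq> H"
  unfolding submodule_gen_def by auto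

lemma submodule_gen_incl: "S \<subseteq> submodule_gen R M S"
  unfolding submodule_gen_def by auto

text \<open>
  Restriction of scalars. The same formula, with a mere section in place of a ring homomorphism, turns
  a module killed by the kernel of a surjection into a module over the quotient ring.
\<close>

definition pullback_mod :: "('a \<Rightarrow> 'c) \<Rightarrow> ('c, 'm) module \<Rightarrow> ('a, 'm) module" where
  "pullback_mod \<phi> N = \<lparr>carrier = carrier N, monoid.mult = undefined, monoid.one = undefined,
     ring.zero = \<zero>\<^bsub>N\<^esub>, ring.add = add N, smult = (\<lambda>r x. \<phi> r \<odot>\<^bsub>N\<^esub> x)\<rparr>"

lemma pullback_mod_simps [simp]:
  "carrier (pullback_mod \<phi> N) = carrier N" "\<zero>\<^bsub>pullback_mod \<phi> N\<^esub> = \<zero>\<^bsub>N\<^esub>"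
  "x \<oplus>\<^bsub>pullback_mod \<phi> N\<^esub> y = x \<oplus>\<^bsub>N\<^esub> y" "r \<odot>\<^bsub>pullback_mod \<phi> N\<^esub> x = \<phi> r \<odot>\<^bsub>N\<^esub> x"
  by (simp_all add: pullback_mod_def)

lemma pullback_mod_minus [simp]: "x \<ominus>\<^bsub>pullback_mod \<phi> N\<^esub> y = x \<ominus>\<^bsub>N\<^esub> y"
  by (simp add: a_minus_def a_inv_def m_inv_def)

lemma (in ring_hom_cring) pullback_module:
  assumes "Module.module S N"
  shows "Module.module R (pullback_mod h N)"
proof -
  interpret N: Module.module S N by fact
  have "abelian_group (pullback_mod h N)"
    by (rule abelian_groupI) (auto simp: N.M.a_ac intro: bexI[of _ "\<ominus>\<^bsub>N\<^esub> _"] N.M.l_neg)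
  then show ?thesis
    by (intro moduleI R.cring_axioms) (auto simp: N.smult_l_distr N.smult_r_distr N.smult_assoc1)
qed

lemma pullback_lin:
  assumes "h \<in> lin_maps A M N" "\<phi> \<in> carrier R \<rightarrow> carrier A"
  shows "h \<in> lin_maps R (pullback_mod \<phi> M) (pullback_mod \<phi> N)"
  using assms by (auto simp: lin_maps_def Pi_iff)

text \<open>
  The A-module N is the quotient of the R-module M by S, for a surjection \<open>\<phi>\<close> from R to A. Modules over
  the quotient ring are compared through such presentations: two modules presented by the same M and S
  are isomorphic, and no map between them has to be constructed by hand.
\<close>

definition presents ::
    "('a, 'r) ring_scheme \<Rightarrow> ('a \<Rightarrow> 'c) \<Rightarrow> ('a, 'm) module \<Rightarrow> 'm set \<Rightarrow> ('c, 'n) module \<Rightarrow> ('m \<Rightarrow> 'n) \<Rightarrow> bool" where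
  "presents R \<phi> M S N g \<longleftrightarrow> g \<in> lin_maps R M (pullback_mod \<phi> N) \<and> g ` carrier M = carrier N
     \<and> {x \<in> carrier M. g x = \<zero>\<^bsub>N\<^esub>} = S"

lemma presentsD:
  assumes "presents R \<phi> M S N g"
  shows "g \<in> lin_maps R M (pullback_mod \<phi> N)" "g ` carrier M = carrier N"
    "{x \<in> carrier M. g x = \<zero>\<^bsub>N\<^esub>} = S"
  using assms by (auto simp: presents_def)

locale surjective_change = ring_hom_cring R A \<phi> for R (structure) and A (structure) and \<phi> +
  assumes surj: "\<phi> ` carrier R = carrier A"
begin

lemma image_submodule:
  assumes "g \<in> lin_maps R M (pullback_mod \<phi> N)" "Module.module R M" "Module.module A N" "submodule H R M"
  shows "submodule (g ` H) A N"
proof -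
  interpret M: Module.module R M by fact
  interpret N: Module.module A N by fact
  note g = assms(1) and E = M.submoduleE[OF assms(4)]
  have P: "Module.module R (pullback_mod \<phi> N)" by (rule pullback_module[OF assms(3)])
  show ?thesis
  proof (rule N.submoduleI_smult)
    show "g ` H \<subseteq> carrier N" using lin_closed[OF g] E(1) by auto
    show "\<zero>\<^bsub>N\<^esub> \<in> g ` H" using lin_zero[OF g assms(2) P] submodule_zero[OF assms(2,4)] by force
    fix a b assume "a \<in> g ` H" "b \<in> g ` H"
    then obtain x y where x: "x \<in> H" "y \<in> H" "a = g x" "b = g y" by blast
    show "a \<oplus>\<^bsub>N\<^esub> b \<in> g ` H"
      using lin_add[OF g, of x y] x E(1) E(5)[OF x(1,2)] by (metis imageI pullback_mod_simps(3) subsetD)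
  next
    fix r a assume "r \<in> carrier A" "a \<in> g ` H"
    then obtain t x where x: "t \<in> carrier R" "r = \<phi> t" "x \<in> H" "a = g x" unfolding surj[symmetric] by blast
    show "r \<odot>\<^bsub>N\<^esub> a \<in> g ` H"
      using lin_smult[OF g x(1), of x] x E(1) E(4)[OF x(1,3)] by (metis imageI pullback_mod_simps(4) subsetD)
  qed
qed

lemma presents_eq_iff:
  assumes "presents R \<phi> M K N g" "Module.module R M" "Module.module A N" "x \<in> carrier M" "y \<in> carrier M"
  shows "g x = g y \<longleftrightarrow> x \<ominus>\<^bsub>M\<^esub> y \<in> K"
proof -
  interpret M: Module.module R M by fact
  interpret N: Module.module A N by fact
  note g = presentsD(1)[OF assms(1)]
  have "g (x \<ominus>\<^bsub>M\<^esub> y) = g x \<ominus>\<^bsub>N\<^esub> g y"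
    using lin_minus[OF g assms(2) pullback_module[OF assms(3)] assms(4,5)] by simp
  moreover have "g x = g y \<longleftrightarrow> g x \<ominus>\<^bsub>N\<^esub> g y = \<zero>\<^bsub>N\<^esub>"
  proof
    assume "g x \<ominus>\<^bsub>N\<^esub> g y = \<zero>\<^bsub>N\<^esub>"
    moreover have "g x = (g x \<ominus>\<^bsub>N\<^esub> g y) \<oplus>\<^bsub>N\<^esub> g y"
      using lin_closed[OF g] assms(4,5) by (simp add: a_minus_def N.M.a_assoc N.M.l_neg)
    ultimately show "g x = g y" using lin_closed[OF g] assms(5) by simp
  qed (use lin_closed[OF g] assms(4,5) in \<open>simp add: a_minus_def N.M.r_neg\<close>)
  ultimately show ?thesis using presentsD(3)[OF assms(1)] assms(4,5) by auto
qed

lemma presents_iso: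
  assumes "presents R \<phi> M K N1 g1" "presents R \<phi> M K N2 g2" "Module.module R M" "Module.module A N1" "Module.module A N2"
  shows "mod_isomorphic A N1 N2"
proof -
  interpret M: Module.module R M by fact
  \<comment> \<open>any preimage under g1 will do, since g1 and g2 have the same kernel\<close>
  define h where "h z = g2 (SOME x. x \<in> carrier M \<and> g1 x = z)" for z
  have h: "h (g1 x) = g2 x" if "x \<in> carrier M" for x
  proof -
    let ?y = "SOME y. y \<in> carrier M \<and> g1 y = g1 x"
    have y: "?y \<in> carrier M \<and> g1 ?y = g1 x" by (rule someI[of _ x]) (use that in simp)
    then have "g2 ?y = g2 x"
      using presents_eq_iff[OF assms(1,3,4), of ?y x] presents_eq_iff[OF assms(2,3,5), of ?y x] that by simp
    then show ?thesis by (simp add: h_def)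
  qed
  note g1 = presentsD(1)[OF assms(1)] and g2 = presentsD(1)[OF assms(2)]
  have s: "(\<And>x. x \<in> carrier M \<Longrightarrow> P (g1 x)) \<Longrightarrow> z \<in> carrier N1 \<Longrightarrow> P z" for P z
    using presentsD(2)[OF assms(1)] by (metis imageE)
  have "h \<in> lin_maps A N1 N2"
  proof (rule lin_mapsI)
    fix z assume "z \<in> carrier N1"
    then show "h z \<in> carrier N2" by (rule s[rotated]) (use h lin_closed[OF g2] in simp)
  next
    fix z w assume "z \<in> carrier N1" "w \<in> carrier N1"
    then show "h (z \<oplus>\<^bsub>N1\<^esub> w) = h z \<oplus>\<^bsub>N2\<^esub> h w"
    proof (elim s[rotated])
      fix x y assume xy: "x \<in> carrier M" "y \<in> carrier M"
      have "g1 x \<oplus>\<^bsub>N1\<^esub> g1 y = g1 (x \<oplus>\<^bsub>M\<^esub> y)" using lin_add[OF g1 xy] by simp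
      then show "h (g1 x \<oplus>\<^bsub>N1\<^esub> g1 y) = h (g1 x) \<oplus>\<^bsub>N2\<^esub> h (g1 y)"
        using xy h lin_add[OF g2 xy] by simp
    qed
  next
    fix a z assume "a \<in> carrier A" "z \<in> carrier N1"
    then obtain r x where rx: "r \<in> carrier R" "a = \<phi> r" "x \<in> carrier M" "z = g1 x"
      using surj presentsD(2)[OF assms(1)] by (metis imageE)
    have "a \<odot>\<^bsub>N1\<^esub> z = g1 (r \<odot>\<^bsub>M\<^esub> x)" using lin_smult[OF g1] rx by simp
    then show "h (a \<odot>\<^bsub>N1\<^esub> z) = a \<odot>\<^bsub>N2\<^esub> h z" using rx h lin_smult[OF g2] by simp
  qed
  moreover have "bij_betw h (carrier N1) (carrier N2)"
    unfolding bij_betw_def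
  proof
    show "inj_on h (carrier N1)"
    proof (rule inj_onI)
      fix z w assume "z \<in> carrier N1" "w \<in> carrier N1" and eq: "h z = h w"
      then have "z \<in> g1 ` carrier M" "w \<in> g1 ` carrier M" by (simp_all add: presentsD(2)[OF assms(1)])
      then obtain x y where xy: "x \<in> carrier M" "y \<in> carrier M" "z = g1 x" "w = g1 y" by auto
      show "z = w"
        using eq presents_eq_iff[OF assms(1,3,4) xy(1,2)] presents_eq_iff[OF assms(2,3,5) xy(1,2)]
        unfolding xy(3,4) h[OF xy(1)] h[OF xy(2)] by blast
    qed
    have "h ` carrier N1 = g2 ` carrier M"
      unfolding presentsD(2)[OF assms(1), symmetric] image_image by (rule image_cong) (simp_all add: h)
    then show "h ` carrier N1 = carrier N2" using presentsD(2)[OF assms(2)] by simp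
  qed
  ultimately show ?thesis unfolding mod_isomorphic_def by blast
qed

lemma presents_compose:
  assumes "presents R \<phi> M K N g" "Module.module R M" "Module.module A N" "j \<in> lin_maps R L M"
    "\<And>z. z \<in> carrier M \<Longrightarrow> \<exists>x\<in>carrier L. z \<ominus>\<^bsub>M\<^esub> j x \<in> K"
  shows "presents R \<phi> L {x \<in> carrier L. j x \<in> K} N (\<lambda>x. g (j x))"
  unfolding presents_def
proof (intro conjI)
  note j = lin_closed[OF assms(4)]
  show "(\<lambda>x. g (j x)) \<in> lin_maps R L (pullback_mod \<phi> N)" by (rule lin_compose[OF assms(4) presentsD(1)[OF assms(1)]])
  show "(\<lambda>x. g (j x)) ` carrier L = carrier N"
  proof (intro equalityI subsetI)
    fix z assume "z \<in> carrier N"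
    then obtain y where y: "y \<in> carrier M" "z = g y" using presentsD(2)[OF assms(1)] by auto
    obtain x where "x \<in> carrier L" "y \<ominus>\<^bsub>M\<^esub> j x \<in> K" using assms(5)[OF y(1)] by auto
    then show "z \<in> (\<lambda>x. g (j x)) ` carrier L"
      using presents_eq_iff[OF assms(1-3) y(1) j] y(2) by auto
  qed (use presentsD(2)[OF assms(1)] j in auto)
  show "{x \<in> carrier L. g (j x) = \<zero>\<^bsub>N\<^esub>} = {x \<in> carrier L. j x \<in> K}"
    using presentsD(3)[OF assms(1)] j by auto
qed

lemma presents_quot:
  assumes "presents R \<phi> M K N g" "Module.module R M" "Module.module A N" "submodule H A N"
  shows "presents R \<phi> M {x \<in> carrier M. g x \<in> H} (quot_mod N H) (\<lambda>x. H +>\<^bsub>N\<^esub> g x)"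
  unfolding presents_def
proof (intro conjI)
  note g = presentsD(1)[OF assms(1)]
  have "(\<lambda>y. H +>\<^bsub>N\<^esub> y) \<in> lin_maps R (pullback_mod \<phi> N) (pullback_mod \<phi> (quot_mod N H))"
    by (rule pullback_lin[OF quot_mod_lin[OF assms(3,4)]]) auto
  from lin_compose[OF g this] show "(\<lambda>x. H +>\<^bsub>N\<^esub> g x) \<in> lin_maps R M (pullback_mod \<phi> (quot_mod N H))" .
  show "(\<lambda>x. H +>\<^bsub>N\<^esub> g x) ` carrier M = carrier (quot_mod N H)"
    unfolding quot_mod_simps(1) presentsD(2)[OF assms(1), symmetric] by auto
  show "{x \<in> carrier M. H +>\<^bsub>N\<^esub> g x = \<zero>\<^bsub>quot_mod N H\<^esub>} = {x \<in> carrier M. g x \<in> H}"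
    using coset_zero_iff[OF assms(3,4)] lin_closed[OF g] by (auto simp: quot_mod_simps)
qed

end

section \<open>Homology\<close>

lemma cycles_submodule:
  assumes "chain_complex R C"
  shows "submodule (cycles C n) R (chains C n)"
  using lin_kernel_submodule[OF cx_lin[OF assms, of n] cx_module[OF assms] cx_module[OF assms] zero_submodule[OF cx_module[OF assms]]]
  by (simp add: cycles_def)

lemma cx_lin_Suc:
  assumes "chain_complex R C"
  shows "bdry C (n + 1) \<in> lin_maps R (chains C (n + 1)) (chains C n)"
  using cx_lin[OF assms, of "n + 1"] by simp

lemma boundaries_submodule:
  assumes "chain_complex R C"
  shows "submodule (boundaries C n) R (chains C n)"
  unfolding boundaries_def
  by (rule lin_image_submodule[OF cx_lin_Suc[OF assms] cx_module[OF assms] cx_module[OF assms]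
        Module.module.carrier_is_submodule[OF cx_module[OF assms]]])

lemma boundaries_subset_cycles:
  assumes "chain_complex R C"
  shows "boundaries C n \<subseteq> cycles C n"
  using lin_closed[OF cx_lin_Suc[OF assms]] cx_dd[OF assms, of _ "n + 1"]
  by (auto simp: boundaries_def cycles_def)

lemma submodule_restrict:
  assumes "Module.module R M" "submodule H R M" "submodule Z R M" "H \<subseteq> Z"
  shows "submodule H R (M\<lparr>carrier := Z\<rparr>)"
proof -
  interpret M: Module.module R M by fact
  interpret Z: Module.module R "M\<lparr>carrier := Z\<rparr>" by (rule submodule.submodule_is_module[OF assms(3,1)])
  have "Module.module R (M\<lparr>carrier := H\<rparr>)" by (rule submodule.submodule_is_module[OF assms(2,1)])
  then show ?thesis by (intro Z.module_incl_imp_submodule) (use assms(4) in auto)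
qed

lemma cycles_module:
  assumes "chain_complex R C"
  shows "Module.module R (chains C n\<lparr>carrier := cycles C n\<rparr>)"
  by (rule submodule.submodule_is_module[OF cycles_submodule[OF assms] cx_module[OF assms]])

lemma boundaries_submodule_cycles:
  assumes "chain_complex R C"
  shows "submodule (boundaries C n) R (chains C n\<lparr>carrier := cycles C n\<rparr>)"
  by (rule submodule_restrict[OF cx_module boundaries_submodule cycles_submodule boundaries_subset_cycles]) (rule assms)+

lemma homology_module:
  assumes "chain_complex R C"
  shows "Module.module R (homology C n)"
  unfolding homology_def by (rule quot_mod_module[OF cycles_module[OF assms] boundaries_submodule_cycles[OF assms]])

lemma minus_carrier_update:
  assumes "Module.module R M" "submodule Z R M" "y \<in> Z"
  shows "x \<ominus>\<^bsub>M\<lparr>carrier := Z\<rparr>\<^esub> y = x \<ominus>\<^bsub>M\<^esub> y"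
proof -
  interpret M: Module.module R M by fact
  interpret Z: Module.module R "M\<lparr>carrier := Z\<rparr>" by (rule submodule.submodule_is_module[OF assms(2,1)])
  have y: "y \<in> carrier M" using M.submoduleE(1)[OF assms(2)] assms(3) by auto
  have z: "\<ominus>\<^bsub>M\<lparr>carrier := Z\<rparr>\<^esub> y \<in> Z" using Z.M.a_inv_closed assms(3) by simp
  then have "\<ominus>\<^bsub>M\<lparr>carrier := Z\<rparr>\<^esub> y \<in> carrier M" using M.submoduleE(1)[OF assms(2)] by auto
  moreover have "\<ominus>\<^bsub>M\<lparr>carrier := Z\<rparr>\<^esub> y \<oplus>\<^bsub>M\<^esub> y = \<zero>\<^bsub>M\<^esub>" using Z.M.l_neg[of y] assms(3) by simp
  ultimately have "\<ominus>\<^bsub>M\<^esub> y = \<ominus>\<^bsub>M\<lparr>carrier := Z\<rparr>\<^esub> y" using y by (metis M.M.minus_equality)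
  then show ?thesis by (simp add: a_minus_def)
qed

context surjective_change
begin

text \<open>
  If each chain module of E is presented by some M modulo K, and the differential of E lifts to
  \<open>\<delta>\<close>, then the homology of E can be read off in M: a cycle of E lifts to an element whose image under \<open>\<delta>\<close>
  is a relation, and it is a boundary if it is an image under \<open>\<delta>\<close> up to a relation. The map \<open>\<delta>\<close> itself need
  only be a differential modulo K.
\<close>

lemma homology_presents:
  assumes M: "\<And>n. Module.module R (M n)" and E: "\<And>n. Module.module A (chains E n)"
    and pr: "\<And>n. presents R \<phi> (M n) (K n) (chains E n) (\<Theta> n)"
    and \<delta>: "\<And>n. \<delta> n \<in> lin_maps R (M n) (M (n - 1))"
    and comm: "\<And>n x. x \<in> carrier (M n) \<Longrightarrow> bdry E n (\<Theta> n x) = \<Theta> (n - 1) (\<delta> n x)"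
    and \<delta>\<delta>: "\<And>n x. x \<in> carrier (M n) \<Longrightarrow> \<delta> (n - 1) (\<delta> n x) \<in> K (n - 2)"
  shows "chain_complex A E"
    and "presents R \<phi> (M n\<lparr>carrier := {x \<in> carrier (M n). \<delta> n x \<in> K (n - 1)}\<rparr>)
      {x \<in> carrier (M n). \<delta> n x \<in> K (n - 1) \<and> (\<exists>v\<in>carrier (M (n + 1)). x \<ominus>\<^bsub>M n\<^esub> \<delta> (n + 1) v \<in> K n)}
      (homology E n) (\<lambda>x. boundaries E n +>\<^bsub>chains E n\<^esub> \<Theta> n x)"
    and "submodule {x \<in> carrier (M n). \<delta> n x \<in> K (n - 1)} R (M n)"
    and "x \<in> carrier (M n) \<Longrightarrow> \<Theta> n x \<in> boundaries E n \<longleftrightarrow> (\<exists>v\<in>carrier (M (n + 1)). x \<ominus>\<^bsub>M n\<^esub> \<delta> (n + 1) v \<in> K n)"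
    and "cycles E n = \<Theta> n ` {x \<in> carrier (M n). \<delta> n x \<in> K (n - 1)}"
proof -
  note \<Theta> = presentsD(1)[OF pr] and \<Theta>s = presentsD(2)[OF pr] and \<Theta>k = presentsD(3)[OF pr]
  have \<Theta>c: "\<Theta> n x \<in> carrier (chains E n)" if "x \<in> carrier (M n)" for n x using lin_closed[OF \<Theta> that] by simp
  have s: "(\<And>x. x \<in> carrier (M n) \<Longrightarrow> P (\<Theta> n x)) \<Longrightarrow> z \<in> carrier (chains E n) \<Longrightarrow> P z" for P z n
    using \<Theta>s[of n] by (metis imageE)
  have lin: "bdry E n \<in> lin_maps A (chains E n) (chains E (n - 1))" for n
  proof (rule lin_mapsI)
    fix z assume "z \<in> carrier (chains E n)"
    then show "bdry E n z \<in> carrier (chains E (n - 1))"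
      by (rule s[rotated]) (simp add: comm \<Theta>c lin_closed[OF \<delta>])
  next
    fix z w assume "z \<in> carrier (chains E n)" "w \<in> carrier (chains E n)"
    then show "bdry E n (z \<oplus>\<^bsub>chains E n\<^esub> w) = bdry E n z \<oplus>\<^bsub>chains E (n - 1)\<^esub> bdry E n w"
    proof (elim s[rotated])
      fix x y assume xy: "x \<in> carrier (M n)" "y \<in> carrier (M n)"
      interpret M: Module.module R "M n" by (rule M)
      have "\<Theta> n x \<oplus>\<^bsub>chains E n\<^esub> \<Theta> n y = \<Theta> n (x \<oplus>\<^bsub>M n\<^esub> y)" using lin_add[OF \<Theta> xy] by simp
      then show "bdry E n (\<Theta> n x \<oplus>\<^bsub>chains E n\<^esub> \<Theta> n y) = bdry E n (\<Theta> n x) \<oplus>\<^bsub>chains E (n - 1)\<^esub> bdry E n (\<Theta> n y)"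
        using xy lin_add[OF \<delta> xy] lin_add[OF \<Theta> lin_closed[OF \<delta> xy(1)] lin_closed[OF \<delta> xy(2)]] by (simp add: comm)
    qed
  next
    fix a z assume "a \<in> carrier A" "z \<in> carrier (chains E n)"
    then obtain r x where rx: "r \<in> carrier R" "a = \<phi> r" "x \<in> carrier (M n)" "z = \<Theta> n x"
      using surj \<Theta>s[of n] by (metis imageE)
    interpret M: Module.module R "M n" by (rule M)
    have "a \<odot>\<^bsub>chains E n\<^esub> z = \<Theta> n (r \<odot>\<^bsub>M n\<^esub> x)" using lin_smult[OF \<Theta> rx(1,3)] rx by simp
    then show "bdry E n (a \<odot>\<^bsub>chains E n\<^esub> z) = a \<odot>\<^bsub>chains E (n - 1)\<^esub> bdry E n z"
      using rx lin_smult[OF \<delta> rx(1,3)] lin_smult[OF \<Theta> rx(1) lin_closed[OF \<delta> rx(3)]] by (simp add: comm)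
  qed
  have dd: "bdry E (n - 1) (bdry E n z) = \<zero>\<^bsub>chains E (n - 2)\<^esub>" if "z \<in> carrier (chains E n)" for n z
    using that
  proof (rule s[rotated])
    fix x assume x: "x \<in> carrier (M n)"
    have "\<Theta> (n - 2) (\<delta> (n - 1) (\<delta> n x)) = \<zero>\<^bsub>chains E (n - 2)\<^esub>"
      using \<delta>\<delta>[OF x] \<Theta>k[of "n - 2"] by auto
    then show "bdry E (n - 1) (bdry E n (\<Theta> n x)) = \<zero>\<^bsub>chains E (n - 2)\<^esub>"
      using x lin_closed[OF \<delta> x] by (simp add: comm)
  qed
  show cx: "chain_complex A E" unfolding chain_complex_def using E lin dd by blast
  have \<delta>K: "\<delta> n x \<in> K (n - 1) \<longleftrightarrow> \<Theta> n x \<in> cycles E n" if "x \<in> carrier (M n)" for n x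
    using that lin_closed[OF \<delta> that] \<Theta>k[of "n - 1"] by (auto simp: cycles_def \<Theta>c comm)
  let ?Z = "{x \<in> carrier (M n). \<delta> n x \<in> K (n - 1)}"
  show cyc: "cycles E n = \<Theta> n ` {x \<in> carrier (M n). \<delta> n x \<in> K (n - 1)}"
  proof (intro equalityI subsetI)
    fix z assume z: "z \<in> cycles E n"
    then have "z \<in> \<Theta> n ` carrier (M n)" by (simp add: cycles_def \<Theta>s)
    then show "z \<in> \<Theta> n ` {x \<in> carrier (M n). \<delta> n x \<in> K (n - 1)}" using z by (auto simp: \<delta>K)
  qed (auto simp: \<delta>K)
  have "submodule (K (n - 1)) R (M (n - 1))"
    using lin_kernel_submodule[OF \<Theta> M pullback_module[OF E] zero_submodule[OF pullback_module[OF E]], of "n - 1"] \<Theta>k[of "n - 1"] by simp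
  from lin_kernel_submodule[OF \<delta> M M this]
  show Z: "submodule {x \<in> carrier (M n). \<delta> n x \<in> K (n - 1)} R (M n)" .
  have b: "\<Theta> n x \<in> boundaries E n \<longleftrightarrow> (\<exists>v\<in>carrier (M (n + 1)). x \<ominus>\<^bsub>M n\<^esub> \<delta> (n + 1) v \<in> K n)"
    if x: "x \<in> carrier (M n)" for x
  proof -
    have "boundaries E n = (\<lambda>v. \<Theta> n (\<delta> (n + 1) v)) ` carrier (M (n + 1))"
      unfolding boundaries_def \<Theta>s[symmetric] using comm[of _ "n + 1"] by (auto simp: image_iff)
    moreover have "\<delta> (n + 1) v \<in> carrier (M n)" if "v \<in> carrier (M (n + 1))" for v
      using lin_closed[OF \<delta> that] by simp
    ultimately show ?thesis using presents_eq_iff[OF pr M E x] by auto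
  qed
  then show "x \<in> carrier (M n) \<Longrightarrow> \<Theta> n x \<in> boundaries E n \<longleftrightarrow> (\<exists>v\<in>carrier (M (n + 1)). x \<ominus>\<^bsub>M n\<^esub> \<delta> (n + 1) v \<in> K n)" .
  have "presents R \<phi> (M n\<lparr>carrier := ?Z\<rparr>) {x \<in> ?Z. \<Theta> n x = \<zero>\<^bsub>chains E n\<^esub>} (chains E n\<lparr>carrier := cycles E n\<rparr>) (\<Theta> n)"
    unfolding presents_def
    using \<Theta>[of n] cyc \<delta>K[of _ n] by (auto simp: lin_maps_def)
  from presents_quot[OF this submodule.submodule_is_module[OF Z M] cycles_module[OF cx] boundaries_submodule_cycles[OF cx]]
  have "presents R \<phi> (M n\<lparr>carrier := ?Z\<rparr>) {x \<in> ?Z. \<Theta> n x \<in> boundaries E n} (homology E n)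
      (\<lambda>x. boundaries E n +>\<^bsub>chains E n\<^esub> \<Theta> n x)"
    by (simp add: homology_def)
  moreover have "{x \<in> ?Z. \<Theta> n x \<in> boundaries E n}
      = {x \<in> carrier (M n). \<delta> n x \<in> K (n - 1) \<and> (\<exists>v\<in>carrier (M (n + 1)). x \<ominus>\<^bsub>M n\<^esub> \<delta> (n + 1) v \<in> K n)}"
    using b by auto
  ultimately show "presents R \<phi> (M n\<lparr>carrier := ?Z\<rparr>)
      {x \<in> carrier (M n). \<delta> n x \<in> K (n - 1) \<and> (\<exists>v\<in>carrier (M (n + 1)). x \<ominus>\<^bsub>M n\<^esub> \<delta> (n + 1) v \<in> K n)}
      (homology E n) (\<lambda>x. boundaries E n +>\<^bsub>chains E n\<^esub> \<Theta> n x)" by simp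
qed

end

section \<open>Extension of scalars along a surjection\<close>

text \<open>
  The product \<open>I M\<close>, built up by one summand \<open>i x\<close> at a time, so that statements about it are proved by induction.
\<close>

inductive_set ideal_span :: "'a set \<Rightarrow> ('a, 'm) module \<Rightarrow> 'm set" for I M where
  zero: "\<zero>\<^bsub>M\<^esub> \<in> ideal_span I M"
| add: "i \<in> I \<Longrightarrow> x \<in> carrier M \<Longrightarrow> y \<in> ideal_span I M \<Longrightarrow> i \<odot>\<^bsub>M\<^esub> x \<oplus>\<^bsub>M\<^esub> y \<in> ideal_span I M"

lemma ideal_span_closed:
  assumes "Module.module R M" "I \<subseteq> carrier R" "z \<in> ideal_span I M"
  shows "z \<in> carrier M"
proof -
  interpret M: Module.module R M by fact
  from assms(3) show ?thesis using assms(2) by induction auto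
qed

lemma ideal_span_incl:
  assumes "Module.module R M" "I \<subseteq> carrier R" "i \<in> I" "x \<in> carrier M"
  shows "i \<odot>\<^bsub>M\<^esub> x \<in> ideal_span I M"
proof -
  interpret M: Module.module R M by fact
  have "i \<in> carrier R" using assms by auto
  then show ?thesis using ideal_span.add[OF assms(3,4) ideal_span.zero] assms(4) by simp
qed

lemma ideal_span_submodule:
  assumes "Module.module R M" "I \<subseteq> carrier R"
  shows "submodule (ideal_span I M) R M"
proof -
  interpret M: Module.module R M by fact
  have iR: "i \<in> carrier R" if "i \<in> I" for i using that assms(2) by auto
  note c = ideal_span_closed[OF assms]
  have smult: "r \<odot>\<^bsub>M\<^esub> z \<in> ideal_span I M" if r: "r \<in> carrier R" and "z \<in> ideal_span I M" for r z
    using that(2)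
  proof induction
    case zero
    then show ?case using r ideal_span.zero by simp
  next
    case (add i x y)
    have "r \<odot>\<^bsub>M\<^esub> (i \<odot>\<^bsub>M\<^esub> x \<oplus>\<^bsub>M\<^esub> y) = i \<odot>\<^bsub>M\<^esub> (r \<odot>\<^bsub>M\<^esub> x) \<oplus>\<^bsub>M\<^esub> r \<odot>\<^bsub>M\<^esub> y"
      using r add iR c by (simp add: M.smult_r_distr M.smult_assoc1[symmetric] M.R.m_comm)
    then show ?case using ideal_span.add[OF add(1) _ add(4), of "r \<odot>\<^bsub>M\<^esub> x"] add r by simp
  qed
  show ?thesis
  proof (rule M.submoduleI)
    fix x y assume "x \<in> ideal_span I M" and y: "y \<in> ideal_span I M"
    from this(1) show "x \<oplus>\<^bsub>M\<^esub> y \<in> ideal_span I M"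
    proof induction
      case zero
      then show ?case using y c by simp
    next
      case (add i x z)
      have "i \<odot>\<^bsub>M\<^esub> x \<oplus>\<^bsub>M\<^esub> z \<oplus>\<^bsub>M\<^esub> y = i \<odot>\<^bsub>M\<^esub> x \<oplus>\<^bsub>M\<^esub> (z \<oplus>\<^bsub>M\<^esub> y)" using add y c iR by (simp add: M.M.a_assoc)
      then show ?case using ideal_span.add add by metis
    qed
  next
    fix x assume x: "x \<in> ideal_span I M"
    have "\<ominus>\<^bsub>M\<^esub> x = (\<ominus>\<^bsub>R\<^esub> \<one>\<^bsub>R\<^esub>) \<odot>\<^bsub>M\<^esub> x" using c[OF x] M.smult_l_minus[of "\<one>\<^bsub>R\<^esub>" x] by simp
    then show "\<ominus>\<^bsub>M\<^esub> x \<in> ideal_span I M" using smult[OF _ x] by simp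
  qed (use c smult ideal_span.zero in auto)
qed

lemma ideal_span_least:
  assumes "submodule H R M" "Module.module R M" "\<And>i x. i \<in> I \<Longrightarrow> x \<in> carrier M \<Longrightarrow> i \<odot>\<^bsub>M\<^esub> x \<in> H"
  shows "ideal_span I M \<subseteq> H"
proof
  fix z assume "z \<in> ideal_span I M"
  then show "z \<in> H"
    by induction (use assms(3) submodule_zero[OF assms(2,1)] Module.module.submoduleE(5)[OF assms(2,1)] in auto)
qed

lemma ideal_span_lin:
  assumes "h \<in> lin_maps R M N" "Module.module R M" "Module.module R N" "I \<subseteq> carrier R" "z \<in> ideal_span I M"
  shows "h z \<in> ideal_span I N"
proof -
  interpret M: Module.module R M by fact
  have "ideal_span I M \<subseteq> {x \<in> carrier M. h x \<in> ideal_span I N}"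
    by (rule ideal_span_least[OF lin_kernel_submodule[OF assms(1-3) ideal_span_submodule[OF assms(3,4)]] assms(2)])
      (use assms(4) in \<open>auto simp: lin_smult[OF assms(1)] subset_iff intro!: ideal_span_incl[OF assms(3,4)] lin_closed[OF assms(1)]\<close>)
  then show ?thesis using assms(5) by auto
qed

text \<open>
  This makes membership in \<open>I F\<close> a condition on coordinates, for a free module F.
\<close>

lemma ideal_span_free_mod:
  assumes "cring R" "ideal I R"
  shows "ideal_span I (free_mod R B) = {f \<in> carrier (free_mod R B). \<forall>b. f b \<in> I}"
proof -
  interpret R: cring R by fact
  interpret I: ideal I R by fact
  let ?F = "free_mod R B"
  interpret F: Module.module R ?F by (rule R.free_mod_module)
  have I: "I \<subseteq> carrier R" by (rule I.a_subset)
  show ?thesis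
  proof (intro equalityI subsetI)
    fix z assume "z \<in> ideal_span I ?F"
    then show "z \<in> {f \<in> carrier ?F. \<forall>b. f b \<in> I}"
    proof induction
      case zero
      then show ?case using F.M.zero_closed by simp
    next
      case (add i x y)
      have "i \<odot>\<^bsub>?F\<^esub> x \<oplus>\<^bsub>?F\<^esub> y \<in> carrier ?F" using add I by (intro F.M.a_closed F.smult_closed) auto
      then show ?case using add R.free_mod_value[of x B] I.I_r_closed by (simp add: I.a_closed)
    qed
  next
    fix f assume "f \<in> {f \<in> carrier ?F. \<forall>b. f b \<in> I}"
    then have f: "f \<in> carrier ?F" and fI: "\<And>b. f b \<in> I" by auto
    have "finsum ?F (\<lambda>b. f b \<odot>\<^bsub>?F\<^esub> basis_vec R b) {b. f b \<noteq> \<zero>\<^bsub>R\<^esub>} \<in> ideal_span I ?F"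
      using R.free_mod_support_subset[OF f]
      by (intro finsum_in_submodule[OF ideal_span_submodule[OF F.module_axioms I] F.module_axioms])
        (auto simp del: free_mod_simps intro!: ideal_span_incl[OF F.module_axioms I fI] R.basis_vec_closed)
    then show "f \<in> ideal_span I ?F" using R.free_mod_expand[OF f] by simp
  qed
qed

lemma (in abelian_group) finsum_times:
  assumes "finite S" "finite T" "\<And>i j. i \<in> S \<Longrightarrow> j \<in> T \<Longrightarrow> f i j \<in> carrier G"
  shows "finsum G (\<lambda>(i, j). f i j) (S \<times> T) = finsum G (\<lambda>i. finsum G (f i) T) S"
proof -
  have "S \<times> T = (\<Union>i\<in>S. {i} \<times> T)" by auto
  then have "finsum G (\<lambda>(i, j). f i j) (S \<times> T) = finsum G (\<lambda>i. finsum G (\<lambda>(i, j). f i j) ({i} \<times> T)) S"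
    using assms by (simp only:) (rule add.finprod_UN_disjoint, auto simp: pairwise_def disjnt_def)
  also have "\<dots> = finsum G (\<lambda>i. finsum G (f i) T) S"
  proof (rule finsum_cong')
    fix i assume i: "i \<in> S"
    have e: "{i} \<times> T = Pair i ` T" by auto
    show "finsum G (\<lambda>(i, j). f i j) ({i} \<times> T) = finsum G (f i) T"
      unfolding e using assms i by (subst finsum_reindex) (auto simp: inj_on_def)
  qed (use assms in \<open>auto intro!: finsum_closed\<close>)
  finally show ?thesis .
qed

lemma coset_union:
  assumes "\<And>f. f \<in> U \<Longrightarrow> g f = c" "U \<noteq> {}"
  shows "(\<Union>f\<in>U. g f) = c"
  using assms by auto

text \<open>
  The element \<open>1 \<otimes> x\<close>. For surjective \<open>\<phi>\<close> every element of the tensor product has this form.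
\<close>

definition scalar_inclusion ::
    "('a, 'r) ring_scheme \<Rightarrow> ('c, 'd) ring_scheme \<Rightarrow> ('a \<Rightarrow> 'c) \<Rightarrow> ('a, 'm) module \<Rightarrow> 'm \<Rightarrow> ('m \<Rightarrow> 'c) set" where
  "scalar_inclusion R A \<phi> M x = tensor_rel R A \<phi> M +>\<^bsub>free_mod A (carrier M)\<^esub> basis_vec A x"

context surjective_change
begin

abbreviation ker where "ker \<equiv> {r \<in> carrier R. \<phi> r = \<zero>\<^bsub>A\<^esub>}"

abbreviation tens where "tens M \<equiv> tensor_mod R A \<phi> M"

abbreviation \<tau> where "\<tau> M x \<equiv> scalar_inclusion R A \<phi> M x"

lemma tensor_rel_generators:
  assumes "Module.module R M"
  shows "{basis_vec A (x \<oplus>\<^bsub>M\<^esub> y) \<ominus>\<^bsub>free_mod A (carrier M)\<^esub> (basis_vec A x \<oplus>\<^bsub>free_mod A (carrier M)\<^esub> basis_vec A y) | x y.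
            x \<in> carrier M \<and> y \<in> carrier M}
        \<union> {basis_vec A (r \<odot>\<^bsub>M\<^esub> x) \<ominus>\<^bsub>free_mod A (carrier M)\<^esub> \<phi> r \<odot>\<^bsub>free_mod A (carrier M)\<^esub> basis_vec A x | r x.
            r \<in> carrier R \<and> x \<in> carrier M} \<subseteq> carrier (free_mod A (carrier M))"
proof -
  interpret M: Module.module R M by fact
  interpret F: Module.module A "free_mod A (carrier M)" by (rule S.free_mod_module)
  show ?thesis
    by (auto simp del: free_mod_simps intro!: F.M.minus_closed F.M.a_closed F.smult_closed S.basis_vec_closed)
qed

lemma tensor_rel_submodule:
  assumes "Module.module R M"
  shows "submodule (tensor_rel R A \<phi> M) A (free_mod A (carrier M))"
  unfolding tensor_rel_def Let_def
  by (rule submodule_gen_submodule[OF S.free_mod_module tensor_rel_generators[OF assms]])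

lemma tensor_module:
  assumes "Module.module R M"
  shows "Module.module A (tens M)"
  unfolding tensor_mod_def by (rule quot_mod_module[OF S.free_mod_module tensor_rel_submodule[OF assms]])

text \<open>
  A linear map on the free module over M that respects the defining relations of the tensor product
  takes the same value on all representatives of a class. The maps induced on tensor products are unions
  over all representatives, and by this lemma all members of such a union agree.
\<close>

lemma tensor_rel_kill:
  assumes M: "Module.module R M" and T: "Module.module A T"
    and L: "L \<in> lin_maps A (free_mod A (carrier M)) T"
    and La: "\<And>x y. x \<in> carrier M \<Longrightarrow> y \<in> carrier M \<Longrightarrow>
      L (basis_vec A (x \<oplus>\<^bsub>M\<^esub> y)) = L (basis_vec A x) \<oplus>\<^bsub>T\<^esub> L (basis_vec A y)"
    and Ls: "\<And>r x. r \<in> carrier R \<Longrightarrow> x \<in> carrier M \<Longrightarrow> L (basis_vec A (r \<odot>\<^bsub>M\<^esub> x)) = \<phi> r \<odot>\<^bsub>T\<^esub> L (basis_vec A x)"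
    and f: "f \<in> \<tau> M x" and x: "x \<in> carrier M"
  shows "L f = L (basis_vec A x)"
proof -
  let ?F = "free_mod A (carrier M)"
  interpret M: Module.module R M by fact
  interpret T: Module.module A T by fact
  interpret F: Module.module A ?F by (rule S.free_mod_module)
  have e: "basis_vec A y \<in> carrier ?F" if "y \<in> carrier M" for y by (rule S.basis_vec_closed[OF that])
  note Lc = lin_closed[OF L e]
  have k: "submodule {f \<in> carrier ?F. L f \<in> {\<zero>\<^bsub>T\<^esub>}} A ?F"
    by (rule lin_kernel_submodule[OF L F.module_axioms T zero_submodule[OF T]])
  have "tensor_rel R A \<phi> M \<subseteq> {f \<in> carrier ?F. L f \<in> {\<zero>\<^bsub>T\<^esub>}}"
    unfolding tensor_rel_def Let_def
  proof (rule submodule_gen_least[OF k], rule subsetI)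
    fix g assume g: "g \<in> {basis_vec A (x \<oplus>\<^bsub>M\<^esub> y) \<ominus>\<^bsub>?F\<^esub> (basis_vec A x \<oplus>\<^bsub>?F\<^esub> basis_vec A y) | x y. x \<in> carrier M \<and> y \<in> carrier M}
        \<union> {basis_vec A (r \<odot>\<^bsub>M\<^esub> x) \<ominus>\<^bsub>?F\<^esub> \<phi> r \<odot>\<^bsub>?F\<^esub> basis_vec A x | r x. r \<in> carrier R \<and> x \<in> carrier M}"
    then have gF: "g \<in> carrier ?F" using tensor_rel_generators[OF M] by blast
    consider (a) y z where "g = basis_vec A (y \<oplus>\<^bsub>M\<^esub> z) \<ominus>\<^bsub>?F\<^esub> (basis_vec A y \<oplus>\<^bsub>?F\<^esub> basis_vec A z)" "y \<in> carrier M" "z \<in> carrier M"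
      | (b) r y where "g = basis_vec A (r \<odot>\<^bsub>M\<^esub> y) \<ominus>\<^bsub>?F\<^esub> \<phi> r \<odot>\<^bsub>?F\<^esub> basis_vec A y" "r \<in> carrier R" "y \<in> carrier M"
      using g by blast
    then have "L g = \<zero>\<^bsub>T\<^esub>"
    proof cases
      case a
      have "L g = L (basis_vec A (y \<oplus>\<^bsub>M\<^esub> z)) \<ominus>\<^bsub>T\<^esub> L (basis_vec A y \<oplus>\<^bsub>?F\<^esub> basis_vec A z)"
        unfolding a(1) by (rule lin_minus[OF L F.module_axioms T]) (intro e F.M.a_closed M.M.a_closed a)+
      then show ?thesis using a lin_add[OF L e e] La Lc by (simp add: a_minus_def T.M.r_neg del: free_mod_simps)
    next
      case b
      have "L g = L (basis_vec A (r \<odot>\<^bsub>M\<^esub> y)) \<ominus>\<^bsub>T\<^esub> L (\<phi> r \<odot>\<^bsub>?F\<^esub> basis_vec A y)"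
        unfolding b(1) by (rule lin_minus[OF L F.module_axioms T]) (intro e F.smult_closed M.smult_closed hom_closed b)+
      then show ?thesis using b lin_smult[OF L _ e] Ls Lc by (simp add: a_minus_def T.M.r_neg del: free_mod_simps)
    qed
    then show "g \<in> {f \<in> carrier ?F. L f \<in> {\<zero>\<^bsub>T\<^esub>}}" using gF by simp
  qed
  moreover obtain t where "t \<in> tensor_rel R A \<phi> M" "f = t \<oplus>\<^bsub>?F\<^esub> basis_vec A x"
    using f by (auto simp: scalar_inclusion_def a_r_coset_def' simp del: free_mod_simps)
  ultimately show ?thesis using lin_add[OF L _ e[OF x], of t] Lc[OF x] by auto
qed

lemma \<tau>_closed: "x \<in> carrier M \<Longrightarrow> \<tau> M x \<in> carrier (tens M)"
  unfolding tensor_mod_def scalar_inclusion_def quot_mod_simps(1) by (rule imageI[OF S.basis_vec_closed])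

lemma \<tau>_lin:
  assumes "Module.module R M"
  shows "(\<lambda>x. \<tau> M x) \<in> lin_maps R M (pullback_mod \<phi> (tens M))"
proof -
  let ?F = "free_mod A (carrier M)" and ?R = "tensor_rel R A \<phi> M"
  interpret M: Module.module R M by fact
  interpret F: Module.module A ?F by (rule S.free_mod_module)
  note sub = tensor_rel_submodule[OF assms]
  have e: "basis_vec A y \<in> carrier ?F" if "y \<in> carrier M" for y by (rule S.basis_vec_closed[OF that])
  have gen: "?R \<supseteq> {basis_vec A (x \<oplus>\<^bsub>M\<^esub> y) \<ominus>\<^bsub>?F\<^esub> (basis_vec A x \<oplus>\<^bsub>?F\<^esub> basis_vec A y) | x y. x \<in> carrier M \<and> y \<in> carrier M}
        \<union> {basis_vec A (r \<odot>\<^bsub>M\<^esub> x) \<ominus>\<^bsub>?F\<^esub> \<phi> r \<odot>\<^bsub>?F\<^esub> basis_vec A x | r x. r \<in> carrier R \<and> x \<in> carrier M}"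
    unfolding tensor_rel_def Let_def by (rule submodule_gen_incl)
  show ?thesis
  proof (rule lin_mapsI)
    fix x y assume x: "x \<in> carrier M" and y: "y \<in> carrier M"
    have "?R +>\<^bsub>?F\<^esub> basis_vec A (x \<oplus>\<^bsub>M\<^esub> y) = ?R +>\<^bsub>?F\<^esub> (basis_vec A x \<oplus>\<^bsub>?F\<^esub> basis_vec A y)"
      using gen x y by (subst coset_minus_iff[OF F.module_axioms sub]) (auto simp del: free_mod_simps intro!: e F.M.a_closed)
    then show "\<tau> M (x \<oplus>\<^bsub>M\<^esub> y) = \<tau> M x \<oplus>\<^bsub>pullback_mod \<phi> (tens M)\<^esub> \<tau> M y"
      using coset_add[OF F.module_axioms sub e[OF x] e[OF y]] by (simp add: tensor_mod_def scalar_inclusion_def del: free_mod_simps)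
  next
    fix r x assume r: "r \<in> carrier R" and x: "x \<in> carrier M"
    have "?R +>\<^bsub>?F\<^esub> basis_vec A (r \<odot>\<^bsub>M\<^esub> x) = ?R +>\<^bsub>?F\<^esub> (\<phi> r \<odot>\<^bsub>?F\<^esub> basis_vec A x)"
      using gen r x by (subst coset_minus_iff[OF F.module_axioms sub]) (auto simp del: free_mod_simps intro!: e F.smult_closed)
    then show "\<tau> M (r \<odot>\<^bsub>M\<^esub> x) = r \<odot>\<^bsub>pullback_mod \<phi> (tens M)\<^esub> \<tau> M x"
      using coset_smult[OF F.module_axioms sub hom_closed[OF r] e[OF x]] by (simp add: tensor_mod_def scalar_inclusion_def del: free_mod_simps)
  qed (simp add: \<tau>_closed)
qed

lemma \<tau>_surj:
  assumes "Module.module R M"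
  shows "(\<lambda>x. \<tau> M x) ` carrier M = carrier (tens M)"
proof
  let ?F = "free_mod A (carrier M)" and ?R = "tensor_rel R A \<phi> M"
  note sub = tensor_rel_submodule[OF assms]
  show "(\<lambda>x. \<tau> M x) ` carrier M \<subseteq> carrier (tens M)" by (auto simp: \<tau>_closed)
  have "?R +>\<^bsub>?F\<^esub> f \<in> (\<lambda>x. \<tau> M x) ` carrier M" if f: "f \<in> carrier ?F" for f
    by (rule lin_image_in_submodule[OF quot_mod_lin[OF S.free_mod_module sub] quot_mod_module[OF S.free_mod_module sub] _ _ f])
      (use image_submodule[OF \<tau>_lin[OF assms] assms tensor_module[OF assms] Module.module.carrier_is_submodule[OF assms]] in \<open>auto simp: tensor_mod_def scalar_inclusion_def\<close>)
  then show "carrier (tens M) \<subseteq> (\<lambda>x. \<tau> M x) ` carrier M"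
    by (auto simp: tensor_mod_def quot_mod_simps(1))
qed

text \<open>
  That \<open>I M\<close> is contained in the kernel is clear. For the converse, \<open>M / I M\<close> is a module over A, with a
  scalar acting through any of its lifts to R, and the universal property gives a map from \<open>A \<otimes> M\<close> to it
  that takes \<open>1 \<otimes> x\<close> to the class of x.
\<close>

lemma \<tau>_kernel:
  assumes "Module.module R M"
  shows "{x \<in> carrier M. \<tau> M x = \<zero>\<^bsub>tens M\<^esub>} = ideal_span ker M"
proof -
  let ?F = "free_mod A (carrier M)" and ?IM = "ideal_span ker M"
  interpret M: Module.module R M by fact
  interpret F: Module.module A ?F by (rule S.free_mod_module)
  interpret T: Module.module A "tens M" by (rule tensor_module[OF assms])
  have kR: "ker \<subseteq> carrier R" by auto
  note sub = ideal_span_submodule[OF assms kR]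
  have ideal_span_zero: "\<tau> M x = \<zero>\<^bsub>tens M\<^esub>" if "x \<in> ?IM" for x
  proof -
    have "?IM \<subseteq> {x \<in> carrier M. \<tau> M x \<in> {\<zero>\<^bsub>pullback_mod \<phi> (tens M)\<^esub>}}"
    proof (rule ideal_span_least[OF lin_kernel_submodule[OF \<tau>_lin[OF assms] assms pullback_module[OF T.module_axioms] zero_submodule[OF pullback_module[OF T.module_axioms]]] assms])
      fix i x assume i: "i \<in> ker" and x: "x \<in> carrier M"
      then show "i \<odot>\<^bsub>M\<^esub> x \<in> {x \<in> carrier M. \<tau> M x \<in> {\<zero>\<^bsub>pullback_mod \<phi> (tens M)\<^esub>}}"
        using lin_smult[OF \<tau>_lin[OF assms], of i x] \<tau>_closed[OF x] by simp
    qed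
    then show ?thesis using that by auto
  qed
  let ?Q = "quot_mod M ?IM"
  interpret Q: Module.module R ?Q by (rule quot_mod_module[OF assms sub])
  \<comment> \<open>a section of \<open>\<phi>\<close>; its choice does not matter on M / I M\<close>
  define \<rho> where "\<rho> a = (SOME r. r \<in> carrier R \<and> \<phi> r = a)" for a
  have \<rho>: "\<rho> a \<in> carrier R" "\<phi> (\<rho> a) = a" if "a \<in> carrier A" for a
  proof -
    have "\<exists>r. r \<in> carrier R \<and> \<phi> r = a" using that surj by (metis imageE)
    then show "\<rho> a \<in> carrier R" "\<phi> (\<rho> a) = a" unfolding \<rho>_def by (metis (mono_tags, lifting) someI_ex)+
  qed
  have indep: "r \<odot>\<^bsub>?Q\<^esub> U = s \<odot>\<^bsub>?Q\<^esub> U"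
    if rs: "r \<in> carrier R" "s \<in> carrier R" "\<phi> r = \<phi> s" and U: "U \<in> carrier ?Q" for r s U
  proof -
    obtain x where x: "x \<in> carrier M" "U = ?IM +>\<^bsub>M\<^esub> x" using U by (auto simp: quot_mod_simps(1))
    have "\<phi> (r \<ominus> s) = \<zero>\<^bsub>A\<^esub>" using rs by (simp add: a_minus_def S.r_neg)
    then have k: "r \<ominus> s \<in> ker" using rs by simp
    have "r \<odot>\<^bsub>M\<^esub> x \<ominus>\<^bsub>M\<^esub> s \<odot>\<^bsub>M\<^esub> x = (r \<ominus> s) \<odot>\<^bsub>M\<^esub> x"
      using rs x by (simp add: a_minus_def M.smult_l_distr M.smult_l_minus)
    then have "r \<odot>\<^bsub>M\<^esub> x \<ominus>\<^bsub>M\<^esub> s \<odot>\<^bsub>M\<^esub> x \<in> ?IM" using ideal_span_incl[OF assms kR k x(1)] by simp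
    then show ?thesis using rs x by (simp add: coset_smult[OF assms sub] coset_minus_iff[OF assms sub])
  qed
  define Q' where "Q' = pullback_mod \<rho> ?Q"
  have Q's: "carrier Q' = carrier ?Q" "\<zero>\<^bsub>Q'\<^esub> = \<zero>\<^bsub>?Q\<^esub>" "x \<oplus>\<^bsub>Q'\<^esub> y = x \<oplus>\<^bsub>?Q\<^esub> y" "a \<odot>\<^bsub>Q'\<^esub> x = \<rho> a \<odot>\<^bsub>?Q\<^esub> x" for x y a
    by (simp_all add: Q'_def)
  have Q': "Module.module A Q'"
  proof (rule moduleI)
    show "cring A" ..
    show "abelian_group Q'"
      by (rule abelian_groupI) (auto simp: Q's Q.M.a_ac intro: bexI[of _ "\<ominus>\<^bsub>?Q\<^esub> _"] Q.M.l_neg)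
  next
    fix a b U assume "a \<in> carrier A" "b \<in> carrier A" "U \<in> carrier Q'"
    then show "(a \<oplus>\<^bsub>A\<^esub> b) \<odot>\<^bsub>Q'\<^esub> U = a \<odot>\<^bsub>Q'\<^esub> U \<oplus>\<^bsub>Q'\<^esub> b \<odot>\<^bsub>Q'\<^esub> U"
      "(a \<otimes>\<^bsub>A\<^esub> b) \<odot>\<^bsub>Q'\<^esub> U = a \<odot>\<^bsub>Q'\<^esub> (b \<odot>\<^bsub>Q'\<^esub> U)"
      using indep[of "\<rho> (a \<oplus>\<^bsub>A\<^esub> b)" "\<rho> a \<oplus> \<rho> b" U] indep[of "\<rho> (a \<otimes>\<^bsub>A\<^esub> b)" "\<rho> a \<otimes> \<rho> b" U] \<rho>
      by (simp_all add: Q's Q.smult_l_distr Q.smult_assoc1)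
  next
    fix U assume "U \<in> carrier Q'"
    then show "\<one>\<^bsub>A\<^esub> \<odot>\<^bsub>Q'\<^esub> U = U" using indep[of "\<rho> \<one>\<^bsub>A\<^esub>" \<one> U] \<rho> by (simp add: Q's)
  qed (simp_all add: Q's \<rho> Q.smult_r_distr)
  let ?v = "\<lambda>x. ?IM +>\<^bsub>M\<^esub> x"
  have vc: "?v x \<in> carrier Q'" if "x \<in> carrier M" for x using that by (simp add: Q's quot_mod_simps(1))
  have L: "lin_ext A Q' ?v \<in> lin_maps A ?F Q'" using vc by (intro lin_ext_lin Q') auto
  have Lb: "lin_ext A Q' ?v (basis_vec A x) = ?v x" if "x \<in> carrier M" for x
    using vc[OF that] by (intro lin_ext_basis Q')
  have "x \<in> ?IM" if x: "x \<in> carrier M" and z: "\<tau> M x = \<zero>\<^bsub>tens M\<^esub>" for x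
  proof -
    have "\<tau> M \<zero>\<^bsub>M\<^esub> = \<zero>\<^bsub>tens M\<^esub>" using ideal_span_zero ideal_span.zero by blast
    then have inz: "basis_vec A x \<in> \<tau> M \<zero>\<^bsub>M\<^esub>"
      using z abelian_subgroup.a_rcos_self[OF submodule_abelian_subgroup[OF F.module_axioms tensor_rel_submodule[OF assms]] S.basis_vec_closed[OF x]]
      by (simp add: scalar_inclusion_def)
    have "lin_ext A Q' ?v (basis_vec A x) = lin_ext A Q' ?v (basis_vec A \<zero>\<^bsub>M\<^esub>)"
    proof (rule tensor_rel_kill[OF assms Q' L _ _ inz])
      show "lin_ext A Q' ?v (basis_vec A (x \<oplus>\<^bsub>M\<^esub> y)) = lin_ext A Q' ?v (basis_vec A x) \<oplus>\<^bsub>Q'\<^esub> lin_ext A Q' ?v (basis_vec A y)"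
        if "x \<in> carrier M" "y \<in> carrier M" for x y
        using that by (simp add: Lb Q's coset_add[OF assms sub])
      show "lin_ext A Q' ?v (basis_vec A (r \<odot>\<^bsub>M\<^esub> x)) = \<phi> r \<odot>\<^bsub>Q'\<^esub> lin_ext A Q' ?v (basis_vec A x)"
        if "r \<in> carrier R" "x \<in> carrier M" for r x
        using that indep[of "\<rho> (\<phi> r)" r "?v x"] \<rho>[of "\<phi> r"] vc[of x] by (simp add: Lb Q's coset_smult[OF assms sub])
    qed simp
    then have "?v x = ?v \<zero>\<^bsub>M\<^esub>" using x by (simp add: Lb)
    then have "x \<ominus>\<^bsub>M\<^esub> \<zero>\<^bsub>M\<^esub> \<in> ?IM" using coset_minus_iff[OF assms sub x] by simp
    then show ?thesis by (rule submodule_transfer[OF assms sub x ideal_span.zero])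
  qed
  then show ?thesis using ideal_span_zero ideal_span_closed[OF assms kR] by blast
qed

theorem \<tau>_presents:
  assumes "Module.module R M"
  shows "presents R \<phi> M (ideal_span ker M) (tens M) (\<lambda>x. \<tau> M x)"
  unfolding presents_def using \<tau>_lin[OF assms] \<tau>_surj[OF assms] \<tau>_kernel[OF assms] by simp

lemma \<tau>_nonempty:
  assumes "Module.module R M" "x \<in> carrier M"
  shows "basis_vec A x \<in> \<tau> M x"
  unfolding scalar_inclusion_def
  by (rule abelian_subgroup.a_rcos_self[OF submodule_abelian_subgroup[OF S.free_mod_module tensor_rel_submodule[OF assms(1)]] S.basis_vec_closed[OF assms(2)]])

lemma tensor_map_\<tau>:
  assumes M: "Module.module R M" and N: "Module.module R N" and h: "h \<in> lin_maps R M N" and x: "x \<in> carrier M"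
  shows "tensor_map R A \<phi> N h (\<tau> M x) = \<tau> N (h x)"
proof -
  let ?F = "free_mod A (carrier M)" and ?G = "free_mod A (carrier N)" and ?R = "tensor_rel R A \<phi> N"
  interpret M: Module.module R M by fact
  let ?H = "lin_ext A ?G (\<lambda>x. basis_vec A (h x))"
  have hb: "basis_vec A (h y) \<in> carrier ?G" if "y \<in> carrier M" for y
    by (rule S.basis_vec_closed[OF lin_closed[OF h that]])
  have H: "?H \<in> lin_maps A ?F ?G" using hb by (intro lin_ext_lin S.free_mod_module) auto
  have c: "(\<lambda>f. ?R +>\<^bsub>?G\<^esub> f) \<in> lin_maps A ?G (tens N)"
    unfolding tensor_mod_def by (rule quot_mod_lin[OF S.free_mod_module tensor_rel_submodule[OF N]])
  have Lb: "?R +>\<^bsub>?G\<^esub> ?H (basis_vec A y) = \<tau> N (h y)" if "y \<in> carrier M" for y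
    using lin_ext_basis[where v = "\<lambda>x. basis_vec A (h x)", OF S.free_mod_module hb[OF that]]
    by (simp add: scalar_inclusion_def)
  have const: "?R +>\<^bsub>?G\<^esub> ?H f = ?R +>\<^bsub>?G\<^esub> ?H (basis_vec A x)" if "f \<in> \<tau> M x" for f
  proof (rule tensor_rel_kill[OF M tensor_module[OF N] lin_compose[OF H c] _ _ that x])
    show "?R +>\<^bsub>?G\<^esub> ?H (basis_vec A (y \<oplus>\<^bsub>M\<^esub> z)) = (?R +>\<^bsub>?G\<^esub> ?H (basis_vec A y)) \<oplus>\<^bsub>tens N\<^esub> (?R +>\<^bsub>?G\<^esub> ?H (basis_vec A z))"
      if "y \<in> carrier M" "z \<in> carrier M" for y z
      using that lin_add[OF \<tau>_lin[OF N] lin_closed[OF h] lin_closed[OF h]] by (simp add: Lb lin_add[OF h])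
    show "?R +>\<^bsub>?G\<^esub> ?H (basis_vec A (r \<odot>\<^bsub>M\<^esub> z)) = \<phi> r \<odot>\<^bsub>tens N\<^esub> (?R +>\<^bsub>?G\<^esub> ?H (basis_vec A z))"
      if "r \<in> carrier R" "z \<in> carrier M" for r z
      using that lin_smult[OF \<tau>_lin[OF N] _ lin_closed[OF h]] by (simp add: Lb lin_smult[OF h])
  qed
  have "(\<Union>f\<in>\<tau> M x. ?R +>\<^bsub>?G\<^esub> ?H f) = ?R +>\<^bsub>?G\<^esub> ?H (basis_vec A x)"
    by (rule coset_union[OF const]) (use \<tau>_nonempty[OF M x] in blast)+
  then show ?thesis unfolding tensor_map_def Let_def Lb[OF x] .
qed

lemma tensor_pairing_\<tau>:
  assumes L: "Module.module R L" and M: "Module.module R M" and N: "Module.module R N"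
    and \<beta>: "bilin R L M N \<beta>" and x: "x \<in> carrier L" and y: "y \<in> carrier M"
  shows "tensor_pairing R A \<phi> N \<beta> (\<tau> L x) (\<tau> M y) = \<tau> N (\<beta> x y)"
proof -
  let ?F = "free_mod A (carrier L)" and ?G = "free_mod A (carrier M)" and ?K = "free_mod A (carrier N)"
    and ?R = "tensor_rel R A \<phi> N" and ?T = "tens N"
  interpret L: Module.module R L by fact
  interpret M: Module.module R M by fact
  interpret T: Module.module A ?T by (rule tensor_module[OF N])
  interpret K: Module.module A ?K by (rule S.free_mod_module)
  have c: "(\<lambda>f. ?R +>\<^bsub>?K\<^esub> f) \<in> lin_maps A ?K ?T"
    unfolding tensor_mod_def by (rule quot_mod_lin[OF S.free_mod_module tensor_rel_submodule[OF N]])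
  note \<beta>c = bilin_closed[OF \<beta>]
  have tc: "\<tau> N (\<beta> x y) \<in> carrier ?T" if "x \<in> carrier L" "y \<in> carrier M" for x y
    by (rule \<tau>_closed[OF \<beta>c[OF that]])
  have inner: "lin_ext A ?T (\<lambda>y. \<tau> N (\<beta> x' y)) g = \<tau> N (\<beta> x' y)" if g: "g \<in> \<tau> M y" and x': "x' \<in> carrier L" for g x'
  proof -
    let ?L = "lin_ext A ?T (\<lambda>y. \<tau> N (\<beta> x' y))"
    have l: "?L \<in> lin_maps A ?G ?T" using tc x' by (intro lin_ext_lin T.module_axioms) auto
    have b: "?L (basis_vec A y) = \<tau> N (\<beta> x' y)" if "y \<in> carrier M" for y
      using tc[OF x' that] by (intro lin_ext_basis T.module_axioms)
    have "?L g = ?L (basis_vec A y)"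
      by (rule tensor_rel_kill[OF M T.module_axioms l _ _ g y])
        (use lin_add[OF \<tau>_lin[OF N] \<beta>c[OF x'] \<beta>c[OF x']] lin_smult[OF \<tau>_lin[OF N] _ \<beta>c[OF x']] in
          \<open>simp_all add: b lin_add[OF bilin_right[OF \<beta> x']] lin_smult[OF bilin_right[OF \<beta> x']]\<close>)
    then show ?thesis using b y by simp
  qed
  have outer: "lin_ext A ?T (\<lambda>x. \<tau> N (\<beta> x y)) f = \<tau> N (\<beta> x y)" if f: "f \<in> \<tau> L x" for f
  proof -
    let ?L = "lin_ext A ?T (\<lambda>x. \<tau> N (\<beta> x y))"
    have l: "?L \<in> lin_maps A ?F ?T" using tc y by (intro lin_ext_lin T.module_axioms) auto
    have b: "?L (basis_vec A x) = \<tau> N (\<beta> x y)" if "x \<in> carrier L" for x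
      using tc[OF that y] by (intro lin_ext_basis T.module_axioms)
    have "?L f = ?L (basis_vec A x)"
      by (rule tensor_rel_kill[OF L T.module_axioms l _ _ f x])
        (use lin_add[OF \<tau>_lin[OF N] \<beta>c[OF _ y] \<beta>c[OF _ y]] lin_smult[OF \<tau>_lin[OF N] _ \<beta>c[OF _ y]] in
          \<open>simp_all add: b lin_add[OF bilin_left[OF \<beta> y]] lin_smult[OF bilin_left[OF \<beta> y]]\<close>)
    then show ?thesis using b x by simp
  qed
  have sub: "\<tau> L x \<subseteq> carrier ?F" if "x \<in> carrier L" for x
    unfolding scalar_inclusion_def
    by (rule abelian_monoid.a_r_coset_subset_G[OF abelian_group.axioms(1)[OF Module.module.axioms(2)[OF S.free_mod_module]]
        Module.module.submoduleE(1)[OF S.free_mod_module tensor_rel_submodule[OF L]] S.basis_vec_closed[OF that]])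
  have sub': "\<tau> M y \<subseteq> carrier ?G" if "y \<in> carrier M" for y
    unfolding scalar_inclusion_def
    by (rule abelian_monoid.a_r_coset_subset_G[OF abelian_group.axioms(1)[OF Module.module.axioms(2)[OF S.free_mod_module]]
        Module.module.submoduleE(1)[OF S.free_mod_module tensor_rel_submodule[OF M]] S.basis_vec_closed[OF that]])
  have const: "?R +>\<^bsub>?K\<^esub> finsum ?K (\<lambda>(x, y). (f x \<otimes>\<^bsub>A\<^esub> g y) \<odot>\<^bsub>?K\<^esub> basis_vec A (\<beta> x y)) ({x. f x \<noteq> \<zero>\<^bsub>A\<^esub>} \<times> {y. g y \<noteq> \<zero>\<^bsub>A\<^esub>})
      = \<tau> N (\<beta> x y)" if fx: "f \<in> \<tau> L x" and gy: "g \<in> \<tau> M y" for f g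
  proof -
    let ?S = "{x. f x \<noteq> \<zero>\<^bsub>A\<^esub>}" and ?S' = "{y. g y \<noteq> \<zero>\<^bsub>A\<^esub>}"
    have f: "f \<in> carrier ?F" and g: "g \<in> carrier ?G" using fx gy sub[OF x] sub'[OF y] by auto
    note fv = S.free_mod_value[OF f] and gv = S.free_mod_value[OF g]
    have S: "finite ?S" "?S \<subseteq> carrier L" "finite ?S'" "?S' \<subseteq> carrier M"
      using S.free_mod_support[OF f] S.free_mod_support[OF g] S.free_mod_support_subset[OF f] S.free_mod_support_subset[OF g] by auto
    have bK: "basis_vec A (\<beta> x y) \<in> carrier ?K" if "x \<in> ?S" "y \<in> ?S'" for x y
      using that S by (intro S.basis_vec_closed \<beta>c) auto
    have tS: "\<tau> N (\<beta> x y) \<in> carrier ?T" if "x \<in> ?S" "y \<in> ?S'" for x y using that S by (intro tc) auto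
    have "?R +>\<^bsub>?K\<^esub> finsum ?K (\<lambda>(x, y). (f x \<otimes>\<^bsub>A\<^esub> g y) \<odot>\<^bsub>?K\<^esub> basis_vec A (\<beta> x y)) (?S \<times> ?S')
      = finsum ?T (\<lambda>p. ?R +>\<^bsub>?K\<^esub> (case p of (x, y) \<Rightarrow> (f x \<otimes>\<^bsub>A\<^esub> g y) \<odot>\<^bsub>?K\<^esub> basis_vec A (\<beta> x y))) (?S \<times> ?S')"
      by (rule lin_finsum[OF c K.module_axioms T.module_axioms])
        (use bK fv gv in \<open>auto simp del: free_mod_simps intro!: K.smult_closed\<close>)
    also have "\<dots> = finsum ?T (\<lambda>(x, y). f x \<odot>\<^bsub>?T\<^esub> (g y \<odot>\<^bsub>?T\<^esub> \<tau> N (\<beta> x y))) (?S \<times> ?S')"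
    proof (rule T.M.finsum_cong')
      fix p assume "p \<in> ?S \<times> ?S'"
      then obtain x y where p: "p = (x, y)" "x \<in> ?S" "y \<in> ?S'" by auto
      show "?R +>\<^bsub>?K\<^esub> (case p of (x, y) \<Rightarrow> (f x \<otimes>\<^bsub>A\<^esub> g y) \<odot>\<^bsub>?K\<^esub> basis_vec A (\<beta> x y))
          = (case p of (x, y) \<Rightarrow> f x \<odot>\<^bsub>?T\<^esub> (g y \<odot>\<^bsub>?T\<^esub> \<tau> N (\<beta> x y)))"
        using p lin_smult[OF c S.m_closed[OF fv gv] bK[OF p(2,3)], of x y] T.smult_assoc1[OF fv gv tS[OF p(2,3)], of x y]
        by (simp add: scalar_inclusion_def del: free_mod_simps)
    qed (use fv gv tS in auto)
    also have "\<dots> = finsum ?T (\<lambda>x. finsum ?T (\<lambda>y. f x \<odot>\<^bsub>?T\<^esub> (g y \<odot>\<^bsub>?T\<^esub> \<tau> N (\<beta> x y))) ?S') ?S"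
      by (rule T.M.finsum_times) (use S fv gv tS in auto)
    also have "\<dots> = finsum ?T (\<lambda>x. f x \<odot>\<^bsub>?T\<^esub> \<tau> N (\<beta> x y)) ?S"
    proof (rule T.M.finsum_cong')
      fix x' assume x': "x' \<in> ?S"
      then have x'L: "x' \<in> carrier L" using S by auto
      have "finsum ?T (\<lambda>y. f x' \<odot>\<^bsub>?T\<^esub> (g y \<odot>\<^bsub>?T\<^esub> \<tau> N (\<beta> x' y))) ?S' = f x' \<odot>\<^bsub>?T\<^esub> lin_ext A ?T (\<lambda>y. \<tau> N (\<beta> x' y)) g"
        unfolding lin_ext_def by (rule T.finsum_smult_ldistr[symmetric]) (use S fv gv tS x' in auto)
      then show "finsum ?T (\<lambda>y. f x' \<odot>\<^bsub>?T\<^esub> (g y \<odot>\<^bsub>?T\<^esub> \<tau> N (\<beta> x' y))) ?S' = f x' \<odot>\<^bsub>?T\<^esub> \<tau> N (\<beta> x' y)"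
        using inner[OF gy x'L] by simp
    qed (use fv tc y S in auto)
    also have "\<dots> = \<tau> N (\<beta> x y)" using outer[OF fx] by (simp add: lin_ext_def)
    finally show ?thesis .
  qed
  have ne: "\<tau> L x \<noteq> {}" "\<tau> M y \<noteq> {}" using \<tau>_nonempty[OF L x] \<tau>_nonempty[OF M y] by blast+
  show ?thesis unfolding tensor_pairing_def Let_def
    by (rule coset_union[OF coset_union[OF const ne(2)] ne(1)])
qed

end

section \<open>Contraction operators\<close>

type_synonym 'a qchain = "nat set \<times> nat multiset \<Rightarrow> 'a"

text \<open>
  Squares and anticommutators of contractions are double sums over ordered pairs of distinct indices,
  whose terms cancel in pairs.
\<close>

lemma (in abelian_group) antisymmetric_double_sum:
  assumes "finite J" "\<And>i j. i \<in> J \<Longrightarrow> j \<in> J \<Longrightarrow> i \<noteq> j \<Longrightarrow> g i j \<in> carrier G \<and> g i j = \<ominus> g j i"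
  shows "finsum G (\<lambda>j. finsum G (\<lambda>i. g i j) (J - {j})) J = \<zero>"
  using assms
proof (induction J rule: finite_induct)
  case (insert x J)
  have c: "g i j \<in> carrier G" if "i \<in> insert x J" "j \<in> insert x J" "i \<noteq> j" for i j
    using insert.prems that by blast
  have in1: "finsum G (\<lambda>i. g i x) (insert x J - {x}) = finsum G (\<lambda>i. g i x) J"
    using insert.hyps by simp
  have in2: "finsum G (\<lambda>i. g i j) (insert x J - {j}) = g x j \<oplus> finsum G (\<lambda>i. g i j) (J - {j})" if j: "j \<in> J" for j
  proof -
    have "insert x J - {j} = insert x (J - {j})" using j insert.hyps by auto
    then show ?thesis
      using insert.hyps j c by (simp only:) (rule finsum_insert, auto)
  qed
  have P1: "(\<lambda>i. g i x) \<in> J \<rightarrow> carrier G" "(\<lambda>j. g x j) \<in> J \<rightarrow> carrier G" using c insert.hyps by auto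
  have P2: "(\<lambda>j. finsum G (\<lambda>i. g i j) (J - {j})) \<in> J \<rightarrow> carrier G" using c by (auto intro!: finsum_closed)
  have ih: "finsum G (\<lambda>j. finsum G (\<lambda>i. g i j) (J - {j})) J = \<zero>"
    by (rule insert.IH, rule insert.prems) auto
  have P3: "(\<lambda>j. g x j \<oplus> finsum G (\<lambda>i. g i j) (J - {j})) \<in> J \<rightarrow> carrier G" using P1 P2 by auto
  have e: "finsum G (\<lambda>j. finsum G (\<lambda>i. g i j) (insert x J - {j})) J
      = finsum G (\<lambda>j. g x j \<oplus> finsum G (\<lambda>i. g i j) (J - {j})) J"
    by (rule finsum_cong'[OF refl P3 in2])
  have "finsum G (\<lambda>j. finsum G (\<lambda>i. g i j) (insert x J - {j})) (insert x J)
      = finsum G (\<lambda>i. g i x) (insert x J - {x}) \<oplus> finsum G (\<lambda>j. finsum G (\<lambda>i. g i j) (insert x J - {j})) J"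
  proof (rule finsum_insert[OF insert.hyps])
    show "(\<lambda>j. finsum G (\<lambda>i. g i j) (insert x J - {j})) \<in> J \<rightarrow> carrier G"
    proof
      fix j assume j: "j \<in> J"
      show "finsum G (\<lambda>i. g i j) (insert x J - {j}) \<in> carrier G" unfolding in2[OF j] using P3 j by (rule funcset_mem)
    qed
    show "finsum G (\<lambda>i. g i x) (insert x J - {x}) \<in> carrier G" unfolding in1 by (rule finsum_closed[OF P1(1)])
  qed
  also have "\<dots> = finsum G (\<lambda>i. g i x) J \<oplus> finsum G (\<lambda>j. g x j \<oplus> finsum G (\<lambda>i. g i j) (J - {j})) J"
    unfolding in1 e ..
  also have "\<dots> = finsum G (\<lambda>i. g i x) J \<oplus> (finsum G (\<lambda>j. g x j) J \<oplus> \<zero>)"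
    unfolding finsum_addf[OF P1(2) P2] ih ..
  also have "\<dots> = finsum G (\<lambda>i. g i x \<oplus> g x i) J"
    unfolding finsum_addf[OF P1] r_zero[OF finsum_closed[OF P1(2)]] ..
  also have "\<dots> = finsum G (\<lambda>i. \<zero>) J"
  proof (rule finsum_cong')
    fix i assume i: "i \<in> J"
    then have "g i x = \<ominus> g x i" "g x i \<in> carrier G" using insert.prems insert.hyps by blast+
    then show "g i x \<oplus> g x i = \<zero>" by (simp add: l_neg)
  qed auto
  finally show ?case by simp
qed simp

context cring
begin

text \<open>
  All complexes \<open>Q\<^bsup>(k)\<^esup>\<close> and all \<open>K(R; I\<^sup>s)\<close>, in all degrees, sit inside one free module FF, on the pairs (J, m)
  that stand for \<open>e\<^sub>J u\<^sub>m\<close>. An operator is defined once on FF, and \<open>fs B\<close> collects the elements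
  supported on B.
\<close>

abbreviation FF :: "('a, 'a qchain) module" where "FF \<equiv> free_mod R UNIV"
abbreviation FF_zero ("\<zero>\<^sub>F") where "\<zero>\<^sub>F \<equiv> \<zero>\<^bsub>FF\<^esub>"
abbreviation FF_add (infixl "\<oplus>\<^sub>F" 65) where "f \<oplus>\<^sub>F g \<equiv> f \<oplus>\<^bsub>FF\<^esub> g"
abbreviation FF_minus (infixl "\<ominus>\<^sub>F" 65) where "f \<ominus>\<^sub>F g \<equiv> f \<ominus>\<^bsub>FF\<^esub> g"
abbreviation FF_smult (infixl "\<odot>\<^sub>F" 70) where "r \<odot>\<^sub>F f \<equiv> r \<odot>\<^bsub>FF\<^esub> f"
abbreviation FF_neg ("\<ominus>\<^sub>F _" [81] 80) where "\<ominus>\<^sub>F f \<equiv> \<ominus>\<^bsub>FF\<^esub> f"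
abbreviation fs :: "(nat set \<times> nat multiset) set \<Rightarrow> ('a qchain) set" where
  "fs B \<equiv> carrier (free_mod R B)"
abbreviation bv :: "nat set \<times> nat multiset \<Rightarrow> 'a qchain" where "bv \<equiv> basis_vec R"
abbreviation sg :: "nat set \<Rightarrow> nat \<Rightarrow> 'a" where "sg \<equiv> koszul_sign R"

lemma FF_module: "Module.module R FF" by (rule free_mod_module)

lemma fsI: "f \<in> carrier FF \<Longrightarrow> (\<And>b. b \<notin> B \<Longrightarrow> f b = \<zero>) \<Longrightarrow> f \<in> fs B"
  by (auto simp: free_mod_carrier)

lemma fs_FF: "f \<in> fs B \<Longrightarrow> f \<in> carrier FF" by (rule free_mod_mono[OF _ subset_UNIV])

lemma free_mod_update: "free_mod R B = FF\<lparr>carrier := fs B\<rparr>" by (simp add: free_mod_def)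

lemma fs_submodule: "submodule (fs B) R FF"
proof -
  interpret F: Module.module R FF by (rule FF_module)
  show ?thesis
    by (rule F.module_incl_imp_submodule) (auto simp: fs_FF free_mod_update[symmetric] free_mod_module)
qed

lemma lin_restrict_FF: "h \<in> lin_maps R FF M \<Longrightarrow> h \<in> lin_maps R (free_mod R B) M"
  by (auto simp: lin_maps_def fs_FF)

lemma lin_fs_image:
  assumes "h \<in> lin_maps R FF FF" "\<And>b. b \<in> B \<Longrightarrow> h (bv b) \<in> fs B'" "f \<in> fs B"
  shows "h f \<in> fs B'"
  by (rule lin_image_in_submodule[OF lin_restrict_FF[OF assms(1)] FF_module fs_submodule assms(2,3)])

lemma lin_eq_on_fs:
  assumes "h \<in> lin_maps R FF M" "g \<in> lin_maps R FF M" "Module.module R M"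
    "\<And>b. b \<in> B \<Longrightarrow> h (bv b) = g (bv b)" "f \<in> fs B"
  shows "h f = g f"
  by (rule lin_eq_on_free[OF lin_restrict_FF[OF assms(1)] lin_restrict_FF[OF assms(2)] assms(3-5)])

lemma bv_FF [simp, intro]: "bv b \<in> carrier FF" by (rule basis_vec_closed) simp

lemma finsum_free_mod_FF:
  assumes "g \<in> S \<rightarrow> fs B"
  shows "finsum (free_mod R B) g S = finsum FF g S"
proof (cases "finite S")
  case True
  have "g \<in> S \<rightarrow> carrier FF" using assms fs_FF by auto
  then show ?thesis using True assms by (simp add: finsum_free_mod del: free_mod_simps)
next
  case False
  interpret F: Module.module R FF by (rule FF_module)
  interpret B: Module.module R "free_mod R B" by (rule free_mod_module)
  show ?thesis using False by (simp add: F.M.finsum_infinite B.M.finsum_infinite)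
qed

lemma lin_ext_free_mod_FF:
  assumes "v \<in> B \<rightarrow> fs B'" "f \<in> fs B"
  shows "lin_ext R (free_mod R B') v f = lin_ext R FF v f"
proof -
  interpret B: Module.module R "free_mod R B'" by (rule free_mod_module)
  have "(\<lambda>b. f b \<odot>\<^bsub>free_mod R B'\<^esub> v b) \<in> {b. f b \<noteq> \<zero>} \<rightarrow> fs B'"
  proof
    fix b assume "b \<in> {b. f b \<noteq> \<zero>}"
    then have "v b \<in> fs B'" using free_mod_support_subset[OF assms(2)] assms(1) by auto
    then show "f b \<odot>\<^bsub>free_mod R B'\<^esub> v b \<in> fs B'" by (rule B.smult_closed[OF free_mod_value[OF assms(2)]])
  qed
  from finsum_free_mod_FF[OF this] show ?thesis by (simp add: lin_ext_def)
qed

definition alt :: "nat \<Rightarrow> 'a" where "alt n = (\<ominus> \<one>) [^] n"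

lemma alt_closed [simp, intro]: "alt n \<in> carrier R" by (simp add: alt_def)
lemma alt_0 [simp]: "alt 0 = \<one>" by (simp add: alt_def)
lemma alt_Suc [simp]: "alt (Suc n) = \<ominus> alt n" by (simp add: alt_def r_minus)

lemma sg_alt: "sg J j = alt (card {i \<in> J. i < j})" by (simp add: koszul_sign_def alt_def)

lemma sg_closed [simp, intro]: "sg J j \<in> carrier R" by (simp add: sg_alt)

lemma sg_swap:
  assumes "finite J" "i \<in> J" "j \<in> J" "i \<noteq> j"
  shows "sg J j \<otimes> sg (J - {j}) i = \<ominus> (sg J i \<otimes> sg (J - {i}) j)"
proof -
  have less: "sg J j \<otimes> sg (J - {j}) i = \<ominus> (sg J i \<otimes> sg (J - {i}) j)" if "i < j" "i \<in> J" "j \<in> J" for i j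
  proof -
    have "{l \<in> J. l < j} = insert i {l \<in> J - {i}. l < j}" using that by auto
    then have "card {l \<in> J. l < j} = Suc (card {l \<in> J - {i}. l < j})" using assms(1) by simp
    then have a: "sg J j = \<ominus> sg (J - {i}) j" by (simp add: sg_alt)
    have "{l \<in> J - {j}. l < i} = {l \<in> J. l < i}" using that by auto
    then have b: "sg (J - {j}) i = sg J i" by (simp add: sg_alt)
    show ?thesis unfolding a b by (simp add: l_minus r_minus m_comm)
  qed
  show ?thesis
  proof (cases "i < j")
    case True
    then show ?thesis using less assms by simp
  next
    case False
    then show ?thesis using less[of j i] assms by simp
  qed
qed

definition contr_basis :: "(nat \<Rightarrow> 'a) \<Rightarrow> (nat \<Rightarrow> nat multiset \<Rightarrow> nat multiset) \<Rightarrow> nat set \<times> nat multiset \<Rightarrow> 'a qchain" where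
  "contr_basis c t = (\<lambda>(J, m). finsum FF (\<lambda>j. (sg J j \<otimes> c j) \<odot>\<^sub>F bv (J - {j}, t j m)) J)"

text \<open>
  Both differentials remove an index j from J with the Koszul sign. The Koszul differential multiplies
  by \<open>u\<^sub>j\<close> and leaves m alone; \<open>\<partial>\<close> has coefficient 1 and adds j to m. So their squares and their
  anticommutator are instances of one computation, which only needs the operations on m to commute.
\<close>

definition contr :: "(nat \<Rightarrow> 'a) \<Rightarrow> (nat \<Rightarrow> nat multiset \<Rightarrow> nat multiset)
    \<Rightarrow> 'a qchain \<Rightarrow> 'a qchain" where
  "contr c t = lin_ext R FF (contr_basis c t)"

lemma smult_FF [intro]: "r \<in> carrier R \<Longrightarrow> x \<in> carrier FF \<Longrightarrow> r \<odot>\<^sub>F x \<in> carrier FF"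
  by (rule Module.module.smult_closed[OF FF_module])

lemma contr_basis_closed:
  assumes c0: "c \<in> UNIV \<rightarrow> carrier R"
  shows "contr_basis c t b \<in> carrier FF"
proof -
  have c: "c j \<in> carrier R" for j using c0 by auto
  interpret F: Module.module R FF by (rule FF_module)
  show ?thesis unfolding contr_basis_def
    by (cases b) (auto intro!: F.M.finsum_closed c smult_FF simp del: free_mod_simps)
qed

lemma contr_lin: "c \<in> UNIV \<rightarrow> carrier R \<Longrightarrow> contr c t \<in> lin_maps R FF FF"
  unfolding contr_def by (rule lin_ext_lin[OF FF_module]) (simp add: contr_basis_closed)

lemma contr_bv:
  assumes "c \<in> UNIV \<rightarrow> carrier R"
  shows "contr c t (bv (J, m)) = finsum FF (\<lambda>j. (sg J j \<otimes> c j) \<odot>\<^sub>F bv (J - {j}, t j m)) J"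
proof -
  have "contr c t (bv (J, m)) = contr_basis c t (J, m)"
    unfolding contr_def using contr_basis_closed[OF assms] by (intro lin_ext_basis FF_module)
  then show ?thesis by (simp add: contr_basis_def)
qed

lemma contr_contr_bv:
  assumes c0: "c \<in> UNIV \<rightarrow> carrier R" and c0': "c' \<in> UNIV \<rightarrow> carrier R"
  shows "contr c' t' (contr c t (bv (J, m))) = finsum FF (\<lambda>j. finsum FF (\<lambda>i.
      ((sg J j \<otimes> sg (J - {j}) i) \<otimes> (c j \<otimes> c' i)) \<odot>\<^sub>F bv (J - {j} - {i}, t' i (t j m))) (J - {j})) J"
proof -
  have c: "c j \<in> carrier R" for j using c0 by auto
  have c': "c' j \<in> carrier R" for j using c0' by auto
  interpret F: Module.module R FF by (rule FF_module)
  note l = contr_lin[OF c0', where t = t']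
  have t1: "(\<lambda>j. (sg J j \<otimes> c j) \<odot>\<^sub>F bv (J - {j}, t j m)) \<in> J \<rightarrow> carrier FF"
    using c by (auto simp del: free_mod_simps)
  have "contr c' t' (contr c t (bv (J, m)))
      = finsum FF (\<lambda>j. contr c' t' ((sg J j \<otimes> c j) \<odot>\<^sub>F bv (J - {j}, t j m))) J"
    unfolding contr_bv[OF c0] by (rule lin_finsum[OF l FF_module FF_module t1])
  also have "\<dots> = finsum FF (\<lambda>j. finsum FF (\<lambda>i.
      ((sg J j \<otimes> sg (J - {j}) i) \<otimes> (c j \<otimes> c' i)) \<odot>\<^sub>F bv (J - {j} - {i}, t' i (t j m))) (J - {j})) J"
  proof (rule F.M.finsum_cong')
    fix j assume "j \<in> J"
    let ?r = "sg J j \<otimes> c j"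
    have r: "?r \<in> carrier R" using c by simp
    have t2: "(\<lambda>i. (sg (J - {j}) i \<otimes> c' i) \<odot>\<^sub>F bv (J - {j} - {i}, t' i (t j m))) \<in> J - {j} \<rightarrow> carrier FF"
      using c' by (auto simp del: free_mod_simps)
    have "contr c' t' (?r \<odot>\<^sub>F bv (J - {j}, t j m)) = ?r \<odot>\<^sub>F contr c' t' (bv (J - {j}, t j m))"
      by (rule lin_smult[OF l r bv_FF])
    also have "\<dots> = finsum FF (\<lambda>i. ?r \<odot>\<^sub>F ((sg (J - {j}) i \<otimes> c' i) \<odot>\<^sub>F bv (J - {j} - {i}, t' i (t j m)))) (J - {j})"
    proof (cases "finite (J - {j})")
      case True
      then show ?thesis unfolding contr_bv[OF c0'] by (rule F.finsum_smult_ldistr[OF _ r t2])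
    next
      case False
      then show ?thesis unfolding contr_bv[OF c0'] using r F.smult_r_null[OF r]
        by (simp add: F.M.finsum_infinite del: free_mod_simps)
    qed
    also have "\<dots> = finsum FF (\<lambda>i. ((sg J j \<otimes> sg (J - {j}) i) \<otimes> (c j \<otimes> c' i)) \<odot>\<^sub>F bv (J - {j} - {i}, t' i (t j m))) (J - {j})"
    proof (rule F.M.finsum_cong')
      fix i assume "i \<in> J - {j}"
      have "?r \<odot>\<^sub>F ((sg (J - {j}) i \<otimes> c' i) \<odot>\<^sub>F bv (J - {j} - {i}, t' i (t j m)))
          = (?r \<otimes> (sg (J - {j}) i \<otimes> c' i)) \<odot>\<^sub>F bv (J - {j} - {i}, t' i (t j m))"
        using c' by (intro F.smult_assoc1[symmetric] r) auto
      also have "?r \<otimes> (sg (J - {j}) i \<otimes> c' i) = (sg J j \<otimes> sg (J - {j}) i) \<otimes> (c j \<otimes> c' i)"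
        using c c' by (simp add: m_ac)
      finally show "?r \<odot>\<^sub>F ((sg (J - {j}) i \<otimes> c' i) \<odot>\<^sub>F bv (J - {j} - {i}, t' i (t j m)))
          = ((sg J j \<otimes> sg (J - {j}) i) \<otimes> (c j \<otimes> c' i)) \<odot>\<^sub>F bv (J - {j} - {i}, t' i (t j m))" .
    qed (use c c' in \<open>auto simp del: free_mod_simps\<close>)
    finally show "contr c' t' (?r \<odot>\<^sub>F bv (J - {j}, t j m)) = finsum FF (\<lambda>i.
      ((sg J j \<otimes> sg (J - {j}) i) \<otimes> (c j \<otimes> c' i)) \<odot>\<^sub>F bv (J - {j} - {i}, t' i (t j m))) (J - {j})" .
  qed (use c c' in \<open>auto simp del: free_mod_simps intro!: F.M.finsum_closed\<close>)
  finally show ?thesis .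
qed

lemma contr_anticommute:
  assumes c0: "c \<in> UNIV \<rightarrow> carrier R" and c0': "c' \<in> UNIV \<rightarrow> carrier R"
    and t: "\<And>i j m. t' i (t j m) = t j (t' i m)" and f: "f \<in> carrier FF"
  shows "contr c' t' (contr c t f) \<oplus>\<^sub>F contr c t (contr c' t' f) = \<zero>\<^sub>F"
proof (rule lin_eq_on_fs[OF _ lin_zero_map[OF FF_module] FF_module _ f])
  have c: "c j \<in> carrier R" for j using c0 by auto
  have c': "c' j \<in> carrier R" for j using c0' by auto
  interpret F: Module.module R FF by (rule FF_module)
  note l = contr_lin[OF c0, where t = t] and l' = contr_lin[OF c0', where t = t']
  show "(\<lambda>f. contr c' t' (contr c t f) \<oplus>\<^sub>F contr c t (contr c' t' f)) \<in> lin_maps R FF FF"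
    by (intro lin_plus FF_module lin_compose[OF l l'] lin_compose[OF l' l])
  fix b :: "nat set \<times> nat multiset"
  obtain J m where b: "b = (J, m)" by (cases b)
  show "contr c' t' (contr c t (bv b)) \<oplus>\<^sub>F contr c t (contr c' t' (bv b)) = \<zero>\<^sub>F"
  proof (cases "finite J")
    case False
    have "contr c t (bv b) = \<zero>\<^sub>F" "contr c' t' (bv b) = \<zero>\<^sub>F"
      unfolding b contr_bv[OF c0] contr_bv[OF c0'] using False by (simp_all add: F.M.finsum_infinite del: free_mod_simps)
    then show ?thesis using lin_zero[OF l FF_module FF_module] lin_zero[OF l' FF_module FF_module]
      by (simp del: free_mod_simps)
  next
    case True
    let ?g = "\<lambda>i j. ((sg J j \<otimes> sg (J - {j}) i) \<otimes> (c j \<otimes> c' i)) \<odot>\<^sub>F bv (J - {j} - {i}, t' i (t j m))"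
    let ?h = "\<lambda>i j. ((sg J j \<otimes> sg (J - {j}) i) \<otimes> (c' j \<otimes> c i)) \<odot>\<^sub>F bv (J - {j} - {i}, t i (t' j m))"
    have gc: "?g i j \<in> carrier FF" and hc: "?h i j \<in> carrier FF" for i j
      using c c' by (auto simp del: free_mod_simps)
    have gh: "?g i j = \<ominus>\<^sub>F ?h j i" if ij: "i \<in> J" "j \<in> J" "i \<noteq> j" for i j
    proof -
      have s: "J - {j} - {i} = J - {i} - {j}" by auto
      have "(sg J j \<otimes> sg (J - {j}) i) \<otimes> (c j \<otimes> c' i) = \<ominus> ((sg J i \<otimes> sg (J - {i}) j) \<otimes> (c' i \<otimes> c j))"
        unfolding sg_swap[OF True ij] using c c' by (simp add: l_minus r_minus m_comm)
      moreover have "(\<ominus> ((sg J i \<otimes> sg (J - {i}) j) \<otimes> (c' i \<otimes> c j))) \<odot>\<^sub>F bv (J - {i} - {j}, t j (t' i m)) = \<ominus>\<^sub>F ?h j i"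
        using c c' by (intro F.smult_l_minus) auto
      ultimately show ?thesis unfolding t s by (simp del: free_mod_simps)
    qed
    have dbl: "finsum FF (\<lambda>j. finsum FF (\<lambda>i. ?g i j) (J - {j})) J \<oplus>\<^sub>F finsum FF (\<lambda>j. finsum FF (\<lambda>i. ?h i j) (J - {j})) J
        = finsum FF (\<lambda>j. finsum FF (\<lambda>i. ?g i j \<oplus>\<^sub>F ?h i j) (J - {j})) J"
    proof -
      have G: "(\<lambda>j. finsum FF (\<lambda>i. ?g i j) (J - {j})) \<in> J \<rightarrow> carrier FF" "(\<lambda>j. finsum FF (\<lambda>i. ?h i j) (J - {j})) \<in> J \<rightarrow> carrier FF"
        using gc hc by (auto intro!: F.M.finsum_closed simp del: free_mod_simps)
      show ?thesis
        unfolding F.M.finsum_addf[OF G, symmetric]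
        by (intro F.M.finsum_cong' refl F.M.finsum_addf[symmetric])
          (use gc hc in \<open>auto intro!: F.M.finsum_closed F.M.a_closed simp del: free_mod_simps\<close>)
    qed
    have "finsum FF (\<lambda>j. finsum FF (\<lambda>i. ?g i j \<oplus>\<^sub>F ?h i j) (J - {j})) J = \<zero>\<^sub>F"
    proof (rule F.M.antisymmetric_double_sum[OF True], intro conjI)
      fix i j assume ij: "i \<in> J" "j \<in> J" "i \<noteq> j"
      show "?g i j \<oplus>\<^sub>F ?h i j \<in> carrier FF" by (rule F.M.a_closed[OF gc hc])
      have "?g j i = \<ominus>\<^sub>F ?h i j" using gh[of j i] ij by blast
      then have "?h i j = \<ominus>\<^sub>F ?g j i" using F.M.minus_minus[OF hc[of j i]] by (simp only:)
      then show "?g i j \<oplus>\<^sub>F ?h i j = \<ominus>\<^sub>F (?g j i \<oplus>\<^sub>F ?h j i)"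
        unfolding gh[OF ij] F.M.minus_add[OF gc hc] using gc hc by (simp add: F.M.a_comm del: free_mod_simps)
    qed
    then show ?thesis unfolding b contr_contr_bv[OF c0 c0'] contr_contr_bv[OF c0' c0] dbl .
  qed
qed

lemma contr_square:
  assumes c0: "c \<in> UNIV \<rightarrow> carrier R" and t: "\<And>i j m. t i (t j m) = t j (t i m)" and f: "f \<in> carrier FF"
  shows "contr c t (contr c t f) = \<zero>\<^sub>F"
proof (rule lin_eq_on_fs[OF _ lin_zero_map[OF FF_module] FF_module _ f])
  have c: "c j \<in> carrier R" for j using c0 by auto
  interpret F: Module.module R FF by (rule FF_module)
  note l = contr_lin[OF c0, where t = t]
  show "(\<lambda>f. contr c t (contr c t f)) \<in> lin_maps R FF FF" by (rule lin_compose[OF l l])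
  fix b :: "nat set \<times> nat multiset"
  obtain J m where b: "b = (J, m)" by (cases b)
  show "contr c t (contr c t (bv b)) = \<zero>\<^sub>F"
  proof (cases "finite J")
    case False
    have "contr c t (bv b) = \<zero>\<^sub>F"
      unfolding b contr_bv[OF c0] using False by (simp add: F.M.finsum_infinite del: free_mod_simps)
    then show ?thesis using lin_zero[OF l FF_module FF_module] by (simp del: free_mod_simps)
  next
    case True
    show ?thesis unfolding b contr_contr_bv[OF c0 c0]
    proof (rule F.M.antisymmetric_double_sum[OF True], intro conjI)
      fix i j assume ij: "i \<in> J" "j \<in> J" "i \<noteq> j"
      show "((sg J j \<otimes> sg (J - {j}) i) \<otimes> (c j \<otimes> c i)) \<odot>\<^sub>F bv (J - {j} - {i}, t i (t j m)) \<in> carrier FF"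
        using c by (auto simp del: free_mod_simps)
      have s: "J - {j} - {i} = J - {i} - {j}" by auto
      have e: "(sg J j \<otimes> sg (J - {j}) i) \<otimes> (c j \<otimes> c i) = \<ominus> ((sg J i \<otimes> sg (J - {i}) j) \<otimes> (c i \<otimes> c j))"
        unfolding sg_swap[OF True ij] using c by (simp add: l_minus r_minus m_comm)
      show "((sg J j \<otimes> sg (J - {j}) i) \<otimes> (c j \<otimes> c i)) \<odot>\<^sub>F bv (J - {j} - {i}, t i (t j m))
          = \<ominus>\<^sub>F (((sg J i \<otimes> sg (J - {i}) j) \<otimes> (c i \<otimes> c j)) \<odot>\<^sub>F bv (J - {i} - {j}, t j (t i m)))"
        unfolding e s t[of i j] using c by (intro F.smult_l_minus) auto
    qed
  qed
qed

lemma contr_fs: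
  assumes c0: "c \<in> UNIV \<rightarrow> carrier R" and f: "f \<in> fs B"
    and B: "\<And>J m j. (J, m) \<in> B \<Longrightarrow> finite J \<Longrightarrow> j \<in> J \<Longrightarrow> c j \<noteq> \<zero> \<Longrightarrow> (J - {j}, t j m) \<in> B'"
  shows "contr c t f \<in> fs B'"
proof (rule lin_fs_image[OF contr_lin[OF c0] _ f])
  have c: "c j \<in> carrier R" for j using c0 by auto
  interpret F: Module.module R FF by (rule FF_module)
  interpret B': Module.module R "free_mod R B'" by (rule free_mod_module)
  fix b assume b: "b \<in> B"
  obtain J m where bJ: "b = (J, m)" by (cases b)
  show "contr c t (bv b) \<in> fs B'"
    unfolding bJ contr_bv[OF c0]
  proof (cases "finite J")
    case True
    show "finsum FF (\<lambda>j. (sg J j \<otimes> c j) \<odot>\<^sub>F bv (J - {j}, t j m)) J \<in> fs B'"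
    proof (rule finsum_in_submodule[OF fs_submodule FF_module], rule Pi_I)
      fix j assume j: "j \<in> J"
      show "(sg J j \<otimes> c j) \<odot>\<^sub>F bv (J - {j}, t j m) \<in> fs B'"
      proof (cases "c j = \<zero>")
        case True
        have "\<zero> \<odot>\<^sub>F bv (J - {j}, t j m) = \<zero>\<^sub>F" by (rule F.smult_l_null) simp
        then show ?thesis using True submodule_zero[OF FF_module fs_submodule[of B']] by (simp del: free_mod_simps)
      next
        case False
        have "bv (J - {j}, t j m) \<in> fs B'" by (rule basis_vec_closed[OF B[OF b[unfolded bJ] True j False]])
        then show ?thesis using Module.module.submoduleE(4)[OF FF_module fs_submodule] c by (simp del: free_mod_simps)
      qed
    qed
  next
    case False
    then show "finsum FF (\<lambda>j. (sg J j \<otimes> c j) \<odot>\<^sub>F bv (J - {j}, t j m)) J \<in> fs B'"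
      using submodule_zero[OF FF_module fs_submodule[of B']] by (simp add: F.M.finsum_infinite del: free_mod_simps)
  qed
qed

definition restr :: "(nat set \<times> nat multiset \<Rightarrow> bool) \<Rightarrow> 'a qchain \<Rightarrow> 'a qchain" where
  "restr P f = (\<lambda>b. if P b then f b else \<zero>)"

lemma restr_fs: "f \<in> fs B \<Longrightarrow> restr P f \<in> fs {b \<in> B. P b}"
  by (auto simp: restr_def free_mod_carrier elim!: finite_subset[rotated])

lemma restr_FF: "f \<in> carrier FF \<Longrightarrow> restr P f \<in> carrier FF"
  by (rule fs_FF[OF restr_fs])

lemma restr_lin: "restr P \<in> lin_maps R FF FF"
  by (rule lin_mapsI) (auto simp: restr_FF[unfolded restr_def] restr_def)

lemma restr_id: "f \<in> fs {b. P b} \<Longrightarrow> restr P f = f"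
  by (auto simp: restr_def free_mod_carrier)

lemma restr_zero: "f \<in> fs {b. \<not> P b} \<Longrightarrow> restr P f = \<zero>\<^sub>F"
  by (auto simp: restr_def free_mod_carrier)

lemma restr_contr:
  assumes c0: "c \<in> UNIV \<rightarrow> carrier R" and P: "\<And>J m j. j \<in> J \<Longrightarrow> P' (J - {j}, t j m) \<longleftrightarrow> P (J, m)"
    and f: "f \<in> carrier FF"
  shows "restr P' (contr c t f) = contr c t (restr P f)"
proof (rule lin_eq_on_fs[OF lin_compose[OF contr_lin[OF c0] restr_lin] lin_compose[OF restr_lin contr_lin[OF c0]] FF_module _ f])
  have c: "c j \<in> carrier R" for j using c0 by auto
  fix b :: "nat set \<times> nat multiset"
  obtain J m where b: "b = (J, m)" by (cases b)
  show "restr P' (contr c t (bv b)) = contr c t (restr P (bv b))"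
  proof (cases "P b")
    case True
    have "bv b \<in> fs {b}" by (rule basis_vec_closed) simp
    from contr_fs[OF c0 this] have "contr c t (bv b) \<in> fs {b. P' b}" using True P b by auto
    moreover have "restr P (bv b) = bv b" using True by (auto simp: restr_def basis_vec_def)
    ultimately show ?thesis by (simp add: restr_id)
  next
    case False
    have "bv b \<in> fs {b}" by (rule basis_vec_closed) simp
    from contr_fs[OF c0 this] have "contr c t (bv b) \<in> fs {b. \<not> P' b}" using False P b by auto
    moreover have "restr P (bv b) = \<zero>\<^sub>F" using False by (auto simp: restr_def basis_vec_def)
    ultimately show ?thesis using lin_zero[OF contr_lin[OF c0] FF_module FF_module] by (simp add: restr_zero del: free_mod_simps)
  qed
qed

section \<open>The contracting homotopy\<close>

text \<open>The map \<open>\<partial>\<close> on all columns at once.\<close>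

definition del :: "'a qchain \<Rightarrow> 'a qchain" where
  "del = contr (\<lambda>j. \<one>) add_mset"

lemma del_lin: "del \<in> lin_maps R FF FF" unfolding del_def by (rule contr_lin) auto

lemma del_del: "f \<in> carrier FF \<Longrightarrow> del (del f) = \<zero>\<^sub>F"
  unfolding del_def by (rule contr_square) auto

lemma del_fs:
  assumes "f \<in> fs B" "\<And>J m j. (J, m) \<in> B \<Longrightarrow> finite J \<Longrightarrow> j \<in> J \<Longrightarrow> (J - {j}, add_mset j m) \<in> B'"
  shows "del f \<in> fs B'"
  unfolding del_def by (rule contr_fs[OF _ assms(1)]) (use assms(2) in auto)

text \<open>
  With x the smallest index that occurs in J or in m, the homotopy moves x from m to J when x does not
  lie in J, and is zero otherwise. As x precedes every element of J, no sign is needed; and no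
  denominators occur, in contrast with the usual homotopy of the polynomial de Rham complex, which
  divides by the total degree.
\<close>

definition hom_basis :: "nat set \<times> nat multiset \<Rightarrow> 'a qchain" where
  "hom_basis = (\<lambda>(J, m). let x = Min (J \<union> set_mset m) in
     if x \<in># m \<and> x \<notin> J then bv (insert x J, m - {#x#}) else \<zero>\<^sub>F)"

definition hom :: "'a qchain \<Rightarrow> 'a qchain" where
  "hom = lin_ext R FF hom_basis"

lemma hom_basis_closed: "hom_basis b \<in> carrier FF"
  using Module.module.axioms(2)[OF FF_module, THEN abelian_group.axioms(1), THEN abelian_monoid.zero_closed]
  by (cases b) (simp add: hom_basis_def Let_def del: free_mod_simps)

lemma hom_lin: "hom \<in> lin_maps R FF FF"
  unfolding hom_def by (rule lin_ext_lin[OF FF_module]) (simp add: hom_basis_closed)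

lemma hom_bv: "hom (bv b) = hom_basis b"
  unfolding hom_def using hom_basis_closed by (intro lin_ext_basis FF_module)

lemma hom_fs:
  assumes "f \<in> fs B" "\<And>J m x. (J, m) \<in> B \<Longrightarrow> x \<in># m \<Longrightarrow> x \<notin> J \<Longrightarrow> (insert x J, m - {#x#}) \<in> B'"
  shows "hom f \<in> fs B'"
proof (rule lin_fs_image[OF hom_lin _ assms(1)])
  fix b assume "b \<in> B"
  then show "hom (bv b) \<in> fs B'"
    unfolding hom_bv using assms(2) submodule_zero[OF FF_module fs_submodule[of B']]
    by (cases b) (auto simp: hom_basis_def Let_def simp del: free_mod_simps intro!: basis_vec_closed)
qed

text \<open>
  The map \<open>\<partial>\<close> keeps the union of J and m, hence also the smallest index x. If x lies in J, the homotopy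
  vanishes on \<open>e\<^sub>J u\<^sub>m\<close>, and in its composite with \<open>\<partial>\<close> only the term that moves x to m survives, and is moved
  back. If x does not lie in J, all terms but the one that returns x to m cancel in pairs, as inserting
  x into J changes the sign of every other index. Only the pair of the empty set and the empty
  multiset, where there is no x, is excluded.
\<close>

lemma hom_identity:
  assumes f: "f \<in> fs B" and B: "\<And>J m. (J, m) \<in> B \<Longrightarrow> finite J \<and> \<not> (J = {} \<and> m = {#})"
  shows "del (hom f) \<oplus>\<^sub>F hom (del f) = f"
proof -
  interpret F: Module.module R FF by (rule FF_module)
  have "(\<lambda>f. del (hom f) \<oplus>\<^sub>F hom (del f)) f = (\<lambda>f. f) f"
  proof (rule lin_eq_on_fs[OF _ lin_id FF_module _ f])
    show "(\<lambda>f. del (hom f) \<oplus>\<^sub>F hom (del f)) \<in> lin_maps R FF FF"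
      by (intro lin_plus FF_module lin_compose[OF hom_lin del_lin] lin_compose[OF del_lin hom_lin])
    fix b assume b: "b \<in> B"
    obtain J m where bJ: "b = (J, m)" by (cases b)
    have J: "finite J" and ne: "J \<union> set_mset m \<noteq> {}" using B b bJ by auto
    define x where "x = Min (J \<union> set_mset m)"
    have x: "x \<in> J \<union> set_mset m" unfolding x_def by (rule Min_in) (use J ne in auto)
    have xmin: "x \<le> y" if "y \<in> J \<union> set_mset m" for y unfolding x_def by (rule Min_le) (use J that in auto)
    have del_bv: "del (bv (J, m)) = finsum FF (\<lambda>j. sg J j \<odot>\<^sub>F bv (J - {j}, add_mset j m)) J" for J m
      unfolding del_def by (subst contr_bv) (simp_all del: free_mod_simps)
    have tc: "(\<lambda>j. sg J j \<odot>\<^sub>F bv (J - {j}, add_mset j m)) \<in> J \<rightarrow> carrier FF" for J m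
      by (auto simp del: free_mod_simps)
    have hd: "hom (del (bv (J, m))) = finsum FF (\<lambda>j. sg J j \<odot>\<^sub>F hom_basis (J - {j}, add_mset j m)) J"
    proof -
      have "hom (del (bv (J, m))) = finsum FF (\<lambda>j. hom (sg J j \<odot>\<^sub>F bv (J - {j}, add_mset j m))) J"
        unfolding del_bv by (rule lin_finsum[OF hom_lin FF_module FF_module tc])
      also have "\<dots> = finsum FF (\<lambda>j. sg J j \<odot>\<^sub>F hom_basis (J - {j}, add_mset j m)) J"
        by (rule F.M.finsum_cong')
          (auto simp: lin_smult[OF hom_lin sg_closed bv_FF] hom_bv simp del: free_mod_simps intro!: smult_FF hom_basis_closed)
      finally show ?thesis .
    qed
    have min': "Min ((J - {j}) \<union> set_mset (add_mset j m)) = x" if "j \<in> J" for j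
    proof -
      have "(J - {j}) \<union> set_mset (add_mset j m) = J \<union> set_mset m" using that by auto
      then show ?thesis by (simp add: x_def)
    qed
    show "del (hom (bv b)) \<oplus>\<^sub>F hom (del (bv b)) = bv b"
    proof (cases "x \<in> J")
      case True
      have h0: "hom (bv b) = \<zero>\<^sub>F" unfolding hom_bv bJ hom_basis_def using True by (simp add: Let_def x_def)
      have sx: "sg J x = \<one>"
      proof -
        have e: "{i \<in> J. i < x} = {}" using xmin by force
        show ?thesis unfolding sg_alt e by simp
      qed
      have "hom (del (bv (J, m))) = finsum FF (\<lambda>j. if x = j then bv (J, m) else \<zero>\<^sub>F) J"
        unfolding hd
      proof (rule F.M.finsum_cong')
        fix j assume j: "j \<in> J"
        show "sg J j \<odot>\<^sub>F hom_basis (J - {j}, add_mset j m) = (if x = j then bv (J, m) else \<zero>\<^sub>F)"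
        proof (cases "x = j")
          case True
          then have "hom_basis (J - {j}, add_mset j m) = bv (J, m)"
            unfolding hom_basis_def using min'[OF j] j by (simp add: Let_def insert_absorb)
          then show ?thesis using True sx by (simp del: free_mod_simps)
        next
          case False
          then have "hom_basis (J - {j}, add_mset j m) = \<zero>\<^sub>F"
            unfolding hom_basis_def using min'[OF j] \<open>x \<in> J\<close> by (simp add: Let_def)
          then show ?thesis using False by (simp add: F.smult_r_null[OF sg_closed] del: free_mod_simps)
        qed
      qed (auto simp del: free_mod_simps)
      also have "\<dots> = bv (J, m)" by (rule F.M.finsum_singleton[OF True J]) auto
      finally have hd': "hom (del (bv (J, m))) = bv (J, m)" .
      show ?thesis
        unfolding h0 lin_zero[OF del_lin FF_module FF_module] unfolding bJ hd' by (rule F.M.l_zero[OF bv_FF])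
    next
      case False
      then have xm: "x \<in># m" using x by auto
      have xl: "x < j" if "j \<in> J" for j using xmin[of j] that False by (cases "x = j") auto
      let ?J = "insert x J" and ?m = "m - {#x#}"
      let ?t = "\<lambda>j. sg J j \<odot>\<^sub>F bv (insert x (J - {j}), add_mset j m - {#x#})"
      have tF: "?t j \<in> carrier FF" for j by (auto simp del: free_mod_simps)
      have h1: "hom (bv b) = bv (?J, ?m)" unfolding hom_bv bJ hom_basis_def using False xm by (simp add: Let_def x_def)
      have sx: "sg ?J x = \<one>"
      proof -
        have e: "{i \<in> ?J. i < x} = {}" using xl by force
        show ?thesis unfolding sg_alt e by simp
      qed
      have sj: "sg ?J j = \<ominus> sg J j" if "j \<in> J" for j
      proof -
        have e: "{i \<in> ?J. i < j} = insert x {i \<in> J. i < j}" using xl[OF that] by auto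
        show ?thesis unfolding sg_alt e using False J by simp
      qed
      have "del (hom (bv b)) = sg ?J x \<odot>\<^sub>F bv (?J - {x}, add_mset x ?m)
          \<oplus>\<^sub>F finsum FF (\<lambda>j. sg ?J j \<odot>\<^sub>F bv (?J - {j}, add_mset j ?m)) J"
        unfolding h1 del_bv by (rule F.M.finsum_insert[OF J False]) (auto simp del: free_mod_simps)
      also have "sg ?J x \<odot>\<^sub>F bv (?J - {x}, add_mset x ?m) = bv b"
        using False xm sx unfolding bJ by (simp del: free_mod_simps)
      also have "finsum FF (\<lambda>j. sg ?J j \<odot>\<^sub>F bv (?J - {j}, add_mset j ?m)) J = finsum FF (\<lambda>j. \<ominus>\<^sub>F ?t j) J"
      proof (rule F.M.finsum_cong')
        fix j assume j: "j \<in> J"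
        have "?J - {j} = insert x (J - {j})" using xl[OF j] by auto
        moreover have "add_mset j ?m = add_mset j m - {#x#}" using xl[OF j] xm by (simp add: multiset_eq_iff)
        ultimately show "sg ?J j \<odot>\<^sub>F bv (?J - {j}, add_mset j ?m) = \<ominus>\<^sub>F ?t j"
          unfolding sj[OF j] by (simp add: F.smult_l_minus[OF sg_closed bv_FF] del: free_mod_simps)
      qed (use tF in \<open>auto simp del: free_mod_simps\<close>)
      finally have d: "del (hom (bv b)) = bv b \<oplus>\<^sub>F finsum FF (\<lambda>j. \<ominus>\<^sub>F ?t j) J" .
      have hd': "hom (del (bv b)) = finsum FF ?t J"
        unfolding bJ hd
      proof (rule F.M.finsum_cong')
        fix j assume j: "j \<in> J"
        have "hom_basis (J - {j}, add_mset j m) = bv (insert x (J - {j}), add_mset j m - {#x#})"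
          unfolding hom_basis_def using min'[OF j] False xm by (simp add: Let_def)
        then show "sg J j \<odot>\<^sub>F hom_basis (J - {j}, add_mset j m) = ?t j" by (simp del: free_mod_simps)
      qed (use tF in \<open>auto simp del: free_mod_simps\<close>)
      have nc: "(\<lambda>j. \<ominus>\<^sub>F ?t j) \<in> J \<rightarrow> carrier FF" "?t \<in> J \<rightarrow> carrier FF"
        using tF F.M.a_inv_closed by blast+
      have "finsum FF (\<lambda>j. \<ominus>\<^sub>F ?t j) J \<oplus>\<^sub>F finsum FF ?t J = finsum FF (\<lambda>j. \<ominus>\<^sub>F ?t j \<oplus>\<^sub>F ?t j) J"
        by (rule F.M.finsum_addf[OF nc, symmetric])
      also have "\<dots> = \<zero>\<^sub>F" by (simp only: F.M.l_neg[OF tF] F.M.finsum_zero)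
      finally have z: "finsum FF (\<lambda>j. \<ominus>\<^sub>F ?t j) J \<oplus>\<^sub>F finsum FF ?t J = \<zero>\<^sub>F" .
      show ?thesis unfolding d hd'
        using F.M.a_assoc[OF bv_FF F.M.finsum_closed[OF nc(1)] F.M.finsum_closed[OF nc(2)]] z
        by (simp only: F.M.r_zero[OF bv_FF])
    qed
  qed
  then show ?thesis .
qed

end

section \<open>The ring as a module over itself\<close>

lemma reg_mod_simps [simp]:
  "carrier (reg_mod R) = carrier R" "\<zero>\<^bsub>reg_mod R\<^esub> = \<zero>\<^bsub>R\<^esub>"
  "x \<oplus>\<^bsub>reg_mod R\<^esub> y = x \<oplus>\<^bsub>R\<^esub> y" "r \<odot>\<^bsub>reg_mod R\<^esub> x = r \<otimes>\<^bsub>R\<^esub> x"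
  by (simp_all add: reg_mod_def)

lemma reg_mod_coset [simp]: "a_r_coset (reg_mod R) = a_r_coset R"
  by (simp add: fun_eq_iff a_r_coset_def')

lemma reg_mod_minus [simp]: "x \<ominus>\<^bsub>reg_mod R\<^esub> y = x \<ominus>\<^bsub>R\<^esub> y"
  by (simp add: a_minus_def a_inv_def m_inv_def)

context cring
begin

lemma reg_mod_module: "Module.module R (reg_mod R)"
proof -
  have "abelian_group (reg_mod R)"
    by (rule abelian_groupI) (auto simp: a_ac intro: bexI[of _ "\<ominus> _"] l_neg)
  then show ?thesis by (intro moduleI cring_axioms) (auto simp: l_distr r_distr m_assoc)
qed

lemma ideal_submodule: "ideal K R \<Longrightarrow> submodule K R (reg_mod R)"
proof -
  assume "ideal K R"
  then interpret K: ideal K R .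
  interpret M: Module.module R "reg_mod R" by (rule reg_mod_module)
  have "\<ominus>\<^bsub>reg_mod R\<^esub> x = \<ominus> x" for x by (simp add: a_inv_def m_inv_def)
  then show ?thesis by (intro M.submoduleI) (auto simp: K.I_l_closed)
qed

lemma submodule_ideal:
  assumes "submodule K R (reg_mod R)"
  shows "ideal K R"
proof -
  interpret M: Module.module R "reg_mod R" by (rule reg_mod_module)
  note E = M.submoduleE[OF assms]
  have neg: "\<ominus>\<^bsub>reg_mod R\<^esub> x = \<ominus> x" for x by (simp add: a_inv_def m_inv_def)
  show ?thesis
  proof (rule idealI[OF ring_axioms])
    show "subgroup K (add_monoid R)"
      by (rule subgroup.intro)
        (use E submodule_zero[OF reg_mod_module assms] neg in \<open>auto simp: a_inv_def[symmetric]\<close>)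
    fix a x assume "a \<in> K" "x \<in> carrier R"
    then show "x \<otimes> a \<in> K" "a \<otimes> x \<in> K" using E(4)[of x a] E(1) m_comm[of a x] by auto
  qed
qed

lemma smult_vector_lin:
  assumes "Module.module R M" "v \<in> carrier M"
  shows "(\<lambda>r. r \<odot>\<^bsub>M\<^esub> v) \<in> lin_maps R (reg_mod R) M"
proof -
  interpret M: Module.module R M by fact
  show ?thesis using assms(2) by (intro lin_mapsI) (simp_all add: M.smult_l_distr M.smult_assoc1)
qed

lemma ideal_smult_preimage:
  fixes M :: "('a, 'm) module"
  assumes "Module.module R M" "v \<in> carrier M" "submodule H R M"
  shows "ideal {r \<in> carrier R. r \<odot>\<^bsub>M\<^esub> v \<in> H} R"
  using submodule_ideal[OF lin_kernel_submodule[OF smult_vector_lin[OF assms(1,2)] reg_mod_module assms(1,3)]] by simp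

end

section \<open>The Koszul complex of a regular sequence\<close>

lemma seq_index_interval: "n \<in> seq_index N \<Longrightarrow> {1..n} \<subseteq> seq_index N"
  by (auto simp: seq_index_def) (meson dual_order.trans enat_ord_simps(1))

lemma finite_subset_seq_index:
  assumes "finite J" "J \<subseteq> seq_index N"
  obtains n where "J \<subseteq> {1..n}" "{1..n} \<subseteq> seq_index N"
proof (cases "J = {}")
  case True
  then show ?thesis using that[of 0] by simp
next
  case False
  have "Max J \<in> seq_index N" using assms Max_in[OF assms(1) False] by auto
  moreover have "J \<subseteq> {1..Max J}" using assms by (auto simp: seq_index_def)
  ultimately show ?thesis using that seq_index_interval by blast
qed

locale koszul = cring R for R (structure) +
  fixes N :: enat and u :: "nat \<Rightarrow> 'a"
  assumes u_closed: "u \<in> seq_index N \<rightarrow> carrier R"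
begin

abbreviation X where "X \<equiv> seq_index N"

definition w :: "nat \<Rightarrow> 'a" where "w j = (if j \<in> X then u j else \<zero>)"

lemma w_Pi: "w \<in> UNIV \<rightarrow> carrier R" using u_closed by (auto simp: w_def)
lemma w_closed [simp, intro]: "w j \<in> carrier R" using w_Pi by auto

definition kd :: "'a qchain \<Rightarrow> 'a qchain" where
  "kd = contr w (\<lambda>j m. m)"

lemma kd_lin: "kd \<in> lin_maps R FF FF" unfolding kd_def by (rule contr_lin[OF w_Pi])

lemma kd_kd: "f \<in> carrier FF \<Longrightarrow> kd (kd f) = \<zero>\<^sub>F"
  unfolding kd_def by (rule contr_square[OF w_Pi]) auto

lemma kd_del: "f \<in> carrier FF \<Longrightarrow> kd (del f) \<oplus>\<^sub>F del (kd f) = \<zero>\<^sub>F"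
  unfolding kd_def del_def by (rule contr_anticommute) (auto simp: w_Pi)

lemma kd_fs:
  assumes "f \<in> fs B" "\<And>J m j. (J, m) \<in> B \<Longrightarrow> finite J \<Longrightarrow> j \<in> J \<Longrightarrow> j \<in> X \<Longrightarrow> (J - {j}, m) \<in> B'"
  shows "kd f \<in> fs B'"
  unfolding kd_def
proof (rule contr_fs[OF w_Pi assms(1)])
  fix J m j assume "(J, m) \<in> B" "finite J" "j \<in> J" "w j \<noteq> \<zero>"
  then show "(J - {j}, m) \<in> B'" by (intro assms(2)) (auto simp: w_def split: if_splits)
qed

lemma kd_bv: "kd (bv (J, m)) = finsum FF (\<lambda>j. (sg J j \<otimes> w j) \<odot>\<^sub>F bv (J - {j}, m)) J"
  unfolding kd_def by (rule contr_bv[OF w_Pi])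

lemma kd_bv_single: "kd (bv ({j}, m)) = w j \<odot>\<^sub>F bv ({}, m)"
proof -
  interpret F: Module.module R FF by (rule FF_module)
  have e: "{i \<in> {j}. i < j} = {}" by auto
  have "sg {j} j = \<one>" unfolding sg_alt e by simp
  then show ?thesis unfolding kd_bv by (subst F.M.finsum_insert) (auto simp: F.M.r_zero simp del: free_mod_simps)
qed

lemma kd_values:
  assumes K: "ideal K R" and f: "f \<in> fs B" and B: "\<And>J m j. (J, m) \<in> B \<Longrightarrow> j \<in> J \<Longrightarrow> w j \<in> K"
  shows "kd f b \<in> K"
proof -
  interpret K: ideal K R by fact
  have sub: "submodule (ideal_span K FF) R FF" by (rule ideal_span_submodule[OF FF_module K.a_subset])
  have "kd f \<in> ideal_span K FF"
  proof (rule lin_image_in_submodule[OF lin_restrict_FF[OF kd_lin] FF_module sub _ f])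
    fix b assume b: "b \<in> B"
    obtain J m where bJ: "b = (J, m)" by (cases b)
    show "kd (bv b) \<in> ideal_span K FF"
      unfolding bJ kd_bv
    proof (rule finsum_in_submodule[OF sub FF_module], rule Pi_I)
      fix j assume "j \<in> J"
      then have "sg J j \<otimes> w j \<in> K" using B b bJ by (intro K.I_l_closed) auto
      then show "(sg J j \<otimes> w j) \<odot>\<^sub>F bv (J - {j}, m) \<in> ideal_span K FF"
        by (rule ideal_span_incl[OF FF_module K.a_subset _ bv_FF])
    qed
  qed
  then show ?thesis unfolding ideal_span_free_mod[OF cring_axioms K] by blast
qed

text \<open>
  The Koszul complex of the first n members of the sequence, in exterior degree p, with
  multiplicities in S carried along as labels.
\<close>

definition sq_basis :: "nat \<Rightarrow> nat \<Rightarrow> nat multiset set \<Rightarrow> (nat set \<times> nat multiset) set" where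
  "sq_basis n p S = {(J, m). J \<subseteq> {1..n} \<and> card J = p \<and> m \<in> S}"

text \<open>
  For n greater than all members of J this is right multiplication by \<open>e\<^sub>n\<close>; the operation that follows it
  reads off the coefficient of \<open>e\<^sub>n\<close>.
\<close>

definition wedge :: "nat \<Rightarrow> 'a qchain \<Rightarrow> 'a qchain" where
  "wedge n f = (\<lambda>(J, m). if n \<in> J then f (J - {n}, m) else \<zero>)"

definition unwedge :: "nat \<Rightarrow> 'a qchain \<Rightarrow> 'a qchain" where
  "unwedge n f = (\<lambda>(J, m). if n \<in> J then \<zero> else f (insert n J, m))"

lemma wedge_FF: "f \<in> carrier FF \<Longrightarrow> wedge n f \<in> carrier FF"
proof -
  assume f: "f \<in> carrier FF"
  have "{b. wedge n f b \<noteq> \<zero>} \<subseteq> (\<lambda>(J, m). (insert n J, m)) ` {b. f b \<noteq> \<zero>}"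
  proof
    fix b assume b: "b \<in> {b. wedge n f b \<noteq> \<zero>}"
    obtain J m where "b = (J, m)" by (cases b)
    then have "n \<in> J" "f (J - {n}, m) \<noteq> \<zero>" "b = (insert n (J - {n}), m)" using b by (auto simp: wedge_def split: if_splits)
    then show "b \<in> (\<lambda>(J, m). (insert n J, m)) ` {b. f b \<noteq> \<zero>}" by (intro image_eqI[where x = "(J - {n}, m)"]) auto
  qed
  then have "finite {b. wedge n f b \<noteq> \<zero>}" using free_mod_support[OF f] finite_surj by blast
  then show ?thesis using free_mod_value[OF f] by (auto simp: free_mod_carrier wedge_def)
qed

lemma unwedge_FF: "f \<in> carrier FF \<Longrightarrow> unwedge n f \<in> carrier FF"
proof -
  assume f: "f \<in> carrier FF"
  have "{b. unwedge n f b \<noteq> \<zero>} \<subseteq> (\<lambda>(J, m). (J - {n}, m)) ` {b. f b \<noteq> \<zero>}"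
  proof
    fix b assume b: "b \<in> {b. unwedge n f b \<noteq> \<zero>}"
    obtain J m where "b = (J, m)" by (cases b)
    then have "n \<notin> J" "f (insert n J, m) \<noteq> \<zero>" "b = (insert n J - {n}, m)" using b by (auto simp: unwedge_def split: if_splits)
    then show "b \<in> (\<lambda>(J, m). (J - {n}, m)) ` {b. f b \<noteq> \<zero>}" by (intro image_eqI[where x = "(insert n J, m)"]) auto
  qed
  then have "finite {b. unwedge n f b \<noteq> \<zero>}" using free_mod_support[OF f] finite_surj by blast
  then show ?thesis using free_mod_value[OF f] by (auto simp: free_mod_carrier unwedge_def)
qed

lemma wedge_lin: "wedge n \<in> lin_maps R FF FF"
  by (rule lin_mapsI) (auto simp: wedge_FF[unfolded wedge_def] wedge_def fun_eq_iff)

lemma wedge_bv: "n \<notin> J \<Longrightarrow> wedge n (bv (J, m)) = bv (insert n J, m)"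
proof
  fix b assume "n \<notin> J"
  then show "wedge n (bv (J, m)) b = bv (insert n J, m) b"
    by (cases b) (auto simp: wedge_def basis_vec_def)
qed

text \<open>
  The factor \<open>alt q\<close> appears because \<open>e\<^sub>n\<close> is put last, behind q other generators.
\<close>

lemma kd_wedge:
  assumes f: "f \<in> fs (sq_basis n q S)" and n: "Suc n \<in> X"
  shows "kd (wedge (Suc n) f) = wedge (Suc n) (kd f) \<oplus>\<^sub>F (alt q \<otimes> u (Suc n)) \<odot>\<^sub>F f"
proof (rule lin_eq_on_fs[OF lin_compose[OF wedge_lin kd_lin] _ FF_module _ f])
  interpret F: Module.module R FF by (rule FF_module)
  let ?n = "Suc n"
  have c: "alt q \<otimes> u ?n \<in> carrier R" using u_closed n by auto
  show "(\<lambda>f. wedge ?n (kd f) \<oplus>\<^sub>F (alt q \<otimes> u ?n) \<odot>\<^sub>F f) \<in> lin_maps R FF FF"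
    by (intro lin_plus FF_module lin_compose[OF kd_lin wedge_lin] lin_smult_map lin_id c)
  fix b assume b: "b \<in> sq_basis n q S"
  obtain J m where bJ: "b = (J, m)" by (cases b)
  have J: "J \<subseteq> {1..n}" "card J = q" using b bJ by (auto simp: sq_basis_def)
  then have fin: "finite J" and nJ: "?n \<notin> J" by (auto intro: finite_subset)
  let ?J = "insert ?n J"
  have s1: "sg ?J ?n = alt q"
  proof -
    have e: "{i \<in> ?J. i < ?n} = J" using J by auto
    show ?thesis unfolding sg_alt e using J by simp
  qed
  have s2: "sg ?J j = sg J j" if "j \<in> J" for j
  proof -
    have e: "{i \<in> ?J. i < j} = {i \<in> J. i < j}" using that J by auto
    show ?thesis unfolding sg_alt e ..
  qed
  have t: "(sg J j \<otimes> w j) \<odot>\<^sub>F bv (K, m) \<in> carrier FF" for J j K m by (auto simp del: free_mod_simps)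
  have "kd (wedge ?n (bv b)) = (sg ?J ?n \<otimes> w ?n) \<odot>\<^sub>F bv (?J - {?n}, m) \<oplus>\<^sub>F
      finsum FF (\<lambda>j. (sg ?J j \<otimes> w j) \<odot>\<^sub>F bv (?J - {j}, m)) J"
    unfolding bJ wedge_bv[OF nJ] kd_bv using t by (intro F.M.finsum_insert[OF fin nJ]) auto
  also have "(sg ?J ?n \<otimes> w ?n) \<odot>\<^sub>F bv (?J - {?n}, m) = (alt q \<otimes> u ?n) \<odot>\<^sub>F bv b"
    using nJ n by (simp add: s1 w_def bJ del: free_mod_simps)
  also have "finsum FF (\<lambda>j. (sg ?J j \<otimes> w j) \<odot>\<^sub>F bv (?J - {j}, m)) J = wedge ?n (kd (bv b))"
  proof -
    have "wedge ?n (kd (bv b)) = finsum FF (\<lambda>j. wedge ?n ((sg J j \<otimes> w j) \<odot>\<^sub>F bv (J - {j}, m))) J"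
      unfolding bJ kd_bv by (rule lin_finsum[OF wedge_lin FF_module FF_module]) (use t in auto)
    also have "\<dots> = finsum FF (\<lambda>j. (sg ?J j \<otimes> w j) \<odot>\<^sub>F bv (?J - {j}, m)) J"
    proof (rule F.M.finsum_cong')
      fix j assume j: "j \<in> J"
      have e: "?J - {j} = insert ?n (J - {j})" using j nJ by auto
      have "wedge ?n ((sg J j \<otimes> w j) \<odot>\<^sub>F bv (J - {j}, m)) = (sg J j \<otimes> w j) \<odot>\<^sub>F wedge ?n (bv (J - {j}, m))"
        by (rule lin_smult[OF wedge_lin _ bv_FF]) simp
      also have "wedge ?n (bv (J - {j}, m)) = bv (?J - {j}, m)" unfolding e by (rule wedge_bv) (use nJ in simp)
      finally show "wedge ?n ((sg J j \<otimes> w j) \<odot>\<^sub>F bv (J - {j}, m)) = (sg ?J j \<otimes> w j) \<odot>\<^sub>F bv (?J - {j}, m)"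
        unfolding s2[OF j] .
    qed (use t in auto)
    finally show ?thesis by simp
  qed
  finally show "kd (wedge ?n (bv b)) = wedge ?n (kd (bv b)) \<oplus>\<^sub>F (alt q \<otimes> u ?n) \<odot>\<^sub>F bv b"
    using F.M.a_comm[of "(alt q \<otimes> u ?n) \<odot>\<^sub>F bv b" "wedge ?n (kd (bv b))"] c
      lin_closed[OF lin_compose[OF kd_lin wedge_lin] bv_FF] by (simp add: smult_FF del: free_mod_simps)
qed

lemma sq_basis_kd: "f \<in> fs (sq_basis n (Suc p) S) \<Longrightarrow> kd f \<in> fs (sq_basis n p S)"
  by (erule kd_fs) (auto simp: sq_basis_def)

text \<open>
  The elements r for which \<open>r u\<^sub>m\<close> is a boundary form an ideal, and it contains each \<open>u\<^sub>j\<close> because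
  \<open>d (e\<^sub>j u\<^sub>m) = u\<^sub>j u\<^sub>m\<close>.
\<close>

lemma sq_degree_zero_boundary:
  assumes n: "{1..n} \<subseteq> X" and f: "f \<in> fs (sq_basis n 0 S)" and v: "\<And>b. f b \<in> genideal R (u ` {1..n})"
  shows "\<exists>g\<in>fs (sq_basis n 1 S). kd g = f"
proof -
  interpret F: Module.module R FF by (rule FF_module)
  let ?H = "kd ` fs (sq_basis n 1 S)"
  have H: "submodule ?H R FF" by (rule lin_image_submodule[OF kd_lin FF_module FF_module fs_submodule])
  note HE = F.submoduleE[OF H]
  have uc: "u ` {1..n} \<subseteq> carrier R" using n u_closed by auto
  have inH: "r \<odot>\<^sub>F bv ({}, m) \<in> ?H" if m: "m \<in> S" and r: "r \<in> genideal R (u ` {1..n})" for m r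
  proof -
    let ?I = "{r \<in> carrier R. r \<odot>\<^sub>F bv ({}, m) \<in> ?H}"
    have "ideal ?I R" by (rule ideal_smult_preimage[OF FF_module bv_FF H])
    moreover have "u ` {1..n} \<subseteq> ?I"
    proof
      fix a assume "a \<in> u ` {1..n}"
      then obtain j where j: "j \<in> {1..n}" "a = u j" by auto
      have "kd (bv ({j}, m)) = a \<odot>\<^sub>F bv ({}, m)" using kd_bv_single[of j m] j n by (auto simp: w_def simp del: free_mod_simps)
      moreover have "bv ({j}, m) \<in> fs (sq_basis n 1 S)" by (rule basis_vec_closed) (use j m in \<open>auto simp: sq_basis_def\<close>)
      ultimately have "a \<odot>\<^sub>F bv ({}, m) \<in> ?H" by force
      then show "a \<in> ?I" using uc j by auto
    qed
    ultimately have "genideal R (u ` {1..n}) \<subseteq> ?I" by (rule genideal_minimal)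
    then show ?thesis using r by blast
  qed
  have "finsum FF (\<lambda>b. f b \<odot>\<^sub>F bv b) {b. f b \<noteq> \<zero>} \<in> ?H"
  proof (rule finsum_in_submodule[OF H FF_module], rule Pi_I)
    fix b assume "b \<in> {b. f b \<noteq> \<zero>}"
    then have "b \<in> sq_basis n 0 S" using free_mod_support_subset[OF f] by auto
    then obtain m where "b = ({}, m)" "m \<in> S" by (auto simp: sq_basis_def) (metis card_eq_0_iff finite_atLeastAtMost finite_subset)
    then show "f b \<odot>\<^sub>F bv b \<in> ?H" using inH v by simp
  qed
  then have "f \<in> ?H" using free_mod_expand[OF fs_FF[OF f]] by simp
  then show ?thesis by auto
qed

lemma sq_basis_values:
  assumes "{1..n} \<subseteq> X" "f \<in> fs (sq_basis n p S)"
  shows "kd f b \<in> genideal R (u ` {1..n})"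
proof (rule kd_values[OF genideal_ideal assms(2)])
  show uc: "u ` {1..n} \<subseteq> carrier R" using assms u_closed by auto
  fix J m j assume "(J, m) \<in> sq_basis n p S" "j \<in> J"
  then have "j \<in> {1..n}" by (auto simp: sq_basis_def)
  then show "w j \<in> genideal R (u ` {1..n})" using assms(1) genideal_self[OF uc] by (auto simp: w_def)
qed

end

locale regular_koszul = koszul +
  assumes regular: "\<And>k r. \<lbrakk>k \<in> seq_index N; r \<in> carrier R; u k \<otimes> r \<in> genideal R (u ` {1..<k})\<rbrakk> \<Longrightarrow> r \<in> genideal R (u ` {1..<k})"
begin

text \<open>
  The classical induction on the length. A cycle is written as \<open>a + b e\<^sub>n\<close>, where a and b do not involve \<open>e\<^sub>n\<close>;
  then \<open>d b = 0\<close> and, up to sign, \<open>d a = u\<^sub>n b\<close>. If b has degree zero, the second equation puts \<open>u\<^sub>n b\<close> into the ideal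
  of the earlier members, and regularity puts b into it. In every degree b is therefore a boundary dc, and
  subtracting the boundary of \<open>c e\<^sub>n\<close> leaves a cycle that does not involve \<open>e\<^sub>n\<close>.
\<close>

lemma sq_acyclic:
  assumes "{1..n} \<subseteq> X" "f \<in> fs (sq_basis n (Suc q) S)" "kd f = \<zero>\<^sub>F"
  shows "\<exists>g\<in>fs (sq_basis n (Suc (Suc q)) S). kd g = f"
  using assms
proof (induction n arbitrary: q f)
  case 0
  have "sq_basis 0 (Suc q) S = {}" by (auto simp: sq_basis_def)
  then have "f = \<zero>\<^sub>F" using "0.prems"(2) by (auto simp: free_mod_carrier)
  moreover have "kd \<zero>\<^sub>F = \<zero>\<^sub>F" by (rule lin_zero[OF kd_lin FF_module FF_module])
  ultimately show ?case using submodule_zero[OF FF_module fs_submodule[of "sq_basis 0 (Suc (Suc q)) S"]]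
    by (intro bexI[of _ "\<zero>\<^sub>F"]) simp_all
next
  case (Suc n)
  interpret F: Module.module R FF by (rule FF_module)
  let ?n = "Suc n"
  note f = Suc.prems(2)
  have fF: "f \<in> carrier FF" by (rule fs_FF[OF f])
  have n: "{1..n} \<subseteq> X" "?n \<in> X" using Suc.prems(1) by auto
  have un: "u ?n \<in> carrier R" using u_closed n by auto
  define a where "a = restr (\<lambda>(J, m). ?n \<notin> J) f"
  define b where "b = unwedge ?n f"
  have aS: "a \<in> fs (sq_basis n (Suc q) S)"
  proof -
    have "a \<in> fs {b \<in> sq_basis ?n (Suc q) S. case b of (J, m) \<Rightarrow> ?n \<notin> J}" unfolding a_def by (rule restr_fs[OF f])
    moreover have "{b \<in> sq_basis ?n (Suc q) S. case b of (J, m) \<Rightarrow> ?n \<notin> J} \<subseteq> sq_basis n (Suc q) S"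
      by (auto simp: sq_basis_def, drule (1) subsetD, auto simp: le_Suc_eq)
    ultimately show ?thesis by (rule free_mod_mono)
  qed
  have bS: "b \<in> fs (sq_basis n q S)"
  proof (rule fsI)
    show "b \<in> carrier FF" unfolding b_def by (rule unwedge_FF[OF fF])
    fix c assume c: "c \<notin> sq_basis n q S"
    obtain J m where cJ: "c = (J, m)" by (cases c)
    show "b c = \<zero>"
    proof (rule ccontr)
      assume nz: "b c \<noteq> \<zero>"
      then have nJ: "?n \<notin> J" and "f (insert ?n J, m) \<noteq> \<zero>" by (auto simp: b_def unwedge_def cJ split: if_splits)
      then have k: "(insert ?n J, m) \<in> sq_basis ?n (Suc q) S" using free_mod_support_subset[OF f] by auto
      then have "finite (insert ?n J)" by (auto simp: sq_basis_def intro: finite_subset)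
      moreover have "J \<subseteq> {1..n}"
      proof
        fix x assume x: "x \<in> J"
        have "insert ?n J \<subseteq> {1..?n}" using k by (simp add: sq_basis_def)
        then have "x \<in> {1..?n}" using x by blast
        moreover have "x \<noteq> ?n" using x nJ by blast
        ultimately show "x \<in> {1..n}" by simp
      qed
      ultimately have "c \<in> sq_basis n q S" using k nJ by (auto simp: sq_basis_def cJ)
      then show False using c by simp
    qed
  qed
  have aF: "a \<in> carrier FF" and bF: "b \<in> carrier FF" by (rule fs_FF[OF aS], rule fs_FF[OF bS])
  have fab: "f = a \<oplus>\<^sub>F wedge ?n b"
    using free_mod_value[OF fF]
    by (auto simp: fun_eq_iff a_def b_def restr_def wedge_def unwedge_def insert_absorb)
  have s: "alt q \<otimes> u ?n \<in> carrier R" using un by simp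
  have df: "kd f = kd a \<oplus>\<^sub>F (wedge ?n (kd b) \<oplus>\<^sub>F (alt q \<otimes> u ?n) \<odot>\<^sub>F b)"
    unfolding fab kd_wedge[OF bS n(2), symmetric] by (rule lin_add[OF kd_lin aF wedge_FF[OF bF]])
  have kdaS: "kd a \<in> fs (sq_basis n q S)" by (rule sq_basis_kd[OF aS])
  have kdb: "kd b \<in> fs {(J, m). ?n \<notin> J}"
    by (rule kd_fs[OF bS]) (auto simp: sq_basis_def)
  have out: "g (J, m) = \<zero>" if "g \<in> fs (sq_basis n q S)" "?n \<in> J" for g J m
  proof -
    have "(J, m) \<notin> sq_basis n q S" using that(2) by (auto simp: sq_basis_def)
    then show ?thesis using that(1) by (auto simp: free_mod_carrier)
  qed
  have kdb0: "kd b = \<zero>\<^sub>F"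
  proof
    fix c :: "nat set \<times> nat multiset"
    obtain J m where cJ: "c = (J, m)" by (cases c)
    show "kd b c = \<zero>\<^sub>F c"
    proof (cases "?n \<in> J")
      case True
      then show ?thesis using kdb cJ by (auto simp: free_mod_carrier)
    next
      case False
      have v: "kd b (J, m) \<in> carrier R" by (rule free_mod_value[OF lin_closed[OF kd_lin bF]])
      have "kd f (insert ?n J, m) = \<zero>" using Suc.prems(3) by simp
      moreover have "kd f (insert ?n J, m) = kd b (J, m)"
        unfolding df using out[OF kdaS, of "insert ?n J" m] out[OF bS, of "insert ?n J" m] False v s
        by (simp add: wedge_def)
      ultimately show ?thesis using cJ by simp
    qed
  qed
  have dz: "kd a c \<oplus> (alt q \<otimes> u ?n) \<otimes> b c = \<zero>" for c
  proof -
    have v: "b c \<in> carrier R" "kd a c \<in> carrier R"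
      by (rule free_mod_value[OF bF], rule free_mod_value[OF lin_closed[OF kd_lin aF]])
    have "wedge ?n (\<lambda>b. \<zero>) c = \<zero>" by (cases c) (simp add: wedge_def)
    moreover have "kd f c = \<zero>" using Suc.prems(3) by simp
    ultimately show ?thesis using v s unfolding df kdb0 by simp
  qed
  have "\<exists>c\<in>fs (sq_basis n (Suc q) S). kd c = b"
  proof (cases q)
    case 0
    have "b c \<in> genideal R (u ` {1..n})" for c
    proof -
      have v: "b c \<in> carrier R" "kd a c \<in> carrier R"
        by (rule free_mod_value[OF bF], rule free_mod_value[OF lin_closed[OF kd_lin aF]])
      have uc: "u ` {1..n} \<subseteq> carrier R" using n u_closed by auto
      interpret G: ideal "genideal R (u ` {1..n})" R by (rule genideal_ideal[OF uc])
      have "u ?n \<otimes> b c \<oplus> kd a c = \<zero>" using dz[of c] v un 0 a_comm[of "kd a c" "u ?n \<otimes> b c"] by simp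
      from minus_equality[OF this] have "u ?n \<otimes> b c = \<ominus> kd a c" using v un by simp
      moreover have "\<ominus> kd a c \<in> genideal R (u ` {1..n})" by (rule G.a_inv_closed[OF sq_basis_values[OF n(1) aS]])
      ultimately have "u ?n \<otimes> b c \<in> genideal R (u ` {1..n})" by (simp only:)
      moreover have e: "{1..n} = {1..<?n}" by auto
      ultimately show ?thesis using regular[OF n(2) v(1)] unfolding e by blast
    qed
    then show ?thesis using sq_degree_zero_boundary[OF n(1)] bS 0 by simp
  next
    case (Suc q')
    then show ?thesis using Suc.IH[OF n(1), of b q'] bS kdb0 by simp
  qed
  then obtain c where cS: "c \<in> fs (sq_basis n (Suc q) S)" and c: "kd c = b" by blast
  have cF: "c \<in> carrier FF" by (rule fs_FF[OF cS])
  let ?t = "alt (Suc q) \<otimes> u ?n"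
  have t: "?t \<in> carrier R" using un by simp
  have dwc: "kd (wedge ?n c) = wedge ?n b \<oplus>\<^sub>F ?t \<odot>\<^sub>F c"
    using kd_wedge[OF cS n(2)] c by simp
  \<comment> \<open>the cycle without \<open>e\<^sub>n\<close> that is left after subtracting the boundary of \<open>c e\<^sub>n\<close>\<close>
  define f' where "f' = a \<ominus>\<^sub>F ?t \<odot>\<^sub>F c"
  have f'S: "f' \<in> fs (sq_basis n (Suc q) S)"
    unfolding f'_def by (rule submodule_minus[OF FF_module fs_submodule aS F.submoduleE(4)[OF fs_submodule t cS]])
  have tcF: "?t \<odot>\<^sub>F c \<in> carrier FF" by (rule smult_FF[OF t cF])
  have wcF: "wedge ?n c \<in> carrier FF" and wbF: "wedge ?n b \<in> carrier FF" by (rule wedge_FF[OF cF], rule wedge_FF[OF bF])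
  have feq: "f = kd (wedge ?n c) \<oplus>\<^sub>F f'"
  proof -
    have "kd (wedge ?n c) \<oplus>\<^sub>F f' = (wedge ?n b \<oplus>\<^sub>F ?t \<odot>\<^sub>F c) \<oplus>\<^sub>F (a \<ominus>\<^sub>F ?t \<odot>\<^sub>F c)"
      unfolding dwc f'_def ..
    also have "\<dots> = a \<oplus>\<^sub>F wedge ?n b"
      using aF tcF wbF F.M.r_neg1 F.M.r_neg2 by (simp add: a_minus_def F.M.a_ac F.M.r_neg del: free_mod_simps)
    finally show ?thesis using fab by simp
  qed
  have f'F: "f' \<in> carrier FF" by (rule fs_FF[OF f'S])
  have "kd f' = \<zero>\<^sub>F"
  proof -
    have "kd f = kd (kd (wedge ?n c)) \<oplus>\<^sub>F kd f'"
      by (subst feq) (rule lin_add[OF kd_lin lin_closed[OF kd_lin wcF] f'F])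
    then show ?thesis using Suc.prems(3) kd_kd[OF wcF] F.M.l_zero[OF lin_closed[OF kd_lin f'F]] by (simp del: free_mod_simps)
  qed
  from Suc.IH[OF n(1) f'S this] obtain g where gS: "g \<in> fs (sq_basis n (Suc (Suc q)) S)" and g: "kd g = f'" by blast
  have wcS: "wedge ?n c \<in> fs (sq_basis ?n (Suc (Suc q)) S)"
  proof (rule fsI)
    fix d assume d: "d \<notin> sq_basis ?n (Suc (Suc q)) S"
    obtain J m where dJ: "d = (J, m)" by (cases d)
    show "wedge ?n c d = \<zero>"
    proof (rule ccontr)
      assume "wedge ?n c d \<noteq> \<zero>"
      then have nJ: "?n \<in> J" and "c (J - {?n}, m) \<noteq> \<zero>" by (auto simp: wedge_def dJ split: if_splits)
      then have k: "J - {?n} \<subseteq> {1..n}" "card (J - {?n}) = Suc q" "m \<in> S"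
        using free_mod_support_subset[OF cS] by (auto simp: sq_basis_def)
      then have "card J = Suc (Suc q)" using nJ by (metis card_Suc_Diff1 card_eq_0_iff finite_Diff2 finite.emptyI finite_insert nat.distinct(1))
      moreover have "J \<subseteq> {1..?n}" using k(1) by auto
      ultimately have "d \<in> sq_basis ?n (Suc (Suc q)) S" using k by (auto simp: sq_basis_def dJ)
      then show False using d by simp
    qed
  qed (rule wcF)
  have gS': "g \<in> fs (sq_basis ?n (Suc (Suc q)) S)"
    by (rule free_mod_mono[OF gS]) (auto simp: sq_basis_def)
  show ?case
  proof (rule bexI)
    show "wedge ?n c \<oplus>\<^sub>F g \<in> fs (sq_basis ?n (Suc (Suc q)) S)"
      by (rule F.submoduleE(5)[OF fs_submodule wcS gS'])
    show "kd (wedge ?n c \<oplus>\<^sub>F g) = f"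
      unfolding lin_add[OF kd_lin wcF fs_FF[OF gS]] g using feq by simp
  qed
qed

text \<open>
  A given cycle involves finitely many indices, so an infinite sequence reduces to a finite one.
\<close>

lemma koszul_acyclic:
  assumes f: "f \<in> fs (Q_basis N k n)" and n: "n > 0" and d: "kd f = \<zero>\<^sub>F"
  shows "\<exists>g\<in>fs (Q_basis N k (n + 1)). kd g = f"
proof -
  let ?S = "{m. set_mset m \<subseteq> X \<and> size m = k}"
  define J0 where "J0 = \<Union>(fst ` {b. f b \<noteq> \<zero>})"
  have sub: "{b. f b \<noteq> \<zero>} \<subseteq> Q_basis N k n" by (rule free_mod_support_subset[OF f])
  have fst: "finite (fst b) \<and> fst b \<subseteq> X" if "f b \<noteq> \<zero>" for b
    using subsetD[OF sub, of b] that by (auto simp: Q_basis_def)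
  have "finite J0" unfolding J0_def using free_mod_support[OF f] fst by auto
  moreover have "J0 \<subseteq> X" unfolding J0_def using fst by blast
  ultimately obtain n0 where n0: "J0 \<subseteq> {1..n0}" "{1..n0} \<subseteq> X" by (rule finite_subset_seq_index)
  obtain q where q: "n = int (Suc q)" using n by (metis gr0_implies_Suc pos_int_cases)
  have fS: "f \<in> fs (sq_basis n0 (Suc q) ?S)"
  proof (rule fsI)
    fix b assume b: "b \<notin> sq_basis n0 (Suc q) ?S"
    show "f b = \<zero>"
    proof (rule ccontr)
      assume nz: "f b \<noteq> \<zero>"
      obtain J m where bJ: "b = (J, m)" by (cases b)
      have "b \<in> Q_basis N k n" using nz sub by auto
      moreover have "J \<subseteq> J0" using nz unfolding J0_def bJ by force
      ultimately have "b \<in> sq_basis n0 (Suc q) ?S" using n0 q by (auto simp: Q_basis_def sq_basis_def bJ)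
      then show False using b by simp
    qed
  qed (rule fs_FF[OF f])
  obtain g where g: "g \<in> fs (sq_basis n0 (Suc (Suc q)) ?S)" "kd g = f" using sq_acyclic[OF n0(2) fS d] by blast
  have "sq_basis n0 (Suc (Suc q)) ?S \<subseteq> Q_basis N k (n + 1)"
    using n0(2) q by (auto simp: sq_basis_def Q_basis_def intro: finite_subset)
  then show ?thesis using g free_mod_mono by blast
qed

end

section \<open>The complexes resolving the quotients by powers of the ideal\<close>

lemma int_card_pred: "finite J \<Longrightarrow> j \<in> J \<Longrightarrow> int (card J - Suc 0) = int (card J) - 1"
  using card_gt_0_iff[of J] by auto

lemma module_neg_zero: "Module.module R M \<Longrightarrow> \<ominus>\<^bsub>M\<^esub> \<zero>\<^bsub>M\<^esub> = \<zero>\<^bsub>M\<^esub>"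
proof -
  assume "Module.module R M"
  then interpret M: Module.module R M .
  show ?thesis by (rule M.M.minus_equality) simp_all
qed

lemma (in abelian_group) minus_minus_cancel:
  assumes "x \<in> carrier G" "y \<in> carrier G"
  shows "x \<ominus> (x \<ominus> y) = y"
proof -
  have "x \<ominus> (x \<ominus> y) = x \<oplus> (\<ominus> x \<oplus> y)" using assms by (simp add: a_minus_def minus_add)
  then show ?thesis using assms by (simp add: r_neg2)
qed

lemma (in abelian_group) minus_minus_swap:
  assumes "x \<in> carrier G" "y \<in> carrier G" "z \<in> carrier G"
  shows "(x \<ominus> y) \<ominus> (x \<ominus> z) = z \<ominus> y"
proof -
  have "(x \<ominus> y) \<ominus> (x \<ominus> z) = x \<oplus> (\<ominus> x \<oplus> (z \<oplus> \<ominus> y))" using assms by (simp add: a_minus_def minus_add a_ac)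
  then show ?thesis using assms by (simp add: r_neg2 a_minus_def)
qed

context cring
begin

lemma ideal_pow_0: "ideal_pow R I 0 = carrier R"
  by (simp add: ideal_pow_def nat_pow_def ideals_set_def)

lemma ideal_pow_Suc: "ideal_pow R I (Suc k) = ideal_prod R (ideal_pow R I k) I"
  by (simp add: ideal_pow_def nat_pow_def ideals_set_def)

lemma ideal_pow_ideal: "ideal I R \<Longrightarrow> ideal (ideal_pow R I k) R"
  by (induction k) (simp_all add: ideal_pow_0 ideal_pow_Suc oneideal ideal_prod_is_ideal)

lemma ideal_pow_mult:
  assumes "ideal I R" "a \<in> ideal_pow R I k" "b \<in> I"
  shows "a \<otimes> b \<in> ideal_pow R I (Suc k)"
  unfolding ideal_pow_Suc by (rule ideal_prod.prod[OF assms(2,3)])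

lemma ideal_pow_decreasing:
  assumes "ideal I R" "k \<le> l"
  shows "ideal_pow R I l \<subseteq> ideal_pow R I k"
  using assms(2)
proof (induction rule: dec_induct)
  case (step l)
  then show ?case using ideal_prod_inter[OF ideal_pow_ideal[OF assms(1)] assms(1), of l] by (auto simp: ideal_pow_Suc)
qed simp

lemma ideal_pow_1: "ideal I R \<Longrightarrow> ideal_pow R I 1 = I"
  using ideal_prod_commute[OF oneideal] ideal_prod_one by (simp add: ideal_pow_Suc ideal_pow_0)

end

context koszul
begin

definition II where "II = genideal R (u ` X)"

lemma uX: "u ` X \<subseteq> carrier R" using u_closed by auto
lemma II_ideal: "ideal II R" unfolding II_def by (rule genideal_ideal[OF uX])
lemma w_II: "w j \<in> II"
  using genideal_self[OF uX] additive_subgroup.zero_closed[OF ideal.axioms(1)[OF II_ideal]]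
  by (auto simp: II_def w_def)

abbreviation Ip where "Ip k \<equiv> ideal_pow R II k"
lemma Ip_ideal: "ideal (Ip k) R" by (rule ideal_pow_ideal[OF II_ideal])

definition mon :: "nat multiset \<Rightarrow> 'a" where "mon m = finprod R (\<lambda>i. w i [^] count m i) (set_mset m)"

lemma mon_closed [simp, intro]: "mon m \<in> carrier R" by (auto simp: mon_def intro!: finprod_closed)

lemma mon_superset:
  assumes "finite S" "set_mset m \<subseteq> S"
  shows "mon m = finprod R (\<lambda>i. w i [^] count m i) S"
  unfolding mon_def
  by (rule finprod_mono_neutral_cong_left) (use assms in \<open>auto simp: not_in_iff\<close>)

lemma mon_empty [simp]: "mon {#} = \<one>" by (simp add: mon_def)

lemma mon_add [simp]: "mon (add_mset j m) = w j \<otimes> mon m"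
proof -
  let ?S = "insert j (set_mset m) - {j}"
  let ?p = "finprod R (\<lambda>i. w i [^] count m i) ?S"
  have p: "?p \<in> carrier R" by (auto intro!: finprod_closed)
  have e: "insert j (set_mset m) = insert j ?S" by auto
  have "mon (add_mset j m) = finprod R (\<lambda>i. w i [^] count (add_mset j m) i) (insert j ?S)"
    by (rule mon_superset) auto
  also have "\<dots> = w j [^] Suc (count m j) \<otimes> finprod R (\<lambda>i. w i [^] count (add_mset j m) i) ?S"
    by (subst finprod_insert) auto
  also have "finprod R (\<lambda>i. w i [^] count (add_mset j m) i) ?S = ?p"
    by (rule finprod_cong') auto
  also have "w j [^] Suc (count m j) \<otimes> ?p = w j \<otimes> (w j [^] count m j \<otimes> ?p)"
    using p by (simp add: m_ac)
  also have "w j [^] count m j \<otimes> ?p = mon m"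
  proof -
    have "mon m = finprod R (\<lambda>i. w i [^] count m i) (insert j ?S)" by (rule mon_superset) auto
    also have "\<dots> = w j [^] count m j \<otimes> ?p" by (subst finprod_insert) auto
    finally show ?thesis by simp
  qed
  finally show ?thesis .
qed

lemma mon_Ip: "mon m \<in> Ip (size m)"
proof (induction m)
  case empty
  then show ?case by (simp add: ideal_pow_0)
next
  case (add j m)
  then show ?case using ideal_pow_mult[OF II_ideal add w_II[of j]] by (simp add: m_comm)
qed

text \<open>
  A power of I is generated by the monomials in the members of the sequence; products of arbitrary
  elements of I are reduced to them one factor at a time.
\<close>

lemma Ip_least:
  assumes K: "ideal K R" and m: "\<And>m. set_mset m \<subseteq> X \<Longrightarrow> size m = k \<Longrightarrow> mon m \<in> K"
  shows "Ip k \<subseteq> K"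
  using assms
proof (induction k arbitrary: K)
  case 0
  then have "\<one> \<in> K" using "0.prems"(2)[of "{#}"] by simp
  then show ?case using ideal.one_imp_carrier[OF "0.prems"(1)] by (simp add: ideal_pow_0)
next
  case (Suc k)
  interpret K: ideal K R by (rule Suc.prems)
  have sub: "submodule K R (reg_mod R)" by (rule ideal_submodule[OF Suc.prems(1)])
  have 1: "a \<otimes> mon m \<in> K" if "set_mset m \<subseteq> X" "size m = k" "a \<in> II" for m a
  proof -
    have "ideal {r \<in> carrier R. r \<otimes> mon m \<in> K} R"
      using ideal_smult_preimage[OF reg_mod_module _ sub, of "mon m"] by simp
    moreover have "u ` X \<subseteq> {r \<in> carrier R. r \<otimes> mon m \<in> K}"
    proof
      fix r assume "r \<in> u ` X"
      then obtain j where j: "j \<in> X" "r = u j" by auto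
      have "mon (add_mset j m) \<in> K" by (rule Suc.prems(2)) (use that j in auto)
      then show "r \<in> {r \<in> carrier R. r \<otimes> mon m \<in> K}" using j uX by (auto simp: w_def)
    qed
    ultimately have "II \<subseteq> {r \<in> carrier R. r \<otimes> mon m \<in> K}" unfolding II_def by (rule genideal_minimal)
    then show ?thesis using that by auto
  qed
  have 2: "b \<otimes> a \<in> K" if a: "a \<in> II" and b: "b \<in> Ip k" for a b
  proof -
    have aR: "a \<in> carrier R" using a ideal.Icarr[OF II_ideal] by blast
    have "ideal {r \<in> carrier R. r \<otimes> a \<in> K} R"
      using ideal_smult_preimage[OF reg_mod_module _ sub, of a] aR by simp
    then have "Ip k \<subseteq> {r \<in> carrier R. r \<otimes> a \<in> K}"
      by (rule Suc.IH) (use 1 a aR in \<open>auto simp: m_comm[of _ a]\<close>)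
    then show ?thesis using b by auto
  qed
  show ?case
  proof
    fix x assume "x \<in> Ip (Suc k)"
    then have "x \<in> ideal_prod R (Ip k) II" by (simp only: ideal_pow_Suc)
    then show "x \<in> K" by (induction rule: ideal_prod.induct) (auto simp: 2)
  qed
qed

text \<open>
  The substitution \<open>e\<^sub>J u\<^sub>m \<mapsto> u\<^sup>m\<close>. It is used only in exterior degree zero, as the augmentation.
\<close>

definition ev :: "'a qchain \<Rightarrow> 'a" where
  "ev = lin_ext R (reg_mod R) (\<lambda>(J, m). mon m)"

lemma ev_lin: "ev \<in> lin_maps R FF (reg_mod R)"
  unfolding ev_def by (rule lin_ext_lin[OF reg_mod_module]) auto

lemma ev_bv: "ev (bv (J, m)) = mon m"
  unfolding ev_def using lin_ext_basis[OF reg_mod_module, of "\<lambda>(J, m). mon m" "(J, m)"] by simp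

lemma ev_closed: "f \<in> carrier FF \<Longrightarrow> ev f \<in> carrier R" using lin_closed[OF ev_lin] by simp

lemma del_bv_single: "del (bv ({j}, m)) = bv ({}, add_mset j m)"
proof -
  interpret F: Module.module R FF by (rule FF_module)
  have e: "{i \<in> {j}. i < j} = {}" by auto
  have "sg {j} j = \<one>" unfolding sg_alt e by simp
  moreover have "del (bv ({j}, m)) = finsum FF (\<lambda>i. (sg {j} i \<otimes> \<one>) \<odot>\<^sub>F bv ({j} - {i}, add_mset i m)) {j}"
    unfolding del_def by (rule contr_bv) simp
  ultimately show ?thesis by (subst (asm) F.M.finsum_insert) (auto simp: F.M.r_zero F.smult_one simp del: free_mod_simps)
qed

text \<open>
  The basis of \<open>K(R; I\<^sup>s)\<close> in degree n: the basis elements of the columns \<open>Q\<^bsup>(k)\<^esup>\<close> with k < s.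
\<close>

definition KB :: "nat \<Rightarrow> int \<Rightarrow> (nat set \<times> nat multiset) set" where
  "KB s n = {(J, m). finite J \<and> J \<subseteq> X \<and> int (card J) = n \<and> set_mset m \<subseteq> X \<and> size m < s}"

abbreviation low :: "nat \<Rightarrow> 'a qchain \<Rightarrow> 'a qchain" where
  "low s \<equiv> restr (\<lambda>(J, m). size m < s)"

text \<open>
  The differential of \<open>K(R; I\<^sup>s)\<close>, with \<open>\<partial>\<close> cut off behind the last column. The sign of \<open>\<partial>\<close> makes the sum of all
  substitutions an augmentation, as \<open>e\<^sub>j u\<^sub>m\<close> is sent to \<open>u\<^sub>j u\<^sub>m - u\<^bsub>jm\<^esub>\<close>. Changing it replaces the complex by
  an isomorphic one.
\<close>

definition Kd :: "nat \<Rightarrow> 'a qchain \<Rightarrow> 'a qchain" where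
  "Kd s f = kd f \<ominus>\<^sub>F low s (del f)"

lemma Kd_lin: "Kd s \<in> lin_maps R FF FF"
  unfolding Kd_def[abs_def] by (intro lin_minus_map FF_module kd_lin lin_compose[OF del_lin restr_lin])

lemma Kd_fs: "f \<in> fs (KB s n) \<Longrightarrow> Kd s f \<in> fs (KB s (n - 1))"
proof -
  assume f: "f \<in> fs (KB s n)"
  have "kd f \<in> fs (KB s (n - 1))" by (rule kd_fs[OF f]) (auto simp: KB_def intro: int_card_pred)
  moreover have "low s (del f) \<in> fs (KB s (n - 1))"
  proof -
    have "del f \<in> fs {(J, m). finite J \<and> J \<subseteq> X \<and> int (card J) = n - 1 \<and> set_mset m \<subseteq> X}"
      by (rule del_fs[OF f]) (auto simp: KB_def intro: int_card_pred)
    from restr_fs[OF this, of "\<lambda>(J, m). size m < s"] show ?thesis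
      by (rule free_mod_mono) (auto simp: KB_def)
  qed
  ultimately show ?thesis unfolding Kd_def by (rule submodule_minus[OF FF_module fs_submodule])
qed

lemma low_kd: "f \<in> carrier FF \<Longrightarrow> low s (kd f) = kd (low s f)"
  unfolding kd_def by (rule restr_contr[OF w_Pi]) auto

lemma low_del: "f \<in> carrier FF \<Longrightarrow> low (Suc s) (del f) = del (low s f)"
  unfolding del_def by (rule restr_contr) auto

lemma low_low: "s \<le> t \<Longrightarrow> low s (low t f) = low s f"
  by (auto simp: restr_def fun_eq_iff)

lemma low_id: "f \<in> fs (KB s n) \<Longrightarrow> low s f = f"
  by (rule restr_id, erule free_mod_mono) (auto simp: KB_def)

lemma low_fs: "f \<in> fs (KB t n) \<Longrightarrow> s \<le> t \<Longrightarrow> low s f \<in> fs (KB s n)"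
  by (drule restr_fs, erule free_mod_mono) (auto simp: KB_def)

lemma KB_mono: "f \<in> fs (KB s n) \<Longrightarrow> s \<le> t \<Longrightarrow> f \<in> fs (KB t n)"
  by (erule free_mod_mono) (auto simp: KB_def)

lemma Q_KB: "f \<in> fs (Q_basis N s n) \<Longrightarrow> f \<in> fs (KB (Suc s) n)"
  by (erule free_mod_mono) (auto simp: KB_def Q_basis_def)

lemma top_Q:
  assumes "f \<in> fs (KB (Suc s) n)" "low s f = \<zero>\<^sub>F"
  shows "f \<in> fs (Q_basis N s n)"
proof (rule fsI[OF fs_FF[OF assms(1)]])
  fix b assume b: "b \<notin> Q_basis N s n"
  obtain J m where bJ: "b = (J, m)" by (cases b)
  show "f b = \<zero>"
  proof (cases "size m < s")
    case True
    then have "low s f b = f b" by (simp add: restr_def bJ)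
    then show ?thesis using assms(2) by simp
  next
    case False
    then have "b \<notin> KB (Suc s) n" using b bJ by (auto simp: KB_def Q_basis_def)
    then show ?thesis using free_mod_support_subset[OF assms(1)] by blast
  qed
qed

lemma low_zero: "low s \<zero>\<^sub>F = \<zero>\<^sub>F" by (auto simp: restr_def)

lemma low_Q: "f \<in> fs (Q_basis N s n) \<Longrightarrow> low s f = \<zero>\<^sub>F"
  by (rule restr_zero, erule free_mod_mono) (auto simp: Q_basis_def)

lemma Kd_Q: "f \<in> fs (Q_basis N s n) \<Longrightarrow> Kd (Suc s) f = kd f"
proof -
  interpret F: Module.module R FF by (rule FF_module)
  assume f: "f \<in> fs (Q_basis N s n)"
  have "low (Suc s) (del f) = \<zero>\<^sub>F"
    unfolding low_del[OF fs_FF[OF f]] low_Q[OF f] by (rule lin_zero[OF del_lin FF_module FF_module])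
  then show ?thesis unfolding Kd_def using lin_closed[OF kd_lin fs_FF[OF f]]
    by (simp add: a_minus_def module_neg_zero[OF FF_module] F.M.r_zero del: free_mod_simps)
qed

lemma low_Kd:
  assumes "f \<in> carrier FF"
  shows "low s (Kd (Suc s) f) = Kd s (low s f)"
proof -
  have "low s (Kd (Suc s) f) = low s (kd f) \<ominus>\<^sub>F low s (low (Suc s) (del f))"
    unfolding Kd_def by (rule lin_minus[OF restr_lin FF_module FF_module lin_closed[OF kd_lin assms] restr_FF[OF lin_closed[OF del_lin assms]]])
  also have "low s (low (Suc s) (del f)) = low s (del (low s f))"
    unfolding low_del[OF assms, symmetric] by simp
  finally show ?thesis unfolding Kd_def low_kd[OF assms] .
qed

lemma Kd_Kd:
  assumes f: "f \<in> carrier FF"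
  shows "Kd s (Kd s f) = \<zero>\<^sub>F"
proof -
  interpret F: Module.module R FF by (rule FF_module)
  have df: "del f \<in> carrier FF" and kf: "kd f \<in> carrier FF" by (rule lin_closed[OF del_lin f], rule lin_closed[OF kd_lin f])
  have ldf: "low s (del f) \<in> carrier FF" by (rule restr_FF[OF df])
  define A where "A = low s (del (kd f))"
  have A: "A \<in> carrier FF" unfolding A_def by (rule restr_FF[OF lin_closed[OF del_lin kf]])
  have kdA: "kd (low s (del f)) = \<ominus>\<^sub>F A"
  proof -
    have "kd (del f) = \<ominus>\<^sub>F del (kd f)"
      using kd_del[OF f] lin_closed[OF kd_lin df] lin_closed[OF del_lin kf] by (metis F.M.minus_equality)
    then have "low s (kd (del f)) = \<ominus>\<^sub>F A"
      unfolding A_def using lin_neg[OF restr_lin FF_module FF_module lin_closed[OF del_lin kf]] by simp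
    then show ?thesis unfolding low_kd[OF df] .
  qed
  have "low s (del (low s (del f))) = low s (low (Suc s) (del (del f)))" unfolding low_del[OF df] ..
  also have "\<dots> = \<zero>\<^sub>F" unfolding del_del[OF f] low_zero ..
  finally have z: "low s (del (low s (del f))) = \<zero>\<^sub>F" .
  have "kd (Kd s f) = \<zero>\<^sub>F \<ominus>\<^sub>F (\<ominus>\<^sub>F A)"
    unfolding Kd_def lin_minus[OF kd_lin FF_module FF_module kf ldf] kd_kd[OF f] kdA ..
  moreover have "low s (del (Kd s f)) = A \<ominus>\<^sub>F \<zero>\<^sub>F"
    unfolding Kd_def lin_minus[OF lin_compose[OF del_lin restr_lin] FF_module FF_module kf ldf] z A_def ..
  ultimately have "Kd s (Kd s f) = (\<zero>\<^sub>F \<ominus>\<^sub>F (\<ominus>\<^sub>F A)) \<ominus>\<^sub>F (A \<ominus>\<^sub>F \<zero>\<^sub>F)"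
    by (simp only: Kd_def[of s "Kd s f"])
  also have "\<dots> = \<zero>\<^sub>F" using A F.M.minus_minus[OF A]
    by (simp add: a_minus_def module_neg_zero[OF FF_module] F.M.l_zero F.M.r_zero F.M.r_neg del: free_mod_simps)
  finally show ?thesis .
qed

abbreviation one_vec where "one_vec \<equiv> bv ({}, {#})"

lemma Kd_bv_single:
  "Kd s (bv ({j}, m)) = w j \<odot>\<^sub>F bv ({}, m) \<ominus>\<^sub>F (if Suc (size m) < s then bv ({}, add_mset j m) else \<zero>\<^sub>F)"
proof -
  have "low s (bv ({}, add_mset j m)) = (if Suc (size m) < s then bv ({}, add_mset j m) else \<zero>\<^sub>F)"
    by (auto simp: restr_def basis_vec_def)
  then show ?thesis unfolding Kd_def kd_bv_single del_bv_single by simp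
qed

lemma KB_degree_zero: "b \<in> KB s 0 \<Longrightarrow> \<exists>m. b = ({}, m) \<and> set_mset m \<subseteq> X \<and> size m < s"
  by (auto simp: KB_def)

lemma KB_degree_one: "b \<in> KB s 1 \<Longrightarrow> \<exists>j m. b = ({j}, m) \<and> j \<in> X \<and> set_mset m \<subseteq> X \<and> size m < s"
  by (auto simp: KB_def card_1_singleton_iff)

text \<open>
  Modulo boundaries, \<open>u\<^bsub>jm\<^esub>\<close> equals \<open>u\<^sub>j\<close> times \<open>u\<^sub>m\<close> as long as the size of jm is less than s, and otherwise \<open>u\<^sub>j u\<^sub>m\<close>
  is itself a boundary. So every element x of degree zero is congruent to \<open>ev x\<close> times the unit vector, and
  the multiples of the unit vector by monomials of degree s are boundaries.
\<close>

lemma K_augmentation_kernel: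
  assumes s: "s > 0" and x: "x \<in> fs (KB s 0)"
  shows "ev x \<in> Ip s \<longleftrightarrow> (\<exists>y\<in>fs (KB s 1). Kd s y = x)"
proof
  interpret F: Module.module R FF by (rule FF_module)
  assume "\<exists>y\<in>fs (KB s 1). Kd s y = x"
  then obtain y where y: "y \<in> fs (KB s 1)" "Kd s y = x" by blast
  have "ev (Kd s y) \<in> Ip s"
  proof (rule lin_image_in_submodule[OF lin_restrict_FF[OF lin_compose[OF Kd_lin ev_lin]] reg_mod_module ideal_submodule[OF Ip_ideal] _ y(1)])
    fix b assume "b \<in> KB s 1"
    then obtain j m where b: "b = ({j}, m)" "size m < s" using KB_degree_one by blast
    have e1: "ev (w j \<odot>\<^sub>F bv ({}, m)) = w j \<otimes> mon m"
      using lin_smult[OF ev_lin w_closed bv_FF] by (simp add: ev_bv del: free_mod_simps)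
    show "ev (Kd s (bv b)) \<in> Ip s"
    proof (cases "Suc (size m) < s")
      case True
      have "ev (Kd s (bv b)) = w j \<otimes> mon m \<ominus> mon (add_mset j m)"
        unfolding b Kd_bv_single using lin_minus[OF ev_lin FF_module reg_mod_module smult_FF[OF w_closed bv_FF] bv_FF] True
        by (simp add: e1 ev_bv del: free_mod_simps mon_add)
      also have "\<dots> = \<zero>" by (simp add: a_minus_def r_neg)
      finally show ?thesis using additive_subgroup.zero_closed[OF ideal.axioms(1)[OF Ip_ideal]] by simp
    next
      case False
      have "Kd s (bv b) = w j \<odot>\<^sub>F bv ({}, m)"
        unfolding b Kd_bv_single using False smult_FF[OF w_closed[of j] bv_FF[of "({}, m)"]]
        by (simp add: a_minus_def module_neg_zero[OF FF_module] F.M.r_zero del: free_mod_simps)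
      then have "ev (Kd s (bv b)) = mon (add_mset j m)" using e1 by simp
      moreover have "size (add_mset j m) = s" using False b by simp
      ultimately show ?thesis using mon_Ip[of "add_mset j m"] by simp
    qed
  qed
  then show "ev x \<in> Ip s" using y by simp
next
  interpret F: Module.module R FF by (rule FF_module)
  assume ex: "ev x \<in> Ip s"
  let ?H = "Kd s ` fs (KB s 1)"
  have H: "submodule ?H R FF" by (rule lin_image_submodule[OF Kd_lin FF_module FF_module fs_submodule])
  note HE = F.submoduleE[OF H]
  have gen: "w j \<odot>\<^sub>F bv ({}, m) \<ominus>\<^sub>F (if Suc (size m) < s then bv ({}, add_mset j m) else \<zero>\<^sub>F) \<in> ?H"
    if "j \<in> X" "set_mset m \<subseteq> X" "size m < s" for j m
  proof -
    have "bv ({j}, m) \<in> fs (KB s 1)" by (rule basis_vec_closed) (use that in \<open>auto simp: KB_def\<close>)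
    then show ?thesis unfolding Kd_bv_single[symmetric] by (rule imageI)
  qed
  have red: "bv ({}, m) \<ominus>\<^sub>F mon m \<odot>\<^sub>F one_vec \<in> ?H" if "set_mset m \<subseteq> X" "size m < s" for m
    using that
  proof (induction m)
    case empty
    have "bv ({}, {#}) \<ominus>\<^sub>F mon {#} \<odot>\<^sub>F one_vec = \<zero>\<^sub>F"
      by (simp add: a_minus_def F.M.r_neg del: free_mod_simps)
    then show ?case using submodule_zero[OF FF_module H] by simp
  next
    case (add j m)
    have j: "j \<in> X" "set_mset m \<subseteq> X" "size m < s" "Suc (size m) < s" using add.prems by auto
    let ?a = "bv ({}, m)" and ?b = "bv ({}, add_mset j m)" and ?o = "mon m \<odot>\<^sub>F one_vec"
    have c: "w j \<odot>\<^sub>F ?a \<in> carrier FF" "?o \<in> carrier FF" "w j \<odot>\<^sub>F ?o \<in> carrier FF"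
      by (auto simp del: free_mod_simps)
    have 1: "w j \<odot>\<^sub>F ?a \<ominus>\<^sub>F ?b \<in> ?H" using gen[OF j(1-3)] j(4) by simp
    have 2: "w j \<odot>\<^sub>F (?a \<ominus>\<^sub>F ?o) \<in> ?H" by (rule HE(4)[OF w_closed add.IH[OF j(2,3)]])
    have "w j \<odot>\<^sub>F (?a \<ominus>\<^sub>F ?o) = w j \<odot>\<^sub>F ?a \<ominus>\<^sub>F w j \<odot>\<^sub>F ?o"
      using c by (simp add: a_minus_def F.smult_r_distr F.smult_r_minus del: free_mod_simps)
    then have 3: "w j \<odot>\<^sub>F ?a \<ominus>\<^sub>F w j \<odot>\<^sub>F ?o \<in> ?H" using 2 by simp
    have "w j \<odot>\<^sub>F ?o = mon (add_mset j m) \<odot>\<^sub>F one_vec"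
      using F.smult_assoc1[OF w_closed mon_closed bv_FF] by (simp del: free_mod_simps)
    moreover have "(w j \<odot>\<^sub>F ?a \<ominus>\<^sub>F w j \<odot>\<^sub>F ?o) \<ominus>\<^sub>F (w j \<odot>\<^sub>F ?a \<ominus>\<^sub>F ?b) = ?b \<ominus>\<^sub>F w j \<odot>\<^sub>F ?o"
      by (rule F.M.minus_minus_swap[OF c(1,3) bv_FF])
    ultimately show ?case using submodule_minus[OF FF_module H 3 1] by simp
  qed
  have red': "x \<ominus>\<^sub>F ev x \<odot>\<^sub>F one_vec \<in> ?H"
  proof (rule lin_image_in_submodule[OF lin_restrict_FF FF_module H _ x])
    have "(\<lambda>x. ev x \<odot>\<^sub>F one_vec) \<in> lin_maps R FF FF"
      by (rule lin_compose[OF ev_lin smult_vector_lin[OF FF_module bv_FF]])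
    then show "(\<lambda>x. x \<ominus>\<^sub>F ev x \<odot>\<^sub>F one_vec) \<in> lin_maps R FF FF" by (intro lin_minus_map lin_id FF_module)
    fix b assume "b \<in> KB s 0"
    then obtain m where b: "b = ({}, m)" "set_mset m \<subseteq> X" "size m < s" using KB_degree_zero by blast
    then show "bv b \<ominus>\<^sub>F ev (bv b) \<odot>\<^sub>F one_vec \<in> ?H" using red by (simp add: ev_bv del: free_mod_simps)
  qed
  have "Ip s \<subseteq> {r \<in> carrier R. r \<odot>\<^sub>F one_vec \<in> ?H}"
  proof (rule Ip_least[OF ideal_smult_preimage[OF FF_module bv_FF H]])
    fix m' assume m': "set_mset m' \<subseteq> X" "size m' = s"
    then obtain j m where m: "m' = add_mset j m" using s by (metis size_eq_Suc_imp_eq_union gr0_implies_Suc add_mset_add_single)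
    then have j: "j \<in> X" "set_mset m \<subseteq> X" "size m < s" "\<not> Suc (size m) < s" using m' by auto
    have c: "w j \<odot>\<^sub>F bv ({}, m) \<in> carrier FF" "mon m \<odot>\<^sub>F one_vec \<in> carrier FF" "w j \<odot>\<^sub>F (mon m \<odot>\<^sub>F one_vec) \<in> carrier FF"
      by (auto simp del: free_mod_simps)
    have 1: "w j \<odot>\<^sub>F bv ({}, m) \<in> ?H"
      using gen[OF j(1-3)] j(4) c(1) by (simp add: a_minus_def module_neg_zero[OF FF_module] F.M.r_zero del: free_mod_simps)
    have 2: "w j \<odot>\<^sub>F (bv ({}, m) \<ominus>\<^sub>F mon m \<odot>\<^sub>F one_vec) \<in> ?H" by (rule HE(4)[OF w_closed red[OF j(2,3)]])
    have "w j \<odot>\<^sub>F (bv ({}, m) \<ominus>\<^sub>F mon m \<odot>\<^sub>F one_vec)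
        = w j \<odot>\<^sub>F bv ({}, m) \<ominus>\<^sub>F w j \<odot>\<^sub>F (mon m \<odot>\<^sub>F one_vec)"
      using c by (simp add: a_minus_def F.smult_r_distr F.smult_r_minus del: free_mod_simps)
    then have "w j \<odot>\<^sub>F bv ({}, m) \<ominus>\<^sub>F w j \<odot>\<^sub>F (bv ({}, m) \<ominus>\<^sub>F mon m \<odot>\<^sub>F one_vec)
        = w j \<odot>\<^sub>F (mon m \<odot>\<^sub>F one_vec)"
      by (simp only: F.M.minus_minus_cancel[OF c(1,3)])
    moreover have "\<dots> = mon m' \<odot>\<^sub>F one_vec"
      unfolding m using F.smult_assoc1[OF w_closed mon_closed bv_FF] by (simp del: free_mod_simps)
    ultimately have "mon m' \<odot>\<^sub>F one_vec \<in> ?H" using submodule_minus[OF FF_module H 1 2] by simp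
    then show "mon m' \<in> {r \<in> carrier R. r \<odot>\<^sub>F one_vec \<in> ?H}" by simp
  qed
  then have "ev x \<odot>\<^sub>F one_vec \<in> ?H" using ex by auto
  then have "x \<in> ?H" by (rule submodule_transfer[OF FF_module H fs_FF[OF x] _ red'])
  then show "\<exists>y\<in>fs (KB s 1). Kd s y = x" by auto
qed

text \<open>Truncation to the first s columns is a chain map whose kernel is the last column.\<close>

lemma last_column_correction:
  assumes y: "y \<in> fs (KB (Suc s) n)" and z: "z \<in> fs (KB s (n + 1))" "Kd s z = low s y"
  shows "y \<ominus>\<^sub>F Kd (Suc s) z \<in> fs (Q_basis N s n)"
    and "Kd (Suc s) (y \<ominus>\<^sub>F Kd (Suc s) z) = Kd (Suc s) y"
proof -
  interpret F: Module.module R FF by (rule FF_module)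
  have zS: "z \<in> fs (KB (Suc s) (n + 1))" by (rule KB_mono[OF z(1)]) simp
  have yF: "y \<in> carrier FF" and zF: "z \<in> carrier FF" by (rule fs_FF[OF y], rule fs_FF[OF zS])
  have dzF: "Kd (Suc s) z \<in> carrier FF" by (rule lin_closed[OF Kd_lin zF])
  have dz: "Kd (Suc s) z \<in> fs (KB (Suc s) n)" using Kd_fs[OF zS] by simp
  have "low s (y \<ominus>\<^sub>F Kd (Suc s) z) = low s y \<ominus>\<^sub>F low s (Kd (Suc s) z)"
    by (rule lin_minus[OF restr_lin FF_module FF_module yF dzF])
  also have "\<dots> = \<zero>\<^sub>F"
    unfolding low_Kd[OF zF] low_id[OF z(1)] z(2) using restr_FF[OF yF] by (simp add: a_minus_def F.M.r_neg del: free_mod_simps)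
  finally show "y \<ominus>\<^sub>F Kd (Suc s) z \<in> fs (Q_basis N s n)"
    by (rule top_Q[OF submodule_minus[OF FF_module fs_submodule y dz]])
  show "Kd (Suc s) (y \<ominus>\<^sub>F Kd (Suc s) z) = Kd (Suc s) y"
    unfolding lin_minus[OF Kd_lin FF_module FF_module yF dzF] Kd_Kd[OF zF] using lin_closed[OF Kd_lin yF]
    by (simp add: a_minus_def module_neg_zero[OF FF_module] F.M.r_zero del: free_mod_simps)
qed

end

context regular_koszul
begin

text \<open>
  By induction on the number of columns: the truncation of a cycle is a boundary, so the cycle can be
  corrected to lie in the last column, where the Koszul complex is acyclic.
\<close>

lemma K_acyclic:
  assumes "f \<in> fs (KB s n)" "n > 0" "Kd s f = \<zero>\<^sub>F"
  shows "\<exists>g\<in>fs (KB s (n + 1)). Kd s g = f"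
  using assms
proof (induction s arbitrary: f)
  case 0
  have "KB 0 n = {}" by (auto simp: KB_def)
  then have "f = \<zero>\<^sub>F" using "0.prems"(1) by (auto simp: free_mod_carrier)
  moreover have "Kd 0 \<zero>\<^sub>F = \<zero>\<^sub>F" by (rule lin_zero[OF Kd_lin FF_module FF_module])
  ultimately show ?case using submodule_zero[OF FF_module fs_submodule[of "KB 0 (n + 1)"]]
    by (intro bexI[of _ "\<zero>\<^sub>F"]) simp_all
next
  case (Suc s)
  interpret F: Module.module R FF by (rule FF_module)
  note f = Suc.prems(1)
  have fF: "f \<in> carrier FF" by (rule fs_FF[OF f])
  have "Kd s (low s f) = \<zero>\<^sub>F" unfolding low_Kd[OF fF, symmetric] Suc.prems(3) by (rule low_zero)
  from Suc.IH[OF low_fs[OF f] Suc.prems(2) this]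
  obtain y where y: "y \<in> fs (KB s (n + 1))" "Kd s y = low s f" by auto
  have yS: "y \<in> fs (KB (Suc s) (n + 1))" by (rule KB_mono[OF y(1)]) simp
  have yF: "y \<in> carrier FF" by (rule fs_FF[OF yS])
  have dyF: "Kd (Suc s) y \<in> carrier FF" by (rule lin_closed[OF Kd_lin yF])
  define z where "z = f \<ominus>\<^sub>F Kd (Suc s) y"
  have zQ: "z \<in> fs (Q_basis N s n)" unfolding z_def by (rule last_column_correction(1)[OF f y])
  have "kd z = \<zero>\<^sub>F"
    using last_column_correction(2)[OF f y] Suc.prems(3) unfolding z_def[symmetric] Kd_Q[OF zQ] by simp
  from koszul_acyclic[OF zQ Suc.prems(2) this] obtain g where g: "g \<in> fs (Q_basis N s (n + 1))" "kd g = z" by blast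
  have gF: "g \<in> carrier FF" by (rule fs_FF[OF g(1)])
  show ?case
  proof (rule bexI)
    show "y \<oplus>\<^sub>F g \<in> fs (KB (Suc s) (n + 1))" by (rule F.submoduleE(5)[OF fs_submodule yS Q_KB[OF g(1)]])
    have "Kd (Suc s) (y \<oplus>\<^sub>F g) = Kd (Suc s) y \<oplus>\<^sub>F z"
      unfolding lin_add[OF Kd_lin yF gF] Kd_Q[OF g(1)] g(2) ..
    also have "\<dots> = f" unfolding z_def using fF dyF F.M.r_neg2
      by (simp add: a_minus_def F.M.a_ac F.M.r_neg del: free_mod_simps)
    finally show "Kd (Suc s) (y \<oplus>\<^sub>F g) = f" .
  qed
qed

text \<open>
  This is quasi-regularity: a homogeneous form of degree k with value in \<open>I\<^bsup>k+1\<^esup>\<close> has its coefficients in I.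
  The form is a boundary in \<open>K(R; I\<^bsup>k+1\<^esup>)\<close>, and the bounding chain can be corrected to lie in the last column.
\<close>

lemma Q_augmentation_kernel:
  assumes x: "x \<in> fs (Q_basis N k 0)"
  shows "ev x \<in> Ip (Suc k) \<longleftrightarrow> (\<exists>y\<in>fs (Q_basis N k 1). kd y = x)"
proof
  assume "\<exists>y\<in>fs (Q_basis N k 1). kd y = x"
  then obtain y where y: "y \<in> fs (Q_basis N k 1)" "kd y = x" by blast
  then have "\<exists>y\<in>fs (KB (Suc k) 1). Kd (Suc k) y = x" using Q_KB Kd_Q by metis
  then show "ev x \<in> Ip (Suc k)" using K_augmentation_kernel[OF _ Q_KB[OF x]] by simp
next
  interpret F: Module.module R FF by (rule FF_module)
  assume "ev x \<in> Ip (Suc k)"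
  then obtain y where y: "y \<in> fs (KB (Suc k) 1)" "Kd (Suc k) y = x" using K_augmentation_kernel[OF _ Q_KB[OF x]] by auto
  have yF: "y \<in> carrier FF" by (rule fs_FF[OF y(1)])
  have "Kd k (low k y) = \<zero>\<^sub>F" unfolding low_Kd[OF yF, symmetric] y(2) by (rule low_Q[OF x])
  from K_acyclic[OF low_fs[OF y(1)] _ this] obtain z where z: "z \<in> fs (KB k 2)" "Kd k z = low k y" by auto
  have z': "z \<in> fs (KB k (1 + 1))" using z(1) by simp
  note c = last_column_correction[OF y(1) z' z(2)]
  show "\<exists>y\<in>fs (Q_basis N k 1). kd y = x"
    using c(2) unfolding Kd_Q[OF c(1)] y(2) by (rule bexI[OF _ c(1)])
qed

end

section \<open>Free resolutions and the change of rings\<close>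

lemma (in abelian_group) add_minus_cancel_left:
  assumes "x \<in> carrier G" "y \<in> carrier G"
  shows "(x \<oplus> y) \<ominus> x = y"
proof -
  have "(x \<oplus> y) \<ominus> x = (y \<oplus> x) \<oplus> \<ominus> x" using assms by (simp add: a_minus_def a_comm)
  then show ?thesis using assms by (simp add: a_assoc r_neg)
qed

lemma submodule_inter:
  assumes "Module.module R M" "submodule H R M" "submodule K R M"
  shows "submodule (H \<inter> K) R M"
proof -
  interpret M: Module.module R M by fact
  note H = M.submoduleE[OF assms(2)] and K = M.submoduleE[OF assms(3)]
  show ?thesis
    by (rule M.submoduleI_smult) (use H K submodule_zero[OF assms(1,2)] submodule_zero[OF assms(1,3)] in auto)
qed

lemma set_add_iff: "x \<in> H <+>\<^bsub>M\<^esub> K \<longleftrightarrow> (\<exists>h\<in>H. \<exists>k\<in>K. x = h \<oplus>\<^bsub>M\<^esub> k)"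
  by (auto simp: set_add_def')

lemma submodule_sum:
  assumes "Module.module R M" "submodule H R M" "submodule K R M"
  shows "submodule (H <+>\<^bsub>M\<^esub> K) R M"
proof -
  interpret M: Module.module R M by fact
  note H = M.submoduleE[OF assms(2)] and K = M.submoduleE[OF assms(3)]
  show ?thesis
  proof (rule M.submoduleI_smult)
    show "H <+>\<^bsub>M\<^esub> K \<subseteq> carrier M" using H(1) K(1) by (auto simp: set_add_iff subset_iff)
    show "\<zero>\<^bsub>M\<^esub> \<in> H <+>\<^bsub>M\<^esub> K" unfolding set_add_iff
      by (intro bexI[of _ "\<zero>\<^bsub>M\<^esub>"] submodule_zero[OF assms(1,2)] submodule_zero[OF assms(1,3)]) simp
    fix a assume "a \<in> H <+>\<^bsub>M\<^esub> K"
    then obtain h k where hk: "h \<in> H" "k \<in> K" "a = h \<oplus>\<^bsub>M\<^esub> k" by (auto simp: set_add_iff)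
    have c: "h \<in> carrier M" "k \<in> carrier M" using hk H(1) K(1) by auto
    show "r \<odot>\<^bsub>M\<^esub> a \<in> H <+>\<^bsub>M\<^esub> K" if "r \<in> carrier R" for r
      unfolding set_add_iff hk(3) M.smult_r_distr[OF that c] using H(4)[OF that hk(1)] K(4)[OF that hk(2)] by blast
    fix b assume "b \<in> H <+>\<^bsub>M\<^esub> K"
    then obtain h' k' where hk': "h' \<in> H" "k' \<in> K" "b = h' \<oplus>\<^bsub>M\<^esub> k'" by (auto simp: set_add_iff)
    have c': "h' \<in> carrier M" "k' \<in> carrier M" using hk' H(1) K(1) by auto
    have "a \<oplus>\<^bsub>M\<^esub> b = (h \<oplus>\<^bsub>M\<^esub> h') \<oplus>\<^bsub>M\<^esub> (k \<oplus>\<^bsub>M\<^esub> k')" using c c' by (simp add: hk(3) hk'(3) M.M.a_ac)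
    then show "a \<oplus>\<^bsub>M\<^esub> b \<in> H <+>\<^bsub>M\<^esub> K"
      unfolding set_add_iff using H(5)[OF hk(1) hk'(1)] K(5)[OF hk(2) hk'(2)] by blast
  qed
qed

lemma lin_restrict_free:
  assumes "h \<in> lin_maps R (free_mod R UNIV) (free_mod R UNIV)" "cring R"
    "\<And>f. f \<in> carrier (free_mod R B) \<Longrightarrow> h f \<in> carrier (free_mod R B')"
  shows "h \<in> lin_maps R (free_mod R B) (free_mod R B')"
proof -
  interpret R: cring R by fact
  have "f \<in> carrier (free_mod R UNIV)" if "f \<in> carrier (free_mod R B)" for f by (rule R.free_mod_mono[OF that subset_UNIV])
  then show ?thesis using assms(1,3) by (auto simp: lin_maps_def)
qed

lemma free_mod_empty: "carrier (free_mod R {}) = {\<zero>\<^bsub>free_mod R {}\<^esub>}"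
  by (auto simp: free_mod_carrier)

context cring
begin

lemma lin_ext_contr:
  assumes c: "c \<in> UNIV \<rightarrow> carrier R" and f: "f \<in> fs B"
    and B: "\<And>J m j. (J, m) \<in> B \<Longrightarrow> j \<in> J \<Longrightarrow> (J - {j}, t j m) \<in> B' \<and> r J j = sg J j \<otimes> c j"
  shows "lin_ext R (free_mod R B') (\<lambda>(J, m). finsum (free_mod R B') (\<lambda>j. r J j \<odot>\<^bsub>free_mod R B'\<^esub> bv (J - {j}, t j m)) J) f = contr c t f"
proof -
  interpret F: Module.module R FF by (rule FF_module)
  interpret F': Module.module R "free_mod R B'" by (rule free_mod_module)
  let ?v = "\<lambda>(J, m). finsum (free_mod R B') (\<lambda>j. r J j \<odot>\<^bsub>free_mod R B'\<^esub> bv (J - {j}, t j m)) J"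
  have cc: "c j \<in> carrier R" for j using c by auto
  have v: "?v b = contr_basis c t b" "?v b \<in> fs B'" if b: "b \<in> B" for b
  proof -
    obtain J m where bJ: "b = (J, m)" by (cases b)
    have P: "(\<lambda>j. r J j \<odot>\<^bsub>free_mod R B'\<^esub> bv (J - {j}, t j m)) \<in> J \<rightarrow> fs B'"
    proof
      fix j assume j: "j \<in> J"
      have "r J j \<in> carrier R" using B[OF b[unfolded bJ] j] cc by simp
      moreover have "bv (J - {j}, t j m) \<in> fs B'" by (rule basis_vec_closed) (use B[OF b[unfolded bJ] j] in simp)
      ultimately show "r J j \<odot>\<^bsub>free_mod R B'\<^esub> bv (J - {j}, t j m) \<in> fs B'" by (rule F'.smult_closed)
    qed
    have "?v b = finsum FF (\<lambda>j. r J j \<odot>\<^bsub>free_mod R B'\<^esub> bv (J - {j}, t j m)) J"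
      unfolding bJ using finsum_free_mod_FF[OF P] by simp
    also have "\<dots> = contr_basis c t b"
      unfolding bJ contr_basis_def prod.case
    proof (rule F.M.finsum_cong')
      fix j assume j: "j \<in> J"
      show "r J j \<odot>\<^bsub>free_mod R B'\<^esub> bv (J - {j}, t j m) = (sg J j \<otimes> c j) \<odot>\<^sub>F bv (J - {j}, t j m)"
        using B[OF b[unfolded bJ] j] by simp
    qed (use cc in \<open>auto simp del: free_mod_simps\<close>)
    finally show "?v b = contr_basis c t b" .
    show "?v b \<in> fs B'" unfolding bJ prod.case by (rule F'.M.finsum_closed[OF P])
  qed
  have "lin_ext R (free_mod R B') ?v f = lin_ext R FF ?v f" by (rule lin_ext_free_mod_FF[OF _ f]) (use v(2) in blast)
  also have "\<dots> = contr c t f" unfolding contr_def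
    by (rule lin_ext_cong[OF FF_module f]) (use v(1) contr_basis_closed[OF c] in auto)
  finally show ?thesis .
qed

end

context koszul
begin

lemma Q_bdry: "f \<in> fs (Q_basis N k n) \<Longrightarrow> bdry (Q_cx R N u k) n f = kd f"
proof -
  assume f: "f \<in> fs (Q_basis N k n)"
  have "lin_ext R (Q_mod R N k (n - 1)) (\<lambda>(J, m). finsum (Q_mod R N k (n - 1))
      (\<lambda>j. (sg J j \<otimes> u j) \<odot>\<^bsub>Q_mod R N k (n - 1)\<^esub> bv (J - {j}, m)) J) f = contr w (\<lambda>j m. m) f"
    by (rule lin_ext_contr[OF w_Pi f, where r = "\<lambda>J j. sg J j \<otimes> u j"])
      (auto simp: Q_basis_def w_def intro: int_card_pred)
  then show ?thesis by (simp add: Q_cx_def kd_def)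
qed

lemma Q_del_eq: "f \<in> fs (Q_basis N k n) \<Longrightarrow> Q_del R N k n f = del f"
proof -
  assume f: "f \<in> fs (Q_basis N k n)"
  have "lin_ext R (Q_mod R N (Suc k) (n - 1)) (\<lambda>(J, m). finsum (Q_mod R N (Suc k) (n - 1))
      (\<lambda>j. sg J j \<odot>\<^bsub>Q_mod R N (Suc k) (n - 1)\<^esub> bv (J - {j}, add_mset j m)) J) f = contr (\<lambda>j. \<one>) add_mset f"
    by (rule lin_ext_contr[OF _ f, where r = sg]) (auto simp: Q_basis_def intro: int_card_pred)
  then show ?thesis by (simp add: Q_del_def del_def)
qed

lemma Q_kd_fs: "f \<in> fs (Q_basis N k n) \<Longrightarrow> kd f \<in> fs (Q_basis N k (n - 1))"
  by (erule kd_fs) (auto simp: Q_basis_def intro: int_card_pred)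

lemma Q_del_fs: "f \<in> fs (Q_basis N k n) \<Longrightarrow> del f \<in> fs (Q_basis N (Suc k) (n - 1))"
  by (erule del_fs) (auto simp: Q_basis_def intro: int_card_pred)

lemma Q_hom_fs: "f \<in> fs (Q_basis N (Suc k) n) \<Longrightarrow> hom f \<in> fs (Q_basis N k (n + 1))"
proof (erule hom_fs)
  fix J m x assume "(J, m) \<in> Q_basis N (Suc k) n" "x \<in># m" "x \<notin> J"
  then show "(insert x J, m - {#x#}) \<in> Q_basis N k (n + 1)"
    by (auto simp: Q_basis_def size_Diff_singleton dest: in_diffD)
qed

lemma Q_kd_lin: "kd \<in> lin_maps R (Q_mod R N k n) (Q_mod R N k (n - 1))"
  by (rule lin_restrict_free[OF kd_lin cring_axioms Q_kd_fs])

lemma Q_chains [simp]: "chains (Q_cx R N u k) n = Q_mod R N k n" by (simp add: Q_cx_def)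

lemma Q_chain_complex: "chain_complex R (Q_cx R N u k)"
  unfolding chain_complex_def
proof (intro allI conjI ballI)
  fix n
  show "Module.module R (chains (Q_cx R N u k) n)" by (simp add: free_mod_module)
  show "bdry (Q_cx R N u k) n \<in> lin_maps R (chains (Q_cx R N u k) n) (chains (Q_cx R N u k) (n - 1))"
    unfolding Q_chains by (rule lin_cong[OF Q_kd_lin free_mod_module Q_bdry])
  fix x assume "x \<in> carrier (chains (Q_cx R N u k) n)"
  then have x: "x \<in> fs (Q_basis N k n)" by simp
  show "bdry (Q_cx R N u k) (n - 1) (bdry (Q_cx R N u k) n x) = \<zero>\<^bsub>chains (Q_cx R N u k) (n - 2)\<^esub>"
    using kd_kd[OF fs_FF[OF x]] by (simp add: Q_bdry[OF x] Q_bdry[OF Q_kd_fs[OF x]])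
qed

definition K_cx :: "nat \<Rightarrow> ('a, 'a qchain) chain_cx" where
  "K_cx s = \<lparr>chains = (\<lambda>n. free_mod R (KB s n)), bdry = (\<lambda>n. Kd s)\<rparr>"

lemma K_cx_simps [simp]: "chains (K_cx s) n = free_mod R (KB s n)" "bdry (K_cx s) n = Kd s"
  by (simp_all add: K_cx_def)

lemma K_chain_complex: "chain_complex R (K_cx s)"
  unfolding chain_complex_def
proof (intro allI conjI ballI)
  fix n
  show "bdry (K_cx s) n \<in> lin_maps R (chains (K_cx s) n) (chains (K_cx s) (n - 1))"
    unfolding K_cx_simps by (rule lin_restrict_free[OF Kd_lin cring_axioms Kd_fs])
  fix x assume "x \<in> carrier (chains (K_cx s) n)"
  then show "bdry (K_cx s) (n - 1) (bdry (K_cx s) n x) = \<zero>\<^bsub>chains (K_cx s) (n - 2)\<^esub>"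
    using Kd_Kd[OF fs_FF] by simp
qed (simp add: free_mod_module)

lemma Q_ev: "f \<in> fs (Q_basis N k 0) \<Longrightarrow> ev f \<in> Ip k"
proof (rule lin_image_in_submodule[OF lin_restrict_FF[OF ev_lin] reg_mod_module ideal_submodule[OF Ip_ideal]])
  fix b assume "b \<in> Q_basis N k 0"
  then obtain J m where "b = (J, m)" "size m = k" by (auto simp: Q_basis_def)
  then show "ev (bv b) \<in> Ip k" using mon_Ip[of m] by (simp add: ev_bv)
qed

lemma Q_ev_surj: "a \<in> Ip k \<Longrightarrow> \<exists>f\<in>fs (Q_basis N k 0). ev f = a"
proof -
  assume a: "a \<in> Ip k"
  have H: "submodule (ev ` fs (Q_basis N k 0)) R (reg_mod R)"
    by (rule lin_image_submodule[OF ev_lin FF_module reg_mod_module fs_submodule])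
  have "Ip k \<subseteq> ev ` fs (Q_basis N k 0)"
  proof (rule Ip_least[OF submodule_ideal[OF H]])
    fix m assume "set_mset m \<subseteq> X" "size m = k"
    then have "bv ({}, m) \<in> fs (Q_basis N k 0)" by (intro basis_vec_closed) (auto simp: Q_basis_def)
    then show "mon m \<in> ev ` fs (Q_basis N k 0)" using ev_bv by (metis imageI)
  qed
  then show ?thesis using a by auto
qed

lemma Q_aug_eq: "f \<in> fs (Q_basis N k 0) \<Longrightarrow> Q_aug R N u k f = Ip (Suc k) +> ev f"
  and Q_aug_lin: "Q_aug R N u k \<in> lin_maps R (Q_mod R N k 0) (ideal_pow_quot R II k)"
proof -
  let ?M = "reg_mod R\<lparr>carrier := Ip k\<rparr>"
  have sub: "Ip (Suc k) \<subseteq> Ip k" by (rule ideal_pow_decreasing[OF II_ideal]) simp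
  have M: "Module.module R ?M" by (rule submodule.submodule_is_module[OF ideal_submodule[OF Ip_ideal] reg_mod_module])
  have S: "submodule (Ip (Suc k)) R ?M"
    by (rule submodule_restrict[OF reg_mod_module ideal_submodule[OF Ip_ideal] ideal_submodule[OF Ip_ideal] sub])
  have q: "(\<lambda>a. Ip (Suc k) +> a) \<in> lin_maps R ?M (ideal_pow_quot R II k)"
    using quot_mod_lin[OF M S] by (simp add: ideal_pow_quot_def)
  have Qm: "Module.module R (ideal_pow_quot R II k)"
    unfolding ideal_pow_quot_def by (rule quot_mod_module[OF M S])
  have e: "ev \<in> lin_maps R (Q_mod R N k 0) ?M"
    using lin_restrict_FF[OF ev_lin, of "Q_basis N k 0"] Q_ev by (auto simp: lin_maps_def)
  have uc: "u x \<in> carrier R" if "x \<in> X" for x using u_closed that by auto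
  have v: "Ip (Suc k) +> finprod R (\<lambda>i. u i [^] count m i) (set_mset m) = Ip (Suc k) +> mon m"
    if "(J, m) \<in> Q_basis N k 0" for J m
  proof -
    have "finprod R (\<lambda>i. u i [^] count m i) (set_mset m) = mon m"
      unfolding mon_def by (rule finprod_cong') (use that in \<open>auto simp: Q_basis_def w_def uc subset_iff\<close>)
    then show ?thesis by simp
  qed
  have mc: "mon m \<in> Ip k" if "(J, m) \<in> Q_basis N k 0" for J m using that mon_Ip[of m] by (simp add: Q_basis_def)
  let ?v = "\<lambda>(J, m). Ip (Suc k) +> finprod R (\<lambda>i. u i [^] count m i) (set_mset m)"
  have vc: "?v b \<in> carrier (ideal_pow_quot R II k)" if "b \<in> Q_basis N k 0" for b
    using that mc lin_closed[OF q] by (cases b) (simp add: v)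
  have aug: "Q_aug R N u k = lin_ext R (ideal_pow_quot R II k) ?v" by (simp add: Q_aug_def II_def Let_def)
  show l: "Q_aug R N u k \<in> lin_maps R (Q_mod R N k 0) (ideal_pow_quot R II k)"
    unfolding aug by (rule lin_ext_lin[OF Qm]) (use vc in blast)
  show "f \<in> fs (Q_basis N k 0) \<Longrightarrow> Q_aug R N u k f = Ip (Suc k) +> ev f"
  proof (rule lin_eq_on_free[OF l lin_compose[OF e q] Qm])
    fix b assume b: "b \<in> Q_basis N k 0"
    obtain J m where bJ: "b = (J, m)" by (cases b)
    have "Q_aug R N u k (bv b) = ?v b" unfolding aug using vc[OF b] by (intro lin_ext_basis Qm)
    then show "Q_aug R N u k (bv b) = Ip (Suc k) +> ev (bv b)" using b v by (simp add: bJ ev_bv)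
  qed
qed

text \<open>The submodule \<open>I F\<close> of a free module F, by coordinates.\<close>

definition II_valued :: "(nat set \<times> nat multiset) set \<Rightarrow> ('a qchain) set" where
  "II_valued B = {f \<in> fs B. \<forall>b. f b \<in> II}"

lemma ideal_span_II: "ideal_span II (free_mod R B) = II_valued B"
  unfolding II_valued_def by (rule ideal_span_free_mod[OF cring_axioms II_ideal])

lemma II_sub: "II \<subseteq> carrier R" by (rule additive_subgroup.a_subset[OF ideal.axioms(1)[OF II_ideal]])

lemma II_valued_submodule: "submodule (II_valued B) R (free_mod R B)"
  unfolding ideal_span_II[symmetric] by (rule ideal_span_submodule[OF free_mod_module II_sub])

lemma II_valued_lin:
  assumes "h \<in> lin_maps R FF FF" "f \<in> II_valued B" "h f \<in> fs B'"
  shows "h f \<in> II_valued B'"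
proof -
  have "f \<in> ideal_span II FF" unfolding ideal_span_II using assms(2) fs_FF by (auto simp: II_valued_def)
  from ideal_span_lin[OF assms(1) FF_module FF_module II_sub this]
  show ?thesis unfolding ideal_span_II using assms(3) by (auto simp: II_valued_def)
qed

lemma kd_II: "f \<in> carrier FF \<Longrightarrow> kd f b \<in> II"
  by (rule kd_values[OF II_ideal]) (auto simp: w_II)

lemma kd_II_valued: "f \<in> fs B \<Longrightarrow> kd f \<in> fs B' \<Longrightarrow> kd f \<in> II_valued B'"
  using kd_II fs_FF by (auto simp: II_valued_def)

end

locale regular_koszul_nontrivial = regular_koszul +
  assumes one_zero: "\<one> \<noteq> \<zero>"
begin

lemma Q_resolution: "free_resolution R (Q_cx R N u k) (ideal_pow_quot R II k) (Q_aug R N u k)"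
  unfolding free_resolution_def
proof (intro conjI allI impI)
  let ?Q = "Q_cx R N u k"
  show "chain_complex R ?Q" by (rule Q_chain_complex)
  show "is_free_mod R (chains ?Q n)" for n by (simp add: free_mod_is_free[OF cring_axioms one_zero])
  show "carrier (chains ?Q n) = {\<zero>\<^bsub>chains ?Q n\<^esub>}" if "n < 0" for n
  proof -
    have "Q_basis N k n = {}" using that by (auto simp: Q_basis_def)
    then show ?thesis using free_mod_empty[of R] by (simp del: free_mod_simps)
  qed
  show "cycles ?Q n = boundaries ?Q n" if n: "n > 0" for n
  proof (rule equalityI[OF subsetI boundaries_subset_cycles[OF Q_chain_complex]])
    fix f assume "f \<in> cycles ?Q n"
    then have f: "f \<in> fs (Q_basis N k n)" "kd f = \<zero>\<^sub>F" by (auto simp: cycles_def Q_bdry)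
    obtain g where "g \<in> fs (Q_basis N k (n + 1))" "kd g = f" using koszul_acyclic[OF f(1) n f(2)] by blast
    then show "f \<in> boundaries ?Q n" unfolding boundaries_def using Q_bdry by (auto simp: image_iff)
  qed
  show "Q_aug R N u k \<in> lin_maps R (chains ?Q 0) (ideal_pow_quot R II k)" using Q_aug_lin by simp
  have cQ: "carrier (ideal_pow_quot R II k) = (\<lambda>a. Ip (Suc k) +> a) ` Ip k"
    by (simp add: ideal_pow_quot_def quot_mod_simps)
  have "Q_aug R N u k ` fs (Q_basis N k 0) = (\<lambda>f. Ip (Suc k) +> ev f) ` fs (Q_basis N k 0)"
    by (rule image_cong) (simp_all add: Q_aug_eq)
  also have "\<dots> = (\<lambda>a. Ip (Suc k) +> a) ` (ev ` fs (Q_basis N k 0))" by (simp add: image_image)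
  also have "ev ` fs (Q_basis N k 0) = Ip k" using Q_ev Q_ev_surj by blast
  finally show "Q_aug R N u k ` carrier (chains ?Q 0) = carrier (ideal_pow_quot R II k)" unfolding cQ by simp
  have "Q_aug R N u k f = \<zero>\<^bsub>ideal_pow_quot R II k\<^esub> \<longleftrightarrow> ev f \<in> Ip (Suc k)" if f: "f \<in> fs (Q_basis N k 0)" for f
    using coset_zero_iff[OF reg_mod_module ideal_submodule[OF Ip_ideal], of "ev f" "Suc k"] ev_closed[OF fs_FF[OF f]]
    by (simp add: Q_aug_eq[OF f] ideal_pow_quot_def quot_mod_simps)
  then have "{f \<in> carrier (chains ?Q 0). Q_aug R N u k f = \<zero>\<^bsub>ideal_pow_quot R II k\<^esub>}
      = {f \<in> fs (Q_basis N k 0). ev f \<in> Ip (Suc k)}" by auto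
  also have "\<dots> = kd ` fs (Q_basis N k 1)"
    using Q_augmentation_kernel Q_kd_fs[of _ k 1] by auto
  also have "\<dots> = boundaries ?Q 0"
    unfolding boundaries_def by (rule image_cong) (simp_all add: Q_bdry)
  finally show "{f \<in> carrier (chains ?Q 0). Q_aug R N u k f = \<zero>\<^bsub>ideal_pow_quot R II k\<^esub>} = boundaries ?Q 0" .
qed

lemma K_resolution:
  assumes s: "s > 0"
  shows "free_resolution R (K_cx s) (quot_mod (reg_mod R) (Ip s)) (\<lambda>f. Ip s +> ev f)"
  unfolding free_resolution_def
proof (intro conjI allI impI)
  let ?K = "K_cx s"
  show "chain_complex R ?K" by (rule K_chain_complex)
  show "is_free_mod R (chains ?K n)" for n by (simp add: free_mod_is_free[OF cring_axioms one_zero])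
  show "carrier (chains ?K n) = {\<zero>\<^bsub>chains ?K n\<^esub>}" if "n < 0" for n
  proof -
    have "KB s n = {}" using that by (auto simp: KB_def)
    then show ?thesis using free_mod_empty[of R] by (simp del: free_mod_simps)
  qed
  show "cycles ?K n = boundaries ?K n" if n: "n > 0" for n
  proof (rule equalityI[OF subsetI boundaries_subset_cycles[OF K_chain_complex]])
    fix f assume "f \<in> cycles ?K n"
    then have f: "f \<in> fs (KB s n)" "Kd s f = \<zero>\<^sub>F" by (auto simp: cycles_def)
    obtain g where "g \<in> fs (KB s (n + 1))" "Kd s g = f" using K_acyclic[OF f(1) n f(2)] by blast
    then show "f \<in> boundaries ?K n" unfolding boundaries_def by (auto simp: image_iff)
  qed
  note q = quot_mod_lin[OF reg_mod_module ideal_submodule[OF Ip_ideal[of s]]]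
  show "(\<lambda>f. Ip s +> ev f) \<in> lin_maps R (chains ?K 0) (quot_mod (reg_mod R) (Ip s))"
    using lin_compose[OF lin_restrict_FF[OF ev_lin] q] by simp
  have "ev ` fs (KB s 0) = carrier R"
  proof (intro equalityI subsetI)
    fix r assume "r \<in> ev ` fs (KB s 0)"
    then show "r \<in> carrier R" using ev_closed[OF fs_FF] by auto
  next
    fix r assume r: "r \<in> carrier R"
    have o: "bv ({}, {#}) \<in> fs (KB s 0)" by (rule basis_vec_closed) (use s in \<open>auto simp: KB_def\<close>)
    have "r \<odot>\<^sub>F bv ({}, {#}) \<in> fs (KB s 0)"
      by (rule Module.module.submoduleE(4)[OF FF_module fs_submodule r o])
    moreover have "ev (r \<odot>\<^sub>F bv ({}, {#})) = r"
      using lin_smult[OF ev_lin r bv_FF] r by (simp add: ev_bv del: free_mod_simps)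
    ultimately show "r \<in> ev ` fs (KB s 0)" by (metis imageI)
  qed
  then have "(\<lambda>a. Ip s +> a) ` (ev ` fs (KB s 0)) = (\<lambda>a. Ip s +> a) ` carrier R" by simp
  then show "(\<lambda>f. Ip s +> ev f) ` carrier (chains ?K 0) = carrier (quot_mod (reg_mod R) (Ip s))"
    by (simp add: quot_mod_simps image_image)
  have "Ip s +> ev f = \<zero>\<^bsub>quot_mod (reg_mod R) (Ip s)\<^esub> \<longleftrightarrow> ev f \<in> Ip s" if f: "f \<in> fs (KB s 0)" for f
    using coset_zero_iff[OF reg_mod_module ideal_submodule[OF Ip_ideal], of "ev f" s] ev_closed[OF fs_FF[OF f]]
    by (simp add: quot_mod_simps)
  then have "{f \<in> carrier (chains ?K 0). Ip s +> ev f = \<zero>\<^bsub>quot_mod (reg_mod R) (Ip s)\<^esub>}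
      = {f \<in> fs (KB s 0). ev f \<in> Ip s}" by auto
  also have "\<dots> = Kd s ` fs (KB s 1)"
    using K_augmentation_kernel[OF s] Kd_fs[of _ s 1] by auto
  also have "\<dots> = boundaries ?K 0" by (simp add: boundaries_def)
  finally show "{f \<in> carrier (chains ?K 0). Ip s +> ev f = \<zero>\<^bsub>quot_mod (reg_mod R) (Ip s)\<^esub>} = boundaries ?K 0" .
qed

abbreviation A where "A \<equiv> R Quot II"
abbreviation \<phi> where "\<phi> \<equiv> a_r_coset R II"

lemma II_kernel: "{r \<in> carrier R. \<phi> r = \<zero>\<^bsub>A\<^esub>} = II"
proof -
  have z: "\<zero>\<^bsub>A\<^esub> = II" by (simp add: FactRing_def)
  have "\<phi> r = \<zero>\<^bsub>A\<^esub> \<longleftrightarrow> r \<in> II" if "r \<in> carrier R" for r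
    unfolding z using coset_zero_iff[OF reg_mod_module ideal_submodule[OF II_ideal], of r] that
    unfolding reg_mod_coset reg_mod_simps by blast
  then show ?thesis using II_sub by blast
qed

lemma change: "surjective_change R A \<phi>"
proof -
  interpret ideal II R by (rule II_ideal)
  show "surjective_change R A \<phi>"
    by (intro surjective_change.intro rcos_ring_hom_cring cring_axioms surjective_change_axioms.intro)
      (auto simp: FactRing_def A_RCOSETS_def')
qed

lemmas bc_presents_eq_iff = surjective_change.presents_eq_iff[OF change]
  and bc_presents_iso = surjective_change.presents_iso[OF change]
  and bc_presents_compose = surjective_change.presents_compose[OF change]
  and bc_presents_quot = surjective_change.presents_quot[OF change]
  and bc_homology_presents = surjective_change.homology_presents[OF change]
  and bc_tensor_module = surjective_change.tensor_module[OF change]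
  and bc_tensor_map_\<tau> = surjective_change.tensor_map_\<tau>[OF change]
  and bc_tensor_pairing_\<tau> = surjective_change.tensor_pairing_\<tau>[OF change]
  and bc_\<tau>_closed = surjective_change.\<tau>_closed[OF change]
  and bc_\<tau>_presents = surjective_change.\<tau>_presents[OF change, unfolded II_kernel]

abbreviation \<tau> where "\<tau> M x \<equiv> scalar_inclusion R A \<phi> M x"

text \<open>Each \<open>R/I \<otimes> F\<close> is handled as F modulo \<open>I F\<close>.\<close>

lemma \<tau>_free_presents: "presents R \<phi> (free_mod R B) (II_valued B) (tensor_mod R A \<phi> (free_mod R B)) (\<lambda>x. \<tau> (free_mod R B) x)"
  using bc_\<tau>_presents[OF free_mod_module[of B]] unfolding ideal_span_II .

lemma tensor_map_free:
  assumes "h \<in> lin_maps R (free_mod R B) (free_mod R B')" "f \<in> fs B"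
  shows "tensor_map R A \<phi> (free_mod R B') h (\<tau> (free_mod R B) f) = \<tau> (free_mod R B') (h f)"
  by (rule bc_tensor_map_\<tau>[OF free_mod_module free_mod_module assms])

section \<open>Tor in terms of a resolution before the change of rings\<close>

abbreviation ISp where "ISp C n \<equiv> ideal_span II (chains C n)"

text \<open>
  The elements of a complex over R that become cycles over R/I, and those that become boundaries. The
  homology of \<open>R/I \<otimes> C\<close> is their quotient.
\<close>

definition Zc where "Zc C n = {x \<in> carrier (chains C n). bdry C n x \<in> ISp C (n - 1)}"
definition Bd where "Bd C n = boundaries C n <+>\<^bsub>chains C n\<^esub> ISp C n"

lemma ISp_submodule: "chain_complex R C \<Longrightarrow> submodule (ISp C n) R (chains C n)"
  by (rule ideal_span_submodule[OF cx_module II_sub])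

lemma Zc_submodule: "chain_complex R C \<Longrightarrow> submodule (Zc C n) R (chains C n)"
  unfolding Zc_def by (rule lin_kernel_submodule[OF cx_lin cx_module cx_module ISp_submodule])

lemma Bd_submodule: "chain_complex R C \<Longrightarrow> submodule (Bd C n) R (chains C n)"
  unfolding Bd_def by (rule submodule_sum[OF cx_module boundaries_submodule ISp_submodule])

lemma Zc_closed: "x \<in> Zc C n \<Longrightarrow> x \<in> carrier (chains C n)" by (simp add: Zc_def)

lemma Bd_iff:
  assumes C: "chain_complex R C" and z: "z \<in> carrier (chains C n)"
  shows "z \<in> Bd C n \<longleftrightarrow> (\<exists>v\<in>carrier (chains C (n + 1)). z \<ominus>\<^bsub>chains C n\<^esub> bdry C (n + 1) v \<in> ISp C n)"
proof -
  interpret M: Module.module R "chains C n" by (rule cx_module[OF C])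
  have b: "bdry C (n + 1) v \<in> carrier (chains C n)" if "v \<in> carrier (chains C (n + 1))" for v
    by (rule lin_closed[OF cx_lin_Suc[OF C] that])
  have i: "i \<in> carrier (chains C n)" if "i \<in> ISp C n" for i by (rule ideal_span_closed[OF M.module_axioms II_sub that])
  show ?thesis
  proof
    assume "z \<in> Bd C n"
    then obtain v i where v: "v \<in> carrier (chains C (n + 1))" "i \<in> ISp C n" "z = bdry C (n + 1) v \<oplus>\<^bsub>chains C n\<^esub> i"
      unfolding Bd_def set_add_iff boundaries_def by blast
    have "z \<ominus>\<^bsub>chains C n\<^esub> bdry C (n + 1) v = i" unfolding v(3) by (rule M.M.add_minus_cancel_left[OF b[OF v(1)] i[OF v(2)]])
    then have "z \<ominus>\<^bsub>chains C n\<^esub> bdry C (n + 1) v \<in> ISp C n" using v(2) by (simp only:)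
    then show "\<exists>v\<in>carrier (chains C (n + 1)). z \<ominus>\<^bsub>chains C n\<^esub> bdry C (n + 1) v \<in> ISp C n" using v(1) by blast
  next
    assume "\<exists>v\<in>carrier (chains C (n + 1)). z \<ominus>\<^bsub>chains C n\<^esub> bdry C (n + 1) v \<in> ISp C n"
    then obtain v where v: "v \<in> carrier (chains C (n + 1))" "z \<ominus>\<^bsub>chains C n\<^esub> bdry C (n + 1) v \<in> ISp C n" by blast
    have "z \<ominus>\<^bsub>chains C n\<^esub> bdry C (n + 1) v = \<ominus>\<^bsub>chains C n\<^esub> bdry C (n + 1) v \<oplus>\<^bsub>chains C n\<^esub> z"
      unfolding a_minus_def by (rule M.M.a_comm[OF z M.M.a_inv_closed[OF b[OF v(1)]]])
    then have "z = bdry C (n + 1) v \<oplus>\<^bsub>chains C n\<^esub> (z \<ominus>\<^bsub>chains C n\<^esub> bdry C (n + 1) v)"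
      using M.M.r_neg2[OF b[OF v(1)] z] by simp
    then show "z \<in> Bd C n" unfolding Bd_def set_add_iff boundaries_def using v by blast
  qed
qed

lemma Bd_ISp: "chain_complex R C \<Longrightarrow> i \<in> ISp C n \<Longrightarrow> i \<in> Bd C n"
  and Bd_bdry: "chain_complex R C \<Longrightarrow> v \<in> carrier (chains C (n + 1)) \<Longrightarrow> bdry C (n + 1) v \<in> Bd C n"
proof -
  assume C: "chain_complex R C"
  interpret M: Module.module R "chains C n" by (rule cx_module[OF C])
  { assume i: "i \<in> ISp C n"
    then have "i = \<zero>\<^bsub>chains C n\<^esub> \<oplus>\<^bsub>chains C n\<^esub> i" using ideal_span_closed[OF M.module_axioms II_sub] by simp
    then show "i \<in> Bd C n" unfolding Bd_def set_add_iff using i submodule_zero[OF M.module_axioms boundaries_submodule[OF C]] by blast }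
  { assume v: "v \<in> carrier (chains C (n + 1))"
    then have "bdry C (n + 1) v = bdry C (n + 1) v \<oplus>\<^bsub>chains C n\<^esub> \<zero>\<^bsub>chains C n\<^esub>" using lin_closed[OF cx_lin_Suc[OF C]] by simp
    then show "bdry C (n + 1) v \<in> Bd C n"
      unfolding Bd_def set_add_iff boundaries_def using v submodule_zero[OF M.module_axioms ISp_submodule[OF C]] by blast }
qed

lemma Bd_subset: "chain_complex R C \<Longrightarrow> Bd C n \<subseteq> Zc C n"
proof
  fix z assume C: "chain_complex R C" and "z \<in> Bd C n"
  then obtain v i where v: "v \<in> carrier (chains C (n + 1))" "i \<in> ISp C n" "z = bdry C (n + 1) v \<oplus>\<^bsub>chains C n\<^esub> i"
    unfolding Bd_def set_add_iff boundaries_def by blast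
  have z0: "\<zero>\<^bsub>chains C (n - 1)\<^esub> \<in> ISp C (n - 1)" by (rule ideal_span.zero)
  have "bdry C (n + 1) v \<in> Zc C n"
    using lin_closed[OF cx_lin_Suc[OF C] v(1)] cx_dd[OF C v(1)] z0 by (simp add: Zc_def)
  moreover have "i \<in> Zc C n"
    unfolding Zc_def using ideal_span_closed[OF cx_module[OF C] II_sub v(2)]
      ideal_span_lin[OF cx_lin[OF C] cx_module[OF C] cx_module[OF C] II_sub v(2)] by simp
  ultimately show "z \<in> Zc C n" unfolding v(3) by (rule Module.module.submoduleE(5)[OF cx_module[OF C] Zc_submodule[OF C]])
qed

abbreviation Zm where "Zm C n \<equiv> chains C n\<lparr>carrier := Zc C n\<rparr>"

definition tor_class where "tor_class C n x = boundaries (tensor_cx R A \<phi> C) n +>\<^bsub>chains (tensor_cx R A \<phi> C) n\<^esub> \<tau> (chains C n) x"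

lemma Tor_homology:
  assumes C: "chain_complex R C"
  shows Tor_complex: "chain_complex A (tensor_cx R A \<phi> C)"
    and Tor_presents: "presents R \<phi> (Zm C n) (Bd C n) (Tor R A \<phi> C n) (tor_class C n)"
    and \<tau>_boundary: "x \<in> Bd C n \<Longrightarrow> \<tau> (chains C n) x \<in> boundaries (tensor_cx R A \<phi> C) n"
proof -
  let ?E = "tensor_cx R A \<phi> C"
  have E: "chains ?E n = tensor_mod R A \<phi> (chains C n)" for n by (simp add: tensor_cx_def)
  have m: "Module.module R (chains C n)" for n by (rule cx_module[OF C])
  have Em: "Module.module A (chains ?E n)" for n unfolding E by (rule bc_tensor_module[OF m])
  have pr: "presents R \<phi> (chains C n) (ISp C n) (chains ?E n) (\<lambda>x. \<tau> (chains C n) x)" for n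
    unfolding E by (rule bc_\<tau>_presents[OF m])
  have comm: "bdry ?E n (\<tau> (chains C n) x) = \<tau> (chains C (n - 1)) (bdry C n x)" if "x \<in> carrier (chains C n)" for n x
    using bc_tensor_map_\<tau>[OF m m cx_lin[OF C] that] by (simp add: tensor_cx_def)
  have dd: "bdry C (n - 1) (bdry C n x) \<in> ISp C (n - 2)" if "x \<in> carrier (chains C n)" for n x
    unfolding cx_dd[OF C that] by (rule ideal_span.zero)
  note * = bc_homology_presents[where M = "chains C" and E = ?E and K = "ISp C" and \<Theta> = "\<lambda>n x. \<tau> (chains C n) x" and \<delta> = "bdry C",
      OF m Em pr cx_lin[OF C] comm dd]
  have i: "x \<in> carrier (chains C n)" if "x \<in> carrier (chains C n)" for x n by (rule that)
  show "chain_complex A ?E" by (rule *(1)[OF i i])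
  have Z: "{x \<in> carrier (chains C n). bdry C n x \<in> ISp C (n - 1)} = Zc C n" for n by (simp add: Zc_def)
  have "{x \<in> carrier (chains C n). bdry C n x \<in> ISp C (n - 1)
      \<and> (\<exists>v\<in>carrier (chains C (n + 1)). x \<ominus>\<^bsub>chains C n\<^esub> bdry C (n + 1) v \<in> ISp C n)} = Bd C n"
  proof (intro equalityI subsetI)
    fix x assume "x \<in> Bd C n"
    moreover from this have "x \<in> Zc C n" using Bd_subset[OF C] by blast
    ultimately show "x \<in> {x \<in> carrier (chains C n). bdry C n x \<in> ISp C (n - 1)
        \<and> (\<exists>v\<in>carrier (chains C (n + 1)). x \<ominus>\<^bsub>chains C n\<^esub> bdry C (n + 1) v \<in> ISp C n)}"
      using Bd_iff[OF C, of x n] by (simp add: Zc_def)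
  qed (use Bd_iff[OF C] in blast)
  with *(2)[OF i i, of n] show "presents R \<phi> (Zm C n) (Bd C n) (Tor R A \<phi> C n) (tor_class C n)"
    unfolding Z Tor_def tor_class_def[abs_def] by simp
  show "\<tau> (chains C n) x \<in> boundaries ?E n" if x: "x \<in> Bd C n"
  proof -
    have xc: "x \<in> carrier (chains C n)" by (rule Zc_closed[OF subsetD[OF Bd_subset[OF C] x]])
    show ?thesis using *(4)[OF i i xc] Bd_iff[OF C xc] x by simp
  qed
qed

lemma Tor_module: "chain_complex R C \<Longrightarrow> Module.module A (Tor R A \<phi> C n)"
  unfolding Tor_def by (rule homology_module[OF Tor_complex])

lemma Zm_module: "chain_complex R C \<Longrightarrow> Module.module R (Zm C n)"
  by (rule submodule.submodule_is_module[OF Zc_submodule cx_module])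

text \<open>
  An element of Tor is a set of classes, and the product and the induced maps are unions over its members.
  These members all come from elements over R in one coset of the boundaries.
\<close>

lemma tor_class_member:
  assumes C: "chain_complex R C" and x: "x \<in> Zc C n" and z: "z \<in> tor_class C n x"
  shows "\<exists>y\<in>Zc C n. z = \<tau> (chains C n) y \<and> y \<ominus>\<^bsub>chains C n\<^esub> x \<in> Bd C n"
proof -
  note m = cx_module[OF C]
  have E: "chains (tensor_cx R A \<phi> C) n = tensor_mod R A \<phi> (chains C n)" for n by (simp add: tensor_cx_def)
  obtain w where w: "w \<in> carrier (tensor_mod R A \<phi> (chains C (n + 1)))"
      "z = bdry (tensor_cx R A \<phi> C) (n + 1) w \<oplus>\<^bsub>tensor_mod R A \<phi> (chains C n)\<^esub> \<tau> (chains C n) x"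
    using z unfolding tor_class_def a_r_coset_def' boundaries_def E by auto
  obtain v where v: "v \<in> carrier (chains C (n + 1))" "w = \<tau> (chains C (n + 1)) v"
    using w(1) unfolding presentsD(2)[OF bc_\<tau>_presents[OF m], symmetric] by auto
  have dv: "bdry C (n + 1) v \<in> Zc C n" using Bd_subset[OF C] Bd_bdry[OF C v(1)] by blast
  have "bdry (tensor_cx R A \<phi> C) (n + 1) w = \<tau> (chains C n) (bdry C (n + 1) v)"
    using bc_tensor_map_\<tau>[OF m m cx_lin[OF C] v(1)] unfolding v(2) by (simp add: tensor_cx_def)
  then have "z = \<tau> (chains C n) (bdry C (n + 1) v \<oplus>\<^bsub>chains C n\<^esub> x)"
    unfolding w(2) using lin_add[OF presentsD(1)[OF bc_\<tau>_presents[OF m]] Zc_closed[OF dv] Zc_closed[OF x]] by simp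
  moreover have "(bdry C (n + 1) v \<oplus>\<^bsub>chains C n\<^esub> x) \<ominus>\<^bsub>chains C n\<^esub> x \<in> Bd C n"
  proof -
    interpret M: Module.module R "chains C n" by (rule m)
    note c = Zc_closed[OF dv] Zc_closed[OF x]
    have "(bdry C (n + 1) v \<oplus>\<^bsub>chains C n\<^esub> x) \<ominus>\<^bsub>chains C n\<^esub> x = bdry C (n + 1) v"
      using c by (simp add: a_minus_def M.M.a_assoc M.M.r_neg)
    then show ?thesis using Bd_bdry[OF C v(1)] by simp
  qed
  ultimately show ?thesis using Module.module.submoduleE(5)[OF m Zc_submodule[OF C] dv x] by blast
qed

lemma tor_class_nonempty:
  assumes C: "chain_complex R C" and x: "x \<in> Zc C n"
  shows "tor_class C n x \<noteq> {}"
proof -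
  have "\<tau> (chains C n) x \<in> carrier (chains (tensor_cx R A \<phi> C) n)"
    using bc_\<tau>_closed[OF Zc_closed[OF x]] by (simp add: tensor_cx_def)
  from abelian_subgroup.a_rcos_self[OF submodule_abelian_subgroup[OF cx_module[OF Tor_complex[OF C]] boundaries_submodule[OF Tor_complex[OF C]]] this]
  show ?thesis unfolding tor_class_def by blast
qed

section \<open>Exactness\<close>

definition \<kappa> where "\<kappa> k = tor_class (Q_cx R N u k)"

lemma Tor_Q_eq: "Tor_Q R N u k n = Tor R A \<phi> (Q_cx R N u k) n"
  by (simp add: Tor_Q_def II_def Let_def)

lemma Q_bdry_II: "f \<in> fs (Q_basis N k n) \<Longrightarrow> bdry (Q_cx R N u k) n f \<in> II_valued (Q_basis N k (n - 1))"
  using kd_II_valued[OF _ Q_kd_fs] by (simp add: Q_bdry)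

text \<open>
  The Koszul differential has its coefficients in I. So it vanishes over R/I, and Tor of R/I with
  \<open>I\<^sup>k/I\<^bsup>k+1\<^esup>\<close> is \<open>Q\<^bsup>(k)\<^esup>\<close> modulo I.
\<close>

lemma Zc_Q: "Zc (Q_cx R N u k) n = fs (Q_basis N k n)"
  and Bd_Q: "Bd (Q_cx R N u k) n = II_valued (Q_basis N k n)"
proof -
  note C = Q_chain_complex[of k] and V = II_valued_submodule
  show "Zc (Q_cx R N u k) n = fs (Q_basis N k n)" using Q_bdry_II by (auto simp: Zc_def ideal_span_II)
  show "Bd (Q_cx R N u k) n = II_valued (Q_basis N k n)"
  proof (intro equalityI subsetI)
    fix z assume "z \<in> Bd (Q_cx R N u k) n"
    then obtain v i where v: "v \<in> fs (Q_basis N k (n + 1))" "i \<in> II_valued (Q_basis N k n)"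
        "z = bdry (Q_cx R N u k) (n + 1) v \<oplus>\<^bsub>Q_mod R N k n\<^esub> i"
      unfolding Bd_def set_add_iff boundaries_def Q_chains ideal_span_II by blast
    have "bdry (Q_cx R N u k) (n + 1) v \<in> II_valued (Q_basis N k n)" using Q_bdry_II[OF v(1)] by simp
    then show "z \<in> II_valued (Q_basis N k n)"
      unfolding v(3) using v(2) by (rule Module.module.submoduleE(5)[OF free_mod_module V])
  qed (use Bd_ISp[OF C] ideal_span_II in simp)
qed

lemma \<kappa>_presents: "presents R \<phi> (Q_mod R N k n) (II_valued (Q_basis N k n)) (Tor_Q R N u k n) (\<kappa> k n)"
  using Tor_presents[OF Q_chain_complex, of k n] unfolding Zc_Q Bd_Q Tor_Q_eq \<kappa>_def by simp

lemma Tor_Q_module: "Module.module A (Tor_Q R N u k n)"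
  unfolding Tor_Q_eq by (rule Tor_module[OF Q_chain_complex])

lemma \<kappa>_eq_iff:
  assumes "x \<in> fs (Q_basis N k n)" "y \<in> fs (Q_basis N k n)"
  shows "\<kappa> k n x = \<kappa> k n y \<longleftrightarrow> x \<ominus>\<^bsub>Q_mod R N k n\<^esub> y \<in> II_valued (Q_basis N k n)"
  by (rule bc_presents_eq_iff[OF \<kappa>_presents free_mod_module Tor_Q_module assms])

lemma Q_del_lin: "Q_del R N k n \<in> lin_maps R (Q_mod R N k n) (Q_mod R N (Suc k) (n - 1))"
  by (rule lin_cong[OF lin_restrict_free[OF del_lin cring_axioms Q_del_fs] free_mod_module Q_del_eq])

lemma Tor_del_\<kappa>:
  assumes x: "x \<in> fs (Q_basis N k n)"
  shows "Tor_del R N u k n (\<kappa> k n x) = \<kappa> (Suc k) (n - 1) (del x)"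
proof -
  let ?h = "tensor_map R A \<phi> (Q_mod R N (Suc k) (n - 1)) (Q_del R N k n)"
  let ?E = "tensor_cx R A \<phi> (Q_cx R N u (Suc k))"
  note C = Q_chain_complex[of k] and xZ = x[folded Zc_Q]
  have eq: "Tor_del R N u k n U = (\<Union>y\<in>U. boundaries ?E (n - 1) +>\<^bsub>chains ?E (n - 1)\<^esub> ?h y)" for U
    by (simp add: Tor_del_def homology_map_def II_def Let_def)
  have const: "boundaries ?E (n - 1) +>\<^bsub>chains ?E (n - 1)\<^esub> ?h z = \<kappa> (Suc k) (n - 1) (del x)"
    if z: "z \<in> \<kappa> k n x" for z
  proof -
    obtain y where y: "y \<in> fs (Q_basis N k n)" "z = \<tau> (Q_mod R N k n) y" "y \<ominus>\<^bsub>Q_mod R N k n\<^esub> x \<in> II_valued (Q_basis N k n)"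
      using tor_class_member[OF C xZ, of z] z unfolding \<kappa>_def Zc_Q Bd_Q Q_chains by blast
    have "?h z = \<tau> (Q_mod R N (Suc k) (n - 1)) (del y)"
      unfolding y(2) using tensor_map_free[OF Q_del_lin y(1)] by (simp add: Q_del_eq[OF y(1)])
    then have "boundaries ?E (n - 1) +>\<^bsub>chains ?E (n - 1)\<^esub> ?h z = \<kappa> (Suc k) (n - 1) (del y)"
      by (simp add: \<kappa>_def tor_class_def)
    also have "\<dots> = \<kappa> (Suc k) (n - 1) (del x)"
    proof -
      have l: "del \<in> lin_maps R (Q_mod R N k n) (Q_mod R N (Suc k) (n - 1))"
        by (rule lin_restrict_free[OF del_lin cring_axioms Q_del_fs])
      have "del (y \<ominus>\<^bsub>Q_mod R N k n\<^esub> x) \<in> II_valued (Q_basis N (Suc k) (n - 1))"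
        using y(3) Q_del_fs by (intro II_valued_lin[OF del_lin y(3)]) (simp add: II_valued_def)
      then show ?thesis
        using \<kappa>_eq_iff[OF Q_del_fs[OF y(1)] Q_del_fs[OF x]] lin_minus[OF l free_mod_module free_mod_module y(1) x] by simp
    qed
    finally show ?thesis .
  qed
  show ?thesis unfolding eq
    by (rule coset_union[OF const]) (use tor_class_nonempty[OF C xZ] in \<open>simp_all add: \<kappa>_def\<close>)
qed

lemma Tor_del_image:
  "Tor_del R N u k n ` carrier (Tor_Q R N u k n) = (\<lambda>x. \<kappa> (Suc k) (n - 1) (del x)) ` fs (Q_basis N k n)"
proof -
  have "Tor_del R N u k n ` carrier (Tor_Q R N u k n) = (\<lambda>x. Tor_del R N u k n (\<kappa> k n x)) ` fs (Q_basis N k n)"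
    unfolding presentsD(2)[OF \<kappa>_presents, symmetric] image_image ..
  also have "\<dots> = (\<lambda>x. \<kappa> (Suc k) (n - 1) (del x)) ` fs (Q_basis N k n)"
    by (rule image_cong[OF refl Tor_del_\<kappa>])
  finally show ?thesis .
qed

lemma \<kappa>_zero_iff: "x \<in> fs (Q_basis N k n) \<Longrightarrow> \<kappa> k n x = \<zero>\<^bsub>Tor_Q R N u k n\<^esub> \<longleftrightarrow> x \<in> II_valued (Q_basis N k n)"
  using presentsD(3)[OF \<kappa>_presents[of k n]] by auto

text \<open>
  The contracting homotopy is R-linear, so the identity that it satisfies survives modulo I. Its
  exceptional basis element has multidegree zero and does not occur at an intermediate term.
\<close>

theorem Tor_exact:
  "Tor_del R N u k (n + 1) ` carrier (Tor_Q R N u k (n + 1))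
    = {U \<in> carrier (Tor_Q R N u (Suc k) n). Tor_del R N u (Suc k) n U = \<zero>\<^bsub>Tor_Q R N u (Suc (Suc k)) (n - 1)\<^esub>}"
proof -
  interpret F: Module.module R FF by (rule FF_module)
  have "(\<lambda>x. \<kappa> (Suc k) n (del x)) ` fs (Q_basis N k (n + 1))
      = {U \<in> carrier (Tor_Q R N u (Suc k) n). Tor_del R N u (Suc k) n U = \<zero>\<^bsub>Tor_Q R N u (Suc (Suc k)) (n - 1)\<^esub>}"
  proof (intro equalityI subsetI)
    fix U assume "U \<in> (\<lambda>x. \<kappa> (Suc k) n (del x)) ` fs (Q_basis N k (n + 1))"
    then obtain x where x: "x \<in> fs (Q_basis N k (n + 1))" "U = \<kappa> (Suc k) n (del x)" by auto
    have dx: "del x \<in> fs (Q_basis N (Suc k) n)" using Q_del_fs[OF x(1)] by simp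
    have "del (del x) \<in> II_valued (Q_basis N (Suc (Suc k)) (n - 1))"
      unfolding del_del[OF fs_FF[OF x(1)]] using submodule_zero[OF free_mod_module II_valued_submodule] by simp
    then have "Tor_del R N u (Suc k) n U = \<zero>\<^bsub>Tor_Q R N u (Suc (Suc k)) (n - 1)\<^esub>"
      unfolding x(2) Tor_del_\<kappa>[OF dx] using \<kappa>_zero_iff[OF Q_del_fs[OF dx]] by simp
    moreover have "U \<in> carrier (Tor_Q R N u (Suc k) n)"
      unfolding x(2) presentsD(2)[OF \<kappa>_presents, symmetric] using dx by (rule imageI)
    ultimately show "U \<in> {U \<in> carrier (Tor_Q R N u (Suc k) n). Tor_del R N u (Suc k) n U = \<zero>\<^bsub>Tor_Q R N u (Suc (Suc k)) (n - 1)\<^esub>}" by simp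
  next
    fix U assume "U \<in> {U \<in> carrier (Tor_Q R N u (Suc k) n). Tor_del R N u (Suc k) n U = \<zero>\<^bsub>Tor_Q R N u (Suc (Suc k)) (n - 1)\<^esub>}"
    then have U: "U \<in> \<kappa> (Suc k) n ` fs (Q_basis N (Suc k) n)" "Tor_del R N u (Suc k) n U = \<zero>\<^bsub>Tor_Q R N u (Suc (Suc k)) (n - 1)\<^esub>"
      using presentsD(2)[OF \<kappa>_presents] by auto
    then obtain x where x: "x \<in> fs (Q_basis N (Suc k) n)" "U = \<kappa> (Suc k) n x" by auto
    have "del x \<in> II_valued (Q_basis N (Suc (Suc k)) (n - 1))"
      using U(2) unfolding x(2) Tor_del_\<kappa>[OF x(1)] using \<kappa>_zero_iff[OF Q_del_fs[OF x(1)]] by simp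
    moreover have hd: "hom (del x) \<in> fs (Q_basis N (Suc k) n)" using Q_hom_fs[OF Q_del_fs[OF x(1)]] by simp
    ultimately have hV: "hom (del x) \<in> II_valued (Q_basis N (Suc k) n)" by (rule II_valued_lin[OF hom_lin])
    have hx: "hom x \<in> fs (Q_basis N k (n + 1))" by (rule Q_hom_fs[OF x(1)])
    have dhx: "del (hom x) \<in> fs (Q_basis N (Suc k) n)" using Q_del_fs[OF hx] by simp
    have id: "del (hom x) \<oplus>\<^sub>F hom (del x) = x"
      by (rule hom_identity[OF x(1)]) (auto simp: Q_basis_def)
    have "x \<ominus>\<^bsub>Q_mod R N (Suc k) n\<^esub> del (hom x) = hom (del x)"
    proof -
      interpret Q: Module.module R "Q_mod R N (Suc k) n" by (rule free_mod_module)
      have e: "x = del (hom x) \<oplus>\<^bsub>Q_mod R N (Suc k) n\<^esub> hom (del x)" using id by simp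
      have "(del (hom x) \<oplus>\<^bsub>Q_mod R N (Suc k) n\<^esub> hom (del x)) \<ominus>\<^bsub>Q_mod R N (Suc k) n\<^esub> del (hom x) = hom (del x)"
        by (rule Q.M.add_minus_cancel_left[OF dhx hd])
      then show ?thesis unfolding e[symmetric] .
    qed
    then have "U = \<kappa> (Suc k) n (del (hom x))" unfolding x(2) using \<kappa>_eq_iff[OF x(1) dhx] hV by simp
    then show "U \<in> (\<lambda>x. \<kappa> (Suc k) n (del x)) ` fs (Q_basis N k (n + 1))" using hx by (rule image_eqI)
  qed
  then show ?thesis unfolding Tor_del_image by simp
qed

end

section \<open>The spectral sequence\<close>

text \<open>
  An x' in step p - 1 with the same boundary as x puts dx among the boundaries that are divided out on page r, so
  the differential of that page is zero.
\<close>

lemma ss_collapses_at_2I: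
  assumes T: "chain_complex A T" and F: "\<And>p n. submodule (F p n) A (chains T n)"
    and mono: "\<And>p p' n. p \<le> p' \<Longrightarrow> F p n \<subseteq> F p' n"
    and key: "\<And>r p n x. \<lbrakk>r \<ge> 2; x \<in> F p n; bdry T n x \<in> F (p - int r) (n - 1)\<rbrakk> \<Longrightarrow>
      \<exists>x'\<in>F (p - 1) n. bdry T n x' = bdry T n x"
  shows "ss_collapses_at T F 2"
  unfolding ss_collapses_at_def
proof (intro allI impI ballI)
  fix r :: nat and p q :: int and U
  assume r: "r \<ge> 2" and U: "U \<in> carrier (ss_page T F r p q)"
  note Tm = cx_module[OF T]
  have cyc: "submodule (ss_cycles T F r p n) A (chains T n)" for r p n
  proof -
    have "ss_cycles T F r p n = F p n \<inter> {x \<in> carrier (chains T n). bdry T n x \<in> F (p - int r) (n - 1)}"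
      using Module.module.submoduleE(1)[OF Tm F] by (auto simp: ss_cycles_def)
    then show ?thesis using submodule_inter[OF Tm F lin_kernel_submodule[OF cx_lin[OF T] Tm Tm F]] by simp
  qed
  have bim: "submodule (bdry T (n + 1) ` ss_cycles T F r p (n + 1)) A (chains T n)" for r p n
    by (rule lin_image_submodule[OF cx_lin_Suc[OF T] Tm Tm cyc])
  have bd: "submodule (ss_boundaries T F r p n) A (chains T n)" for r p n
    unfolding ss_boundaries_def by (rule submodule_sum[OF Tm cyc bim])
  have bc: "ss_boundaries T F r p n \<subseteq> ss_cycles T F r p n" if "r \<ge> 1" for p n
  proof
    fix x assume "x \<in> ss_boundaries T F r p n"
    then obtain a b where ab: "a \<in> ss_cycles T F (r - 1) (p - 1) n" "b \<in> ss_cycles T F (r - 1) (p + int r - 1) (n + 1)"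
      "x = a \<oplus>\<^bsub>chains T n\<^esub> bdry T (n + 1) b" by (auto simp: ss_boundaries_def set_add_iff)
    have "p - 1 - int (r - 1) = p - int r" "p + int r - 1 - int (r - 1) = p" using that by auto
    then have 1: "a \<in> F (p - 1) n" "bdry T n a \<in> F (p - int r) (n - 1)" "bdry T (n + 1) b \<in> F p n"
      using ab(1,2) by (auto simp: ss_cycles_def)
    have "a \<in> ss_cycles T F r p n" using 1 mono[of "p - 1" p n] by (auto simp: ss_cycles_def)
    moreover have "b \<in> carrier (chains T (n + 1))"
      using ab(2) Module.module.submoduleE(1)[OF Tm F] by (auto simp: ss_cycles_def)
    then have "bdry T n (bdry T (n + 1) b) = \<zero>\<^bsub>chains T (n - 1)\<^esub>" using cx_dd[OF T, of b "n + 1"] by simp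
    then have "bdry T (n + 1) b \<in> ss_cycles T F r p n"
      using 1 submodule_zero[OF Tm F] by (auto simp: ss_cycles_def)
    ultimately show "x \<in> ss_cycles T F r p n" unfolding ab(3) by (rule Module.module.submoduleE(5)[OF Tm cyc])
  qed
  let ?n = "p + q" and ?p = "p - int r"
  let ?B = "ss_boundaries T F r ?p (?n - 1)"
  have dB: "bdry T ?n x \<in> ?B" if x: "x \<in> ss_cycles T F r p ?n" for x
  proof -
    have xF: "x \<in> F p ?n" "bdry T ?n x \<in> F ?p (?n - 1)" using x by (auto simp: ss_cycles_def)
    obtain x' where x': "x' \<in> F (p - 1) ?n" "bdry T ?n x' = bdry T ?n x" using key[OF r xF] by blast
    have "p - 1 - int (r - 1) = ?p" "?p + int r - 1 = p - 1" using r by auto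
    then have "x' \<in> ss_cycles T F (r - 1) (?p + int r - 1) (?n - 1 + 1)"
      using x' xF by (simp add: ss_cycles_def)
    then have "bdry T ?n x \<in> bdry T (?n - 1 + 1) ` ss_cycles T F (r - 1) (?p + int r - 1) (?n - 1 + 1)"
      using x'(2) by (intro image_eqI[where x = x']) simp_all
    moreover have "bdry T ?n x \<in> carrier (chains T (?n - 1))"
      using xF(2) Module.module.submoduleE(1)[OF Tm F] by blast
    then have "bdry T ?n x = \<zero>\<^bsub>chains T (?n - 1)\<^esub> \<oplus>\<^bsub>chains T (?n - 1)\<^esub> bdry T ?n x"
      using abelian_monoid.l_zero[OF abelian_group.axioms(1)[OF Module.module.axioms(2)[OF Tm]]] by metis
    ultimately show ?thesis
      unfolding ss_boundaries_def set_add_iff using submodule_zero[OF Tm cyc] by blast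
  qed
  obtain x0 where x0: "x0 \<in> ss_cycles T F r p ?n" "U = ss_boundaries T F r p ?n +>\<^bsub>chains T ?n\<^esub> x0"
    using U by (auto simp: ss_page_def quot_mod_simps)
  have x0c: "x0 \<in> carrier (chains T ?n)" using x0(1) Module.module.submoduleE(1)[OF Tm cyc] by blast
  have U1: "x \<in> ss_cycles T F r p ?n" if xU: "x \<in> U" for x
  proof -
    obtain b where "b \<in> ss_boundaries T F r p ?n" "x = b \<oplus>\<^bsub>chains T ?n\<^esub> x0"
      using xU unfolding x0(2) a_r_coset_def' by auto
    then show ?thesis using bc r x0(1) Module.module.submoduleE(5)[OF Tm cyc] by fastforce
  qed
  have ne: "U \<noteq> {}"
    using abelian_subgroup.a_rcos_self[OF submodule_abelian_subgroup[OF Tm bd] x0c] x0(2) by blast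
  have const: "?B +>\<^bsub>chains T (?n - 1)\<^esub> bdry T ?n x = ?B" if "x \<in> U" for x
  proof -
    have b: "bdry T ?n x \<in> ?B" by (rule dB[OF U1[OF that]])
    then have "bdry T ?n x \<in> carrier (chains T (?n - 1))" using Module.module.submoduleE(1)[OF Tm bd] by blast
    then show ?thesis using coset_zero_iff[OF Tm bd] b by blast
  qed
  have "ss_diff T F r p q U = ?B" unfolding ss_diff_def by (rule coset_union[OF const ne])
  moreover have "?p + (q + int r - 1) = ?n - 1" by simp
  ultimately show "ss_diff T F r p q U = \<zero>\<^bsub>ss_page T F r (p - int r) (q + int r - 1)\<^esub>"
    unfolding ss_page_def quot_mod_simps(2) by (simp only:)
qed

lemma total_cx_simps:
  "x \<in> carrier (chains (total_cx D) n) \<longleftrightarrow> (\<forall>p. x p \<in> carrier (obj D p (n - p))) \<and> finite {p. x p \<noteq> \<zero>\<^bsub>obj D p (n - p)\<^esub>}"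
  "\<zero>\<^bsub>chains (total_cx D) n\<^esub> = (\<lambda>p. \<zero>\<^bsub>obj D p (n - p)\<^esub>)"
  "x \<oplus>\<^bsub>chains (total_cx D) n\<^esub> y = (\<lambda>p. x p \<oplus>\<^bsub>obj D p (n - p)\<^esub> y p)"
  "r \<odot>\<^bsub>chains (total_cx D) n\<^esub> x = (\<lambda>p. r \<odot>\<^bsub>obj D p (n - p)\<^esub> x p)"
  "bdry (total_cx D) n x = (\<lambda>p. hdiff D (p + 1) (n - p - 1) (x (p + 1)) \<oplus>\<^bsub>obj D p (n - 1 - p)\<^esub> vdiff D p (n - p) (x p))"
  by (simp_all add: total_cx_def)

lemma total_cx_module:
  assumes "cring A" "\<And>p q. Module.module A (obj D p q)"
  shows "Module.module A (chains (total_cx D) n)"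
proof -
  let ?M = "chains (total_cx D) n"
  let ?O = "\<lambda>p. obj D p (n - p)"
  have ab: "abelian_group (?O p)" for p by (rule Module.module.axioms(2)[OF assms(2)])
  have am: "abelian_monoid (?O p)" for p by (rule abelian_group.axioms(1)[OF ab])
  note O = abelian_monoid.a_closed[OF am] abelian_monoid.zero_closed[OF am] abelian_monoid.a_assoc[OF am]
    abelian_monoid.l_zero[OF am] abelian_monoid.a_comm[OF am] Module.module.smult_closed[OF assms(2)]
    Module.module.smult_r_null[OF assms(2)]
  have fin: "finite {p. f p \<noteq> \<zero>\<^bsub>?O p\<^esub>}" if "{p. f p \<noteq> \<zero>\<^bsub>?O p\<^esub>} \<subseteq> {p. x p \<noteq> \<zero>\<^bsub>?O p\<^esub>} \<union> {p. y p \<noteq> \<zero>\<^bsub>?O p\<^esub>}"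
    "x \<in> carrier ?M" "y \<in> carrier ?M" for f x y
    using that finite_subset[OF that(1)] by (simp add: total_cx_simps)
  have sm: "r \<odot>\<^bsub>?M\<^esub> x \<in> carrier ?M" if r: "r \<in> carrier A" and x: "x \<in> carrier ?M" for r x
  proof -
    have "finite {p. r \<odot>\<^bsub>?O p\<^esub> x p \<noteq> \<zero>\<^bsub>?O p\<^esub>}"
      by (rule fin[OF _ x x]) (auto simp: O(7)[OF r])
    then show ?thesis using r x by (simp add: total_cx_simps O)
  qed
  have ag: "abelian_group ?M"
  proof (rule abelian_groupI)
    fix x y assume x: "x \<in> carrier ?M" and y: "y \<in> carrier ?M"
    have "finite {p. x p \<oplus>\<^bsub>?O p\<^esub> y p \<noteq> \<zero>\<^bsub>?O p\<^esub>}"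
      by (rule fin[OF _ x y]) (auto simp: O(2) O(4)[OF O(2)])
    then show "x \<oplus>\<^bsub>?M\<^esub> y \<in> carrier ?M" using x y by (simp add: total_cx_simps O)
    show "x \<oplus>\<^bsub>?M\<^esub> y = y \<oplus>\<^bsub>?M\<^esub> x" using x y by (simp add: total_cx_simps O(5))
  next
    fix x assume x: "x \<in> carrier ?M"
    show "\<exists>y\<in>carrier ?M. y \<oplus>\<^bsub>?M\<^esub> x = \<zero>\<^bsub>?M\<^esub>"
    proof
      interpret A: cring A by fact
      show "(\<ominus>\<^bsub>A\<^esub> \<one>\<^bsub>A\<^esub>) \<odot>\<^bsub>?M\<^esub> x \<in> carrier ?M" by (rule sm[OF _ x]) simp
      show "((\<ominus>\<^bsub>A\<^esub> \<one>\<^bsub>A\<^esub>) \<odot>\<^bsub>?M\<^esub> x) \<oplus>\<^bsub>?M\<^esub> x = \<zero>\<^bsub>?M\<^esub>"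
        unfolding total_cx_simps
      proof
        fix p
        interpret Op: Module.module A "?O p" by (rule assms(2))
        have xp: "x p \<in> carrier (?O p)" using x by (simp add: total_cx_simps)
        show "((\<ominus>\<^bsub>A\<^esub> \<one>\<^bsub>A\<^esub>) \<odot>\<^bsub>?O p\<^esub> x p) \<oplus>\<^bsub>?O p\<^esub> x p = \<zero>\<^bsub>?O p\<^esub>"
          using Op.smult_l_minus[OF A.one_closed xp] xp by (simp add: Op.M.l_neg)
      qed
    qed
  next
    fix x y z assume "x \<in> carrier ?M" "y \<in> carrier ?M" "z \<in> carrier ?M"
    then show "x \<oplus>\<^bsub>?M\<^esub> y \<oplus>\<^bsub>?M\<^esub> z = x \<oplus>\<^bsub>?M\<^esub> (y \<oplus>\<^bsub>?M\<^esub> z)"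
      by (simp add: total_cx_simps O(3))
  qed (simp_all add: total_cx_simps O(2,4))
  show ?thesis
    by (rule moduleI[OF assms(1) ag sm])
      (simp_all add: total_cx_simps Module.module.smult_l_distr[OF assms(2)] Module.module.smult_r_distr[OF assms(2)]
        Module.module.smult_assoc1[OF assms(2)] Module.module.smult_one[OF assms(2)])
qed

context regular_koszul_nontrivial
begin

lemma A_cring: "cring A" by (rule ideal.quotient_is_cring[OF II_ideal cring_axioms])

text \<open>
  The basis in position (p, q) of the double complex; outside the strip of columns it is empty, which
  gives the zero module.
\<close>

definition pbas :: "nat \<Rightarrow> int \<Rightarrow> int \<Rightarrow> (nat set \<times> nat multiset) set" where
  "pbas s p q = (if - int s < p \<and> p \<le> 0 then Q_basis N (nat (- p)) (p + q) else {})"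

abbreviation PD where "PD s \<equiv> P_double R N u s"
abbreviation PM where "PM s p q \<equiv> free_mod R (pbas s p q)"

lemma P_obj: "obj (PD s) p q = tensor_mod R A \<phi> (PM s p q)"
  by (simp add: P_double_def Let_def II_def pbas_def)

lemma \<tau>_zero_iff: "f \<in> fs B \<Longrightarrow> \<tau> (free_mod R B) f = \<zero>\<^bsub>tensor_mod R A \<phi> (free_mod R B)\<^esub> \<longleftrightarrow> f \<in> II_valued B"
  using presentsD(3)[OF \<tau>_free_presents[of B]] by auto

lemma P_vdiff:
  assumes "f \<in> fs (pbas s p q)"
  shows "vdiff (PD s) p q (\<tau> (PM s p q) f) = \<zero>\<^bsub>obj (PD s) p (q - 1)\<^esub>"
proof (cases "- int s < p \<and> p \<le> 0")
  case True
  let ?k = "nat (- p)"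
  have b: "pbas s p q = Q_basis N ?k (p + q)" "pbas s p (q - 1) = Q_basis N ?k (p + q - 1)"
    using True by (simp_all add: pbas_def algebra_simps)
  have f: "f \<in> fs (Q_basis N ?k (p + q))" using assms b by simp
  have "vdiff (PD s) p q (\<tau> (PM s p q) f)
      = tensor_map R A \<phi> (Q_mod R N ?k (p + q - 1)) (bdry (Q_cx R N u ?k) (p + q)) (\<tau> (Q_mod R N ?k (p + q)) f)"
    using True by (simp add: P_double_def Let_def II_def[symmetric] b algebra_simps)
  also have "\<dots> = \<tau> (Q_mod R N ?k (p + q - 1)) (kd f)"
    using tensor_map_free[OF cx_lin[OF Q_chain_complex, unfolded Q_chains] f] Q_bdry[OF f] by simp
  also have "\<dots> = \<zero>\<^bsub>tensor_mod R A \<phi> (Q_mod R N ?k (p + q - 1))\<^esub>"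
    using \<tau>_zero_iff[OF Q_kd_fs[OF f]] kd_II_valued[OF f Q_kd_fs[OF f]] by simp
  finally show ?thesis unfolding P_obj b(2) .
next
  case False
  then show ?thesis unfolding P_obj by (auto simp: P_double_def Let_def II_def[symmetric] pbas_def)
qed

lemma P_hdiff:
  assumes "f \<in> fs (pbas s p q)"
  shows "hdiff (PD s) p q (\<tau> (PM s p q) f) = \<tau> (PM s (p - 1) q) (low s (del f))"
proof -
  have z: "\<tau> (free_mod R B) \<zero>\<^sub>F = \<zero>\<^bsub>tensor_mod R A \<phi> (free_mod R B)\<^esub>" for B
    using \<tau>_zero_iff[of "\<zero>\<^sub>F" B] submodule_zero[OF FF_module fs_submodule[of B]] submodule_zero[OF free_mod_module II_valued_submodule[of B]] by simp
  consider (a) "- int s < p - 1 \<and> p \<le> 0" | (b) "p - 1 = - int s \<and> p \<le> 0" | (c) "\<not> (- int s < p \<and> p \<le> 0)" by linarith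
  then show ?thesis
  proof cases
    case a
    let ?k = "nat (- p)"
    have b: "pbas s p q = Q_basis N ?k (p + q)" "pbas s (p - 1) q = Q_basis N (Suc ?k) (p + q - 1)"
      using a by (simp_all add: pbas_def algebra_simps Suc_nat_eq_nat_zadd1)
    have f: "f \<in> fs (Q_basis N ?k (p + q))" using assms b by simp
    have df: "del f \<in> fs (Q_basis N (Suc ?k) (p + q - 1))" by (rule Q_del_fs[OF f])
    have l: "low s (del f) = del f"
      by (rule restr_id, rule free_mod_mono[OF df]) (use a in \<open>auto simp: Q_basis_def\<close>)
    have "nat (- (p - 1)) = Suc ?k" using a Suc_nat_eq_nat_zadd1[of "- p"] by simp
    then have "hdiff (PD s) p q (\<tau> (PM s p q) f)
        = tensor_map R A \<phi> (Q_mod R N (Suc ?k) (p + q - 1)) (Q_del R N ?k (p + q)) (\<tau> (Q_mod R N ?k (p + q)) f)"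
      using a by (simp add: P_double_def Let_def II_def[symmetric] b(1) algebra_simps)
    also have "\<dots> = \<tau> (Q_mod R N (Suc ?k) (p + q - 1)) (del f)"
      using tensor_map_free[OF Q_del_lin f] Q_del_eq[OF f] by simp
    finally show ?thesis unfolding b(2) l .
  next
    case b
    let ?k = "nat (- p)"
    have col: "- int s < p \<and> p \<le> 0" using b by auto
    then have f: "f \<in> fs (Q_basis N ?k (p + q))" using assms by (simp add: pbas_def)
    have "low s (del f) = \<zero>\<^sub>F"
      by (rule restr_zero, rule free_mod_mono[OF Q_del_fs[OF f]]) (use b in \<open>auto simp: Q_basis_def\<close>)
    moreover have "pbas s (p - 1) q = {}" using b by (simp add: pbas_def)
    moreover have "hdiff (PD s) p q (\<tau> (PM s p q) f) = \<zero>\<^bsub>tensor_mod R A \<phi> (free_mod R {})\<^esub>"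
      using b by (simp add: P_double_def Let_def II_def[symmetric])
    ultimately show ?thesis using z[of "{}"] by (simp only:)
  next
    case c
    then have "pbas s p q = {}" by (auto simp: pbas_def)
    then have "f = \<zero>\<^sub>F" using assms by (auto simp: free_mod_carrier)
    then have "low s (del f) = \<zero>\<^sub>F" using lin_zero[OF lin_compose[OF del_lin restr_lin] FF_module FF_module] by (simp only:)
    moreover have "hdiff (PD s) p q (\<tau> (PM s p q) f) = \<zero>\<^bsub>obj (PD s) (p - 1) q\<^esub>"
      using c by (auto simp: P_double_def Let_def II_def[symmetric])
    ultimately show ?thesis using z unfolding P_obj by (simp only:)
  qed
qed

text \<open>The component in column p.\<close>

definition comp :: "int \<Rightarrow> 'a qchain \<Rightarrow> 'a qchain" where
  "comp p = restr (\<lambda>(J, m). p = - int (size m))"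

lemma comp_lin: "comp p \<in> lin_maps R FF FF" unfolding comp_def by (rule restr_lin)

lemma comp_fs: "f \<in> fs (KB s n) \<Longrightarrow> comp p f \<in> fs (pbas s p (n - p))"
  unfolding comp_def
  by (drule restr_fs[of _ _ "\<lambda>(J, m). p = - int (size m)"], erule free_mod_mono) (auto simp: KB_def pbas_def Q_basis_def)

lemma comp_del: "f \<in> carrier FF \<Longrightarrow> comp p (del f) = del (comp (p + 1) f)"
  unfolding comp_def del_def by (rule restr_contr) auto

lemma comp_low: "comp p (low s f) = low s (comp p f)"
  by (auto simp: comp_def restr_def fun_eq_iff)

lemma low_del_lin: "(\<lambda>f. low s (del f)) \<in> lin_maps R FF FF" by (rule lin_compose[OF del_lin restr_lin])

lemma low_del_fs: "f \<in> fs (KB s n) \<Longrightarrow> low s (del f) \<in> fs (KB s (n - 1))"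
proof -
  assume f: "f \<in> fs (KB s n)"
  have "del f \<in> fs {(J, m). finite J \<and> J \<subseteq> X \<and> int (card J) = n - 1 \<and> set_mset m \<subseteq> X}"
    by (rule del_fs[OF f]) (auto simp: KB_def intro: int_card_pred)
  from restr_fs[OF this, of "\<lambda>(J, m). size m < s"] show ?thesis
    by (rule free_mod_mono) (auto simp: KB_def)
qed

lemma low_del_low_del: "f \<in> carrier FF \<Longrightarrow> low s (del (low s (del f))) = \<zero>\<^sub>F"
proof -
  assume f: "f \<in> carrier FF"
  have "low s (del (low s (del f))) = low s (low (Suc s) (del (del f)))"
    unfolding low_del[OF lin_closed[OF del_lin f]] ..
  then show ?thesis unfolding del_del[OF f] low_zero .
qed

text \<open>
  An element of \<open>K(R; I\<^sup>s)\<close> is sent to the family of the classes of its components modulo I. On the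
  other side \<open>\<partial>\<close> alone remains of the differential.
\<close>

definition \<Theta> :: "nat \<Rightarrow> int \<Rightarrow> 'a qchain \<Rightarrow> int \<Rightarrow> ('a qchain \<Rightarrow> 'a set) set" where
  "\<Theta> s n f = (\<lambda>p. \<tau> (PM s p (n - p)) (comp p f))"

abbreviation Tt where "Tt s \<equiv> total_cx (PD s)"

lemma II_valued_mono: "f \<in> II_valued B \<Longrightarrow> f \<in> fs B' \<Longrightarrow> f \<in> II_valued B'"
  by (simp add: II_valued_def)

lemma \<Theta>_zero_iff:
  assumes "f \<in> fs (KB s n)"
  shows "\<Theta> s n f j = \<zero>\<^bsub>obj (PD s) j (n - j)\<^esub> \<longleftrightarrow> (\<forall>b. comp j f b \<in> II)"
  unfolding \<Theta>_def P_obj \<tau>_zero_iff[OF comp_fs[OF assms]] II_valued_def using comp_fs[OF assms] by simp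

lemma total_module: "Module.module A (chains (Tt s) n)"
  by (rule total_cx_module[OF A_cring]) (simp add: P_obj bc_tensor_module free_mod_module)

lemma \<Theta>_presents: "presents R \<phi> (free_mod R (KB s n)) (II_valued (KB s n)) (chains (Tt s) n) (\<Theta> s n)"
  unfolding presents_def
proof (intro conjI)
  have empty: "\<tau> (PM s p (n - p)) g = \<zero>\<^bsub>obj (PD s) p (n - p)\<^esub>" if "\<not> (- int s < p \<and> p \<le> 0)" "g \<in> fs (pbas s p (n - p))" for g p
  proof -
    have "pbas s p (n - p) = {}" using that(1) by (auto simp: pbas_def)
    then have "g \<in> II_valued (pbas s p (n - p))"
      using that(2) submodule_zero[OF free_mod_module II_valued_submodule[of "{}"]] by (auto simp: free_mod_carrier II_valued_def)
    then show ?thesis unfolding P_obj using \<tau>_zero_iff[OF that(2)] by simp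
  qed
  have cl: "\<Theta> s n f \<in> carrier (chains (Tt s) n)" if f: "f \<in> fs (KB s n)" for f
  proof -
    have "{p. \<Theta> s n f p \<noteq> \<zero>\<^bsub>obj (PD s) p (n - p)\<^esub>} \<subseteq> {- int s..0}"
    proof
      fix p assume p: "p \<in> {p. \<Theta> s n f p \<noteq> \<zero>\<^bsub>obj (PD s) p (n - p)\<^esub>}"
      show "p \<in> {- int s..0}"
      proof (rule ccontr)
        assume "p \<notin> {- int s..0}"
        then have "\<not> (- int s < p \<and> p \<le> 0)" by auto
        from empty[OF this comp_fs[OF f]] show False using p unfolding \<Theta>_def by blast
      qed
    qed
    then have "finite {p. \<Theta> s n f p \<noteq> \<zero>\<^bsub>obj (PD s) p (n - p)\<^esub>}" by (rule finite_subset) simp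
    then show ?thesis using bc_\<tau>_closed[OF comp_fs[OF f]] by (simp add: total_cx_simps P_obj \<Theta>_def)
  qed
  show "\<Theta> s n \<in> lin_maps R (free_mod R (KB s n)) (pullback_mod \<phi> (chains (Tt s) n))"
  proof (rule lin_mapsI)
    fix f g assume f: "f \<in> fs (KB s n)" and g: "g \<in> fs (KB s n)"
    show "\<Theta> s n (f \<oplus>\<^bsub>free_mod R (KB s n)\<^esub> g) = \<Theta> s n f \<oplus>\<^bsub>pullback_mod \<phi> (chains (Tt s) n)\<^esub> \<Theta> s n g"
      unfolding pullback_mod_simps total_cx_simps
    proof
      fix p
      have "comp p (f \<oplus>\<^bsub>free_mod R (KB s n)\<^esub> g) = comp p f \<oplus>\<^bsub>PM s p (n - p)\<^esub> comp p g"
        using lin_add[OF comp_lin fs_FF[OF f] fs_FF[OF g]] by simp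
      then show "\<Theta> s n (f \<oplus>\<^bsub>free_mod R (KB s n)\<^esub> g) p = \<Theta> s n f p \<oplus>\<^bsub>obj (PD s) p (n - p)\<^esub> \<Theta> s n g p"
        unfolding \<Theta>_def P_obj using lin_add[OF presentsD(1)[OF \<tau>_free_presents] comp_fs[OF f] comp_fs[OF g]]
        by (simp del: free_mod_simps)
    qed
  next
    fix r f assume r: "r \<in> carrier R" and f: "f \<in> fs (KB s n)"
    show "\<Theta> s n (r \<odot>\<^bsub>free_mod R (KB s n)\<^esub> f) = r \<odot>\<^bsub>pullback_mod \<phi> (chains (Tt s) n)\<^esub> \<Theta> s n f"
      unfolding pullback_mod_simps total_cx_simps
    proof
      fix p
      have "comp p (r \<odot>\<^bsub>free_mod R (KB s n)\<^esub> f) = r \<odot>\<^bsub>PM s p (n - p)\<^esub> comp p f"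
        using lin_smult[OF comp_lin r fs_FF[OF f]] by simp
      then show "\<Theta> s n (r \<odot>\<^bsub>free_mod R (KB s n)\<^esub> f) p = \<phi> r \<odot>\<^bsub>obj (PD s) p (n - p)\<^esub> \<Theta> s n f p"
        unfolding \<Theta>_def P_obj using lin_smult[OF presentsD(1)[OF \<tau>_free_presents] r comp_fs[OF f]]
        by (simp del: free_mod_simps)
    qed
  qed (simp add: cl)
  show "\<Theta> s n ` fs (KB s n) = carrier (chains (Tt s) n)"
  proof (intro equalityI subsetI)
    fix z assume z: "z \<in> carrier (chains (Tt s) n)"
    have "\<forall>p. \<exists>x. x \<in> fs (pbas s p (n - p)) \<and> \<tau> (PM s p (n - p)) x = z p"
    proof
      fix p
      have "z p \<in> (\<lambda>x. \<tau> (PM s p (n - p)) x) ` fs (pbas s p (n - p))"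
        unfolding presentsD(2)[OF \<tau>_free_presents] using z by (simp add: total_cx_simps P_obj)
      then show "\<exists>x. x \<in> fs (pbas s p (n - p)) \<and> \<tau> (PM s p (n - p)) x = z p" by auto
    qed
    from choice[OF this] obtain x where x: "\<And>p. x p \<in> fs (pbas s p (n - p))" "\<And>p. \<tau> (PM s p (n - p)) (x p) = z p" by blast
    define f where "f = (\<lambda>b :: nat set \<times> nat multiset. x (- int (size (snd b))) b)"
    have supp: "b \<in> pbas s p (n - p)" if "x p b \<noteq> \<zero>" for p b using x(1)[of p] that unfolding free_mod_carrier by blast
    have nz: "b \<in> KB s n \<and> - int (size (snd b)) \<in> {- int s..0}" if "f b \<noteq> \<zero>" for b
      using supp[of "- int (size (snd b))" b] that
      by (cases b) (auto simp: f_def pbas_def Q_basis_def KB_def split: if_splits)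
    have "{b. f b \<noteq> \<zero>} \<subseteq> (\<Union>p\<in>{- int s..0}. {b. x p b \<noteq> \<zero>})"
    proof
      fix b assume b: "b \<in> {b. f b \<noteq> \<zero>}"
      then have "x (- int (size (snd b))) b \<noteq> \<zero>" by (simp add: f_def)
      then show "b \<in> (\<Union>p\<in>{- int s..0}. {b. x p b \<noteq> \<zero>})" using nz[of b] b by blast
    qed
    moreover have "finite (\<Union>p\<in>{- int s..0}. {b. x p b \<noteq> \<zero>})" using free_mod_support[OF x(1)] by blast
    ultimately have "finite {b. f b \<noteq> \<zero>}" by (rule finite_subset)
    moreover have "f b \<in> carrier R" for b unfolding f_def by (rule free_mod_value[OF x(1)])
    ultimately have f: "f \<in> fs (KB s n)" unfolding free_mod_carrier using nz by blast
    have c: "comp p f = x p" for p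
    proof
      fix b
      show "comp p f b = x p b"
      proof (cases "p = - int (size (snd b))")
        case True
        then show ?thesis by (cases b) (simp add: comp_def restr_def f_def)
      next
        case False
        then have "b \<notin> pbas s p (n - p)" by (cases b) (auto simp: pbas_def Q_basis_def)
        then have "x p b = \<zero>" using supp by blast
        then show ?thesis using False by (cases b) (simp add: comp_def restr_def)
      qed
    qed
    have "\<Theta> s n f = z" unfolding \<Theta>_def c x(2) ..
    then show "z \<in> \<Theta> s n ` fs (KB s n)" using f by blast
  qed (use cl in blast)
  show "{f \<in> fs (KB s n). \<Theta> s n f = \<zero>\<^bsub>chains (Tt s) n\<^esub>} = II_valued (KB s n)"
  proof (intro equalityI subsetI)
    fix f assume "f \<in> {f \<in> fs (KB s n). \<Theta> s n f = \<zero>\<^bsub>chains (Tt s) n\<^esub>}"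
    then have f: "f \<in> fs (KB s n)" "\<And>p. \<Theta> s n f p = \<zero>\<^bsub>obj (PD s) p (n - p)\<^esub>" by (auto simp: total_cx_simps)
    have "f b \<in> II" for b
    proof -
      have "comp (- int (size (snd b))) f b \<in> II" using f(2) \<Theta>_zero_iff[OF f(1)] by blast
      then show ?thesis by (cases b) (simp add: comp_def restr_def)
    qed
    then show "f \<in> II_valued (KB s n)" using f(1) by (simp add: II_valued_def)
  next
    fix f assume "f \<in> II_valued (KB s n)"
    then have f: "f \<in> fs (KB s n)" "\<And>b. f b \<in> II" by (auto simp: II_valued_def)
    have "\<Theta> s n f p = \<zero>\<^bsub>obj (PD s) p (n - p)\<^esub>" for p
      unfolding \<Theta>_zero_iff[OF f(1)] comp_def restr_def
      using f(2) additive_subgroup.zero_closed[OF ideal.axioms(1)[OF II_ideal]] by simp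
    then show "f \<in> {f \<in> fs (KB s n). \<Theta> s n f = \<zero>\<^bsub>chains (Tt s) n\<^esub>}" using f(1) by (simp add: total_cx_simps fun_eq_iff)
  qed
qed

lemma \<Theta>_bdry:
  assumes f: "f \<in> fs (KB s n)"
  shows "bdry (Tt s) n (\<Theta> s n f) = \<Theta> s (n - 1) (low s (del f))"
proof
  fix p
  have i: "n - (p + 1) = n - p - 1" "p + 1 - 1 = p" "n - 1 - p = n - p - 1" by auto
  interpret O: Module.module A "obj (PD s) p (n - p - 1)" unfolding P_obj by (rule bc_tensor_module[OF free_mod_module])
  have c1: "comp (p + 1) f \<in> fs (pbas s (p + 1) (n - p - 1))" using comp_fs[OF f, of "p + 1"] unfolding i .
  have h: "hdiff (PD s) (p + 1) (n - p - 1) (\<Theta> s n f (p + 1)) = \<tau> (PM s p (n - p - 1)) (low s (del (comp (p + 1) f)))"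
    using P_hdiff[OF c1] unfolding \<Theta>_def i .
  have e: "low s (del (comp (p + 1) f)) = comp p (low s (del f))"
    unfolding comp_low comp_del[OF fs_FF[OF f]] ..
  have v: "vdiff (PD s) p (n - p) (\<Theta> s n f p) = \<zero>\<^bsub>obj (PD s) p (n - p - 1)\<^esub>"
    using P_vdiff[OF comp_fs[OF f]] unfolding \<Theta>_def .
  have "comp p (low s (del f)) \<in> fs (pbas s p (n - p - 1))" using comp_fs[OF low_del_fs[OF f], of p] unfolding i .
  then have "\<tau> (PM s p (n - p - 1)) (comp p (low s (del f))) \<in> carrier (obj (PD s) p (n - p - 1))"
    unfolding P_obj by (rule bc_\<tau>_closed)
  then show "bdry (Tt s) n (\<Theta> s n f) p = \<Theta> s (n - 1) (low s (del f)) p"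
    unfolding total_cx_simps h v unfolding e \<Theta>_def i by (rule O.M.r_zero)
qed

lemmas total_homology = bc_homology_presents[where M = "\<lambda>n. free_mod R (KB s n)" and E = "Tt s" and K = "\<lambda>n. II_valued (KB s n)"
    and \<Theta> = "\<lambda>n. \<Theta> s n" and \<delta> = "\<lambda>n f. low s (del f)" for s, OF free_mod_module total_module \<Theta>_presents
    lin_restrict_free[OF low_del_lin cring_axioms low_del_fs] \<Theta>_bdry]

lemma low_del_low_del_II: "f \<in> fs (KB s n) \<Longrightarrow> low s (del (low s (del f))) \<in> II_valued (KB s (n - 2))"
  unfolding low_del_low_del[OF fs_FF] using submodule_zero[OF free_mod_module II_valued_submodule] by simp

lemma total_complex: "chain_complex A (Tt s)"
proof -
  have i: "x \<in> fs (KB s n)" if "x \<in> fs (KB s n)" for x n by (rule that)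
  show ?thesis by (rule total_homology(1)[OF i i low_del_low_del_II])
qed

text \<open>
  If the boundary of x lies two steps below x, then the horizontal differential kills the leading
  component of x. Since the vertical differential is zero over R/I, dropping the leading component
  does not change the boundary.
\<close>

theorem collapse: "ss_collapses_at (Tt s) (column_filtration (PD s)) 2"
proof (rule ss_collapses_at_2I[OF total_complex])
  let ?F = "column_filtration (PD s)"
  have om: "Module.module A (obj (PD s) p q)" for p q unfolding P_obj by (rule bc_tensor_module[OF free_mod_module])
  show "submodule (?F p n) A (chains (Tt s) n)" for p n
  proof -
    interpret T: Module.module A "chains (Tt s) n" by (rule total_module)
    show ?thesis
    proof (rule T.submoduleI_smult)
      show "\<zero>\<^bsub>chains (Tt s) n\<^esub> \<in> ?F p n"
        unfolding column_filtration_def using T.M.zero_closed by (simp add: total_cx_simps(2))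
      fix a b assume "a \<in> ?F p n" "b \<in> ?F p n"
      then have ab: "a \<in> carrier (chains (Tt s) n)" "b \<in> carrier (chains (Tt s) n)"
        "\<And>j. j > p \<Longrightarrow> a j = \<zero>\<^bsub>obj (PD s) j (n - j)\<^esub>" "\<And>j. j > p \<Longrightarrow> b j = \<zero>\<^bsub>obj (PD s) j (n - j)\<^esub>"
        by (auto simp: column_filtration_def)
      have "(a \<oplus>\<^bsub>chains (Tt s) n\<^esub> b) j = \<zero>\<^bsub>obj (PD s) j (n - j)\<^esub>" if "j > p" for j
      proof -
        interpret O: Module.module A "obj (PD s) j (n - j)" by (rule om)
        show ?thesis using ab(3,4)[OF that] by (simp add: total_cx_simps(3))
      qed
      then show "a \<oplus>\<^bsub>chains (Tt s) n\<^esub> b \<in> ?F p n" using T.M.a_closed[OF ab(1,2)] by (simp add: column_filtration_def)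
    next
      fix r a assume r: "r \<in> carrier A" and "a \<in> ?F p n"
      then have a: "a \<in> carrier (chains (Tt s) n)" "\<And>j. j > p \<Longrightarrow> a j = \<zero>\<^bsub>obj (PD s) j (n - j)\<^esub>"
        by (auto simp: column_filtration_def)
      have "(r \<odot>\<^bsub>chains (Tt s) n\<^esub> a) j = \<zero>\<^bsub>obj (PD s) j (n - j)\<^esub>" if "j > p" for j
        using a(2)[OF that] Module.module.smult_r_null[OF om r] by (simp add: total_cx_simps(4))
      then show "r \<odot>\<^bsub>chains (Tt s) n\<^esub> a \<in> ?F p n" using T.smult_closed[OF r a(1)] by (simp add: column_filtration_def)
    qed (auto simp: column_filtration_def)
  qed
  show "?F p n \<subseteq> ?F p' n" if "p \<le> p'" for p p' n using that by (auto simp: column_filtration_def)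
  fix r :: nat and p n x assume r: "r \<ge> 2" and x: "x \<in> ?F p n" and dx: "bdry (Tt s) n x \<in> ?F (p - int r) (n - 1)"
  interpret F: Module.module R FF by (rule FF_module)
  have "x \<in> carrier (chains (Tt s) n)" using x by (simp add: column_filtration_def)
  then obtain f where f: "f \<in> fs (KB s n)" "x = \<Theta> s n f"
    unfolding presentsD(2)[OF \<Theta>_presents, symmetric] by auto
  have fF: "f \<in> carrier FF" by (rule fs_FF[OF f(1)])
  have f1: "\<forall>b. comp j f b \<in> II" if "j > p" for j
    using x that \<Theta>_zero_iff[OF f(1)] by (simp add: column_filtration_def f(2))
  \<comment> \<open>the component of d x in column p - 1 is the horizontal image of the leading component of x\<close>
  have "bdry (Tt s) n x (p - 1) = \<zero>\<^bsub>obj (PD s) (p - 1) (n - 1 - (p - 1))\<^esub>"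
    using dx r by (simp add: column_filtration_def)
  then have f2: "\<forall>b. comp (p - 1) (low s (del f)) b \<in> II"
    unfolding f(2) \<Theta>_bdry[OF f(1)] \<Theta>_zero_iff[OF low_del_fs[OF f(1)]] .
  have cK: "comp p f \<in> fs (KB s n)"
    unfolding comp_def by (rule free_mod_mono[OF restr_fs[OF f(1)]]) auto
  define f' where "f' = f \<ominus>\<^sub>F comp p f"
  have f': "f' \<in> fs (KB s n)" unfolding f'_def by (rule submodule_minus[OF FF_module fs_submodule f(1) cK])
  have cf': "comp j f' b \<in> II" if "j > p - 1" for j b
  proof (cases "j = p")
    case True
    have "comp p f' = comp p f \<ominus>\<^sub>F comp p (comp p f)"
      unfolding f'_def by (rule lin_minus[OF comp_lin FF_module FF_module fF fs_FF[OF cK]])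
    also have "comp p (comp p f) = comp p f" by (auto simp: comp_def restr_def fun_eq_iff)
    also have "comp p f \<ominus>\<^sub>F comp p f = \<zero>\<^sub>F" using fs_FF[OF cK] by (simp add: a_minus_def F.M.r_neg del: free_mod_simps)
    finally show ?thesis using True additive_subgroup.zero_closed[OF ideal.axioms(1)[OF II_ideal]] by simp
  next
    case False
    have "comp j f' = comp j f \<ominus>\<^sub>F comp j (comp p f)"
      unfolding f'_def by (rule lin_minus[OF comp_lin FF_module FF_module fF fs_FF[OF cK]])
    also have "comp j (comp p f) = \<zero>\<^sub>F" using False by (auto simp: comp_def restr_def fun_eq_iff)
    also have "comp j f \<ominus>\<^sub>F \<zero>\<^sub>F = comp j f"
      using lin_closed[OF comp_lin fF] by (simp add: a_minus_def module_neg_zero[OF FF_module] F.M.r_zero del: free_mod_simps)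
    finally have e: "comp j f' = comp j f" .
    have "j > p" using False that by simp
    from f1[OF this] show ?thesis unfolding e by blast
  qed
  show "\<exists>x'\<in>?F (p - 1) n. bdry (Tt s) n x' = bdry (Tt s) n x"
  proof
    show "\<Theta> s n f' \<in> ?F (p - 1) n"
      using cf' \<Theta>_zero_iff[OF f'] lin_closed[OF presentsD(1)[OF \<Theta>_presents] f'] by (simp add: column_filtration_def)
    have "low s (del f') = low s (del f) \<ominus>\<^sub>F low s (del (comp p f))"
      unfolding f'_def by (rule lin_minus[OF low_del_lin FF_module FF_module fF fs_FF[OF cK]])
    also have "low s (del (comp p f)) = comp (p - 1) (low s (del f))"
      unfolding comp_low comp_del[OF fF] by simp
    finally have e: "low s (del f') = low s (del f) \<ominus>\<^sub>F comp (p - 1) (low s (del f))" .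
    have c: "comp (p - 1) (low s (del f)) \<in> fs (KB s (n - 1))"
      unfolding comp_def by (rule free_mod_mono[OF restr_fs[OF low_del_fs[OF f(1)]]]) auto
    have "low s (del f) \<ominus>\<^bsub>free_mod R (KB s (n - 1))\<^esub> low s (del f') = comp (p - 1) (low s (del f))"
    proof -
      interpret K: Module.module R "free_mod R (KB s (n - 1))" by (rule free_mod_module)
      have "low s (del f') = low s (del f) \<ominus>\<^bsub>free_mod R (KB s (n - 1))\<^esub> comp (p - 1) (low s (del f))"
        unfolding e free_mod_minus[OF low_del_fs[OF f(1)] c] free_mod_minus[OF fs_FF[OF low_del_fs[OF f(1)]] fs_FF[OF c]] ..
      then show ?thesis using K.M.minus_minus_cancel[OF low_del_fs[OF f(1)] c] by simp
    qed
    then have "low s (del f) \<ominus>\<^bsub>free_mod R (KB s (n - 1))\<^esub> low s (del f') \<in> II_valued (KB s (n - 1))"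
      using f2 c by (simp add: II_valued_def)
    then have "\<Theta> s (n - 1) (low s (del f)) = \<Theta> s (n - 1) (low s (del f'))"
      using bc_presents_eq_iff[OF \<Theta>_presents free_mod_module total_module low_del_fs[OF f(1)] low_del_fs[OF f']] by simp
    then show "bdry (Tt s) n (\<Theta> s n f') = bdry (Tt s) n x" unfolding f(2) \<Theta>_bdry[OF f(1)] \<Theta>_bdry[OF f'] ..
  qed
qed

end

section \<open>Independence of the resolution\<close>

lemma signed_submodule_iff:
  assumes "Module.module R M" "submodule H R M" "z \<in> carrier M"
  shows "signed M p z \<in> H \<longleftrightarrow> z \<in> H"
proof -
  interpret M: Module.module R M by fact
  note neg = M.submoduleE(3)[OF assms(2)]
  have "\<ominus>\<^bsub>M\<^esub> z \<in> H \<longleftrightarrow> z \<in> H" using neg[of z] neg[of "\<ominus>\<^bsub>M\<^esub> z"] assms(3) by auto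
  then show ?thesis by (simp add: signed_def)
qed

lemma submodule_cancel_left:
  assumes "Module.module R M" "submodule H R M" "x \<in> H" "y \<in> carrier M" "x \<oplus>\<^bsub>M\<^esub> y \<in> H"
  shows "y \<in> H"
proof -
  interpret M: Module.module R M by fact
  have "x \<in> carrier M" using M.submoduleE(1)[OF assms(2)] assms(3) by auto
  from M.M.add_minus_cancel_left[OF this assms(4)] show ?thesis
    using submodule_minus[OF assms(1,2,5,3)] by simp
qed

lemma submodule_cancel_right:
  assumes "Module.module R M" "submodule H R M" "y \<in> H" "x \<in> carrier M" "x \<oplus>\<^bsub>M\<^esub> y \<in> H"
  shows "x \<in> H"
proof -
  interpret M: Module.module R M by fact
  have "y \<in> carrier M" using M.submoduleE(1)[OF assms(2)] assms(3) by auto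
  then have "x \<oplus>\<^bsub>M\<^esub> y = y \<oplus>\<^bsub>M\<^esub> x" using assms(4) by (simp add: M.M.a_comm)
  then show ?thesis using submodule_cancel_left[OF assms(1-4)] assms(5) by simp
qed

lemma submodule_congruent:
  assumes "Module.module R M" "submodule H R M" "x \<in> carrier M" "y \<in> carrier M" "x \<ominus>\<^bsub>M\<^esub> y \<in> H"
  shows "x \<in> H \<longleftrightarrow> y \<in> H"
proof -
  interpret M: Module.module R M by fact
  have "x \<ominus>\<^bsub>M\<^esub> (x \<ominus>\<^bsub>M\<^esub> y) = y" by (rule M.M.minus_minus_cancel[OF assms(3,4)])
  then show ?thesis using submodule_transfer[OF assms(1-3) _ assms(5)] submodule_minus[OF assms(1,2) _ assms(5), of x] by auto
qed

context regular_koszul_nontrivial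
begin

definition chain_map where
  "chain_map C D f \<longleftrightarrow> (\<forall>n. f n \<in> lin_maps R (chains C n) (chains D n)
     \<and> (\<forall>x\<in>carrier (chains C n). bdry D n (f n x) = f (n - 1) (bdry C n x)))"

lemma chain_map_lin: "chain_map C D f \<Longrightarrow> f n \<in> lin_maps R (chains C n) (chains D n)"
  and chain_map_bdry: "chain_map C D f \<Longrightarrow> x \<in> carrier (chains C n) \<Longrightarrow> bdry D n (f n x) = f (n - 1) (bdry C n x)"
  by (simp_all add: chain_map_def)

lemma chain_map_Zc:
  assumes f: "chain_map C D f" and C: "chain_complex R C" and D: "chain_complex R D" and x: "x \<in> Zc C n"
  shows "f n x \<in> Zc D n"
proof -
  have x': "x \<in> carrier (chains C n)" "bdry C n x \<in> ISp C (n - 1)" using x by (simp_all add: Zc_def)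
  from ideal_span_lin[OF chain_map_lin[OF f] cx_module[OF C] cx_module[OF D] II_sub x'(2)]
  show ?thesis unfolding Zc_def using lin_closed[OF chain_map_lin[OF f] x'(1)] chain_map_bdry[OF f x'(1)] by simp
qed

lemma chain_map_Bd:
  assumes f: "chain_map C D f" and C: "chain_complex R C" and D: "chain_complex R D" and x: "x \<in> Bd C n"
  shows "f n x \<in> Bd D n"
proof -
  obtain v i where v: "v \<in> carrier (chains C (n + 1))" "i \<in> ISp C n" "x = bdry C (n + 1) v \<oplus>\<^bsub>chains C n\<^esub> i"
    using x unfolding Bd_def set_add_iff boundaries_def by blast
  note fl = chain_map_lin[OF f]
  have "f n x = f n (bdry C (n + 1) v) \<oplus>\<^bsub>chains D n\<^esub> f n i"
    unfolding v(3) by (rule lin_add[OF fl lin_closed[OF cx_lin_Suc[OF C] v(1)] ideal_span_closed[OF cx_module[OF C] II_sub v(2)]])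
  also have "f n (bdry C (n + 1) v) = bdry D (n + 1) (f (n + 1) v)" using chain_map_bdry[OF f v(1)] by simp
  finally show ?thesis
    using Module.module.submoduleE(5)[OF cx_module[OF D] Bd_submodule[OF D] Bd_bdry[OF D lin_closed[OF fl v(1)]]
        Bd_ISp[OF D ideal_span_lin[OF fl cx_module[OF C] cx_module[OF D] II_sub v(2)]]] by simp
qed

lemma chain_map_compose: "chain_map C D f \<Longrightarrow> chain_map D E g \<Longrightarrow> chain_map C E (\<lambda>n x. g n (f n x))"
  unfolding chain_map_def[of C E]
  by (simp add: lin_compose[OF chain_map_lin chain_map_lin] chain_map_bdry lin_closed[OF chain_map_lin])

text \<open>
  A lift of the identity is homotopic to the identity, and the homotopy takes elements with boundary in
  \<open>I C\<close> to the right place because it is linear.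
\<close>

lemma chain_map_over_identity:
  assumes C: "free_resolution R C N' \<epsilon>" and N: "Module.module R N'" and t: "chain_map C C t"
    and t0: "\<And>x. x \<in> carrier (chains C 0) \<Longrightarrow> \<epsilon> (t 0 x) = \<epsilon> x" and x: "x \<in> Zc C n"
  shows "t n x \<ominus>\<^bsub>chains C n\<^esub> x \<in> Bd C n"
proof (cases "n \<ge> 0")
  case True
  note Cc = free_resolutionD(1)[OF C] and \<epsilon> = free_resolutionD(3)[OF C]
  note m = cx_module[OF Cc]
  interpret N: Module.module R N' by fact
  note tl = chain_map_lin[OF t]
  let ?d = "\<lambda>n x. t n x \<ominus>\<^bsub>chains C n\<^esub> x"
  have dl: "?d n \<in> lin_maps R (chains C n) (chains C n)" for n by (rule lin_minus_map[OF tl lin_id m])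
  have dc: "bdry C n (?d n x) = ?d (n - 1) (bdry C n x)" if "x \<in> carrier (chains C n)" for n x
    using lin_minus[OF cx_lin[OF Cc] m m lin_closed[OF tl that] that] chain_map_bdry[OF t that] by simp
  have d0: "\<epsilon> (?d 0 x) = \<zero>\<^bsub>N'\<^esub>" if "x \<in> carrier (chains C 0)" for x
    using lin_minus[OF \<epsilon> m N lin_closed[OF tl that] that] t0[OF that] lin_closed[OF \<epsilon> that] by (simp add: a_minus_def N.M.r_neg)
  from chain_map_nullhomotopy[OF free_resolution_nonneg[OF C] C dl dc d0]
  obtain h where hl: "\<And>n. h n \<in> lin_maps R (chains C n) (chains C (n + 1))"
    and h: "\<And>n x. n \<ge> 0 \<Longrightarrow> x \<in> carrier (chains C n) \<Longrightarrow>
      bdry C (n + 1) (h n x) = signed (chains C n) n (?d n x) \<oplus>\<^bsub>chains C n\<^esub> h (n - 1) (bdry C n x)" by blast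
  have xc: "x \<in> carrier (chains C n)" and bx: "bdry C n x \<in> ISp C (n - 1)" using x by (simp_all add: Zc_def)
  have hl': "h (n - 1) \<in> lin_maps R (chains C (n - 1)) (chains C n)" using hl[of "n - 1"] by simp
  have "h (n - 1) (bdry C n x) \<in> Bd C n" by (rule Bd_ISp[OF Cc ideal_span_lin[OF hl' m m II_sub bx]])
  moreover have "signed (chains C n) n (?d n x) \<oplus>\<^bsub>chains C n\<^esub> h (n - 1) (bdry C n x) \<in> Bd C n"
    using Bd_bdry[OF Cc lin_closed[OF hl xc]] h[OF True xc] by simp
  moreover note sc = signed_closed[OF m lin_closed[OF dl xc], of n]
  ultimately have "signed (chains C n) n (?d n x) \<in> Bd C n" using submodule_cancel_right[OF m Bd_submodule[OF Cc]] by blast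
  then show ?thesis unfolding signed_submodule_iff[OF m Bd_submodule[OF Cc] lin_closed[OF dl xc]] .
next
  case False
  note Cc = free_resolutionD(1)[OF C]
  have "t n x \<in> carrier (chains C n)" by (rule lin_closed[OF chain_map_lin[OF t] Zc_closed[OF x]])
  then have "t n x = \<zero>\<^bsub>chains C n\<^esub>" "x = \<zero>\<^bsub>chains C n\<^esub>" using False free_resolutionD(6)[OF C, of n] Zc_closed[OF x] by auto
  then show ?thesis
    using submodule_minus[OF cx_module[OF Cc] Bd_submodule[OF Cc]] submodule_zero[OF cx_module[OF Cc] Bd_submodule[OF Cc]] by metis
qed

lemma resolution_comparison:
  assumes C: "free_resolution R C N' \<epsilon>" and D: "free_resolution R D N' \<eta>" and N: "Module.module R N'"
  obtains f where "chain_map C D f" "\<And>x. x \<in> carrier (chains C 0) \<Longrightarrow> \<eta> (f 0 x) = \<epsilon> x"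
proof -
  note Cc = free_resolutionD(1)[OF C] and \<epsilon> = free_resolutionD(3,5)[OF C]
  have "\<epsilon> (bdry C 1 x) = \<zero>\<^bsub>N'\<^esub>" if "x \<in> carrier (chains C 1)" for x
    using \<epsilon>(2) that by (auto simp: boundaries_def)
  from chain_map_lift[OF free_resolution_nonneg[OF C] D N \<epsilon>(1) this]
  show ?thesis using that unfolding chain_map_def by blast
qed

end

context regular_koszul_nontrivial
begin

lemma over_identity_congruent:
  assumes C: "free_resolution R C N' \<epsilon>" and N: "Module.module R N'" and t: "chain_map C C t"
    and t0: "\<And>x. x \<in> carrier (chains C 0) \<Longrightarrow> \<epsilon> (t 0 x) = \<epsilon> x" and x: "x \<in> Zc C n"
  shows "t n x \<in> Bd C n \<longleftrightarrow> x \<in> Bd C n"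
  using submodule_congruent[OF cx_module Bd_submodule lin_closed[OF chain_map_lin[OF t]] _ chain_map_over_identity[OF assms]]
    free_resolutionD(1)[OF C] Zc_closed[OF x] by blast

text \<open>
  Comparison maps in both directions exist and are inverse to each other up to homotopy. Hence the Tor
  modules of D are also presented by the other resolution C.
\<close>

lemma resolution_comparison_presents:
  assumes C: "free_resolution R C N' \<epsilon>" and D: "free_resolution R D N' \<eta>" and N: "Module.module R N'"
    and f: "chain_map C D f" and f0: "\<And>x. x \<in> carrier (chains C 0) \<Longrightarrow> \<eta> (f 0 x) = \<epsilon> x"
  shows "\<And>z. z \<in> Zc D n \<Longrightarrow> \<exists>x\<in>Zc C n. z \<ominus>\<^bsub>chains D n\<^esub> f n x \<in> Bd D n"
    and "presents R \<phi> (Zm C n) (Bd C n) (Tor R A \<phi> D n) (\<lambda>x. tor_class D n (f n x))"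
proof -
  note Cc = free_resolutionD(1)[OF C] and Dc = free_resolutionD(1)[OF D]
  note Dm = cx_module[OF Dc] and Ds = Bd_submodule[OF Dc]
  interpret D: Module.module R "chains D n" by (rule Dm)
  obtain g where g: "chain_map D C g" and g0: "\<And>x. x \<in> carrier (chains D 0) \<Longrightarrow> \<epsilon> (g 0 x) = \<eta> x"
    using resolution_comparison[OF D C N] by blast
  have fg0: "\<eta> (f 0 (g 0 x)) = \<eta> x" if "x \<in> carrier (chains D 0)" for x
    using f0 g0 that lin_closed[OF chain_map_lin[OF g]] by simp
  have gf0: "\<epsilon> (g 0 (f 0 x)) = \<epsilon> x" if "x \<in> carrier (chains C 0)" for x
    using f0 g0 that lin_closed[OF chain_map_lin[OF f]] by simp
  show onto: "\<exists>x\<in>Zc C n. z \<ominus>\<^bsub>chains D n\<^esub> f n x \<in> Bd D n" if z: "z \<in> Zc D n" for z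
  proof
    show gz: "g n z \<in> Zc C n" by (rule chain_map_Zc[OF g Dc Cc z])
    let ?y = "f n (g n z)"
    have c: "?y \<in> carrier (chains D n)" "z \<in> carrier (chains D n)"
      using Zc_closed[OF chain_map_Zc[OF f Cc Dc gz]] Zc_closed[OF z] by auto
    have "?y \<ominus>\<^bsub>chains D n\<^esub> z \<in> Bd D n"
      by (rule chain_map_over_identity[OF D N chain_map_compose[OF g f] fg0 z])
    moreover have "z \<ominus>\<^bsub>chains D n\<^esub> ?y = \<ominus>\<^bsub>chains D n\<^esub> (?y \<ominus>\<^bsub>chains D n\<^esub> z)"
      using c by (simp add: a_minus_def D.M.minus_add D.M.a_comm)
    ultimately show "z \<ominus>\<^bsub>chains D n\<^esub> ?y \<in> Bd D n" using D.submoduleE(3)[OF Ds] by simp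
  qed
  have fl: "f n \<in> lin_maps R (Zm C n) (Zm D n)"
    using chain_map_lin[OF f, of n] chain_map_Zc[OF f Cc Dc] Zc_closed[of _ C n] by (auto simp: lin_maps_def)
  have onto': "\<exists>x\<in>carrier (Zm C n). z \<ominus>\<^bsub>Zm D n\<^esub> f n x \<in> Bd D n" if z: "z \<in> carrier (Zm D n)" for z
    using onto[of z] z minus_carrier_update[OF Dm Zc_submodule[OF Dc] chain_map_Zc[OF f Cc Dc]] by auto
  have "f n x \<in> Bd D n \<longleftrightarrow> x \<in> Bd C n" if x: "x \<in> Zc C n" for x
    using chain_map_Bd[OF f Cc Dc, of x n] chain_map_Bd[OF g Dc Cc, of "f n x" n]
      over_identity_congruent[OF C N chain_map_compose[OF f g] gf0 x] by blast
  then have ker: "{x \<in> carrier (Zm C n). f n x \<in> Bd D n} = Bd C n" using Bd_subset[OF Cc, of n] by auto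
  show "presents R \<phi> (Zm C n) (Bd C n) (Tor R A \<phi> D n) (\<lambda>x. tor_class D n (f n x))"
    using bc_presents_compose[OF Tor_presents[OF Dc] Zm_module[OF Dc] Tor_module[OF Dc] fl onto'] unfolding ker .
qed

section \<open>The homology of the total complex\<close>

text \<open>
  The differential of \<open>K(R; I\<^sup>s)\<close> without its Koszul part. The two agree modulo I up to sign, so they have
  the same cycles and boundaries over R/I.
\<close>

definition L_cx :: "nat \<Rightarrow> ('a, 'a qchain) chain_cx" where
  "L_cx s = \<lparr>chains = (\<lambda>n. free_mod R (KB s n)), bdry = (\<lambda>n f. low s (del f))\<rparr>"

lemma L_cx_simps [simp]: "chains (L_cx s) n = free_mod R (KB s n)" "bdry (L_cx s) n = (\<lambda>f. low s (del f))"
  by (simp_all add: L_cx_def)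

lemma L_complex: "chain_complex R (L_cx s)"
  unfolding chain_complex_def L_cx_simps
  using low_del_low_del[OF fs_FF] lin_restrict_free[OF low_del_lin cring_axioms low_del_fs] by (simp add: free_mod_module)

lemma free_minus_FF: "x \<in> fs B \<Longrightarrow> y \<in> fs B \<Longrightarrow> x \<ominus>\<^bsub>free_mod R B\<^esub> y = x \<ominus>\<^sub>F y"
  unfolding free_mod_minus free_mod_minus[OF fs_FF fs_FF] ..

lemma Kd_parts:
  assumes f: "f \<in> fs (KB s n)"
  shows "kd f \<in> II_valued (KB s (n - 1))"
    and "Kd s f = kd f \<ominus>\<^bsub>free_mod R (KB s (n - 1))\<^esub> low s (del f)"
    and "low s (del f) = kd f \<ominus>\<^bsub>free_mod R (KB s (n - 1))\<^esub> Kd s f"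
proof -
  interpret K: Module.module R "free_mod R (KB s (n - 1))" by (rule free_mod_module)
  have k: "kd f \<in> fs (KB s (n - 1))" by (rule kd_fs[OF f]) (auto simp: KB_def intro: int_card_pred)
  show "kd f \<in> II_valued (KB s (n - 1))" by (rule kd_II_valued[OF f k])
  show *: "Kd s f = kd f \<ominus>\<^bsub>free_mod R (KB s (n - 1))\<^esub> low s (del f)"
    unfolding Kd_def free_minus_FF[OF k low_del_fs[OF f]] ..
  show "low s (del f) = kd f \<ominus>\<^bsub>free_mod R (KB s (n - 1))\<^esub> Kd s f"
    unfolding * by (rule K.M.minus_minus_cancel[OF k low_del_fs[OF f], symmetric])
qed

lemma Zc_K: "Zc (K_cx s) n = Zc (L_cx s) n"
proof -
  have "Kd s f \<in> II_valued (KB s (n - 1)) \<longleftrightarrow> low s (del f) \<in> II_valued (KB s (n - 1))" if f: "f \<in> fs (KB s n)" for f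
    using Kd_parts[OF f] submodule_minus[OF free_mod_module II_valued_submodule Kd_parts(1)[OF f]] by metis
  then show ?thesis unfolding Zc_def by (auto simp: ideal_span_II)
qed

lemma Bd_K: "Bd (K_cx s) n = Bd (L_cx s) n"
proof -
  have V: "submodule (II_valued (KB s n)) R (free_mod R (KB s n))" by (rule II_valued_submodule)
  have *: "kd v \<in> Bd C n"
    if "chain_complex R C" "chains C n = free_mod R (KB s n)" "v \<in> fs (KB s (n + 1))" for v and C :: "('a, 'a qchain) chain_cx"
    using Bd_ISp[OF that(1), of "kd v" n] Kd_parts(1)[OF that(3)] that(2) by (simp add: ideal_span_II)
  have sub: "Bd C n \<subseteq> Bd D n" if C: "chain_complex R C" "chains C = (\<lambda>n. free_mod R (KB s n))"
      and D: "chain_complex R D" "chains D = (\<lambda>n. free_mod R (KB s n))"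
      and d: "\<And>v. v \<in> fs (KB s (n + 1)) \<Longrightarrow> bdry C (n + 1) v = kd v \<ominus>\<^bsub>free_mod R (KB s n)\<^esub> bdry D (n + 1) v"
    for C D :: "('a, 'a qchain) chain_cx"
  proof
    fix z assume "z \<in> Bd C n"
    then obtain v i where v: "v \<in> fs (KB s (n + 1))" "i \<in> ISp C n" "z = bdry C (n + 1) v \<oplus>\<^bsub>chains C n\<^esub> i"
      unfolding Bd_def set_add_iff boundaries_def C(2) by blast
    have m: "Module.module R (chains D n)" "submodule (Bd D n) R (chains D n)"
      by (rule cx_module[OF D(1)], rule Bd_submodule[OF D(1)])
    have "bdry C (n + 1) v \<in> Bd D n"
      unfolding d[OF v(1)] using submodule_minus[OF m *[OF D(1) _ v(1)] Bd_bdry[OF D(1)]] v(1) D(2) by simp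
    moreover have "i \<in> Bd D n" using Bd_ISp[OF D(1)] v(2) C(2) D(2) by simp
    ultimately have "bdry C (n + 1) v \<oplus>\<^bsub>chains D n\<^esub> i \<in> Bd D n" by (rule Module.module.submoduleE(5)[OF m])
    then show "z \<in> Bd D n" unfolding v(3) C(2) D(2) .
  qed
  have c: "chains (K_cx s) = (\<lambda>n. free_mod R (KB s n))" "chains (L_cx s) = (\<lambda>n. free_mod R (KB s n))" by (auto simp: fun_eq_iff)
  show ?thesis
  proof (rule equalityI)
    show "Bd (K_cx s) n \<subseteq> Bd (L_cx s) n"
      by (rule sub[OF K_chain_complex c(1) L_complex c(2)]) (use Kd_parts(2)[of _ s "n + 1"] in simp)
    show "Bd (L_cx s) n \<subseteq> Bd (K_cx s) n"
      by (rule sub[OF L_complex c(2) K_chain_complex c(1)]) (use Kd_parts(3)[of _ s "n + 1"] in simp)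
  qed
qed

lemma total_presents:
  "presents R \<phi> (Zm (K_cx s) n) (Bd (K_cx s) n) (homology (Tt s) n) (\<lambda>x. boundaries (Tt s) n +>\<^bsub>chains (Tt s) n\<^esub> \<Theta> s n x)"
proof -
  have i: "x \<in> fs (KB s n)" if "x \<in> fs (KB s n)" for x n by (rule that)
  have Z: "{x \<in> fs (KB s n). low s (del x) \<in> II_valued (KB s (n - 1))} = Zc (K_cx s) n"
    unfolding Zc_K by (simp add: Zc_def ideal_span_II)
  have B: "{x \<in> fs (KB s n). low s (del x) \<in> II_valued (KB s (n - 1))
      \<and> (\<exists>v\<in>fs (KB s (n + 1)). x \<ominus>\<^bsub>free_mod R (KB s n)\<^esub> low s (del v) \<in> II_valued (KB s n))} = Bd (K_cx s) n"
    using Bd_iff[OF L_complex, of _ s n] Bd_subset[OF L_complex, of s n] unfolding Bd_K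
    by (auto simp: Zc_def ideal_span_II simp del: free_mod_simps)
  show ?thesis using total_homology(2)[OF i i low_del_low_del_II, of n] unfolding Z B by simp
qed

lemma total_homology_module: "Module.module A (homology (Tt s) n)"
  by (rule homology_module[OF total_complex])

section \<open>The cokernel\<close>

text \<open>
  The contracting homotopy, applied to the part of x outside the last column, writes that part as a
  boundary plus an element of \<open>I K\<close>. In degree zero this fails for the unit vector, and it is the reason why
  the case n = 0 has a different answer.
\<close>

lemma top_decomposition:
  assumes x: "x \<in> Zc (K_cx (Suc t)) n" and n: "n \<noteq> 0"
  shows "\<exists>q\<in>fs (Q_basis N t n). x \<ominus>\<^bsub>free_mod R (KB (Suc t) n)\<^esub> q \<in> Bd (K_cx (Suc t)) n"
proof
  let ?s = "Suc t"
  let ?K = "free_mod R (KB ?s n)"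
  interpret K: Module.module R ?K by (rule free_mod_module)
  have xf: "x \<in> fs (KB ?s n)" and dx: "low ?s (del x) \<in> II_valued (KB ?s (n - 1))"
    using x unfolding Zc_K by (simp_all add: Zc_def ideal_span_II)
  define y where "y = low t x"
  have y: "y \<in> fs (KB t n)" unfolding y_def by (rule low_fs[OF xf]) simp
  have ys: "y \<in> fs (KB ?s n)" by (rule KB_mono[OF y]) simp
  define q where "q = x \<ominus>\<^bsub>?K\<^esub> y"
  have qs: "q \<in> fs (KB ?s n)" unfolding q_def by (rule K.M.minus_closed[OF xf ys])
  have "low t q = low t x \<ominus>\<^sub>F low t (low t x)"
    unfolding q_def free_minus_FF[OF xf ys] unfolding y_def
    by (rule lin_minus[OF restr_lin FF_module FF_module fs_FF[OF xf] restr_FF[OF fs_FF[OF xf]]])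
  also have "\<dots> = \<zero>\<^sub>F"
  proof -
    interpret F: Module.module R FF by (rule FF_module)
    show ?thesis using restr_FF[OF fs_FF[OF xf], of "\<lambda>(J, m). size m < t"]
      by (simp only: low_low[OF order_refl] a_minus_def F.M.r_neg)
  qed
  finally show "q \<in> fs (Q_basis N t n)" by (rule top_Q[OF qs])
  have ne: "finite J \<and> \<not> (J = {} \<and> m = {#})" if "(J, m) \<in> KB t n" for J m using that n by (auto simp: KB_def)
  have h: "hom y \<in> fs (KB t (n + 1))"
    by (rule hom_fs[OF y]) (auto simp: KB_def size_Diff_singleton dest: in_diffD)
  have "low ?s (del (hom y)) \<in> Bd (L_cx ?s) n"
    using Bd_bdry[OF L_complex, of "hom y" ?s n] KB_mono[OF h, of ?s] by simp
  then have 1: "del (hom y) \<in> Bd (L_cx ?s) n" unfolding low_del[OF fs_FF[OF h]] low_id[OF h] .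
  have dy: "del y = low ?s (del x)" unfolding y_def low_del[OF fs_FF[OF xf]] ..
  have "hom (del y) \<in> fs (KB ?s n)"
    unfolding dy using low_del_fs[OF xf] by (rule hom_fs) (auto simp: KB_def size_Diff_singleton dest: in_diffD)
  then have "hom (del y) \<in> II_valued (KB ?s n)" using II_valued_lin[OF hom_lin dx] unfolding dy by blast
  then have 2: "hom (del y) \<in> Bd (L_cx ?s) n" using Bd_ISp[OF L_complex, of _ ?s n] by (simp add: ideal_span_II)
  have "del (hom y) \<oplus>\<^bsub>?K\<^esub> hom (del y) = y" using hom_identity[OF y ne] by simp
  then have "y \<in> Bd (K_cx ?s) n"
    unfolding Bd_K using Module.module.submoduleE(5)[OF cx_module[OF L_complex] Bd_submodule[OF L_complex] 1 2]
    by (simp del: free_mod_simps)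
  then show "x \<ominus>\<^bsub>?K\<^esub> q \<in> Bd (K_cx ?s) n" unfolding q_def K.M.minus_minus_cancel[OF xf ys] .
qed

lemma Q_Zc: "q \<in> fs (Q_basis N t n) \<Longrightarrow> q \<in> Zc (K_cx (Suc t)) n"
  using kd_II_valued[OF _ Q_KB[OF Q_kd_fs]] Q_KB by (simp add: Zc_def ideal_span_II Kd_Q)

definition top_boundaries where "top_boundaries t n = {q \<in> fs (Q_basis N t n). q \<in> Bd (K_cx (Suc t)) n}"

lemma top_presents:
  assumes pr: "presents R \<phi> (Zm (K_cx (Suc t)) n) (Bd (K_cx (Suc t)) n) T h" and T: "Module.module A T" and n: "n \<noteq> 0"
  shows "presents R \<phi> (Q_mod R N t n) (top_boundaries t n) T (\<lambda>x. h x)"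
proof -
  let ?K = "K_cx (Suc t)"
  have l: "(\<lambda>x. x) \<in> lin_maps R (Q_mod R N t n) (Zm ?K n)"
    using Q_Zc by (intro lin_mapsI) simp_all
  have onto: "\<exists>x\<in>carrier (Q_mod R N t n). z \<ominus>\<^bsub>Zm ?K n\<^esub> x \<in> Bd ?K n" if "z \<in> carrier (Zm ?K n)" for z
    using top_decomposition[of z t n] that n minus_carrier_update[OF cx_module[OF K_chain_complex] Zc_submodule[OF K_chain_complex] Q_Zc]
    by (simp del: free_mod_simps)
  show ?thesis using bc_presents_compose[OF pr Zm_module[OF K_chain_complex] T l onto] unfolding top_boundaries_def .
qed

text \<open>
  An element of the last column that bounds is the image under \<open>\<partial>\<close> of the component of the bounding chain
  in the last column but one.
\<close>

lemma coker_kernel: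
  assumes q: "q \<in> fs (Q_basis N (Suc r) n)"
  shows "\<kappa> (Suc r) n q \<in> Tor_del R N u r (n + 1) ` carrier (Tor_Q R N u r (n + 1)) \<longleftrightarrow> q \<in> Bd (K_cx (Suc (Suc r))) n"
proof -
  let ?s = "Suc (Suc r)"
  have qs: "q \<in> fs (KB ?s n)" by (rule Q_KB[OF q])
  have dQ: "del x \<in> fs (Q_basis N (Suc r) n)" if "x \<in> fs (Q_basis N r (n + 1))" for x using Q_del_fs[OF that] by simp
  have low: "low ?s (del x) = del x" if "x \<in> fs (Q_basis N r (n + 1))" for x by (rule low_id[OF Q_KB[OF dQ[OF that]]])
  have "\<kappa> (Suc r) n q \<in> Tor_del R N u r (n + 1) ` carrier (Tor_Q R N u r (n + 1))
      \<longleftrightarrow> (\<exists>x\<in>fs (Q_basis N r (n + 1)). q \<ominus>\<^bsub>Q_mod R N (Suc r) n\<^esub> del x \<in> II_valued (Q_basis N (Suc r) n))"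
    unfolding Tor_del_image using \<kappa>_eq_iff[OF q dQ] by (auto simp del: free_mod_simps)
  also have "\<dots> \<longleftrightarrow> (\<exists>v\<in>fs (KB ?s (n + 1)). q \<ominus>\<^bsub>free_mod R (KB ?s n)\<^esub> low ?s (del v) \<in> II_valued (KB ?s n))"
  proof
    assume "\<exists>x\<in>fs (Q_basis N r (n + 1)). q \<ominus>\<^bsub>Q_mod R N (Suc r) n\<^esub> del x \<in> II_valued (Q_basis N (Suc r) n)"
    then obtain x where x: "x \<in> fs (Q_basis N r (n + 1))" "q \<ominus>\<^bsub>Q_mod R N (Suc r) n\<^esub> del x \<in> II_valued (Q_basis N (Suc r) n)" by blast
    have "q \<ominus>\<^bsub>Q_mod R N (Suc r) n\<^esub> del x = q \<ominus>\<^bsub>free_mod R (KB ?s n)\<^esub> low ?s (del x)"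
      unfolding low[OF x(1)] free_minus_FF[OF q dQ[OF x(1)]] free_minus_FF[OF qs Q_KB[OF dQ[OF x(1)]]] ..
    moreover from this have "q \<ominus>\<^bsub>free_mod R (KB ?s n)\<^esub> low ?s (del x) \<in> II_valued (KB ?s n)"
      using x(2) II_valued_mono[OF _ Q_KB, of _ "Q_basis N (Suc r) n" "Suc r" n] by (auto simp: II_valued_def simp del: free_mod_simps)
    moreover have "x \<in> fs (KB ?s (n + 1))" by (rule KB_mono[OF Q_KB[OF x(1)]]) simp
    ultimately show "\<exists>v\<in>fs (KB ?s (n + 1)). q \<ominus>\<^bsub>free_mod R (KB ?s n)\<^esub> low ?s (del v) \<in> II_valued (KB ?s n)" by blast
  next
    assume "\<exists>v\<in>fs (KB ?s (n + 1)). q \<ominus>\<^bsub>free_mod R (KB ?s n)\<^esub> low ?s (del v) \<in> II_valued (KB ?s n)"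
    then obtain v where v: "v \<in> fs (KB ?s (n + 1))" "q \<ominus>\<^bsub>free_mod R (KB ?s n)\<^esub> low ?s (del v) \<in> II_valued (KB ?s n)" by blast
    \<comment> \<open>p is the last column, and x the component of v in the column before it\<close>
    define p where "p = - int (Suc r)"
    define x where "x = comp (p + 1) v"
    have x: "x \<in> fs (Q_basis N r (n + 1))"
      unfolding x_def comp_def by (rule free_mod_mono[OF restr_fs[OF v(1)]]) (auto simp: KB_def Q_basis_def p_def)
    have cq: "comp p q = q"
      unfolding comp_def by (rule restr_id, rule free_mod_mono[OF q]) (auto simp: Q_basis_def p_def)
    have cd: "comp p (low ?s (del v)) = del x"
      unfolding comp_low comp_del[OF fs_FF[OF v(1)]] x_def[symmetric] by (rule low[OF x])
    have "comp p (q \<ominus>\<^sub>F low ?s (del v)) = comp p q \<ominus>\<^sub>F comp p (low ?s (del v))"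
      by (rule lin_minus[OF comp_lin FF_module FF_module fs_FF[OF q] lin_closed[OF low_del_lin fs_FF[OF v(1)]]])
    then have "comp p (q \<ominus>\<^sub>F low ?s (del v)) = q \<ominus>\<^sub>F del x" unfolding cq cd .
    moreover have "q \<ominus>\<^sub>F low ?s (del v) \<in> II_valued (KB ?s n)"
      using v(2) low_del_fs[OF v(1)] by (simp add: free_minus_FF[OF qs] del: free_mod_simps)
    then have "comp p (q \<ominus>\<^sub>F low ?s (del v)) b \<in> II" for b
      using additive_subgroup.zero_closed[OF ideal.axioms(1)[OF II_ideal]] by (auto simp: II_valued_def comp_def restr_def)
    ultimately have "q \<ominus>\<^bsub>Q_mod R N (Suc r) n\<^esub> del x \<in> II_valued (Q_basis N (Suc r) n)"
      using submodule_minus[OF FF_module fs_submodule q dQ[OF x]] unfolding free_minus_FF[OF q dQ[OF x]]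
      by (simp add: II_valued_def del: free_mod_simps)
    then show "\<exists>x\<in>fs (Q_basis N r (n + 1)). q \<ominus>\<^bsub>Q_mod R N (Suc r) n\<^esub> del x \<in> II_valued (Q_basis N (Suc r) n)" using x by blast
  qed
  also have "\<dots> \<longleftrightarrow> q \<in> Bd (K_cx ?s) n"
    using Bd_iff[OF L_complex, of q ?s n] qs unfolding Bd_K by (simp add: ideal_span_II del: free_mod_simps)
  finally show ?thesis .
qed

lemma coker_presents:
  "\<exists>h. presents R \<phi> (Q_mod R N (Suc r) n) (top_boundaries (Suc r) n)
     (quot_mod (Tor_Q R N u (Suc r) n) (Tor_del R N u r (n + 1) ` carrier (Tor_Q R N u r (n + 1)))) h"
  and coker_module: "Module.module A (quot_mod (Tor_Q R N u (Suc r) n) (Tor_del R N u r (n + 1) ` carrier (Tor_Q R N u r (n + 1))))"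
proof -
  let ?H = "Tor_del R N u r (n + 1) ` carrier (Tor_Q R N u r (n + 1))"
  have del: "del \<in> lin_maps R (Q_mod R N r (n + 1)) (Q_mod R N (Suc r) n)"
    by (rule lin_restrict_free[OF del_lin cring_axioms]) (use Q_del_fs[of _ r "n + 1"] in simp)
  have "submodule (del ` fs (Q_basis N r (n + 1))) R (Q_mod R N (Suc r) n)"
    by (rule lin_image_submodule[OF del free_mod_module free_mod_module Module.module.carrier_is_submodule[OF free_mod_module]])
  from surjective_change.image_submodule[OF change presentsD(1)[OF \<kappa>_presents] free_mod_module Tor_Q_module this]
  have H: "submodule ?H A (Tor_Q R N u (Suc r) n)" unfolding Tor_del_image image_image by simp
  then show "Module.module A (quot_mod (Tor_Q R N u (Suc r) n) ?H)" by (rule quot_mod_module[OF Tor_Q_module])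
  have "{q \<in> fs (Q_basis N (Suc r) n). \<kappa> (Suc r) n q \<in> ?H} = top_boundaries (Suc r) n"
    unfolding top_boundaries_def using coker_kernel by blast
  then show "\<exists>h. presents R \<phi> (Q_mod R N (Suc r) n) (top_boundaries (Suc r) n) (quot_mod (Tor_Q R N u (Suc r) n) ?H) h"
    using bc_presents_quot[OF \<kappa>_presents free_mod_module Tor_Q_module H] by auto
qed

section \<open>Degree zero\<close>

lemma Ip_II: "s > 0 \<Longrightarrow> Ip s \<subseteq> II"
  using ideal_pow_decreasing[OF II_ideal, of 1 s] ideal_pow_1[OF II_ideal] by simp

lemma quot_Ip_module: "Module.module R (quot_mod (reg_mod R) (Ip s))"
  by (rule quot_mod_module[OF reg_mod_module ideal_submodule[OF Ip_ideal]])

lemma ideal_span_quot: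
  assumes s: "s > 0" and r: "r \<in> carrier R" and m: "Ip s +> r \<in> ideal_span II (quot_mod (reg_mod R) (Ip s))"
  shows "r \<in> II"
proof -
  let ?Q = "quot_mod (reg_mod R) (Ip s)"
  note I = ideal_submodule[OF Ip_ideal[of s]]
  note q = quot_mod_lin[OF reg_mod_module I]
  have "ideal_span II ?Q \<subseteq> (\<lambda>a. Ip s +>\<^bsub>reg_mod R\<^esub> a) ` II"
  proof (rule ideal_span_least[OF lin_image_submodule[OF q reg_mod_module quot_Ip_module ideal_submodule[OF II_ideal]] quot_Ip_module])
    fix i U assume i: "i \<in> II" and "U \<in> carrier ?Q"
    then obtain a where a: "a \<in> carrier R" "U = Ip s +>\<^bsub>reg_mod R\<^esub> a" by (auto simp: quot_mod_simps)
    have iR: "i \<in> carrier R" using i II_sub by auto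
    have "i \<odot>\<^bsub>?Q\<^esub> U = Ip s +>\<^bsub>reg_mod R\<^esub> (i \<otimes> a)"
      unfolding a(2) using coset_smult[OF reg_mod_module I iR, of a] a(1) by simp
    then show "i \<odot>\<^bsub>?Q\<^esub> U \<in> (\<lambda>a. Ip s +>\<^bsub>reg_mod R\<^esub> a) ` II" using ideal.I_r_closed[OF II_ideal i a(1)] by blast
  qed
  then obtain a where a: "a \<in> II" "Ip s +> r = Ip s +> a" using m by auto
  have "r \<ominus> a \<in> Ip s"
    using coset_minus_iff[OF reg_mod_module I, of r a] a r II_sub by auto
  then show ?thesis
    using submodule_transfer[OF reg_mod_module ideal_submodule[OF II_ideal], of r a] r a(1) Ip_II[OF s] by auto
qed

text \<open>
  An element of degree zero is congruent to a multiple of a lift p0 of 1. A multiple \<open>r p0\<close> vanishes in Tor only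
  if the augmentation puts r into \<open>I (R/I\<^sup>s)\<close>, that is into I.
\<close>

lemma Tor_degree_zero:
  assumes s: "s > 0" and P: "free_resolution R P (quot_mod (reg_mod R) (Ip s)) \<epsilon>"
  shows "mod_isomorphic A (Tor R A \<phi> P 0) (reg_mod A)"
proof -
  let ?Q = "quot_mod (reg_mod R) (Ip s)"
  note Pc = free_resolutionD(1)[OF P] and \<epsilon> = free_resolutionD(3)[OF P] and I = ideal_submodule[OF Ip_ideal[of s]]
  note m = cx_module[OF Pc] and Bs = Bd_submodule[OF Pc]
  interpret P: Module.module R "chains P 0" by (rule m)
  interpret Q: Module.module R ?Q by (rule quot_Ip_module)
  have Z: "Zc P 0 = carrier (chains P 0)"
    unfolding Zc_def using cx_closed[OF Pc, of _ 0] free_resolutionD(6)[OF P, of "-1"] ideal_span.zero[of "chains P (-1)" II] by auto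
  have Zm: "Zm P 0 = chains P 0" unfolding Z by simp
  have "\<one> \<in> carrier (reg_mod R)" by simp
  then have "Ip s +> \<one> \<in> \<epsilon> ` carrier (chains P 0)" unfolding free_resolutionD(4)[OF P] using lin_closed[OF quot_mod_lin[OF reg_mod_module I]] by simp
  then obtain p0 where p0: "p0 \<in> carrier (chains P 0)" "\<epsilon> p0 = Ip s +> \<one>" by auto
  let ?j = "\<lambda>r. r \<odot>\<^bsub>chains P 0\<^esub> p0"
  have j: "?j \<in> lin_maps R (reg_mod R) (chains P 0)" by (rule smult_vector_lin[OF m p0(1)])
  have \<epsilon>j: "\<epsilon> (?j r) = Ip s +> r" if r: "r \<in> carrier R" for r
    using lin_smult[OF \<epsilon> r p0(1)] coset_smult[OF reg_mod_module I r, of \<one>] r p0(2) by simp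
  have bd: "z \<in> Bd P 0" if "z \<in> carrier (chains P 0)" "\<epsilon> z = \<zero>\<^bsub>?Q\<^esub>" for z
  proof -
    have "z \<in> boundaries P 0" using that unfolding free_resolutionD(5)[OF P, symmetric] by simp
    then show ?thesis using Bd_bdry[OF Pc, of _ 0] by (auto simp: boundaries_def)
  qed
  have onto: "\<exists>r\<in>carrier (reg_mod R). z \<ominus>\<^bsub>chains P 0\<^esub> ?j r \<in> Bd P 0" if z: "z \<in> carrier (chains P 0)" for z
  proof -
    have "\<epsilon> z \<in> carrier ?Q" by (rule lin_closed[OF \<epsilon> z])
    then obtain r where r: "r \<in> carrier R" "\<epsilon> z = Ip s +> r" by (auto simp: quot_mod_simps)
    have jr: "?j r \<in> carrier (chains P 0)" using r(1) p0(1) by simp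
    have "\<epsilon> (z \<ominus>\<^bsub>chains P 0\<^esub> ?j r) = \<zero>\<^bsub>?Q\<^esub>"
      using lin_minus[OF \<epsilon> m quot_Ip_module z jr] \<epsilon>j[OF r(1)] r(2) lin_closed[OF \<epsilon> z] by (simp add: a_minus_def Q.M.r_neg)
    then show ?thesis using bd[OF P.M.minus_closed[OF z jr]] r(1) by auto
  qed
  have ker: "{r \<in> carrier (reg_mod R). ?j r \<in> Bd P 0} = II"
  proof (intro equalityI subsetI)
    fix r assume r: "r \<in> II"
    then show "r \<in> {r \<in> carrier (reg_mod R). ?j r \<in> Bd P 0}"
      using II_sub Bd_ISp[OF Pc ideal_span_incl[OF m II_sub r p0(1)]] by auto
  next
    fix r assume "r \<in> {r \<in> carrier (reg_mod R). ?j r \<in> Bd P 0}"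
    then have r: "r \<in> carrier R" "?j r \<in> Bd P 0" by auto
    then obtain b i where b: "b \<in> boundaries P 0" "i \<in> ISp P 0" "?j r = b \<oplus>\<^bsub>chains P 0\<^esub> i"
      unfolding Bd_def set_add_iff by blast
    have b': "b \<in> carrier (chains P 0)" "\<epsilon> b = \<zero>\<^bsub>?Q\<^esub>" using b(1) unfolding free_resolutionD(5)[OF P, symmetric] by auto
    have i': "i \<in> carrier (chains P 0)" by (rule ideal_span_closed[OF m II_sub b(2)])
    have "\<epsilon> (?j r) = \<epsilon> i" unfolding b(3) using lin_add[OF \<epsilon> b'(1) i'] b'(2) lin_closed[OF \<epsilon> i'] by simp
    then have "Ip s +> r \<in> ideal_span II ?Q"
      using ideal_span_lin[OF \<epsilon> m quot_Ip_module II_sub b(2)] \<epsilon>j[OF r(1)] by simp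
    then show "r \<in> II" by (rule ideal_span_quot[OF s r(1)])
  qed
  have 1: "presents R \<phi> (reg_mod R) II (Tor R A \<phi> P 0) (\<lambda>r. tor_class P 0 (?j r))"
    using bc_presents_compose[OF Tor_presents[OF Pc, of 0, unfolded Zm] m Tor_module[OF Pc] j onto] unfolding ker .
  interpret \<phi>: ring_hom_cring R A \<phi> by (rule surjective_change.axioms(1)[OF change])
  have 2: "presents R \<phi> (reg_mod R) II (reg_mod A) \<phi>"
    unfolding presents_def using II_kernel surjective_change.surj[OF change] by (auto intro!: lin_mapsI)
  show ?thesis
    by (rule bc_presents_iso[OF 1 2 reg_mod_module Tor_module[OF Pc] cring.reg_mod_module[OF A_cring]])
qed

end

section \<open>Products\<close>

lemma mult_lift_iff:
  "mult_lift R P S \<epsilon> \<mu> \<longleftrightarrow>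
    (\<forall>p q. bilin R (chains P p) (chains P q) (chains P (p + q)) (\<mu> p q))
    \<and> (\<forall>p q. \<forall>x\<in>carrier (chains P p). \<forall>y\<in>carrier (chains P q).
         bdry P (p + q) (\<mu> p q x y) = leibniz P P (chains P (p + q - 1)) p q \<mu> x y)
    \<and> (\<forall>x\<in>carrier (chains P 0). \<forall>y\<in>carrier (chains P 0). \<epsilon> (\<mu> 0 0 x y) = \<epsilon> x \<otimes>\<^bsub>S\<^esub> \<epsilon> y)"
  unfolding mult_lift_def bilin_def leibniz_def signed_def Let_def by blast

context regular_koszul_nontrivial
begin

context
  fixes C :: "('a, 'm) chain_cx" and \<mu> :: "int \<Rightarrow> int \<Rightarrow> 'm \<Rightarrow> 'm \<Rightarrow> 'm"
  assumes C: "chain_complex R C"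
    and \<mu>: "\<And>p q. bilin R (chains C p) (chains C q) (chains C (p + q)) (\<mu> p q)"
    and d\<mu>: "\<And>p q x y. x \<in> carrier (chains C p) \<Longrightarrow> y \<in> carrier (chains C q) \<Longrightarrow>
      bdry C (p + q) (\<mu> p q x y) = leibniz C C (chains C (p + q - 1)) p q \<mu> x y"
begin

text \<open>The Leibniz rule, with terms in \<open>I C\<close> discarded.\<close>

lemma product_boundary_left:
  assumes x: "x \<in> Bd C p" and y: "y \<in> Zc C q"
  shows "\<mu> p q x y \<in> Bd C (p + q)"
proof -
  note m = cx_module[OF C] and Bs = Bd_submodule[OF C]
  have yc: "y \<in> carrier (chains C q)" and dy: "bdry C q y \<in> ISp C (q - 1)" using y by (simp_all add: Zc_def)
  obtain v i where v: "v \<in> carrier (chains C (p + 1))" "i \<in> ISp C p" "x = bdry C (p + 1) v \<oplus>\<^bsub>chains C p\<^esub> i"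
    using x unfolding Bd_def set_add_iff boundaries_def by blast
  have bv: "bdry C (p + 1) v \<in> carrier (chains C p)" by (rule lin_closed[OF cx_lin_Suc[OF C] v(1)])
  have ic: "i \<in> carrier (chains C p)" by (rule ideal_span_closed[OF m II_sub v(2)])
  note l = bilin_left[OF \<mu> yc, of p]
  have "\<mu> p q i y \<in> Bd C (p + q)" by (rule Bd_ISp[OF C ideal_span_lin[OF l m m II_sub v(2)]])
  moreover have "\<mu> p q (bdry C (p + 1) v) y \<in> Bd C (p + q)"
  proof -
    have e: "p + 1 + q = p + q + 1" "p + 1 - 1 = p" "p + q + 1 - 1 = p + q" "p + 1 + (q - 1) = p + q" by auto
    have r: "\<mu> (p + 1) (q - 1) v \<in> lin_maps R (chains C (q - 1)) (chains C (p + q))"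
      using bilin_right[OF \<mu>[of "p + 1" "q - 1"] v(1)] unfolding e .
    let ?s = "signed (chains C (p + q)) (p + 1) (\<mu> (p + 1) (q - 1) v (bdry C q y))"
    have "?s \<in> Bd C (p + q)"
      unfolding signed_submodule_iff[OF m Bs lin_closed[OF r cx_closed[OF C yc]]]
      by (rule Bd_ISp[OF C ideal_span_lin[OF r m m II_sub dy]])
    moreover have "\<mu> p q (bdry C (p + 1) v) y \<oplus>\<^bsub>chains C (p + q)\<^esub> ?s \<in> Bd C (p + q)"
    proof -
      have "\<mu> (p + 1) q v y \<in> carrier (chains C (p + q + 1))" using bilin_closed[OF \<mu> v(1) yc] unfolding e .
      then have "bdry C (p + q + 1) (\<mu> (p + 1) q v y) \<in> Bd C (p + q)" by (rule Bd_bdry[OF C])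
      then show ?thesis using d\<mu>[OF v(1) yc] unfolding leibniz_def e by simp
    qed
    ultimately show ?thesis using submodule_cancel_right[OF m Bs _ lin_closed[OF l bv]] by blast
  qed
  ultimately show ?thesis
    unfolding v(3) lin_add[OF l bv ic] using Module.module.submoduleE(5)[OF m Bs] by blast
qed

lemma product_boundary_right:
  assumes x: "x \<in> Zc C p" and y: "y \<in> Bd C q"
  shows "\<mu> p q x y \<in> Bd C (p + q)"
proof -
  note m = cx_module[OF C] and Bs = Bd_submodule[OF C]
  have xc: "x \<in> carrier (chains C p)" and dx: "bdry C p x \<in> ISp C (p - 1)" using x by (simp_all add: Zc_def)
  obtain v i where v: "v \<in> carrier (chains C (q + 1))" "i \<in> ISp C q" "y = bdry C (q + 1) v \<oplus>\<^bsub>chains C q\<^esub> i"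
    using y unfolding Bd_def set_add_iff boundaries_def by blast
  have bv: "bdry C (q + 1) v \<in> carrier (chains C q)" by (rule lin_closed[OF cx_lin_Suc[OF C] v(1)])
  have ic: "i \<in> carrier (chains C q)" by (rule ideal_span_closed[OF m II_sub v(2)])
  note l = bilin_right[OF \<mu> xc, of q]
  have "\<mu> p q x i \<in> Bd C (p + q)" by (rule Bd_ISp[OF C ideal_span_lin[OF l m m II_sub v(2)]])
  moreover have "\<mu> p q x (bdry C (q + 1) v) \<in> Bd C (p + q)"
  proof -
    have e: "p + (q + 1) = p + q + 1" "q + 1 - 1 = q" "p + q + 1 - 1 = p + q" "p - 1 + (q + 1) = p + q" by auto
    have r: "(\<lambda>z. \<mu> (p - 1) (q + 1) z v) \<in> lin_maps R (chains C (p - 1)) (chains C (p + q))"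
      using bilin_left[OF \<mu>[of "p - 1" "q + 1"] v(1)] unfolding e .
    let ?w = "\<mu> p q x (bdry C (q + 1) v)"
    have "\<mu> (p - 1) (q + 1) (bdry C p x) v \<in> Bd C (p + q)"
      by (rule Bd_ISp[OF C ideal_span_lin[OF r m m II_sub dx]])
    moreover have "\<mu> (p - 1) (q + 1) (bdry C p x) v \<oplus>\<^bsub>chains C (p + q)\<^esub> signed (chains C (p + q)) p ?w \<in> Bd C (p + q)"
    proof -
      have "\<mu> p (q + 1) x v \<in> carrier (chains C (p + q + 1))" using bilin_closed[OF \<mu> xc v(1)] unfolding e .
      then have "bdry C (p + q + 1) (\<mu> p (q + 1) x v) \<in> Bd C (p + q)" by (rule Bd_bdry[OF C])
      then show ?thesis using d\<mu>[OF xc v(1)] unfolding leibniz_def e by simp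
    qed
    ultimately have "signed (chains C (p + q)) p ?w \<in> Bd C (p + q)"
      using submodule_cancel_left[OF m Bs _ signed_closed[OF m lin_closed[OF l bv]]] by blast
    then show ?thesis unfolding signed_submodule_iff[OF m Bs lin_closed[OF l bv]] .
  qed
  ultimately show ?thesis
    unfolding v(3) lin_add[OF l bv ic] using Module.module.submoduleE(5)[OF m Bs] by blast
qed

end

lemma quot_mult: "a \<in> carrier R \<Longrightarrow> b \<in> carrier R \<Longrightarrow> (Ip s +> a) \<otimes>\<^bsub>R Quot Ip s\<^esub> (Ip s +> b) = Ip s +> (a \<otimes> b)"
  using ideal.rcoset_mult_add[OF Ip_ideal] by (simp add: FactRing_def)

lemma quot_bilin:
  "bilin R (quot_mod (reg_mod R) (Ip s)) (quot_mod (reg_mod R) (Ip s)) (quot_mod (reg_mod R) (Ip s)) (\<lambda>x y. x \<otimes>\<^bsub>R Quot Ip s\<^esub> y)"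
proof -
  let ?Q = "quot_mod (reg_mod R) (Ip s)"
  note I = ideal_submodule[OF Ip_ideal[of s]]
  note add = coset_add[OF reg_mod_module I, unfolded reg_mod_simps reg_mod_coset]
    and smult = coset_smult[OF reg_mod_module I, unfolded reg_mod_simps reg_mod_coset]
  have c: "\<exists>a\<in>carrier R. x = Ip s +> a" if "x \<in> carrier ?Q" for x using that by (auto simp: quot_mod_simps)
  have cl: "Ip s +> a \<in> carrier ?Q" if "a \<in> carrier R" for a using that by (auto simp: quot_mod_simps)
  have r: "(\<lambda>y. x \<otimes>\<^bsub>R Quot Ip s\<^esub> y) \<in> lin_maps R ?Q ?Q" if x: "x \<in> carrier ?Q" for x
  proof -
    obtain a where a: "a \<in> carrier R" "x = Ip s +> a" using c[OF x] by blast
    show ?thesis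
    proof (rule lin_mapsI)
      fix y assume "y \<in> carrier ?Q"
      then obtain b where b: "b \<in> carrier R" "y = Ip s +> b" using c by blast
      show "x \<otimes>\<^bsub>R Quot Ip s\<^esub> y \<in> carrier ?Q" unfolding a b quot_mult[OF a(1) b(1)] using a b by (intro cl) simp
      show "x \<otimes>\<^bsub>R Quot Ip s\<^esub> (r \<odot>\<^bsub>?Q\<^esub> y) = r \<odot>\<^bsub>?Q\<^esub> (x \<otimes>\<^bsub>R Quot Ip s\<^esub> y)" if r: "r \<in> carrier R" for r
        unfolding a b using a(1) b(1) r by (simp add: smult quot_mult m_lcomm)
      fix z assume "z \<in> carrier ?Q"
      then obtain d where d: "d \<in> carrier R" "z = Ip s +> d" using c by blast
      show "x \<otimes>\<^bsub>R Quot Ip s\<^esub> (y \<oplus>\<^bsub>?Q\<^esub> z) = (x \<otimes>\<^bsub>R Quot Ip s\<^esub> y) \<oplus>\<^bsub>?Q\<^esub> (x \<otimes>\<^bsub>R Quot Ip s\<^esub> z)"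
        unfolding a b d using a(1) b(1) d(1) by (simp add: add quot_mult r_distr)
    qed
  qed
  have comm: "x \<otimes>\<^bsub>R Quot Ip s\<^esub> y = y \<otimes>\<^bsub>R Quot Ip s\<^esub> x" if "x \<in> carrier ?Q" "y \<in> carrier ?Q" for x y
    using c[OF that(1)] c[OF that(2)] by (auto simp: quot_mult m_comm)
  show ?thesis unfolding bilin_def
  proof (intro conjI ballI)
    fix y assume y: "y \<in> carrier ?Q"
    show "(\<lambda>x. x \<otimes>\<^bsub>R Quot Ip s\<^esub> y) \<in> lin_maps R ?Q ?Q"
      by (rule lin_cong[OF r[OF y] quot_Ip_module comm[OF _ y]])
  qed (rule r)
qed

lemma mult_lift_exists:
  assumes P: "free_resolution R P (quot_mod (reg_mod R) (Ip s)) \<epsilon>"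
  shows "\<exists>\<mu>. mult_lift R P (R Quot Ip s) \<epsilon> \<mu>"
proof -
  note \<epsilon> = free_resolutionD(3,5)[OF P] and Q = quot_Ip_module[of s]
  have b: "\<epsilon> (bdry P 1 x) = \<zero>\<^bsub>quot_mod (reg_mod R) (Ip s)\<^esub>" if "x \<in> carrier (chains P 1)" for x
    using \<epsilon>(2) that by (auto simp: boundaries_def)
  note nn = free_resolution_nonneg[OF P] and \<beta> = bilin_compose[OF quot_bilin \<epsilon>(1) \<epsilon>(1)]
  show ?thesis unfolding mult_lift_iff
    by (rule bilinear_lift[OF nn nn P Q \<beta>])
      (simp_all add: b bilin_zero_left[OF quot_bilin Q Q] bilin_zero_right[OF quot_bilin Q Q] lin_closed[OF \<epsilon>(1)])
qed

context
  fixes P :: "('a, 'p) chain_cx" and \<epsilon> :: "'p \<Rightarrow> 'a set" and t :: nat and \<mu> f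
  assumes t: "t > 0" and P: "free_resolution R P (quot_mod (reg_mod R) (Ip (Suc t))) \<epsilon>"
    and \<mu>: "\<And>p q. bilin R (chains P p) (chains P q) (chains P (p + q)) (\<mu> p q)"
    and d\<mu>: "\<And>p q x y. x \<in> carrier (chains P p) \<Longrightarrow> y \<in> carrier (chains P q) \<Longrightarrow>
      bdry P (p + q) (\<mu> p q x y) = leibniz P P (chains P (p + q - 1)) p q \<mu> x y"
    and \<epsilon>\<mu>: "\<And>x y. x \<in> carrier (chains P 0) \<Longrightarrow> y \<in> carrier (chains P 0) \<Longrightarrow>
      \<epsilon> (\<mu> 0 0 x y) = \<epsilon> x \<otimes>\<^bsub>R Quot Ip (Suc t)\<^esub> \<epsilon> y"
    and f: "chain_map (K_cx (Suc t)) P f"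
    and \<epsilon>f: "\<And>x. x \<in> carrier (chains (K_cx (Suc t)) 0) \<Longrightarrow> \<epsilon> (f 0 x) = Ip (Suc t) +> ev x"
begin

text \<open>
  The composite of the product with the comparison map on the last column lifts the multiplication
  \<open>I\<^bsup>t\<^esup>/I\<^bsup>t+1\<^esup> \<times> I\<^bsup>t\<^esup>/I\<^bsup>t+1\<^esup> \<rightarrow> R/I\<^bsup>t+1\<^esup>\<close>, which is zero because 2t is at least t + 1. It is therefore null-homotopic,
  and over R/I, where every element of \<open>Q\<^bsup>(t)\<^esup>\<close> is a cycle, the homotopy exhibits the product as a boundary.
\<close>

lemma top_product:
  assumes a: "a \<in> fs (Q_basis N t p)" and b: "b \<in> fs (Q_basis N t q)" and pq: "p + q \<ge> 0"
  shows "\<mu> p q (f p a) (f q b) \<in> Bd P (p + q)"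
proof -
  note Pc = free_resolutionD(1)[OF P]
  note m = cx_module[OF Pc] and Bs = Bd_submodule[OF Pc]
  let ?X = "Q_cx R N u t" and ?s = "Suc t"
  let ?F = "\<lambda>p q a b. \<mu> p q (f p a) (f q b)"
  have fl: "f n \<in> lin_maps R (chains ?X n) (chains P n)" for n
    using chain_map_lin[OF f, of n] Q_KB[of _ t n] by (auto simp: lin_maps_def)
  have fd: "bdry P n (f n x) = f (n - 1) (bdry ?X n x)" if "x \<in> carrier (chains ?X n)" for n x
    using chain_map_bdry[OF f, of x n] that Q_KB[of x t n] by (simp add: Q_bdry Kd_Q)
  have F: "bilin R (chains ?X p) (chains ?X q) (chains P (p + q)) (?F p q)" for p q
    by (rule bilin_compose[OF \<mu> fl fl])
  have dF: "bdry P (p + q) (?F p q x y) = leibniz ?X ?X (chains P (p + q - 1)) p q ?F x y"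
    if "x \<in> carrier (chains ?X p)" "y \<in> carrier (chains ?X q)" for p q x y
    unfolding d\<mu>[OF lin_closed[OF fl that(1)] lin_closed[OF fl that(2)]] leibniz_def fd[OF that(1)] fd[OF that(2)] ..
  have F0: "\<epsilon> (?F 0 0 x y) = \<zero>\<^bsub>quot_mod (reg_mod R) (Ip ?s)\<^esub>"
    if x: "x \<in> carrier (chains ?X 0)" and y: "y \<in> carrier (chains ?X 0)" for x y
  proof -
    have x': "x \<in> fs (Q_basis N t 0)" and y': "y \<in> fs (Q_basis N t 0)" using x y by simp_all
    have c: "ev x \<in> carrier R" "ev y \<in> carrier R" by (rule ev_closed[OF fs_FF[OF x']], rule ev_closed[OF fs_FF[OF y']])
    have K: "z \<in> carrier (chains (K_cx ?s) 0)" if "z \<in> fs (Q_basis N t 0)" for z using Q_KB[OF that] by simp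
    have "ev x \<otimes> ev y \<in> Ip ?s"
      by (rule ideal_pow_mult[OF II_ideal Q_ev[OF x'] subsetD[OF Ip_II[OF t] Q_ev[OF y']]])
    then have "Ip ?s +> (ev x \<otimes> ev y) = Ip ?s"
      using coset_zero_iff[OF reg_mod_module ideal_submodule[OF Ip_ideal], of "ev x \<otimes> ev y" ?s] c by simp
    then show ?thesis
      unfolding \<epsilon>\<mu>[OF lin_closed[OF fl x] lin_closed[OF fl y]] \<epsilon>f[OF K[OF x']] \<epsilon>f[OF K[OF y']] quot_mult[OF c] quot_mod_simps .
  qed
  note nn = free_resolution_nonneg[OF Q_resolution[of t]]
  from bilinear_nullhomotopy[OF nn nn P quot_Ip_module F dF F0]
  obtain h where hb: "\<And>p q. bilin R (chains ?X p) (chains ?X q) (chains P (p + q + 1)) (h p q)"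
    and h: "\<And>p q x y. \<lbrakk>x \<in> carrier (chains ?X p); y \<in> carrier (chains ?X q); p + q \<ge> 0\<rbrakk> \<Longrightarrow>
      bdry P (p + q + 1) (h p q x y)
      = signed (chains P (p + q)) (p + q) (?F p q x y) \<oplus>\<^bsub>chains P (p + q)\<^esub> leibniz ?X ?X (chains P (p + q)) p q h x y" by blast
  have a': "a \<in> carrier (chains ?X p)" and b': "b \<in> carrier (chains ?X q)" using a b by simp_all
  have d: "bdry ?X n x \<in> ISp ?X (n - 1)" if "x \<in> fs (Q_basis N t n)" for x n
    using kd_II_valued[OF that Q_kd_fs[OF that]] by (simp add: Q_bdry[OF that] ideal_span_II)
  have Xm: "Module.module R (chains ?X n)" for n by (rule cx_module[OF Q_chain_complex])
  have e: "p - 1 + q + 1 = p + q" "p + (q - 1) + 1 = p + q" by auto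
  note l1 = bilin_left[OF hb[of "p - 1" q, unfolded e] b'] and l2 = bilin_right[OF hb[of p "q - 1", unfolded e] a']
  have "h (p - 1) q (bdry ?X p a) b \<in> Bd P (p + q)"
    by (rule Bd_ISp[OF Pc ideal_span_lin[OF l1 Xm m II_sub d[OF a]]])
  moreover have "signed (chains P (p + q)) p (h p (q - 1) a (bdry ?X q b)) \<in> Bd P (p + q)"
    unfolding signed_submodule_iff[OF m Bs lin_closed[OF l2 cx_closed[OF Q_chain_complex b']]]
    by (rule Bd_ISp[OF Pc ideal_span_lin[OF l2 Xm m II_sub d[OF b]]])
  ultimately have "leibniz ?X ?X (chains P (p + q)) p q h a b \<in> Bd P (p + q)"
    unfolding leibniz_def by (rule Module.module.submoduleE(5)[OF m Bs])
  moreover have "bdry P (p + q + 1) (h p q a b) \<in> Bd P (p + q)" by (rule Bd_bdry[OF Pc bilin_closed[OF hb a' b']])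
  moreover note Fc = bilin_closed[OF F a' b']
  ultimately have "signed (chains P (p + q)) (p + q) (?F p q a b) \<in> Bd P (p + q)"
    unfolding h[OF a' b' pq] using submodule_cancel_right[OF m Bs _ signed_closed[OF m Fc]] by blast
  then show ?thesis unfolding signed_submodule_iff[OF m Bs Fc] .
qed

lemma cycle_decomposition:
  assumes x: "x \<in> Zc P n" and n: "n \<noteq> 0"
  shows "\<exists>a\<in>fs (Q_basis N t n). x \<ominus>\<^bsub>chains P n\<^esub> f n a \<in> Bd P n"
proof -
  let ?K = "K_cx (Suc t)"
  note Pc = free_resolutionD(1)[OF P]
  note m = cx_module[OF Pc] and Bs = Bd_submodule[OF Pc] and fl = chain_map_lin[OF f]
  interpret P: Module.module R "chains P n" by (rule m)
  have K: "free_resolution R ?K (quot_mod (reg_mod R) (Ip (Suc t))) (\<lambda>f. Ip (Suc t) +> ev f)" by (rule K_resolution) simp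
  obtain y where y: "y \<in> Zc ?K n" "x \<ominus>\<^bsub>chains P n\<^esub> f n y \<in> Bd P n"
    using resolution_comparison_presents(1)[OF K P quot_Ip_module f \<epsilon>f x] by blast
  obtain a where a: "a \<in> fs (Q_basis N t n)" "y \<ominus>\<^bsub>free_mod R (KB (Suc t) n)\<^esub> a \<in> Bd ?K n"
    using top_decomposition[OF y(1) n] by blast
  have ac: "a \<in> carrier (chains ?K n)" and yc: "y \<in> carrier (chains ?K n)" using Q_KB[OF a(1)] Zc_closed[OF y(1)] by simp_all
  have xc: "x \<in> carrier (chains P n)" by (rule Zc_closed[OF x])
  have "y \<ominus>\<^bsub>chains ?K n\<^esub> a \<in> Bd ?K n" using a(2) unfolding K_cx_simps .
  from chain_map_Bd[OF f K_chain_complex Pc this]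
  have "f n y \<ominus>\<^bsub>chains P n\<^esub> f n a \<in> Bd P n"
    unfolding lin_minus[OF fl cx_module[OF K_chain_complex] m yc ac] .
  then have "(x \<ominus>\<^bsub>chains P n\<^esub> f n a) \<ominus>\<^bsub>chains P n\<^esub> (x \<ominus>\<^bsub>chains P n\<^esub> f n y) \<in> Bd P n"
    unfolding P.M.minus_minus_swap[OF xc lin_closed[OF fl ac] lin_closed[OF fl yc]] .
  from submodule_transfer[OF m Bs P.M.minus_closed[OF xc lin_closed[OF fl ac]] y(2) this] show ?thesis using a(1) by blast
qed

lemma product_of_cycles:
  assumes x: "x \<in> Zc P p" and y: "y \<in> Zc P q" and p: "p > 0" and q: "q > 0"
  shows "\<mu> p q x y \<in> Bd P (p + q)"
proof -
  note Pc = free_resolutionD(1)[OF P]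
  note m = cx_module[OF Pc] and Bs = Bd_submodule[OF Pc]
  obtain a where a: "a \<in> fs (Q_basis N t p)" "x \<ominus>\<^bsub>chains P p\<^esub> f p a \<in> Bd P p" using cycle_decomposition[OF x] p by auto
  obtain b where b: "b \<in> fs (Q_basis N t q)" "y \<ominus>\<^bsub>chains P q\<^esub> f q b \<in> Bd P q" using cycle_decomposition[OF y] q by auto
  have fa: "f p a \<in> Zc P p" by (rule chain_map_Zc[OF f K_chain_complex Pc Q_Zc[OF a(1)]])
  have fb: "f q b \<in> Zc P q" by (rule chain_map_Zc[OF f K_chain_complex Pc Q_Zc[OF b(1)]])
  note c = Zc_closed[OF x] Zc_closed[OF y] Zc_closed[OF fa] Zc_closed[OF fb]
  have "\<mu> p q x y \<in> Bd P (p + q) \<longleftrightarrow> \<mu> p q (f p a) y \<in> Bd P (p + q)"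
  proof (rule submodule_congruent[OF m Bs bilin_closed[OF \<mu> c(1,2)] bilin_closed[OF \<mu> c(3,2)]])
    show "\<mu> p q x y \<ominus>\<^bsub>chains P (p + q)\<^esub> \<mu> p q (f p a) y \<in> Bd P (p + q)"
      using product_boundary_left[OF Pc \<mu> d\<mu> a(2) y] lin_minus[OF bilin_left[OF \<mu> c(2)] m m c(1,3)] by simp
  qed
  also have "\<dots> \<longleftrightarrow> \<mu> p q (f p a) (f q b) \<in> Bd P (p + q)"
  proof (rule submodule_congruent[OF m Bs bilin_closed[OF \<mu> c(3,2)] bilin_closed[OF \<mu> c(3,4)]])
    show "\<mu> p q (f p a) y \<ominus>\<^bsub>chains P (p + q)\<^esub> \<mu> p q (f p a) (f q b) \<in> Bd P (p + q)"
      using product_boundary_right[OF Pc \<mu> d\<mu> fa b(2)] lin_minus[OF bilin_right[OF \<mu> c(3)] m m c(2,4)] by simp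
  qed
  finally show ?thesis using top_product[OF a(1) b(1)] p q by simp
qed

end

theorem products_vanish:
  assumes t: "t > 0" and P: "free_resolution R P (quot_mod (reg_mod R) (Ip (Suc t))) \<epsilon>"
    and ml: "mult_lift R P (R Quot Ip (Suc t)) \<epsilon> \<mu>" and p: "p > 0" and q: "q > 0"
    and U: "U \<in> carrier (Tor R A \<phi> P p)" and V: "V \<in> carrier (Tor R A \<phi> P q)"
  shows "Tor_prod R A \<phi> P \<mu> p q U V = \<zero>\<^bsub>Tor R A \<phi> P (p + q)\<^esub>"
proof -
  note Pc = free_resolutionD(1)[OF P]
  note m = cx_module[OF Pc]
  let ?E = "tensor_cx R A \<phi> P"
  have \<mu>: "bilin R (chains P p) (chains P q) (chains P (p + q)) (\<mu> p q)" for p q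
    using ml unfolding mult_lift_iff by blast
  have K: "free_resolution R (K_cx (Suc t)) (quot_mod (reg_mod R) (Ip (Suc t))) (\<lambda>f. Ip (Suc t) +> ev f)" by (rule K_resolution) simp
  obtain f where f: "chain_map (K_cx (Suc t)) P f" "\<And>x. x \<in> carrier (chains (K_cx (Suc t)) 0) \<Longrightarrow> \<epsilon> (f 0 x) = Ip (Suc t) +> ev x"
    using resolution_comparison[OF K P quot_Ip_module] by blast
  obtain x where x: "x \<in> Zc P p" "U = tor_class P p x"
    using U unfolding presentsD(2)[OF Tor_presents[OF Pc], symmetric] by auto
  obtain y where y: "y \<in> Zc P q" "V = tor_class P q y"
    using V unfolding presentsD(2)[OF Tor_presents[OF Pc], symmetric] by auto
  have key: "boundaries ?E (p + q) +>\<^bsub>chains ?E (p + q)\<^esub> tensor_pairing R A \<phi> (chains P (p + q)) (\<mu> p q) z w = boundaries ?E (p + q)"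
    if zU: "z \<in> U" and wV: "w \<in> V" for z w
  proof -
    obtain z' where z': "z' \<in> Zc P p" "z = \<tau> (chains P p) z'" using tor_class_member[OF Pc x(1)] zU x(2) by blast
    obtain w' where w': "w' \<in> Zc P q" "w = \<tau> (chains P q) w'" using tor_class_member[OF Pc y(1)] wV y(2) by blast
    have "\<mu> p q z' w' \<in> Bd P (p + q)"
      by (rule product_of_cycles[OF t P \<mu> _ _ f z'(1) w'(1) p q]) (use ml in \<open>unfold mult_lift_iff, blast+\<close>)
    from \<tau>_boundary[OF Pc this]
    have b: "tensor_pairing R A \<phi> (chains P (p + q)) (\<mu> p q) z w \<in> boundaries ?E (p + q)"
      unfolding z'(2) w'(2) bc_tensor_pairing_\<tau>[OF m m m \<mu> Zc_closed[OF z'(1)] Zc_closed[OF w'(1)]] .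
    note Em = cx_module[OF Tor_complex[OF Pc]] and Es = boundaries_submodule[OF Tor_complex[OF Pc]]
    show ?thesis using coset_zero_iff[OF Em Es] b Module.module.submoduleE(1)[OF Em Es] by blast
  qed
  have "Tor_prod R A \<phi> P \<mu> p q U V = boundaries ?E (p + q)"
    unfolding Tor_prod_def Let_def
  proof (rule coset_union)
    show "U \<noteq> {}" unfolding x(2) by (rule tor_class_nonempty[OF Pc x(1)])
    show "(\<Union>w\<in>V. boundaries ?E (p + q) +>\<^bsub>chains ?E (p + q)\<^esub> tensor_pairing R A \<phi> (chains P (p + q)) (\<mu> p q) z w) = boundaries ?E (p + q)"
      if "z \<in> U" for z
      by (rule coset_union[OF key[OF that]]) (use tor_class_nonempty[OF Pc y(1)] in \<open>simp_all add: y(2)\<close>)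
  qed
  then show ?thesis by (simp add: Tor_def homology_def quot_mod_simps)
qed

text \<open>
  Both modules are presented by \<open>K(R; I\<^sup>s)\<close>, respectively by its last column, with the same kernel.
\<close>

theorem Tor_of_power:
  fixes P :: "('a, 'p) chain_cx"
  assumes s: "s \<ge> 2" and P: "free_resolution R P (quot_mod (reg_mod R) (Ip s)) \<epsilon>"
  shows "mod_isomorphic A (homology (Tt s) n) (Tor R A \<phi> P n)"
    and "n \<noteq> 0 \<Longrightarrow> mod_isomorphic A (Tor R A \<phi> P n)
      (quot_mod (Tor_Q R N u (s - 1) n) (Tor_del R N u (s - 2) (n + 1) ` carrier (Tor_Q R N u (s - 2) (n + 1))))"
proof -
  obtain r where r: "s = Suc (Suc r)" using s by (metis add_2_eq_Suc le_Suc_ex)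
  note Pc = free_resolutionD(1)[OF P]
  have K: "free_resolution R (K_cx s) (quot_mod (reg_mod R) (Ip s)) (\<lambda>f. Ip s +> ev f)" by (rule K_resolution) (use s in simp)
  obtain f where f: "chain_map (K_cx s) P f" "\<And>x. x \<in> carrier (chains (K_cx s) 0) \<Longrightarrow> \<epsilon> (f 0 x) = Ip s +> ev x"
    using resolution_comparison[OF K P quot_Ip_module] by blast
  note pr = resolution_comparison_presents(2)[OF K P quot_Ip_module f, of n]
  show "mod_isomorphic A (homology (Tt s) n) (Tor R A \<phi> P n)"
    by (rule bc_presents_iso[OF total_presents pr Zm_module[OF K_chain_complex] total_homology_module Tor_module[OF Pc]])
  assume n: "n \<noteq> 0"
  obtain h where h: "presents R \<phi> (Q_mod R N (Suc r) n) (top_boundaries (Suc r) n)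
     (quot_mod (Tor_Q R N u (Suc r) n) (Tor_del R N u r (n + 1) ` carrier (Tor_Q R N u r (n + 1)))) h"
    using coker_presents by blast
  from bc_presents_iso[OF top_presents[OF pr[unfolded r] Tor_module[OF Pc] n] h free_mod_module Tor_module[OF Pc] coker_module]
  show "mod_isomorphic A (Tor R A \<phi> P n)
      (quot_mod (Tor_Q R N u (s - 1) n) (Tor_del R N u (s - 2) (n + 1) ` carrier (Tor_Q R N u (s - 2) (n + 1))))"
    by (simp add: r)
qed

end

section \<open>From regular sequences to the statement\<close>

text \<open>
  Regularity in terms of multiplication on \<open>R/(u\<^sub>1, \<dots>, u\<^bsub>k-1\<^esub>)\<close> is a statement about ideal membership, and
  \<open>R/I \<noteq> 0\<close> forces 1 to differ from 0.
\<close>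

lemma regular_sequence_koszul:
  assumes "cring R" "regular_sequence R N u"
  shows "regular_koszul_nontrivial R N u"
proof -
  interpret R: cring R by fact
  have uc: "u \<in> seq_index N \<rightarrow> carrier R"
    and reg: "\<And>k x. \<lbrakk>k \<in> seq_index N; x \<in> carrier (R Quot genideal R (u ` {1..<k}));
        (genideal R (u ` {1..<k}) +>\<^bsub>R\<^esub> u k) \<otimes>\<^bsub>R Quot genideal R (u ` {1..<k})\<^esub> x = \<zero>\<^bsub>R Quot genideal R (u ` {1..<k})\<^esub>\<rbrakk>
      \<Longrightarrow> x = \<zero>\<^bsub>R Quot genideal R (u ` {1..<k})\<^esub>"
    and nt: "carrier (R Quot genideal R (u ` seq_index N)) \<noteq> {\<zero>\<^bsub>R Quot genideal R (u ` seq_index N)\<^esub>}"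
    using assms(2) unfolding regular_sequence_def Let_def by blast+
  have "r \<in> genideal R (u ` {1..<k})"
    if k: "k \<in> seq_index N" and r: "r \<in> carrier R" and kr: "u k \<otimes>\<^bsub>R\<^esub> r \<in> genideal R (u ` {1..<k})" for k r
  proof -
    let ?J = "genideal R (u ` {1..<k})"
    have "{1..<k} \<subseteq> seq_index N" using k order_trans[of _ "enat k" N] by (auto simp: seq_index_def)
    then have J: "ideal ?J R" using uc by (intro R.genideal_ideal) auto
    interpret J: ideal ?J R by (rule J)
    have uk: "u k \<in> carrier R" using uc k by auto
    have zero: "?J +>\<^bsub>R\<^esub> a = ?J \<longleftrightarrow> a \<in> ?J" if "a \<in> carrier R" for a
      using coset_zero_iff[OF R.reg_mod_module R.ideal_submodule[OF J], of a] that by simp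
    have "(?J +>\<^bsub>R\<^esub> u k) \<otimes>\<^bsub>R Quot ?J\<^esub> (?J +>\<^bsub>R\<^esub> r) = ?J +>\<^bsub>R\<^esub> (u k \<otimes>\<^bsub>R\<^esub> r)"
      using J.rcoset_mult_add[OF uk r] by (simp add: FactRing_def)
    also have "\<dots> = \<zero>\<^bsub>R Quot ?J\<^esub>" using zero[of "u k \<otimes>\<^bsub>R\<^esub> r"] uk r kr by (simp add: FactRing_def)
    finally have z: "(?J +>\<^bsub>R\<^esub> u k) \<otimes>\<^bsub>R Quot ?J\<^esub> (?J +>\<^bsub>R\<^esub> r) = \<zero>\<^bsub>R Quot ?J\<^esub>" .
    have "?J +>\<^bsub>R\<^esub> r \<in> carrier (R Quot ?J)" using r by (auto simp: FactRing_def A_RCOSETS_def')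
    from reg[OF k this z] show ?thesis using zero[OF r] by (simp add: FactRing_def)
  qed
  moreover have "\<one>\<^bsub>R\<^esub> \<noteq> \<zero>\<^bsub>R\<^esub>"
  proof
    assume "\<one>\<^bsub>R\<^esub> = \<zero>\<^bsub>R\<^esub>"
    then have c: "carrier R = {\<zero>\<^bsub>R\<^esub>}" using R.one_zeroD by simp
    let ?J = "genideal R (u ` seq_index N)"
    have J: "ideal ?J R" using uc by (intro R.genideal_ideal) auto
    then have "?J = {\<zero>\<^bsub>R\<^esub>}"
      using c additive_subgroup.a_subset[OF ideal.axioms(1)[OF J]] additive_subgroup.zero_closed[OF ideal.axioms(1)[OF J]] by auto
    then show False using nt c by (auto simp: FactRing_def A_RCOSETS_def' a_r_coset_def')
  qed
  ultimately show ?thesis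
    using uc by unfold_locales auto
qed

theorem lemma2p1:
  fixes R :: "('a, 'r) ring_scheme" and u :: "nat \<Rightarrow> 'a" and N :: enat
    and I :: "'a set" and s :: nat
  assumes "cring R"
    and "regular_sequence R N u"
    and "I = genideal R (u ` seq_index N)"
    and "s \<ge> 2"
  shows
    "(\<forall>k. free_resolution R (Q_cx R N u k) (ideal_pow_quot R I k) (Q_aug R N u k))
     \<and> (\<forall>k n. 1 \<le> k \<and> k \<le> s - 2 \<longrightarrow>
          Tor_del R N u (k - 1) (n + 1) ` carrier (Tor_Q R N u (k - 1) (n + 1))
          = {U \<in> carrier (Tor_Q R N u k n). Tor_del R N u k n U = \<zero>\<^bsub>Tor_Q R N u (Suc k) (n - 1)\<^esub>})
     \<and> ss_collapses_at (total_cx (P_double R N u s)) (column_filtration (P_double R N u s)) 2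
     \<and> (\<forall>(P :: ('a, 'p) chain_cx) \<epsilon>.
          free_resolution R P (quot_mod (reg_mod R) (ideal_pow R I s)) \<epsilon> \<longrightarrow>
          (let A = R Quot I; T = Tor R A (a_r_coset R I) P in
            (\<forall>n. mod_isomorphic A (homology (total_cx (P_double R N u s)) n) (T n))
            \<and> mod_isomorphic A (T 0) (reg_mod A)
            \<and> (\<forall>n. n \<noteq> 0 \<longrightarrow> mod_isomorphic A (T n)
                 (quot_mod (Tor_Q R N u (s - 1) n)
                    (Tor_del R N u (s - 2) (n + 1) ` carrier (Tor_Q R N u (s - 2) (n + 1)))))
            \<and> (\<exists>\<mu>. mult_lift R P (R Quot ideal_pow R I s) \<epsilon> \<mu>)
            \<and> (\<forall>\<mu>. mult_lift R P (R Quot ideal_pow R I s) \<epsilon> \<mu> \<longrightarrow>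
                 (\<forall>p>0. \<forall>q>0. \<forall>U\<in>carrier (T p). \<forall>V\<in>carrier (T q).
                    Tor_prod R A (a_r_coset R I) P \<mu> p q U V = \<zero>\<^bsub>T (p + q)\<^esub>))))"
proof -
  interpret regular_koszul_nontrivial R N u by (rule regular_sequence_koszul[OF assms(1,2)])
  have I: "I = II" unfolding II_def assms(3) ..
  have s: "s = Suc (s - 1)" "s - 1 > 0" "s > 0" using assms(4) by auto
  have exact: "Tor_del R N u (k - 1) (n + 1) ` carrier (Tor_Q R N u (k - 1) (n + 1))
      = {U \<in> carrier (Tor_Q R N u k n). Tor_del R N u k n U = \<zero>\<^bsub>Tor_Q R N u (Suc k) (n - 1)\<^esub>}" if "1 \<le> k" for k n
    using Tor_exact[of "k - 1" n] that by simp
  show ?thesis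
    unfolding I Let_def
    using Q_resolution exact collapse Tor_of_power[OF assms(4)] Tor_degree_zero[OF s(3)] mult_lift_exists
      products_vanish[OF s(2), folded s(1)]
    by (intro conjI allI impI ballI) simp_all
qed

end
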